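(* Let $(X_n)_{n\ge0}$ be Markov chains on finite pairwise disjoint state spaces $(\mathbb S_n)_{n\ge0}$, with $\mathbb S_0=\{\varnothing\}$, which are either up-down chains satisfying the commutation relation (C) of the context, or more generally Markov chains satisfying (A1)--(A5) of the context, with associated rates $(c_n)$. Let $E$ be a compact metric space, $\iota:\mathbb S=\bigcup_n\mathbb S_n\to E$ a map and $(d^o_s)_{s\in\mathbb S}\subset C(E)$ functions satisfying (L1)--(L3) of the context. Suppose that $c_n\to\infty$ and that the distributions of $\iota(X_n(0))$ converge weakly to a distribution $\mu$ on $E$. Then: 1. There exists a Feller process $F$ in $E$ with initial distribution $\mu$ such that $$\big(\iota(X_n(\lfloor c_nt\rfloor))\big)_{t\ge0}\Longrightarrow(F(t))_{t\ge0}$$ in distribution in the Skorokhod space $D([0,\infty),E)$. 2. The transition semigroup $(\mathcal T(t))_{t\ge0}$ of $F$ satisfies $$\mathcal T(t)h^o_s=e^{-tc_{k-1}}h^o_s,\qquad s\in\mathbb S_k,\ k\ge0,\ t\ge0.$$ 3. The process $F$ is ergodic with a unique stationary measure $M$, which is the weak limit of the push-forwards under $\iota$ of the stationary measures $M_n$ of $X_n$.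
   Context: $C(Z)$ denotes the continuous real functions on $Z$ with the sup norm (all functions if $Z$ is finite). For $s\in\mathbb S$, $|s|$ is the index $n$ with $s\in\mathbb S_n$. Ergodic means: converges in distribution to a unique stationary distribution for any initial state. $T_n$ is the transition operator of $X_n$: $(T_nf)(r)=\mathbb E[f(X_n(1))\mid X_n(0)=r]$. A transition operator from $C(Z')$ to $C(Z)$ ($Z,Z'$ finite) is $f\mapsto\sum_{y\in Z'}\mu(\cdot,y)f(y)$ with $\mu$ a stochastic $Z\times Z'$ matrix. $\mathbf 1_u$ is the indicator of $\{u\}$. Always $c_{-1}=0$. Up-down chains: there are stochastic matrices $p^\uparrow_n$ from $\mathbb S_n$ to $\mathbb S_{n+1}$ ($n\ge0$) and $p^\downarrow_n$ from $\mathbb S_n$ to $\mathbb S_{n-1}$ ($n\ge1$), and $X_n$ has transition matrix $p^\uparrow_np^\downarrow_{n+1}$. (C): there are $\beta_n\in(0,1)$ with $p^\uparrow_np^\downarrow_{n+1}=\beta_np^\downarrow_np^\uparrow_{n-1}+(1-\beta_n)\,\mathrm{Id}$ for $n\ge1$. In this case $c_n=\beta_1^{-1}\cdots\beta_n^{-1}$, $D_n$ is the transition operator of $p^\downarrow_n$ and $U_n$ that of $p^\uparrow_n$. General chains: there are real numbers $(c_n)_{n\ge0}$ and linear operators $(D_n)_{n\ge1}$ such that, with $A_n=c_n(T_n-I)$, for all $n\ge0$: (A1) $0<c_n<c_{n+1}$; (A2) $D_{n+1}$ is a transition operator from $C(\mathbb S_n)$ to $C(\mathbb S_{n+1})$;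 (A3) $\operatorname{range}(A_{n+1}+c_nI)\subset\operatorname{range}D_{n+1}$; (A4) $D_{n+1}$ is injective; (A5) $A_{n+1}D_{n+1}=D_{n+1}A_n$. Then $U_n:C(\mathbb S_{n+1})\to C(\mathbb S_n)$ is the unique linear operator with $c_nD_{n+1}U_n=A_{n+1}+c_nI$. In both cases, for $k\le n$, $s\in\mathbb S_k$, $u\in\mathbb S_n$: $p^\uparrow_{k,n}(s,u)=(U_kU_{k+1}\cdots U_{n-1}\mathbf 1_u)(s)$ and $p^\downarrow_{n,k}(u,s)=(D_nD_{n-1}\cdots D_{k+1}\mathbf 1_s)(u)$ (identity if $k=n$). $d_s(u)=p^\downarrow_{|u|,|s|}(u,s)$ if $|u|\ge|s|$, else $0$; $(d_s)_n=d_s|_{\mathbb S_n}$. $M_n=p^\uparrow_{0,n}(\varnothing,\cdot)$ is the unique stationary distribution of $X_n$. (L1) For every $x\in E$ there are $s_n\in\mathbb S_n$ with $\iota(s_n)\to x$. (L2) The span of $\{d^o_s\}_{s\in\mathbb S}$ is dense in $C(E)$. (L3) For every $s\in\mathbb S$, $\|(d_s)_n-d^o_s\circ\iota|_{\mathbb S_n}\|_{C(\mathbb S_n)}\to0$ as $n\to\infty$. $h^o_s=\sum_{|r|\le|s|}p^\uparrow_{|r|,|s|}(r,s)\,\eta_{|r|,|s|}\,d^o_r$, where $\eta_{i,j}=\prod_{m=i}^{j-1}\frac{c_m}{c_{m-1}-c_{j-1}}$. *)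

theory Defs
  imports "HOL-Probability.Probability"
begin

section \<open>Functions and transition operators on finite sets\<close>

text \<open>
  For a finite set \<open>Z\<close>, the space \<open>C(Z)\<close> of all real functions on \<open>Z\<close> is represented by the
  functions on the ambient type that vanish outside \<open>Z\<close>. Operators between such spaces are
  total functions of which only the restriction to the carrier matters.
\<close>

definition fin_C :: "'s set \<Rightarrow> ('s \<Rightarrow> real) set" where
  "fin_C Z = {f. \<forall>x. x \<notin> Z \<longrightarrow> f x = 0}"

definition linear_operator ::
  "'s set \<Rightarrow> 's set \<Rightarrow> (('s \<Rightarrow> real) \<Rightarrow> ('s \<Rightarrow> real)) \<Rightarrow> bool" where
  "linear_operator Z' Z L \<longleftrightarrow>
     L ` fin_C Z' \<subseteq> fin_C Z \<and>
     (\<forall>f\<in>fin_C Z'. \<forall>g\<in>fin_C Z'. L (\<lambda>x. f x + g x) = (\<lambda>x. L f x + L g x)) \<and>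
     (\<forall>a. \<forall>f\<in>fin_C Z'. L (\<lambda>x. a * f x) = (\<lambda>x. a * L f x))"

definition stochastic_matrix :: "'s set \<Rightarrow> 's set \<Rightarrow> ('s \<Rightarrow> 's \<Rightarrow> real) \<Rightarrow> bool" where
  "stochastic_matrix Z Z' m \<longleftrightarrow>
     (\<forall>x\<in>Z. (\<forall>y\<in>Z'. 0 \<le> m x y) \<and> (\<Sum>y\<in>Z'. m x y) = 1)"

definition matrix_op ::
  "'s set \<Rightarrow> 's set \<Rightarrow> ('s \<Rightarrow> 's \<Rightarrow> real) \<Rightarrow> ('s \<Rightarrow> real) \<Rightarrow> ('s \<Rightarrow> real)" where
  "matrix_op Z Z' m f = (\<lambda>x. if x \<in> Z then \<Sum>y\<in>Z'. m x y * f y else 0)"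

text \<open>As in the mathematical text, the operator goes from \<open>C(Z')\<close> to \<open>C(Z)\<close>.\<close>

definition transition_operator ::
  "'s set \<Rightarrow> 's set \<Rightarrow> (('s \<Rightarrow> real) \<Rightarrow> ('s \<Rightarrow> real)) \<Rightarrow> bool" where
  "transition_operator Z' Z L \<longleftrightarrow>
     (\<exists>m. stochastic_matrix Z Z' m \<and> (\<forall>f\<in>fin_C Z'. L f = matrix_op Z Z' m f))"


section \<open>Markov chains\<close>

definition markov_chain ::
  "'w measure \<Rightarrow> 's set \<Rightarrow> ('s \<Rightarrow> 's \<Rightarrow> real) \<Rightarrow> (nat \<Rightarrow> 'w \<Rightarrow> 's) \<Rightarrow> bool" where
  "markov_chain P Z p X \<longleftrightarrow>
     prob_space P \<and> stochastic_matrix Z Z p \<and>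
     (\<forall>k. X k \<in> measurable P (count_space Z)) \<and>
     (\<forall>k x y. (\<forall>i\<le>k. x i \<in> Z) \<longrightarrow> y \<in> Z \<longrightarrow>
        \<P>(\<omega> in P. \<forall>i\<le>k. X i \<omega> = x i) > 0 \<longrightarrow>
        \<P>(\<omega> in P. X (Suc k) \<omega> = y \<bar> \<forall>i\<le>k. X i \<omega> = x i) = p (x k) y)"

definition stationary_distribution :: "'s set \<Rightarrow> ('s \<Rightarrow> 's \<Rightarrow> real) \<Rightarrow> ('s \<Rightarrow> real) \<Rightarrow> bool" where
  "stationary_distribution Z p m \<longleftrightarrow>
     (\<forall>x\<in>Z. 0 \<le> m x) \<and> (\<Sum>x\<in>Z. m x) = 1 \<and> (\<forall>y\<in>Z. (\<Sum>x\<in>Z. m x * p x y) = m y)"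


section \<open>The two settings\<close>

text \<open>
  Throughout, \<open>S n\<close> is the state space of the chain with index \<open>n\<close> and \<open>p n\<close> its transition
  matrix. The operators \<open>D n\<close> (used for \<open>n \<ge> 1\<close> only) and \<open>U n\<close> map \<open>C(S (n - 1))\<close> to
  \<open>C(S n)\<close> and \<open>C(S (n + 1))\<close> to \<open>C(S n)\<close>, respectively.
\<close>

definition up_down_setting ::
  "(nat \<Rightarrow> 's set) \<Rightarrow> (nat \<Rightarrow> 's \<Rightarrow> 's \<Rightarrow> real) \<Rightarrow> (nat \<Rightarrow> real) \<Rightarrow>
   (nat \<Rightarrow> ('s \<Rightarrow> real) \<Rightarrow> ('s \<Rightarrow> real)) \<Rightarrow> (nat \<Rightarrow> ('s \<Rightarrow> real) \<Rightarrow> ('s \<Rightarrow> real)) \<Rightarrow> bool" where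
  "up_down_setting S p c D U \<longleftrightarrow>
     (\<exists>pup pdown \<beta>.
        (\<forall>n. stochastic_matrix (S n) (S (Suc n)) (pup n)) \<and>
        (\<forall>n\<ge>1. stochastic_matrix (S n) (S (n - 1)) (pdown n)) \<and>
        (\<forall>n. \<forall>x\<in>S n. \<forall>y\<in>S n.
           p n x y = (\<Sum>z\<in>S (Suc n). pup n x z * pdown (Suc n) z y)) \<and>
        (\<forall>n\<ge>1. 0 < \<beta> n \<and> \<beta> n < (1::real)) \<and>
        (\<forall>n\<ge>1. \<forall>x\<in>S n. \<forall>y\<in>S n.
           (\<Sum>z\<in>S (Suc n). pup n x z * pdown (Suc n) z y) =
             \<beta> n * (\<Sum>z\<in>S (n - 1). pdown n x z * pup (n - 1) z y) +
             (1 - \<beta> n) * (if x = y then 1 else 0)) \<and>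
        (\<forall>n. c n = (\<Prod>i=1..n. inverse (\<beta> i))) \<and>
        (\<forall>n\<ge>1. D n = matrix_op (S n) (S (n - 1)) (pdown n)) \<and>
        (\<forall>n. U n = matrix_op (S n) (S (Suc n)) (pup n)))"

definition rate_op ::
  "(nat \<Rightarrow> 's set) \<Rightarrow> (nat \<Rightarrow> 's \<Rightarrow> 's \<Rightarrow> real) \<Rightarrow> (nat \<Rightarrow> real) \<Rightarrow>
   nat \<Rightarrow> ('s \<Rightarrow> real) \<Rightarrow> ('s \<Rightarrow> real)" where
  "rate_op S p c n f = (\<lambda>r. c n * (matrix_op (S n) (S n) (p n) f r - f r))"

text \<open>
  By injectivity of \<open>D (Suc n)\<close>, the last two conjuncts determine \<open>U n\<close> uniquely on
  \<open>C(S (n + 1))\<close>; such a \<open>U n\<close> exists by the other conjuncts.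
\<close>

definition general_setting ::
  "(nat \<Rightarrow> 's set) \<Rightarrow> (nat \<Rightarrow> 's \<Rightarrow> 's \<Rightarrow> real) \<Rightarrow> (nat \<Rightarrow> real) \<Rightarrow>
   (nat \<Rightarrow> ('s \<Rightarrow> real) \<Rightarrow> ('s \<Rightarrow> real)) \<Rightarrow> (nat \<Rightarrow> ('s \<Rightarrow> real) \<Rightarrow> ('s \<Rightarrow> real)) \<Rightarrow> bool" where
  "general_setting S p c D U \<longleftrightarrow>
     (\<forall>n.
        (0 < c n \<and> c n < c (Suc n)) \<and>
        transition_operator (S n) (S (Suc n)) (D (Suc n)) \<and>
        (\<lambda>f r. rate_op S p c (Suc n) f r + c n * f r) ` fin_C (S (Suc n))
          \<subseteq> D (Suc n) ` fin_C (S n) \<and>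
        inj_on (D (Suc n)) (fin_C (S n)) \<and>
        (\<forall>f\<in>fin_C (S n). rate_op S p c (Suc n) (D (Suc n) f) = D (Suc n) (rate_op S p c n f)) \<and>
        linear_operator (S (Suc n)) (S n) (U n) \<and>
        (\<forall>f\<in>fin_C (S (Suc n)).
           (\<lambda>r. c n * D (Suc n) (U n f) r) = (\<lambda>r. rate_op S p c (Suc n) f r + c n * f r)))"


section \<open>Multi-step kernels and the associated functions\<close>

text \<open>\<open>up_iter U k n = U k \<circ> U (k + 1) \<circ> \<dots> \<circ> U (n - 1)\<close> and
  \<open>down_iter D n k = D n \<circ> D (n - 1) \<circ> \<dots> \<circ> D (k + 1)\<close> for \<open>k \<le> n\<close>.\<close>

fun up_iter ::
  "(nat \<Rightarrow> ('s \<Rightarrow> real) \<Rightarrow> ('s \<Rightarrow> real)) \<Rightarrow> nat \<Rightarrow> nat \<Rightarrow> ('s \<Rightarrow> real) \<Rightarrow> ('s \<Rightarrow> real)" where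
  "up_iter U k 0 f = f"
| "up_iter U k (Suc n) f = (if k \<le> n then up_iter U k n (U n f) else f)"

fun down_iter ::
  "(nat \<Rightarrow> ('s \<Rightarrow> real) \<Rightarrow> ('s \<Rightarrow> real)) \<Rightarrow> nat \<Rightarrow> nat \<Rightarrow> ('s \<Rightarrow> real) \<Rightarrow> ('s \<Rightarrow> real)" where
  "down_iter D 0 k f = f"
| "down_iter D (Suc n) k f = (if k \<le> n then D (Suc n) (down_iter D n k f) else f)"

definition p_up ::
  "(nat \<Rightarrow> ('s \<Rightarrow> real) \<Rightarrow> ('s \<Rightarrow> real)) \<Rightarrow> nat \<Rightarrow> nat \<Rightarrow> 's \<Rightarrow> 's \<Rightarrow> real" where
  "p_up U k n s u = up_iter U k n (indicator {u}) s"

definition p_down ::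
  "(nat \<Rightarrow> ('s \<Rightarrow> real) \<Rightarrow> ('s \<Rightarrow> real)) \<Rightarrow> nat \<Rightarrow> nat \<Rightarrow> 's \<Rightarrow> 's \<Rightarrow> real" where
  "p_down D n k u s = down_iter D n k (indicator {s}) u"

definition level :: "(nat \<Rightarrow> 's set) \<Rightarrow> 's \<Rightarrow> nat" where
  "level S s = (THE n. s \<in> S n)"

definition d_fun ::
  "(nat \<Rightarrow> 's set) \<Rightarrow> (nat \<Rightarrow> ('s \<Rightarrow> real) \<Rightarrow> ('s \<Rightarrow> real)) \<Rightarrow> 's \<Rightarrow> 's \<Rightarrow> real" where
  "d_fun S D s u =
     (if level S s \<le> level S u then p_down D (level S u) (level S s) u s else 0)"

text \<open>\<open>rate_before c k\<close> is \<open>c\<^bsub>k-1\<^esub>\<close> with the convention \<open>c\<^bsub>-1\<^esub> = 0\<close>.\<close>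

definition rate_before :: "(nat \<Rightarrow> real) \<Rightarrow> nat \<Rightarrow> real" where
  "rate_before c k = (if k = 0 then 0 else c (k - 1))"

definition eta :: "(nat \<Rightarrow> real) \<Rightarrow> nat \<Rightarrow> nat \<Rightarrow> real" where
  "eta c i j = (\<Prod>m\<in>{i..<j}. c m / (rate_before c m - rate_before c j))"

definition h_lim ::
  "(nat \<Rightarrow> 's set) \<Rightarrow> (nat \<Rightarrow> real) \<Rightarrow> (nat \<Rightarrow> ('s \<Rightarrow> real) \<Rightarrow> ('s \<Rightarrow> real)) \<Rightarrow>
   ('s \<Rightarrow> ('e::metric_space \<Rightarrow>\<^sub>C real)) \<Rightarrow> 's \<Rightarrow> ('e \<Rightarrow>\<^sub>C real)" where
  "h_lim S c U dlim s =
     (\<Sum>r\<in>(\<Union>i\<le>level S s. S i).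
        (p_up U (level S r) (level S s) r s * eta c (level S r) (level S s)) *\<^sub>R dlim r)"

text \<open>
  The space \<open>E\<close> is a type \<open>'e\<close> with \<open>compact (UNIV :: 'e set)\<close>, and
  \<open>C(E)\<close> is the Banach space \<open>'e \<Rightarrow>\<^sub>C real\<close>. Compact metric spaces are complete and second
  countable, so the class \<open>polish_space\<close> may be assumed for \<open>'e\<close> without restriction.
\<close>

definition limit_space_conditions ::
  "(nat \<Rightarrow> 's set) \<Rightarrow> (nat \<Rightarrow> ('s \<Rightarrow> real) \<Rightarrow> ('s \<Rightarrow> real)) \<Rightarrow> ('s \<Rightarrow> 'e) \<Rightarrow>
   ('s \<Rightarrow> ('e::metric_space \<Rightarrow>\<^sub>C real)) \<Rightarrow> bool" where
  "limit_space_conditions S D \<iota> dlim \<longleftrightarrow>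
     (\<forall>x. \<exists>s. (\<forall>n. s n \<in> S n) \<and> (\<lambda>n. \<iota> (s n)) \<longlonglongrightarrow> x) \<and>
     closure (span (dlim ` (\<Union>n. S n))) = UNIV \<and>
     (\<forall>s\<in>(\<Union>n. S n).
        (\<lambda>n. SUP u\<in>S n. \<bar>d_fun S D s u - apply_bcontfun (dlim s) (\<iota> u)\<bar>) \<longlonglongrightarrow> 0)"


section \<open>Weak convergence and convergence in distribution\<close>

definition borel_of_topology :: "'a topology \<Rightarrow> 'a measure" where
  "borel_of_topology T = sigma (topspace T) {U. openin T U}"

definition weakly_converges ::
  "'a topology \<Rightarrow> ('i \<Rightarrow> 'a measure) \<Rightarrow> 'a measure \<Rightarrow> 'i filter \<Rightarrow> bool" where
  "weakly_converges T N N' \<F> \<longleftrightarrow>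
     (\<forall>\<phi>::'a \<Rightarrow> real. continuous_map T euclideanreal \<phi> \<longrightarrow> bounded (\<phi> ` topspace T) \<longrightarrow>
        ((\<lambda>i. \<integral>x. \<phi> x \<partial>N i) \<longlongrightarrow> (\<integral>x. \<phi> x \<partial>N')) \<F>)"

definition converges_in_distribution ::
  "'a topology \<Rightarrow> (nat \<Rightarrow> 'w measure) \<Rightarrow> (nat \<Rightarrow> 'w \<Rightarrow> 'a) \<Rightarrow>
   'v measure \<Rightarrow> ('v \<Rightarrow> 'a) \<Rightarrow> bool" where
  "converges_in_distribution T P Y Q Z \<longleftrightarrow>
     (\<forall>n. Y n \<in> measurable (P n) (borel_of_topology T)) \<and>
     Z \<in> measurable Q (borel_of_topology T) \<and>
     weakly_converges T (\<lambda>n. distr (P n) (borel_of_topology T) (Y n))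
       (distr Q (borel_of_topology T) Z) sequentially"


section \<open>The Skorokhod space \<open>D([0,\<infinity>),E)\<close>\<close>

definition cadlag_paths :: "(real \<Rightarrow> 'e::metric_space) set" where
  "cadlag_paths =
     {x \<in> extensional {0..}.
        (\<forall>t\<ge>0. (x \<longlongrightarrow> x t) (at_right t)) \<and> (\<forall>t>0. \<exists>l. (x \<longlongrightarrow> l) (at_left t))}"

definition time_changes :: "(real \<Rightarrow> real) set" where
  "time_changes = {l. strict_mono_on {0..} l \<and> l ` {0..} = {0..}}"

text \<open>
  The sets \<open>skorokhod_nhd x T e\<close> form a neighbourhood base at \<open>x\<close> of the (J1) topology: a sequence
  \<open>x\<^sub>n\<close> converges to \<open>x\<close> iff for every \<open>T\<close> there are time changes \<open>l\<^sub>n\<close> such that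
  \<open>\<bar>l\<^sub>n t - t\<bar>\<close> and \<open>dist (x\<^sub>n t) (x (l\<^sub>n t))\<close> tend to \<open>0\<close> uniformly on \<open>[0, T]\<close>.
\<close>

definition skorokhod_nhd ::
  "(real \<Rightarrow> 'e::metric_space) \<Rightarrow> real \<Rightarrow> real \<Rightarrow> (real \<Rightarrow> 'e) set" where
  "skorokhod_nhd x T e =
     {y \<in> cadlag_paths. \<exists>l\<in>time_changes. \<forall>t\<in>{0..T}. \<bar>l t - t\<bar> < e \<and> dist (y t) (x (l t)) < e}"

definition skorokhod_open :: "(real \<Rightarrow> 'e::metric_space) set \<Rightarrow> bool" where
  "skorokhod_open V \<longleftrightarrow>
     V \<subseteq> cadlag_paths \<and> (\<forall>x\<in>V. \<exists>T>0. \<exists>e>0. skorokhod_nhd x T e \<subseteq> V)"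

definition skorokhod_topology :: "(real \<Rightarrow> 'e::metric_space) topology" where
  "skorokhod_topology = topology skorokhod_open"

lemma skorokhod_nhd_mono:
  assumes "T' \<le> T" "e \<le> e'"
  shows "skorokhod_nhd x T e \<subseteq> skorokhod_nhd x T' e'"
proof
  fix y assume "y \<in> skorokhod_nhd x T e"
  then obtain l where "y \<in> cadlag_paths" "l \<in> time_changes"
    "\<forall>t\<in>{0..T}. \<bar>l t - t\<bar> < e \<and> dist (y t) (x (l t)) < e"
    unfolding skorokhod_nhd_def by blast
  moreover from this assms
  have "\<forall>t\<in>{0..T'}. \<bar>l t - t\<bar> < e' \<and> dist (y t) (x (l t)) < e'"
    by (force intro: less_le_trans)
  ultimately show "y \<in> skorokhod_nhd x T' e'"
    unfolding skorokhod_nhd_def by blast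
qed

lemma istopology_skorokhod:
  "istopology (skorokhod_open :: (real \<Rightarrow> 'e::metric_space) set \<Rightarrow> bool)"
  unfolding istopology_def
proof (intro conjI allI impI)
  fix V W :: "(real \<Rightarrow> 'e) set"
  assume V: "skorokhod_open V" and W: "skorokhod_open W"
  show "skorokhod_open (V \<inter> W)"
    unfolding skorokhod_open_def
  proof (intro conjI ballI)
    show "V \<inter> W \<subseteq> cadlag_paths"
      using V by (auto simp: skorokhod_open_def)
    fix x assume "x \<in> V \<inter> W"
    then obtain T1 e1 T2 e2 where *: "T1 > 0" "e1 > 0" "skorokhod_nhd x T1 e1 \<subseteq> V"
      "T2 > 0" "e2 > 0" "skorokhod_nhd x T2 e2 \<subseteq> W"
      using V W unfolding skorokhod_open_def by (meson IntD1 IntD2)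
    have "skorokhod_nhd x (max T1 T2) (min e1 e2) \<subseteq> V \<inter> W"
      using * skorokhod_nhd_mono[of T1 "max T1 T2" "min e1 e2" e1 x]
        skorokhod_nhd_mono[of T2 "max T1 T2" "min e1 e2" e2 x] by auto
    with * show "\<exists>T>0. \<exists>e>0. skorokhod_nhd x T e \<subseteq> V \<inter> W"
      by (intro exI[of _ "max T1 T2"] exI[of _ "min e1 e2"] conjI) auto
  qed
next
  fix K :: "(real \<Rightarrow> 'e) set set"
  assume K: "\<forall>V\<in>K. skorokhod_open V"
  show "skorokhod_open (\<Union>K)"
    unfolding skorokhod_open_def
  proof (intro conjI ballI)
    show "\<Union>K \<subseteq> cadlag_paths"
      using K by (auto simp: skorokhod_open_def)
    fix x assume "x \<in> \<Union>K"
    then obtain V where "V \<in> K" "x \<in> V" by blast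
    with K show "\<exists>T>0. \<exists>e>0. skorokhod_nhd x T e \<subseteq> \<Union>K"
      unfolding skorokhod_open_def by (meson Sup_upper subset_trans)
  qed
qed

lemma openin_skorokhod: "openin skorokhod_topology V \<longleftrightarrow> skorokhod_open V"
  unfolding skorokhod_topology_def by (simp add: istopology_skorokhod)

lemma topspace_skorokhod: "topspace skorokhod_topology = cadlag_paths"
proof -
  have "skorokhod_open (cadlag_paths :: (real \<Rightarrow> 'e::metric_space) set)"
    unfolding skorokhod_open_def skorokhod_nhd_def using zero_less_one by blast
  then show ?thesis
    by (auto simp: topspace_def openin_skorokhod skorokhod_open_def)
qed


section \<open>Feller processes\<close>

definition transition_semigroup ::
  "(real \<Rightarrow> 'e \<Rightarrow> 'e measure) \<Rightarrow> real \<Rightarrow> ('e \<Rightarrow> real) \<Rightarrow> ('e \<Rightarrow> real)" where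
  "transition_semigroup \<kappa> t f = (\<lambda>x. \<integral>y. f y \<partial>\<kappa> t x)"

text \<open>
  A conservative transition function whose operators form a strongly continuous semigroup on
  \<open>C(E)\<close>. Positivity, contractivity and preservation of constants are automatic, as
  the \<open>\<kappa> t x\<close> are probability measures.
\<close>

definition feller_transition_function ::
  "(real \<Rightarrow> 'e::metric_space \<Rightarrow> 'e measure) \<Rightarrow> bool" where
  "feller_transition_function \<kappa> \<longleftrightarrow>
     (\<forall>t\<ge>0. \<kappa> t \<in> measurable borel (prob_algebra borel)) \<and>
     (\<forall>x. \<kappa> 0 x = return borel x) \<and>
     (\<forall>s\<ge>0. \<forall>t\<ge>0. \<forall>x. \<kappa> (s + t) x = \<kappa> s x \<bind> \<kappa> t) \<and>
     (\<forall>f::'e \<Rightarrow>\<^sub>C real. \<forall>t\<ge>0. continuous_on UNIV (transition_semigroup \<kappa> t f)) \<and>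
     (\<forall>f::'e \<Rightarrow>\<^sub>C real. uniform_limit UNIV (\<lambda>t. transition_semigroup \<kappa> t f) f (at_right 0))"

definition past ::
  "'v measure \<Rightarrow> (real \<Rightarrow> 'v \<Rightarrow> 'e::topological_space) \<Rightarrow> real \<Rightarrow> 'v measure" where
  "past Q F s = sigma (space Q) (\<Union>u\<in>{0..s}. {F u -` A \<inter> space Q | A. A \<in> sets borel})"

definition path_of :: "(real \<Rightarrow> 'v \<Rightarrow> 'e) \<Rightarrow> 'v \<Rightarrow> (real \<Rightarrow> 'e)" where
  "path_of F \<omega> = (\<lambda>t\<in>{0..}. F t \<omega>)"

text \<open>A process with cadlag paths that is Markov with respect to its own filtration.\<close>

definition feller_process ::
  "'v measure \<Rightarrow> (real \<Rightarrow> 'v \<Rightarrow> 'e::metric_space) \<Rightarrow> (real \<Rightarrow> 'e \<Rightarrow> 'e measure) \<Rightarrow> bool" where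
  "feller_process Q F \<kappa> \<longleftrightarrow>
     prob_space Q \<and> feller_transition_function \<kappa> \<and>
     (\<forall>t\<ge>0. F t \<in> borel_measurable Q) \<and>
     (\<forall>\<omega>\<in>space Q. path_of F \<omega> \<in> cadlag_paths) \<and>
     (\<forall>s\<ge>0. \<forall>t\<ge>0. \<forall>f::'e \<Rightarrow>\<^sub>C real.
        AE \<omega> in Q. real_cond_exp Q (past Q F s) (\<lambda>\<omega>. f (F (s + t) \<omega>)) \<omega> =
          transition_semigroup \<kappa> t f (F s \<omega>))"

definition stationary_measure ::
  "(real \<Rightarrow> 'e::topological_space \<Rightarrow> 'e measure) \<Rightarrow> 'e measure \<Rightarrow> bool" where
  "stationary_measure \<kappa> M \<longleftrightarrow>
     prob_space M \<and> sets M = sets borel \<and> (\<forall>t\<ge>0. M \<bind> \<kappa> t = M)"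

text \<open>\<open>\<kappa> t x\<close> is the law at time \<open>t\<close> of the process started in \<open>x\<close>.\<close>

definition ergodic_with ::
  "(real \<Rightarrow> 'e::topological_space \<Rightarrow> 'e measure) \<Rightarrow> 'e measure \<Rightarrow> bool" where
  "ergodic_with \<kappa> M \<longleftrightarrow>
     stationary_measure \<kappa> M \<and> (\<forall>N. stationary_measure \<kappa> N \<longrightarrow> N = M) \<and>
     (\<forall>x. weakly_converges euclidean (\<lambda>t. \<kappa> t x) M at_top)"

end

theory Submission
  imports Defs "HOL-Real_Asymp.Real_Asymp"
begin

text \<open>
  On \<open>C(S n)\<close> the generator \<open>A n = c n (T n - 1)\<close> maps the functions \<open>d s\<close> with \<open>|s| \<le> k\<close> into their
  span, and this triangular action does not depend on \<open>n\<close>. It is diagonalised by explicit combinations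
  \<open>h s\<close>, for which \<open>T n h s = (1 - c (k - 1) / c n) h s\<close> if \<open>|s| = k\<close>. Hence the powers of \<open>T n\<close>
  converge, first on the \<open>h s\<close> and then, the operators being contractions and the span of the
  \<open>h s\<close> dense, on all of \<open>C(E)\<close>; no general approximation theorem for semigroups is needed. The same
  density argument yields ergodicity and the limit of the stationary distributions.

  Finite-dimensional distributions converge by the Markov property, and the Stone--Weierstrass theorem
  turns this into weak convergence of the restrictions of the paths to a countable dense set of
  times, in a compact space. To reach the Skorokhod space, one shows that up to small probability these
  restrictions lie in one compact set of functions with small oscillation between well separated
  times. On this set the extension to cadlag paths is continuous, so that
  Tietze's theorem transports bounded continuous functionals. The oscillation estimate bounds, by
  Ottaviani's inequality, the probability of a quick exit from a ball, uniformly in the starting point.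
\<close>

section \<open>Probability measures on a compact metric space\<close>

text \<open>The weights in \<open>h_lim\<close> solve a bidiagonal system. For fixed s of level k
  let G_i be the sum of \<open>p_up U i k r s\<close> times \<open>d r\<close> over r in
  \<open>S i\<close>. The generator \<open>A n\<close> annihilates G_0 and maps G_(i+1) to c_i (G_i
  - G_(i+1)). So the combination of the G_i with weights \<open>eta c i k\<close> is an eigenvector
  for -c_(k-1) as soon as \<open>eta\<close> satisfies a first-order recursion in i, and the product
  in its definition is the solution. In the general setting \<open>U n\<close> may have negative
  entries, so \<open>p_up\<close> is no transition probability; even the nonnegativity of the
  weights of M_n has to be drawn from the convergence of the powers of \<open>T n\<close>. Tightness
  has to cope with an unbounded number of exits in bounded time. Discounting time by a factor
  \<beta> makes the expected discount at the k-th exit at most (3/4)^k. The probability of a quick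
  exit anywhere up to step L is then bounded by a geometric sum, 4 \<gamma> / \<beta>^L, where
  \<gamma> bounds the probability that a single exit is quick.\<close>

lemma closed_indicator_limit:
  fixes C :: "'a::metric_space set"
  assumes "closed C"
  obtains f :: "nat \<Rightarrow> 'a \<Rightarrow> real" where "\<And>m. continuous_on UNIV (f m)"
    "\<And>m x. 0 \<le> f m x" "\<And>m x. f m x \<le> 1" "\<And>m x. indicator C x \<le> f m x"
    "\<And>x. (\<lambda>m. f m x) \<longlonglongrightarrow> indicator C x"
proof (cases "C = {}")
  case True
  show ?thesis
    by (rule that[of "\<lambda>_ _. 0"]) (auto simp: True)
next
  case False
  define f :: "nat \<Rightarrow> 'a \<Rightarrow> real" where "f m x = max 0 (1 - real m * infdist x C)" for m x
  show ?thesis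
  proof (rule that[of f])
    show "continuous_on UNIV (f m)" for m
      unfolding f_def by (intro continuous_intros)
    show "0 \<le> f m x" "f m x \<le> 1" for m x
      by (auto simp: f_def infdist_nonneg)
    show "indicator C x \<le> f m x" for m x
      by (auto simp: f_def indicator_def)
    show "(\<lambda>m. f m x) \<longlonglongrightarrow> indicator C x" for x
    proof (cases "x \<in> C")
      case True
      then show ?thesis by (simp add: f_def)
    next
      case x: False
      with assms False have pos: "infdist x C > 0"
        by (metis in_closed_iff_infdist_zero infdist_nonneg less_eq_real_def)
      have "\<forall>\<^sub>F m in sequentially. 1 \<le> real m * infdist x C"
        proof -
      obtain k :: nat where k: "1 / infdist x C \<le> real k" using real_arch_simple by blast
      have "1 \<le> real m * infdist x C" if "k \<le> m" for m
      proof -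
        have "1 / infdist x C \<le> real m" using k that by linarith
        then show ?thesis using pos by (simp add: field_simps)
      qed
      then show ?thesis by (auto simp: eventually_sequentially)
    qed
      then have "\<forall>\<^sub>F m in sequentially. f m x = 0"
        by eventually_elim (auto simp: f_def)
      then show ?thesis
        using x by (simp add: tendsto_eventually)
    qed
  qed
qed

lemma integrable_bounded_borel:
  fixes f :: "'a::topological_space \<Rightarrow> real"
  assumes "prob_space M" "sets M = sets borel" "f \<in> borel_measurable borel" "\<And>x. \<bar>f x\<bar> \<le> B"
  shows "integrable M f"
proof -
  interpret prob_space M by fact
  show ?thesis
    by (rule integrable_const_bound[of _ B]) (use assms in \<open>auto simp: measurable_cong_sets[OF assms(2) refl]\<close>)
qed

lemma continuous_bounded_on_compact_UNIV:
  fixes f :: "'a::topological_space \<Rightarrow> real"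
  assumes "compact (UNIV :: 'a set)" "continuous_on UNIV f"
  obtains B where "B > 0" "\<And>x. \<bar>f x\<bar> \<le> B"
proof -
  have "bounded (range f)"
    using compact_continuous_image[OF assms(2,1)] by (rule compact_imp_bounded)
  then obtain B where "\<And>x. \<bar>f x\<bar> \<le> B"
    by (auto simp: bounded_iff)
  then show ?thesis
    by (intro that[of "\<bar>B\<bar> + 1"]) (auto intro: order_trans[of _ B])
qed

lemma measure_closed_limit:
  fixes C :: "'a::metric_space set"
  assumes "closed C" "prob_space M" "sets M = sets borel"
    "\<And>m. f m \<in> borel_measurable borel"
    "\<And>m x. 0 \<le> f m x" "\<And>m x. f m x \<le> (1::real)" "\<And>x. (\<lambda>m. f m x) \<longlonglongrightarrow> indicator C x"
  shows "(\<lambda>m. \<integral>x. f m x \<partial>M) \<longlonglongrightarrow> measure M C"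
proof -
  interpret prob_space M by fact
  have [measurable]: "C \<in> sets M" "\<And>m. f m \<in> borel_measurable M"
    using assms by (auto simp: measurable_cong_sets[OF assms(3) refl])
  have "(\<lambda>m. \<integral>x. f m x \<partial>M) \<longlonglongrightarrow> (\<integral>x. indicator C x \<partial>M)"
    by (rule integral_dominated_convergence[where w="\<lambda>_. 1"]) (use assms in auto)
  then show ?thesis
    by (simp add: Int_absorb1 sets.sets_into_space)
qed

text \<open>Closed sets form an intersection-stable generator of the Borel sets, and the measure of
  a closed set is the limit of integrals of the bounded continuous functions from
  \<open>closed_indicator_limit\<close>.\<close>

lemma prob_measure_eqI_continuous:
  fixes M N :: "'a::metric_space measure"
  assumes "prob_space M" "prob_space N" "sets M = sets borel" "sets N = sets borel"
    and eq: "\<And>f. continuous_on UNIV f \<Longrightarrow> bounded (range f) \<Longrightarrow> (\<integral>x. f x \<partial>M) = (\<integral>x. (f x :: real) \<partial>N)"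
  shows "M = N"
proof -
  interpret M: prob_space M by fact
  interpret N: prob_space N by fact
  have closed_eq: "emeasure M C = emeasure N C" if C: "closed C" for C
  proof -
    obtain f :: "nat \<Rightarrow> 'a \<Rightarrow> real" where f: "\<And>m. continuous_on UNIV (f m)"
      "\<And>m x. 0 \<le> f m x" "\<And>m x. f m x \<le> 1" "\<And>m x. indicator C x \<le> f m x"
      "\<And>x. (\<lambda>m. f m x) \<longlonglongrightarrow> indicator C x"
      by (rule closed_indicator_limit[OF C]) (rule that)
    have fm: "f m \<in> borel_measurable borel" for m
      using f(1) by (rule borel_measurable_continuous_onI)
    have "(\<lambda>m. \<integral>x. f m x \<partial>M) \<longlonglongrightarrow> measure M C"
      by (rule measure_closed_limit[OF C assms(1,3) fm f(2,3,5)])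
    moreover have "(\<lambda>m. \<integral>x. f m x \<partial>N) \<longlonglongrightarrow> measure N C"
      by (rule measure_closed_limit[OF C assms(2,4) fm f(2,3,5)])
    moreover have "(\<integral>x. f m x \<partial>M) = (\<integral>x. f m x \<partial>N)" for m
      using f by (intro eq) (auto simp: bounded_iff intro!: exI[of _ 1])
    ultimately have "measure M C = measure N C"
      by (simp add: LIMSEQ_unique)
    then show ?thesis
      by (simp add: M.emeasure_eq_measure N.emeasure_eq_measure)
  qed
  show ?thesis
  proof (rule measure_eqI_generator_eq[where E="Collect closed" and \<Omega>=UNIV and A="\<lambda>_. UNIV"])
    show "sets M = sigma_sets UNIV (Collect closed)" "sets N = sigma_sets UNIV (Collect closed)"
      using assms by (simp_all add: borel_eq_closed)
  qed (use closed_eq in \<open>auto simp: Int_stable_def\<close>)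
qed

text \<open>The Cantor set argument: at the first disagreement, index m, the digits 0 and 2
  contribute a difference of 2/3^(m+1), while all later digits together contribute at most
  1/3^(m+1). With binary digits distinct sequences could have the same sum.\<close>

lemma ternary_digits_eq:
  fixes a b :: "nat \<Rightarrow> bool"
  assumes "\<bar>(\<Sum>m. 2 * of_bool (a m) * (1/3::real) ^ Suc m) - (\<Sum>m. 2 * of_bool (b m) * (1/3) ^ Suc m)\<bar> < (1/3) ^ M"
  shows "\<forall>m<M. a m = b m"
proof (rule ccontr)
  assume neg: "\<not> ?thesis"
  obtain m where m: "m < M" "a m \<noteq> b m" "\<And>j. j < m \<Longrightarrow> a j = b j"
  proof -
    let ?P = "\<lambda>m. m < M \<and> a m \<noteq> b m"
    from neg have "?P (Least ?P)" by (intro LeastI_ex[of ?P]) auto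
    moreover from this have "a j = b j" if "j < Least ?P" for j
      using not_less_Least[OF that] that by auto
    ultimately show ?thesis using that[of "Least ?P"] by blast
  qed
  have geom: "summable (\<lambda>m. 2 * (1/3::real) ^ Suc m)"
    by (intro summable_mult summable_ignore_initial_segment[of _ 1, simplified]) (simp add: summable_geometric)
  have sa: "summable (\<lambda>m. 2 * of_bool (c m) * (1/3::real) ^ Suc m)" for c
    by (rule summable_comparison_test'[OF geom]) (auto simp: of_bool_def)
  define d where "d j = 2 * (of_bool (a j) - of_bool (b j)) * (1/3::real) ^ Suc j" for j
  have sd: "summable d"
    using summable_diff[OF sa[of a] sa[of b]] by (simp add: d_def[abs_def] algebra_simps)
  have "(\<Sum>m. 2 * of_bool (a m) * (1/3::real) ^ Suc m) - (\<Sum>m. 2 * of_bool (b m) * (1/3) ^ Suc m) = suminf d"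
    by (subst suminf_diff[OF sa sa]) (simp add: d_def[abs_def] algebra_simps)
  also have "\<dots> = (\<Sum>j. d (j + Suc m)) + sum d {..<Suc m}"
    by (rule suminf_split_initial_segment[OF sd])
  also have "sum d {..<Suc m} = d m"
    using m(3) by (simp add: d_def)
  finally have eq: "(\<Sum>m. 2 * of_bool (a m) * (1/3::real) ^ Suc m) - (\<Sum>m. 2 * of_bool (b m) * (1/3) ^ Suc m)
      = (\<Sum>j. d (j + Suc m)) + d m" .
  have gs: "(\<lambda>j. 2 * (1/3::real) ^ Suc (j + Suc m)) sums ((1/3) ^ Suc m)"
    using sums_mult[OF geometric_sums[of "1/3::real"], of "2 * (1/3)^Suc (Suc m)"]
    by (simp add: power_add algebra_simps)
  have "\<bar>\<Sum>j. d (j + Suc m)\<bar> \<le> (\<Sum>j. 2 * (1/3::real) ^ Suc (j + Suc m))"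
  proof -
    have b: "norm (d (j + Suc m)) \<le> 2 * (1/3::real) ^ Suc (j + Suc m)" for j
      by (simp add: d_def of_bool_def)
    have "norm (\<Sum>j. d (j + Suc m)) \<le> (\<Sum>j. 2 * (1/3::real) ^ Suc (j + Suc m))"
      by (rule norm_suminf_le[OF b sums_summable[OF gs]])
    then show ?thesis by simp
  qed
  also have "\<dots> = (1/3) ^ Suc m"
    using gs by (simp add: sums_iff)
  finally have "\<bar>\<Sum>j. d (j + Suc m)\<bar> \<le> (1/3) ^ Suc m" .
  moreover have "\<bar>d m\<bar> = 2 * (1/3) ^ Suc m"
    using m(2) by (cases "a m"; cases "b m") (simp_all add: d_def)
  ultimately have "(1/3::real) ^ Suc m \<le> \<bar>(\<Sum>j. d (j + Suc m)) + d m\<bar>"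
    by linarith
  moreover have "(1/3::real) ^ M \<le> (1/3) ^ Suc m"
    using m(1) by (intro power_decreasing) auto
  ultimately show False
    using assms unfolding eq by linarith
qed

text \<open>The digits of the code are the indicators of a countable base. By compactness,
  points lying in the same elements of a large finite part of the base are close, so that decoding is
  uniformly continuous. This reduces weak compactness to Helly's theorem on the real line.\<close>

lemma compact_metric_real_coding:
  assumes "compact (UNIV :: 'a::polish_space set)"
  obtains e :: "'a::polish_space \<Rightarrow> real" and g :: "real \<Rightarrow> 'a" where
    "e \<in> borel_measurable borel" "\<And>x. 0 \<le> e x" "\<And>x. e x \<le> 1"
    "continuous_on (closure (range e)) g" "\<And>x. g (e x) = x"
proof -
  obtain BB :: "'a set set" where BB: "countable BB" "topological_basis BB"
    using ex_countable_basis by blast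
  have "BB \<noteq> {}"
    using topological_basisE[OF BB(2) open_UNIV, of undefined] by blast
  define B where "B = from_nat_into BB"
  have rB: "range B = BB"
    unfolding B_def by (rule range_from_nat_into) fact+
  define e where "e x = (\<Sum>m. 2 * of_bool (x \<in> B m) * (1/3::real) ^ Suc m)" for x
  have geom: "(\<lambda>m. 2 * (1/3::real) ^ Suc m) sums 1"
    using sums_mult[OF geometric_sums[of "1/3::real"], of "2/3"] by (simp add: algebra_simps)
  have se: "summable (\<lambda>m. 2 * of_bool (x \<in> B m) * (1/3::real) ^ Suc m)" for x
    by (rule summable_comparison_test'[OF sums_summable[OF geom]]) (auto simp: of_bool_def)
  have e0: "0 \<le> e x" for x
    unfolding e_def by (rule suminf_nonneg[OF se]) auto
  have e1: "e x \<le> 1" for x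
  proof -
    have "e x \<le> (\<Sum>m. 2 * (1/3::real) ^ Suc m)"
      unfolding e_def by (rule suminf_le[OF _ se sums_summable[OF geom]]) (auto simp: of_bool_def)
    then show ?thesis using geom by (simp add: sums_iff)
  qed
  have opB: "open (B m)" for m
    using topological_basis_open[OF BB(2)] rB by blast
  have [measurable]: "B m \<in> sets borel" for m
    using opB by simp
  have em: "e \<in> borel_measurable borel"
    unfolding e_def by measurable
  have unif: "\<exists>M. \<forall>x y. \<bar>e x - e y\<bar> < (1/3) ^ M \<longrightarrow> dist x y < \<epsilon>" if "\<epsilon> > 0" for \<epsilon>
  proof -
    have "\<exists>m. x \<in> B m \<and> B m \<subseteq> ball x (\<epsilon>/2)" for x
      using topological_basisE[OF BB(2) open_ball[of x "\<epsilon>/2"], of x] that rB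
      by (metis centre_in_ball half_gt_zero_iff rangeE)
    then obtain i where i: "\<And>x. x \<in> B (i x)" "\<And>x. B (i x) \<subseteq> ball x (\<epsilon>/2)"
      by metis
    obtain C where C: "finite C" "UNIV \<subseteq> (\<Union>x\<in>C. B (i x))"
      using compactE_image[OF assms, of UNIV "\<lambda>x. B (i x)"] opB i by (metis UNIV_I UN_iff subsetI)
    obtain M where M: "\<And>x. x \<in> C \<Longrightarrow> i x < M"
      using finite_nat_set_iff_bounded[of "i ` C"] C(1) by auto
    have "dist x y < \<epsilon>" if xy: "\<bar>e x - e y\<bar> < (1/3) ^ M" for x y
    proof -
      have "\<forall>m<M. (x \<in> B m) = (y \<in> B m)"
        using ternary_digits_eq[OF xy[unfolded e_def]] .
      moreover obtain z where z: "z \<in> C" "x \<in> B (i z)"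
        using C by blast
      ultimately have "y \<in> B (i z)" using M by blast
      with z i have "dist z x < \<epsilon>/2" "dist z y < \<epsilon>/2" by (auto simp: subset_iff)
      then show ?thesis
        by (metis dist_commute dist_triangle_half_l)
    qed
    then show ?thesis by blast
  qed
  have inj: "inj e"
  proof (rule injI, rule ccontr)
    fix x y assume "e x = e y" "x \<noteq> y"
    then obtain M where "\<forall>x' y'. \<bar>e x' - e y'\<bar> < (1/3) ^ M \<longrightarrow> dist x' y' < dist x y"
      using unif[of "dist x y"] by auto
    then have "\<bar>e x - e y\<bar> < (1/3) ^ M \<longrightarrow> dist x y < dist x y" by blast
    with \<open>e x = e y\<close> show False by simp
  qed
  \<comment> \<open>Uniform continuity lets the decoding extend to the closure of the range, where
    weak limits of codes may put mass.\<close>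
  have "uniformly_continuous_on (range e) (inv e)"
    unfolding uniformly_continuous_on_def
  proof (intro allI impI)
    fix \<epsilon> :: real assume "\<epsilon> > 0"
    then obtain M where "\<forall>x y. \<bar>e x - e y\<bar> < (1/3) ^ M \<longrightarrow> dist x y < \<epsilon>"
      using unif by blast
    then show "\<exists>d>0. \<forall>x\<in>range e. \<forall>x'\<in>range e. dist x' x < d \<longrightarrow> dist (inv e x') (inv e x) < \<epsilon>"
      by (intro exI[of _ "(1/3) ^ M"]) (auto simp: inv_f_f[OF inj] dist_real_def)
  qed
  then obtain g where g: "uniformly_continuous_on (closure (range e)) g" "\<And>x. x \<in> range e \<Longrightarrow> inv e x = g x"
    by (rule uniformly_continuous_on_extension_on_closure) blast
  show ?thesis
  proof (rule that[of e g])
    show "g (e x) = x" for x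
      using g(2)[of "e x"] by (simp add: inv_f_f[OF inj])
  qed (use em e0 e1 g uniformly_continuous_imp_continuous in auto)
qed

text \<open>The images under the code \<open>e\<close> live on [0,1], hence have a weakly convergent
  subsequence, and the limit on the line is brought back by the decoding \<open>g\<close>. The code
  itself need not be continuous: for continuous f the composition \<open>f \<circ> g\<close> is
  continuous on the closed set \<open>C\<close>, and its Tietze extension \<open>F\<close> satisfies
  \<open>F (e x) = f x\<close>.\<close>

proposition prob_measures_compact_weak_subsequence:
  fixes N :: "nat \<Rightarrow> 'a::polish_space measure"
  assumes comp: "compact (UNIV :: 'a set)"
    and N: "\<And>n. prob_space (N n)" "\<And>n. sets (N n) = sets borel"
  obtains r M where "strict_mono (r :: nat \<Rightarrow> nat)" "prob_space M" "sets M = sets borel"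
    "\<And>f :: 'a \<Rightarrow> real. continuous_on UNIV f \<Longrightarrow> (\<lambda>n. \<integral>x. f x \<partial>N (r n)) \<longlonglongrightarrow> (\<integral>x. f x \<partial>M)"
proof -
  obtain e :: "'a \<Rightarrow> real" and g where e: "e \<in> borel_measurable borel" "\<And>x. 0 \<le> e x" "\<And>x. e x \<le> 1"
    and g: "continuous_on (closure (range e)) g" "\<And>x. g (e x) = x"
    using compact_metric_real_coding[OF comp] by metis
  define C where "C = closure (range e)"
  have eN[measurable]: "e \<in> borel_measurable (N n)" for n
    using e(1) by (simp add: measurable_cong_sets[OF N(2) refl])
  define N' where "N' n = distr (N n) borel e" for n
  have rd: "real_distribution (N' n)" for n
    unfolding N'_def real_distribution_def real_distribution_axioms_def
    using prob_space.prob_space_distr[OF N(1) eN] by auto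
  have "tight N'"
    unfolding tight_def
  proof (intro conjI allI impI)
    fix \<epsilon> :: real assume "\<epsilon> > 0"
    \<comment> \<open>Tightness is phrased with intervals open on the left, so the left end is -1 in
      order to keep the point 0 inside.\<close>
    have "measure (N' n) {-1<..1} = 1" for n
    proof -
      interpret prob_space "N n" by (rule N)
      have "-1 < e x" for x using e(2)[of x] by linarith
      then have "e -` {-1<..1} \<inter> space (N n) = space (N n)"
        using e(3) by auto
      then show ?thesis
        by (simp add: N'_def measure_distr prob_space)
    qed
    then show "\<exists>a b. a < b \<and> (\<forall>n. 1 - \<epsilon> < measure (N' n) {a<..b})"
      using \<open>\<epsilon> > 0\<close> by (intro exI[of _ "-1"] exI[of _ 1]) auto
  qed (use rd in auto)
  then obtain r M' where r: "strict_mono (r::nat\<Rightarrow>nat)" and M': "real_distribution M'"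
    and w: "weak_conv_m (N' \<circ> id \<circ> r) M'"
    using tight_imp_convergent_subsubsequence[of N' id] strict_mono_id by (metis)
  interpret M': real_distribution M' by fact
  have conv: "(\<lambda>n. \<integral>x. F (e x) \<partial>N (r n)) \<longlonglongrightarrow> (\<integral>x. F x \<partial>M')"
    if F: "continuous_on UNIV F" "\<And>x. \<bar>F x\<bar> \<le> B" for F :: "real \<Rightarrow> real" and B
  proof -
    have [measurable]: "F \<in> borel_measurable borel"
      using F by (intro borel_measurable_continuous_onI)
    have "(\<lambda>n. integral\<^sup>L ((N' \<circ> id \<circ> r) n) F) \<longlonglongrightarrow> integral\<^sup>L M' F"
    proof (rule weak_conv_imp_integral_bdd_continuous_conv[OF _ M' w])
      show "real_distribution ((N' \<circ> id \<circ> r) n)" for n using rd by simp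
      show "isCont F x" for x
        using F(1) by (simp add: continuous_on_eq_continuous_at)
      show "norm (F x) \<le> B" for x using F(2) by simp
    qed
    then show ?thesis
      by (simp add: N'_def integral_distr)
  qed
  have clC: "closed C" "C \<noteq> {}"
    by (auto simp: C_def)
  \<comment> \<open>All the approximating laws are carried by \<open>C\<close>; testing the limit
    with the capped distance to \<open>C\<close> shows that it is carried by \<open>C\<close>
    too.\<close>
  have aeC: "AE x in M'. x \<in> C"
  proof -
    define dC where "dC x = min 1 (infdist x C)" for x :: real
    have dC: "continuous_on UNIV dC" "\<And>x. \<bar>dC x\<bar> \<le> 1" "\<And>x. 0 \<le> dC x"
      unfolding dC_def by (intro continuous_intros) (auto simp: infdist_nonneg)
    have dC0: "dC x = 0 \<longleftrightarrow> x \<in> C" for x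
      using in_closed_iff_infdist_zero[OF clC, of x] by (simp add: dC_def min_def)
    have "dC (e x) = 0" for x
      unfolding dC0 C_def by (meson closure_subset rangeI subsetD)
    with conv[OF dC(1,2)] have 0: "(\<integral>x. dC x \<partial>M') = 0"
      by (simp add: LIMSEQ_const_iff)
    have [measurable]: "dC \<in> borel_measurable borel"
      using dC by (intro borel_measurable_continuous_onI)
    have "integrable M' dC"
      by (rule M'.integrable_const_bound[of _ 1]) (use dC in auto)
    then have "AE x in M'. dC x = 0"
      using 0 dC(3) integral_nonneg_eq_0_iff_AE[of M' dC] by simp
    then show ?thesis by (simp add: dC0)
  qed
  define g' where "g' x = (if x \<in> C then g x else undefined)" for x
  have g'm[measurable]: "g' \<in> borel_measurable M'"
  proof -
    have "g' \<in> borel_measurable borel"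
      unfolding g'_def by (rule borel_measurable_continuous_on_if) (use clC g in \<open>auto simp: C_def[symmetric]\<close>)
    then show ?thesis by simp
  qed
  define M where "M = distr M' borel g'"
  show ?thesis
  proof (rule that[of r M])
    show "prob_space M" unfolding M_def by (rule M'.prob_space_distr) simp
    fix f :: "'a \<Rightarrow> real" assume f: "continuous_on UNIV f"
    obtain B where B: "B > 0" "\<And>x. \<bar>f x\<bar> \<le> B"
      using continuous_bounded_on_compact_UNIV[OF comp f] by blast
    have "continuous_on C (\<lambda>x. f (g x))"
      using continuous_on_compose2[OF f, of C g] g by (simp add: C_def)
    then obtain F where F: "continuous_on UNIV F" "\<And>x. x \<in> C \<Longrightarrow> F x = f (g x)" "\<And>x. norm (F x) \<le> B"
      using Tietze[of C "\<lambda>x. f (g x)" UNIV B] clC B by auto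
    have "(\<integral>x. f x \<partial>M) = (\<integral>x. f (g' x) \<partial>M')"
      unfolding M_def using f by (intro integral_distr) (auto intro: borel_measurable_continuous_onI)
    also have "\<dots> = (\<integral>x. F x \<partial>M')"
    proof (rule integral_cong_AE)
      have "F \<in> borel_measurable borel" using F(1) by (rule borel_measurable_continuous_onI)
      then show "F \<in> borel_measurable M'" by simp
      show "(\<lambda>x. f (g' x)) \<in> borel_measurable M'"
        by (rule measurable_compose[OF g'm borel_measurable_continuous_onI[OF f]])
      show "AE x in M'. f (g' x) = F x"
        using aeC by eventually_elim (simp add: g'_def F)
    qed
    finally have "(\<lambda>n. \<integral>x. F (e x) \<partial>N (r n)) \<longlonglongrightarrow> (\<integral>x. f x \<partial>M)"
      using conv[OF F(1), of B] F(3) by simp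
    moreover have "F (e x) = f x" for x
      using F(2)[of "e x"] closure_subset[of "range e"] by (auto simp: g C_def)
    ultimately show "(\<lambda>n. \<integral>x. f x \<partial>N (r n)) \<longlonglongrightarrow> (\<integral>x. f x \<partial>M)"
      by simp
  qed (use r in \<open>auto simp: M_def\<close>)
qed

text \<open>Takes the role of the Riesz representation theorem: a functional that is a pointwise
  limit of integrals is the integral with respect to a subsequential weak limit.\<close>

lemma prob_measures_weak_limit:
  fixes N :: "nat \<Rightarrow> 'a::polish_space measure"
  assumes comp: "compact (UNIV :: 'a set)"
    and N: "\<And>n. prob_space (N n)" "\<And>n. sets (N n) = sets borel"
    and L: "\<And>f. continuous_on UNIV f \<Longrightarrow> (\<lambda>n. \<integral>x. f x \<partial>N n) \<longlonglongrightarrow> L f"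
  obtains M where "prob_space M" "sets M = sets borel"
    "\<And>f :: 'a \<Rightarrow> real. continuous_on UNIV f \<Longrightarrow> (\<integral>x. f x \<partial>M) = L f"
proof -
  obtain r M where r: "strict_mono (r :: nat \<Rightarrow> nat)" and M: "prob_space M" "sets M = sets borel"
    "\<And>f :: 'a \<Rightarrow> real. continuous_on UNIV f \<Longrightarrow> (\<lambda>n. \<integral>x. f x \<partial>N (r n)) \<longlonglongrightarrow> (\<integral>x. f x \<partial>M)"
    by (rule prob_measures_compact_weak_subsequence[OF comp N]) (rule that)
  have "(\<integral>x. f x \<partial>M) = L f" if "continuous_on UNIV f" for f :: "'a \<Rightarrow> real"
    using LIMSEQ_unique[OF M(3)[OF that] LIMSEQ_subseq_LIMSEQ[OF L[OF that] r, unfolded comp_def]] .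
  with M(1,2) show ?thesis by (rule that) auto
qed

text \<open>The portmanteau inequality for closed sets. A lower bound uniform in \<open>n\<close>
  survives because \<open>C\<close> is approximated from above by continuous functions; tightness
  reaches the limit law in this way.\<close>

lemma closed_measure_ge_weak_limit:
  fixes M :: "'a::metric_space measure"
  assumes "closed C" "prob_space M" "sets M = sets borel"
    and N: "\<And>n. prob_space (N n)" "\<And>n. sets (N n) = sets borel" "\<And>n. a \<le> measure (N n) C"
    and lim: "\<And>f :: 'a \<Rightarrow> real. continuous_on UNIV f \<Longrightarrow> bounded (range f) \<Longrightarrow>
      (\<lambda>n. \<integral>x. f x \<partial>N n) \<longlonglongrightarrow> (\<integral>x. f x \<partial>M)"
  shows "a \<le> measure M C"
proof -
  obtain f :: "nat \<Rightarrow> 'a \<Rightarrow> real" where f: "\<And>m. continuous_on UNIV (f m)"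
    "\<And>m x. 0 \<le> f m x" "\<And>m x. f m x \<le> 1" "\<And>m x. indicator C x \<le> f m x"
    "\<And>x. (\<lambda>m. f m x) \<longlonglongrightarrow> indicator C x"
    by (rule closed_indicator_limit[OF assms(1)]) (rule that)
  have fm: "f m \<in> borel_measurable borel" for m
    using f(1) by (rule borel_measurable_continuous_onI)
  have "a \<le> (\<integral>x. f m x \<partial>M)" for m
  proof (rule LIMSEQ_le_const[OF lim])
    show "\<exists>k. \<forall>n\<ge>k. a \<le> (\<integral>x. f m x \<partial>N n)"
    proof (intro exI allI impI)
      fix n
      interpret prob_space "N n" by (rule N)
      have C: "C \<in> sets (N n)" using assms N by auto
      have "a \<le> measure (N n) C" by (rule N)
      also have "\<dots> = (\<integral>x. indicator C x \<partial>N n)"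
        using C by (simp add: Int_absorb1 sets.sets_into_space)
      also have "\<dots> \<le> (\<integral>x. f m x \<partial>N n)"
      proof (rule integral_mono)
        show "integrable (N n) (f m)"
          by (rule integrable_bounded_borel[OF N(1,2) fm, of _ 1]) (use f(2,3) in auto)
      qed (use C f in \<open>auto simp: integrable_real_indicator emeasure_eq_measure\<close>)
      finally show "a \<le> (\<integral>x. f m x \<partial>N n)" .
    qed
  qed (use f in \<open>auto simp: bounded_iff intro!: exI[of _ 1]\<close>)
  then show ?thesis
    using measure_closed_limit[OF assms(1-3) fm f(2,3,5)] by (intro LIMSEQ_le_const) auto
qed

section \<open>Eigenfunctions of intertwined chains\<close>

lemma fin_C_indicator [simp]: "s \<in> Z \<Longrightarrow> indicator {s} \<in> fin_C Z"
  by (auto simp: fin_C_def indicator_def)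

lemma fin_C_lincomb: "(\<And>i. i \<in> I \<Longrightarrow> f i \<in> fin_C Z) \<Longrightarrow> (\<lambda>x. \<Sum>i\<in>I. a i * f i x) \<in> fin_C Z"
  by (auto simp: fin_C_def)

lemma fin_C_expand:
  assumes "finite Z" "f \<in> fin_C Z"
  shows "f = (\<lambda>x. \<Sum>r\<in>Z. f r * indicator {r} x)"
proof
  fix x
  have "(\<Sum>r\<in>Z. f r * indicator {r} x) = (\<Sum>r\<in>Z. if r = x then f r else 0)"
    by (intro sum.cong refl) (auto simp: indicator_def)
  also have "\<dots> = f x"
    using assms by (simp add: fin_C_def)
  finally show "f x = (\<Sum>r\<in>Z. f r * indicator {r} x)" ..
qed

lemma linear_operator_add:
  "linear_operator Z' Z L \<Longrightarrow> f \<in> fin_C Z' \<Longrightarrow> g \<in> fin_C Z' \<Longrightarrow> L (\<lambda>x. f x + g x) = (\<lambda>x. L f x + L g x)"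
  by (simp add: linear_operator_def)

lemma linear_operator_scale:
  "linear_operator Z' Z L \<Longrightarrow> f \<in> fin_C Z' \<Longrightarrow> L (\<lambda>x. a * f x) = (\<lambda>x. a * L f x)"
  by (simp add: linear_operator_def)

lemma linear_operator_lincomb:
  assumes L: "linear_operator Z' Z L" and "finite I" "\<And>i. i \<in> I \<Longrightarrow> f i \<in> fin_C Z'"
  shows "L (\<lambda>x. \<Sum>i\<in>I. a i * f i x) = (\<lambda>x. \<Sum>i\<in>I. a i * L (f i) x)"
  using assms(2,3)
proof (induction I rule: finite_induct)
  case empty
  have "(\<lambda>x. 0) \<in> fin_C Z'" by (simp add: fin_C_def)
  from linear_operator_scale[OF L this, of 0] show ?case by simp
next
  case (insert i I)
  have i: "f i \<in> fin_C Z'" and I: "(\<lambda>x. \<Sum>i\<in>I. a i * f i x) \<in> fin_C Z'"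
    using insert.prems by (simp, intro fin_C_lincomb) simp
  have ai: "(\<lambda>x. a i * f i x) \<in> fin_C Z'"
    using i by (simp add: fin_C_def)
  show ?case
    using linear_operator_add[OF L ai I] linear_operator_scale[OF L i, of "a i"] insert
    by simp
qed

lemma linear_operator_fin_C: "linear_operator Z' Z L \<Longrightarrow> f \<in> fin_C Z' \<Longrightarrow> L f \<in> fin_C Z"
  by (auto simp: linear_operator_def)

lemma linear_operator_matrix_op: "linear_operator Z' Z (matrix_op Z Z' m)"
  unfolding linear_operator_def
  by (auto simp: matrix_op_def fin_C_def sum.distrib algebra_simps sum_distrib_left fun_eq_iff)

lemma transition_operator_linear:
  assumes "transition_operator Z' Z L" shows "linear_operator Z' Z L"
proof -
  obtain m where m: "\<And>f. f \<in> fin_C Z' \<Longrightarrow> L f = matrix_op Z Z' m f"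
    using assms by (auto simp: transition_operator_def)
  have fc: "(\<lambda>x. f x + g x) \<in> fin_C Z'" "(\<lambda>x. a * f x) \<in> fin_C Z'"
    if "f \<in> fin_C Z'" "g \<in> fin_C Z'" for f g a
    using that by (auto simp: fin_C_def)
  show ?thesis
    using linear_operator_matrix_op[of Z' Z m] m fc unfolding linear_operator_def
    by (auto simp: image_subset_iff)
qed

lemma matrix_op_one: "stochastic_matrix Z Z' m \<Longrightarrow> matrix_op Z Z' m (indicator Z') = indicator Z"
  by (auto simp: matrix_op_def stochastic_matrix_def fun_eq_iff indicator_def if_distrib cong: sum.cong)

lemma matrix_op_mono:
  assumes "stochastic_matrix Z Z' m" "\<And>y. y \<in> Z' \<Longrightarrow> f y \<le> g y"
  shows "matrix_op Z Z' m f x \<le> matrix_op Z Z' m g x"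
  using assms by (auto simp: matrix_op_def stochastic_matrix_def intro!: sum_mono mult_left_mono)

lemma matrix_op_bound:
  assumes "stochastic_matrix Z Z' m" "\<And>y. y \<in> Z' \<Longrightarrow> \<bar>f y\<bar> \<le> B" "0 \<le> B"
  shows "\<bar>matrix_op Z Z' m f x\<bar> \<le> B"
proof (cases "x \<in> Z")
  case True
  have "\<bar>\<Sum>y\<in>Z'. m x y * f y\<bar> \<le> (\<Sum>y\<in>Z'. \<bar>m x y * f y\<bar>)"
    by (rule sum_abs)
  also have "\<dots> \<le> (\<Sum>y\<in>Z'. m x y * B)"
    using assms True by (intro sum_mono) (auto simp: abs_mult stochastic_matrix_def intro!: mult_mono)
  also have "\<dots> = B"
    using assms True by (simp add: stochastic_matrix_def flip: sum_distrib_right)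
  finally show ?thesis using True by (simp add: matrix_op_def)
qed (use assms in \<open>simp add: matrix_op_def\<close>)

text \<open>The recursion of \<open>up_iter\<close> removes the last operator; the eigenfunction
  computation has to remove the first one, since the generator acts at the lower index.\<close>

lemma up_iter_first:
  "i < k \<Longrightarrow> up_iter U i k f = U i (up_iter U (Suc i) k f)"
proof (induction k arbitrary: f)
  case (Suc k)
  show ?case
  proof (cases "i < k")
    case True
    then show ?thesis using Suc by simp
  next
    case False
    with Suc have "i = k" by simp
    moreover have "up_iter U k k g = g" for g by (cases k) auto
    ultimately show ?thesis by simp
  qed
qed simp

lemma up_iter_same [simp]: "up_iter U k k f = f"
  by (cases k) auto

lemma down_iter_same [simp]: "down_iter D k k f = f"
  by (cases k) auto

lemma eta_same [simp]: "eta c k k = 1"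
  by (simp add: eta_def)

text \<open>The eigenvector recursion c_i eta_(i+1) - c_(i-1) eta_i = -c_(k-1) eta_i. The
  denominators in \<open>eta\<close> are those that solve it downwards from
  \<open>eta c k k = 1\<close>.\<close>

lemma eta_Suc:
  assumes "i < k" "rate_before c i \<noteq> rate_before c k"
  shows "c i * eta c (Suc i) k = (rate_before c i - rate_before c k) * eta c i k"
proof -
  have "{i..<k} = insert i {Suc i..<k}" using assms by auto
  then show ?thesis
    using assms by (simp add: eta_def)
qed

text \<open>
  The commutation relations shared by the two settings. The operators \<open>U n\<close> need not be positive,
  so that no transition matrix of upward steps is available.
\<close>

locale intertwined_chains =
  fixes S :: "nat \<Rightarrow> 's set" and root :: 's and p :: "nat \<Rightarrow> 's \<Rightarrow> 's \<Rightarrow> real"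
    and c :: "nat \<Rightarrow> real" and D U :: "nat \<Rightarrow> ('s \<Rightarrow> real) \<Rightarrow> ('s \<Rightarrow> real)"
  assumes fin_S: "finite (S n)" and disj: "disjoint_family S" and S0: "S 0 = {root}"
    and S_ne: "S n \<noteq> {}"
    and stoch: "stochastic_matrix (S n) (S n) (p n)"
    and c_pos: "0 < c n" and c_less: "c n < c (Suc n)"
    and D_trans: "transition_operator (S n) (S (Suc n)) (D (Suc n))"
    and U_lin: "linear_operator (S (Suc n)) (S n) (U n)"
    and UD: "f \<in> fin_C (S n) \<Longrightarrow> U n (D (Suc n) f) = matrix_op (S n) (S n) (p n) f"
    and rate_DU: "f \<in> fin_C (S (Suc n)) \<Longrightarrow>
      c (Suc n) * (matrix_op (S (Suc n)) (S (Suc n)) (p (Suc n)) f r - f r) = c n * (D (Suc n) (U n f) r - f r)"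
begin

abbreviation T :: "nat \<Rightarrow> ('s \<Rightarrow> real) \<Rightarrow> ('s \<Rightarrow> real)" where
  "T n \<equiv> matrix_op (S n) (S n) (p n)"

lemma level_eq: "s \<in> S k \<Longrightarrow> level S s = k"
  unfolding level_def using disj by (auto simp: disjoint_family_on_def intro!: the_equality)

lemma c_strict_mono: "strict_mono c"
  using c_less by (simp add: strict_mono_Suc_iff)

lemma c_less_iff [simp]: "c i < c j \<longleftrightarrow> i < j" and c_le_iff [simp]: "c i \<le> c j \<longleftrightarrow> i \<le> j"
  using c_strict_mono by (auto simp: strict_mono_less strict_mono_less_eq)

lemma rate_before_less: "i < j \<Longrightarrow> rate_before c i < rate_before c j"
  using c_pos by (auto simp: rate_before_def)

lemma rate_before_nonneg: "0 \<le> rate_before c k"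
  using c_pos by (auto simp: rate_before_def less_imp_le)

lemma rate_before_less_c: "k \<le> n \<Longrightarrow> rate_before c k < c n"
  using c_pos by (auto simp: rate_before_def)

lemma D_lin: "linear_operator (S n) (S (Suc n)) (D (Suc n))"
  by (rule transition_operator_linear[OF D_trans])

lemma T_lin: "linear_operator (S n) (S n) (T n)"
  by (rule linear_operator_matrix_op)

lemma T_fin_C [simp]: "T n f \<in> fin_C (S n)"
  by (auto simp: matrix_op_def fin_C_def)

lemma T_one: "T n (indicator (S n)) = indicator (S n)"
  by (rule matrix_op_one[OF stoch])

lemma D_one: "D (Suc n) (indicator (S n)) = indicator (S (Suc n))"
proof -
  obtain m where m: "stochastic_matrix (S (Suc n)) (S n) m"
    "\<And>f. f \<in> fin_C (S n) \<Longrightarrow> D (Suc n) f = matrix_op (S (Suc n)) (S n) m f"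
    using D_trans[of n] unfolding transition_operator_def by blast
  have "indicator (S n) \<in> fin_C (S n)" by (auto simp: fin_C_def)
  with m show ?thesis using matrix_op_one[OF m(1)] by simp
qed

lemma down_iter_fin_C: "k \<le> n \<Longrightarrow> f \<in> fin_C (S k) \<Longrightarrow> down_iter D n k f \<in> fin_C (S n)"
proof (induction n)
  case (Suc n)
  then show ?case
    using linear_operator_fin_C[OF D_lin] by (cases "k \<le> n") (auto simp: le_Suc_eq)
qed auto

lemma up_iter_fin_C: "k \<le> n \<Longrightarrow> f \<in> fin_C (S n) \<Longrightarrow> up_iter U k n f \<in> fin_C (S k)"
proof (induction n arbitrary: f)
  case (Suc n)
  then show ?case
    using linear_operator_fin_C[OF U_lin] by (cases "k \<le> n") (auto simp: le_Suc_eq)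
qed auto

text \<open>\<open>rate_DU\<close> and \<open>UD\<close> combine into the intertwining of the generators \<open>A n\<close>
  by the operators \<open>D n\<close>.\<close>

lemma rate_D:
  assumes "f \<in> fin_C (S n)"
  shows "c (Suc n) * (T (Suc n) (D (Suc n) f) r - D (Suc n) f r) = c n * (D (Suc n) (T n f) r - D (Suc n) f r)"
proof -
  have "D (Suc n) f \<in> fin_C (S (Suc n))"
    using linear_operator_fin_C[OF D_lin assms] .
  from rate_DU[OF this] show ?thesis
    by (simp add: UD[OF assms])
qed

text \<open>\<open>dn n k s\<close> is \<open>(d s)\<close> restricted to \<open>S n\<close>, for \<open>s \<in> S k\<close>; the functions \<open>hn n k s\<close> below are
  combined from these as \<open>h_lim\<close> is from the limits \<open>dlim\<close>.\<close>

abbreviation dn :: "nat \<Rightarrow> nat \<Rightarrow> 's \<Rightarrow> 's \<Rightarrow> real" where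
  "dn n k s \<equiv> down_iter D n k (indicator {s})"

lemma dn_fin_C: "k \<le> n \<Longrightarrow> s \<in> S k \<Longrightarrow> dn n k s \<in> fin_C (S n)"
  by (intro down_iter_fin_C) auto

lemma dn_root: "dn n 0 root = indicator (S n)"
proof (induction n)
  case 0 then show ?case by (simp add: S0)
next
  case (Suc n) then show ?case by (simp add: D_one)
qed

text \<open>At the lowest possible level n = i + 1 this is \<open>rate_DU\<close> for an indicator,
  expanded in the indicators of \<open>S i\<close>. Applying \<open>D (Suc n)\<close> carries the
  identity from \<open>n\<close> to \<open>Suc n\<close>, the left side by \<open>rate_D\<close> and
  the right side by linearity, with unchanged coefficients.\<close>

lemma rate_dn:
  assumes "Suc i \<le> n" "r \<in> S (Suc i)"
  shows "c n * (T n (dn n (Suc i) r) u - dn n (Suc i) r u) =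
    c i * ((\<Sum>q\<in>S i. U i (indicator {r}) q * dn n i q u) - dn n (Suc i) r u)"
  using assms(1)
proof (induction n arbitrary: u rule: dec_induct)
  case base
  have Ur: "U i (indicator {r}) \<in> fin_C (S i)"
    by (rule linear_operator_fin_C[OF U_lin]) (use assms in auto)
  have "D (Suc i) (U i (indicator {r})) = (\<lambda>x. \<Sum>q\<in>S i. U i (indicator {r}) q * D (Suc i) (indicator {q}) x)"
    by (subst fin_C_expand[OF fin_S Ur], rule linear_operator_lincomb[OF D_lin fin_S]) auto
  with rate_DU[of "indicator {r}" i u] assms show ?case
    by simp
next
  case (step n)
  let ?d = "dn n (Suc i) r"
  have d: "?d \<in> fin_C (S n)" using step assms by (intro dn_fin_C) auto
  have dq: "dn n i q \<in> fin_C (S n)" if "q \<in> S i" for q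
    using step that by (intro dn_fin_C) auto
  have Sq: "(\<lambda>u. \<Sum>q\<in>S i. U i (indicator {r}) q * dn n i q u) \<in> fin_C (S n)"
    by (rule fin_C_lincomb) (rule dq)
  \<comment> \<open>Both sides of the induction hypothesis are combinations of these three
    functions, numbered 0, 1, 2 so that \<open>linear_operator_lincomb\<close> applies to each
    side.\<close>
  let ?f = "\<lambda>b::nat. if b = 0 then T n ?d else if b = 1 then ?d else (\<lambda>u. \<Sum>q\<in>S i. U i (indicator {r}) q * dn n i q u)"
  have fb: "?f b \<in> fin_C (S n)" for b
    using d Sq by simp
  have lin1: "D (Suc n) (\<lambda>u. \<Sum>b\<in>{0,1}. (if b = 0 then c n else - c n) * ?f b u) =
     (\<lambda>u. \<Sum>b\<in>{0,1}. (if b = 0 then c n else - c n) * D (Suc n) (?f b) u)"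
    by (rule linear_operator_lincomb[OF D_lin _ fb]) auto
  have lin2: "D (Suc n) (\<lambda>u. \<Sum>b\<in>{1,2}. (if b = 2 then c i else - c i) * ?f b u) =
     (\<lambda>u. \<Sum>b\<in>{1,2}. (if b = 2 then c i else - c i) * D (Suc n) (?f b) u)"
    by (rule linear_operator_lincomb[OF D_lin _ fb]) auto
  have "(\<lambda>u. \<Sum>b\<in>{0,1}. (if b = 0 then c n else - c n) * ?f b u) =
     (\<lambda>u. \<Sum>b\<in>{1,2}. (if b = 2 then c i else - c i) * ?f b u)"
  proof
    fix u show "(\<Sum>b\<in>{0,1}. (if b = 0 then c n else - c n) * ?f b u) =
       (\<Sum>b\<in>{1,2}. (if b = 2 then c i else - c i) * ?f b u)"
      using step.IH[of u] by (simp add: algebra_simps)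
  qed
  with lin1 lin2 have eq: "(\<lambda>u. \<Sum>b\<in>{0,1}. (if b = 0 then c n else - c n) * D (Suc n) (?f b) u) =
    (\<lambda>u. \<Sum>b\<in>{1,2}. (if b = 2 then c i else - c i) * D (Suc n) (?f b) u)"
    by metis
  have Dsum: "D (Suc n) (\<lambda>u. \<Sum>q\<in>S i. U i (indicator {r}) q * dn n i q u) =
      (\<lambda>u. \<Sum>q\<in>S i. U i (indicator {r}) q * D (Suc n) (dn n i q) u)"
    by (rule linear_operator_lincomb[OF D_lin fin_S dq])
  have dnS: "dn (Suc n) (Suc i) r = D (Suc n) ?d" "\<And>q. dn (Suc n) i q = D (Suc n) (dn n i q)"
    using step by auto
  from fun_cong[OF eq, of u] show ?case
    unfolding dnS rate_D[OF d] by (simp add: Dsum algebra_simps)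
qed

text \<open>Chapman--Kolmogorov for the first upward step; since the entries may be negative, it
  rests on linearity alone.\<close>

lemma p_up_decompose:
  assumes "i < k" "s \<in> S k"
  shows "(\<Sum>r\<in>S (Suc i). U i (indicator {r}) q * p_up U (Suc i) k r s) = p_up U i k q s"
proof -
  have f: "up_iter U (Suc i) k (indicator {s}) \<in> fin_C (S (Suc i))" (is "?f \<in> _")
    using assms by (intro up_iter_fin_C) auto
  have "p_up U i k q s = U i ?f q"
    using assms by (simp add: p_up_def up_iter_first)
  also have "U i ?f = (\<lambda>x. \<Sum>r\<in>S (Suc i). ?f r * U i (indicator {r}) x)"
    by (subst fin_C_expand[OF fin_S f], rule linear_operator_lincomb[OF U_lin fin_S]) auto
  finally show ?thesis
    by (simp add: p_up_def mult.commute)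
qed

section \<open>Eigenfunctions of the transition operators\<close>

definition hn :: "nat \<Rightarrow> nat \<Rightarrow> 's \<Rightarrow> 's \<Rightarrow> real" where
  "hn n k s u = (\<Sum>i\<le>k. \<Sum>r\<in>S i. p_up U i k r s * eta c i k * dn n i r u)"

lemma hn_fin_C: "k \<le> n \<Longrightarrow> hn n k s \<in> fin_C (S n)"
  using dn_fin_C[of _ n] by (auto simp: hn_def[abs_def] fin_C_def)

text \<open>In terms of the sums \<open>G i\<close> the generator takes \<open>G (Suc i)\<close> to
  c_i (G_i - G_(i+1)), by \<open>rate_dn\<close> and \<open>p_up_decompose\<close>, and annihilates
  \<open>G 0\<close>, a multiple of the constant function. Collecting the coefficient of each
  \<open>G i\<close> leaves the recursion \<open>eta_Suc\<close>.\<close>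

lemma T_hn:
  assumes k: "k \<le> n" and s: "s \<in> S k"
  shows "T n (hn n k s) = (\<lambda>u. (1 - rate_before c k / c n) * hn n k s u)"
proof
  fix u
  define G where "G i = (\<Sum>r\<in>S i. p_up U i k r s * dn n i r u)" for i
  have hG: "hn n k s u = (\<Sum>i\<le>k. eta c i k * G i)"
    unfolding hn_def G_def by (simp add: sum_distrib_left algebra_simps)
  have dnf: "dn n i r \<in> fin_C (S n)" if "i \<le> k" "r \<in> S i" for i r
    using dn_fin_C[of i n r] that k by simp
  have "T n (hn n k s) = T n (\<lambda>u. \<Sum>i\<le>k. 1 * (\<Sum>r\<in>S i. p_up U i k r s * eta c i k * dn n i r u))"
    by (simp add: hn_def[abs_def])
  also have "\<dots> = (\<lambda>u. \<Sum>i\<le>k. 1 * T n (\<lambda>u. \<Sum>r\<in>S i. p_up U i k r s * eta c i k * dn n i r u) u)"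
    by (rule linear_operator_lincomb[OF T_lin]) (use dnf in \<open>auto intro!: fin_C_lincomb\<close>)
  also have "\<dots> = (\<lambda>u. \<Sum>i\<le>k. \<Sum>r\<in>S i. p_up U i k r s * eta c i k * T n (dn n i r) u)"
    by (auto simp: fun_eq_iff intro!: sum.cong fun_cong[OF linear_operator_lincomb[OF T_lin fin_S dnf]])
  finally have Th: "T n (hn n k s) u = (\<Sum>i\<le>k. \<Sum>r\<in>S i. p_up U i k r s * eta c i k * T n (dn n i r) u)"
    by (rule fun_cong)
  have "c n * (T n (hn n k s) u - hn n k s u) =
      (\<Sum>i\<le>k. \<Sum>r\<in>S i. p_up U i k r s * eta c i k * (c n * (T n (dn n i r) u - dn n i r u)))"
    unfolding Th hn_def by (simp add: sum_distrib_left algebra_simps sum_subtractf)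
  \<comment> \<open>\<open>G i\<close> receives a contribution from \<open>G (Suc i)\<close>,
    present only for i < k, and one from itself with rate c_(i-1). The convention
    \<open>rate_before c 0 = 0\<close> lets i = 0 join the second sum.\<close>
  also have "\<dots> = (\<Sum>i\<le>k. (if i < k then c i * eta c (Suc i) k else 0) * G i - rate_before c i * eta c i k * G i)"
  proof -
    have z: "(\<Sum>r\<in>S 0. p_up U 0 k r s * eta c 0 k * (c n * (T n (dn n 0 r) u - dn n 0 r u))) = 0"
      by (simp add: S0 dn_root T_one)
    have suc: "(\<Sum>r\<in>S (Suc i). p_up U (Suc i) k r s * eta c (Suc i) k * (c n * (T n (dn n (Suc i) r) u - dn n (Suc i) r u)))
      = c i * eta c (Suc i) k * G i - c i * eta c (Suc i) k * G (Suc i)" if "i < k" for i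
    proof -
      have "(\<Sum>r\<in>S (Suc i). p_up U (Suc i) k r s * eta c (Suc i) k * (c n * (T n (dn n (Suc i) r) u - dn n (Suc i) r u)))
        = (\<Sum>r\<in>S (Suc i). p_up U (Suc i) k r s * eta c (Suc i) k * (c i * ((\<Sum>q\<in>S i. U i (indicator {r}) q * dn n i q u) - dn n (Suc i) r u)))"
        using that k by (intro sum.cong refl) (simp add: rate_dn)
      also have "\<dots> = c i * eta c (Suc i) k * (\<Sum>r\<in>S (Suc i). \<Sum>q\<in>S i. U i (indicator {r}) q * p_up U (Suc i) k r s * dn n i q u)
         - c i * eta c (Suc i) k * G (Suc i)"
        by (simp add: G_def sum_distrib_left algebra_simps sum_subtractf)
      also have "(\<Sum>r\<in>S (Suc i). \<Sum>q\<in>S i. U i (indicator {r}) q * p_up U (Suc i) k r s * dn n i q u) = G i"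
        unfolding G_def p_up_decompose[OF that s, symmetric] sum_distrib_right by (rule sum.swap)
      finally show ?thesis .
    qed
    have "(\<Sum>i\<le>k. \<Sum>r\<in>S i. p_up U i k r s * eta c i k * (c n * (T n (dn n i r) u - dn n i r u)))
      = (\<Sum>i<k. c i * eta c (Suc i) k * G i - c i * eta c (Suc i) k * G (Suc i))"
      by (subst sum.atMost_shift) (simp add: z suc)
    also have "\<dots> = (\<Sum>i<k. c i * eta c (Suc i) k * G i) - (\<Sum>i<k. rate_before c (Suc i) * eta c (Suc i) k * G (Suc i))"
      by (simp add: sum_subtractf rate_before_def)
    also have "(\<Sum>i<k. rate_before c (Suc i) * eta c (Suc i) k * G (Suc i)) = (\<Sum>i\<le>k. rate_before c i * eta c i k * G i)"
      by (subst sum.atMost_shift) (simp add: rate_before_def)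
    also have "(\<Sum>i<k. c i * eta c (Suc i) k * G i) = (\<Sum>i\<le>k. (if i < k then c i * eta c (Suc i) k else 0) * G i)"
      by (simp add: lessThan_Suc_atMost[symmetric])
    finally show ?thesis by (simp add: sum_subtractf)
  qed
  also have "\<dots> = (\<Sum>i\<le>k. - rate_before c k * (eta c i k * G i))"
  proof (rule sum.cong[OF refl])
    fix i assume "i \<in> {..k}"
    then show "(if i < k then c i * eta c (Suc i) k else 0) * G i - rate_before c i * eta c i k * G i = - rate_before c k * (eta c i k * G i)"
      using rate_before_less[of i k] by (cases "i = k") (auto simp: eta_Suc algebra_simps)
  qed
  also have "\<dots> = - rate_before c k * hn n k s u"
    unfolding hG by (simp add: sum_distrib_left)
  finally show "T n (hn n k s) u = (1 - rate_before c k / c n) * hn n k s u"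
    using c_pos[of n] by (simp add: field_simps)
qed

lemma T_pow_hn:
  assumes "k \<le> n" "s \<in> S k"
  shows "(T n ^^ j) (hn n k s) = (\<lambda>u. (1 - rate_before c k / c n) ^ j * hn n k s u)"
proof (induction j)
  case (Suc j)
  have "T n (\<lambda>u. (1 - rate_before c k / c n) ^ j * hn n k s u) = (\<lambda>u. (1 - rate_before c k / c n) ^ j * T n (hn n k s) u)"
    by (rule linear_operator_scale[OF T_lin hn_fin_C[OF assms(1)]])
  then show ?case by (simp add: Suc T_hn[OF assms] mult.assoc mult.left_commute)
qed simp

text \<open>The system expressing the \<open>h\<close>'s by the \<open>d\<close>'s is unitriangular with respect to the level.\<close>

lemma h_sum_split:
  assumes "s \<in> S k"
  shows "(\<Sum>i\<le>k. \<Sum>r\<in>S i. p_up U i k r s * eta c i k * g i r) =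
    (g k s :: real) + (\<Sum>i<k. \<Sum>r\<in>S i. p_up U i k r s * eta c i k * g i r)"
proof -
  have "(\<Sum>r\<in>S k. p_up U k k r s * eta c k k * g k r) = (\<Sum>r\<in>S k. if r = s then g k s else 0)"
    by (intro sum.cong refl) (auto simp: p_up_def)
  also have "\<dots> = g k s" using assms fin_S by simp
  finally show ?thesis by (simp add: lessThan_Suc_atMost[symmetric])
qed

lemma T_pow_lincomb:
  assumes "finite I" "\<And>i. i \<in> I \<Longrightarrow> f i \<in> fin_C (S n)"
  shows "(T n ^^ j) (\<lambda>x. \<Sum>i\<in>I. a i * f i x) = (\<lambda>x. \<Sum>i\<in>I. a i * (T n ^^ j) (f i) x)"
proof (induction j)
  case (Suc j)
  have "(T n ^^ j) (f i) \<in> fin_C (S n)" if "i \<in> I" for i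
    using assms that by (cases j) auto
  then show ?case
    by (simp add: Suc linear_operator_lincomb[OF T_lin assms(1)])
qed simp

text \<open>Solving the unitriangular system by recursion on the level: \<open>dn n k s\<close> is
  \<open>hn n k s\<close> minus a combination of functions of lower level. So a property stable
  under finite combinations has to be checked on eigenfunctions only, and at k = n it reaches the
  indicators of points.\<close>

lemma dn_induct:
  assumes lin: "\<And>(I :: (nat \<times> 's) set) a f. finite I \<Longrightarrow> (\<And>i. i \<in> I \<Longrightarrow> f i \<in> fin_C (S n)) \<Longrightarrow> (\<And>i. i \<in> I \<Longrightarrow> Q (f i)) \<Longrightarrow>
      Q (\<lambda>x. \<Sum>i\<in>I. a i * f i x)"
    and h: "\<And>k s. k \<le> n \<Longrightarrow> s \<in> S k \<Longrightarrow> Q (hn n k s)"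
  shows "k \<le> n \<Longrightarrow> s \<in> S k \<Longrightarrow> Q (dn n k s)"
proof (induction k arbitrary: s rule: less_induct)
  case (less k)
  \<comment> \<open>The index \<open>(k, s)\<close> stands for the eigenfunction, the indices of
    lower level for the functions covered by the induction hypothesis.\<close>
  define I where "I = insert (k, s) (SIGMA i:{..<k}. S i)"
  define f where "f = (\<lambda>(i, r). if i = k then hn n k s else dn n i r)"
  define a where "a = (\<lambda>(i, r). if i = k then 1 else - (p_up U i k r s * eta c i k))"
  have "Q (\<lambda>x. \<Sum>i\<in>I. a i * f i x)"
  proof (rule lin)
    show "finite I" using fin_S by (auto simp: I_def)
    show "f i \<in> fin_C (S n)" if "i \<in> I" for i
      using that less.prems by (auto simp: I_def f_def hn_fin_C dn_fin_C)
    show "Q (f i)" if "i \<in> I" for i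
      using that less h[of k s] by (auto simp: I_def f_def)
  qed
  also have "(\<lambda>x. \<Sum>i\<in>I. a i * f i x) = dn n k s"
  proof
    fix x
    have "(\<Sum>i\<in>I. a i * f i x) = hn n k s x + (\<Sum>i\<in>(SIGMA i:{..<k}. S i). a i * f i x)"
      unfolding I_def using fin_S by (subst sum.insert) (auto simp: a_def f_def)
    also have "(\<Sum>i\<in>(SIGMA i:{..<k}. S i). a i * f i x) = (\<Sum>i<k. \<Sum>r\<in>S i. a (i, r) * f (i, r) x)"
      using fin_S by (subst sum.Sigma) auto
    also have "\<dots> = - (\<Sum>i<k. \<Sum>r\<in>S i. p_up U i k r s * eta c i k * dn n i r x)"
      unfolding sum_negf[symmetric] by (intro sum.cong refl) (auto simp: a_def f_def)
    finally show "(\<Sum>i\<in>I. a i * f i x) = dn n k s x"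
      using h_sum_split[OF less.prems(2), of "\<lambda>i r. dn n i r x"] by (simp add: hn_def)
  qed
  finally show ?case .
qed

section \<open>Powers of the transition operators and the stationary distribution\<close>

lemma T_pow_mono:
  "(\<And>y. y \<in> S n \<Longrightarrow> f y \<le> g y) \<Longrightarrow> x \<in> S n \<Longrightarrow> (T n ^^ j) f x \<le> (T n ^^ j) g x"
proof (induction j arbitrary: x)
  case (Suc j)
  then show ?case by (auto intro!: matrix_op_mono[OF stoch])
qed simp

lemma T_pow_bound:
  assumes "\<And>y. y \<in> S n \<Longrightarrow> \<bar>f y\<bar> \<le> B" "0 \<le> B" "x \<in> S n"
  shows "\<bar>(T n ^^ j) f x\<bar> \<le> B"
  using assms(3)
proof (induction j arbitrary: x)
  case (Suc j)
  then show ?case using assms by (auto intro!: matrix_op_bound[OF stoch])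
qed (use assms in simp)

lemma T_pow_one: "(T n ^^ j) (indicator (S n)) = indicator (S n)"
  by (induction j) (simp_all add: T_one)

text \<open>Integration against M_n, introduced as a linear functional because its weights
  \<open>p_up U 0 n root\<close> are not yet known to be nonnegative.\<close>

definition Mn :: "nat \<Rightarrow> ('s \<Rightarrow> real) \<Rightarrow> real" where
  "Mn n f = up_iter U 0 n f root"

lemma Mn_Suc: "Mn (Suc n) f = Mn n (U n f)"
  by (simp add: Mn_def)

lemma Mn_lincomb:
  assumes "finite I" "\<And>i. i \<in> I \<Longrightarrow> f i \<in> fin_C (S n)"
  shows "Mn n (\<lambda>x. \<Sum>i\<in>I. a i * f i x) = (\<Sum>i\<in>I. a i * Mn n (f i))"
  using assms(2)
proof (induction n arbitrary: f)
  case 0 then show ?case by (simp add: Mn_def)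
next
  case (Suc n)
  have "U n (f i) \<in> fin_C (S n)" if "i \<in> I" for i
    using linear_operator_fin_C[OF U_lin] Suc.prems that by blast
  then show ?case
    by (simp add: Mn_Suc linear_operator_lincomb[OF U_lin assms(1) Suc.prems] Suc.IH)
qed

lemma Mn_one: "Mn n (indicator (S n)) = 1"
proof (induction n)
  case 0 then show ?case by (simp add: Mn_def S0)
next
  case (Suc n)
  have "U n (indicator (S (Suc n))) = indicator (S n)"
    unfolding D_one[symmetric] by (subst UD) (auto simp: T_one fin_C_def)
  then show ?case by (simp add: Mn_Suc Suc)
qed

text \<open>By \<open>rate_DU\<close>, \<open>T (Suc n)\<close> is a convex combination of the
  identity and of D U. The integral of the second term reduces to level \<open>n\<close>, where U D
  U f = T (U f) and invariance is the induction hypothesis.\<close>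

lemma Mn_T:
  assumes "f \<in> fin_C (S n)" shows "Mn n (T n f) = Mn n f"
  using assms
proof (induction n arbitrary: f)
  case 0
  have "p 0 root root = 1" using stoch[of 0] by (simp add: stochastic_matrix_def S0)
  then show ?case by (simp add: Mn_def S0 matrix_op_def)
next
  case (Suc n)
  have Uf: "U n f \<in> fin_C (S n)" using linear_operator_fin_C[OF U_lin Suc.prems] .
  have DU: "D (Suc n) (U n f) \<in> fin_C (S (Suc n))" using linear_operator_fin_C[OF D_lin Uf] .
  let ?a = "\<lambda>b. if b then c n / c (Suc n) else 1 - c n / c (Suc n)"
  let ?f = "\<lambda>b. if b then D (Suc n) (U n f) else f"
  \<comment> \<open>The booleans index the two terms of the convex combination so that
    \<open>Mn_lincomb\<close> applies.\<close>
  have "T (Suc n) f = (\<lambda>x. \<Sum>b\<in>UNIV. ?a b * ?f b x)"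
  proof
    fix x show "T (Suc n) f x = (\<Sum>b\<in>UNIV. ?a b * ?f b x)"
      using rate_DU[OF Suc.prems, of x] c_pos[of "Suc n"] by (simp add: UNIV_bool field_simps)
  qed
  then have "Mn (Suc n) (T (Suc n) f) = (\<Sum>b\<in>UNIV. ?a b * Mn (Suc n) (?f b))"
    using Mn_lincomb[of UNIV ?f "Suc n" ?a] DU Suc.prems by simp
  moreover have "Mn (Suc n) (D (Suc n) (U n f)) = Mn (Suc n) f"
    using Suc.IH[OF Uf] by (simp add: Mn_Suc UD[OF Uf])
  ultimately show ?case
    by (simp add: UNIV_bool algebra_simps)
qed

text \<open>An invariant functional vanishes on eigenfunctions whose eigenvalue is not 1.\<close>

lemma Mn_hn:
  assumes "k \<le> n" "s \<in> S k" "0 < k"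
  shows "Mn n (hn n k s) = 0"
proof -
  have "Mn n (hn n k s) = Mn n (T n (hn n k s))"
    by (rule Mn_T[symmetric, OF hn_fin_C[OF assms(1)]])
  also have "\<dots> = Mn n (\<lambda>u. \<Sum>i\<in>{()}. (1 - rate_before c k / c n) * hn n k s u)"
    by (simp add: T_hn[OF assms(1,2)])
  also have "\<dots> = (\<Sum>i\<in>{()}. (1 - rate_before c k / c n) * Mn n (hn n k s))"
    by (rule Mn_lincomb) (use assms in \<open>auto intro: hn_fin_C\<close>)
  finally show ?thesis
    using assms(3) c_pos[of n] c_pos[of "k - 1"] by (simp add: rate_before_def field_simps)
qed

lemma hn_root: "hn n 0 root = indicator (S n)"
proof
  fix u
  have "hn n 0 root u = p_up U 0 0 root root * eta c 0 0 * dn n 0 root u" by (simp add: hn_def S0)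
  then show "hn n 0 root u = indicator (S n) u" by (simp add: dn_root p_up_def)
qed

text \<open>On eigenfunctions of positive level both sides are 0 in the limit, as the eigenvalues
  lie strictly between 0 and 1; on the one of level 0 both are 1. By \<open>dn_induct\<close> this
  covers the indicators of points, hence all of \<open>fin_C (S n)\<close>.\<close>

lemma T_pow_tendsto_Mn:
  assumes "f \<in> fin_C (S n)" "u \<in> S n"
  shows "(\<lambda>j. (T n ^^ j) f u) \<longlonglongrightarrow> Mn n f"
proof -
  let ?Q = "\<lambda>f. (\<lambda>j. (T n ^^ j) f u) \<longlonglongrightarrow> Mn n f"
  have lin: "?Q (\<lambda>x. \<Sum>i\<in>I. a i * f i x)"
    if "finite I" "\<And>i. i \<in> I \<Longrightarrow> f i \<in> fin_C (S n)" "\<And>i. i \<in> I \<Longrightarrow> ?Q (f i)"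
    for I :: "(nat \<times> 's) set" and a f
  proof -
    have "Mn n (\<lambda>x. \<Sum>i\<in>I. a i * f i x) = (\<Sum>i\<in>I. a i * Mn n (f i))"
      by (rule Mn_lincomb) (fact that)+
    moreover have "(T n ^^ j) (\<lambda>x. \<Sum>i\<in>I. a i * f i x) u = (\<Sum>i\<in>I. a i * (T n ^^ j) (f i) u)" for j
      by (rule fun_cong[OF T_pow_lincomb]) (fact that)+
    ultimately show ?thesis
      using that(3) by (auto intro!: tendsto_sum tendsto_mult tendsto_const)
  qed
  have "?Q (dn n n r)" if "r \<in> S n" for r
  proof (rule dn_induct[of n ?Q, OF lin _ order_refl that])
    fix k s assume ks: "k \<le> n" "s \<in> S k"
    show "?Q (hn n k s)"
    proof (cases "k = 0")
      case True
      with ks have "s = root" by (simp add: S0)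
      then show ?thesis using True assms by (simp add: hn_root Mn_one T_pow_one)
    next
      case False
      have "\<bar>1 - rate_before c k / c n\<bar> < 1"
        using rate_before_less_c[OF ks(1)] c_pos[of n] False c_pos[of "k-1"]
        by (auto simp: rate_before_def abs_less_iff field_simps)
      then have "(\<lambda>j. (1 - rate_before c k / c n) ^ j * hn n k s u) \<longlonglongrightarrow> 0 * hn n k s u"
        by (intro tendsto_mult LIMSEQ_power_zero tendsto_const) auto
      then show ?thesis
        using False by (simp add: T_pow_hn[OF ks] Mn_hn[OF ks])
    qed
  qed
  then have ind: "?Q (indicator {r})" if "r \<in> S n" for r
    using that by simp
  have "?Q (\<lambda>x. \<Sum>r\<in>S n. f r * indicator {r} x)"
  proof -
    have "Mn n (\<lambda>x. \<Sum>r\<in>S n. f r * indicator {r} x) = (\<Sum>r\<in>S n. f r * Mn n (indicator {r}))"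
      by (rule Mn_lincomb[OF fin_S]) simp
    moreover have "(T n ^^ j) (\<lambda>x. \<Sum>r\<in>S n. f r * indicator {r} x) u = (\<Sum>r\<in>S n. f r * (T n ^^ j) (indicator {r}) u)" for j
      by (rule fun_cong[OF T_pow_lincomb[OF fin_S]]) simp
    ultimately show ?thesis
      using ind by (auto intro!: tendsto_sum tendsto_mult tendsto_const)
  qed
  then show ?thesis
    using fin_C_expand[OF fin_S assms(1)] by metis
qed

lemma T_pow_indicator_nonneg: "x \<in> S n \<Longrightarrow> 0 \<le> (T n ^^ j) (indicator {u}) x"
proof (induction j arbitrary: x)
  case (Suc j)
  then show ?case
    using stoch[of n] by (auto simp: matrix_op_def stochastic_matrix_def intro!: sum_nonneg mult_nonneg_nonneg)
qed simp

text \<open>A limit of the nonnegative entries of the powers of \<open>T n\<close>. The defining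
  product of the operators \<open>U\<close> gives no sign in the general setting.\<close>

lemma p_up_root_nonneg:
  assumes "u \<in> S n" shows "0 \<le> p_up U 0 n root u"
proof -
  obtain x where x: "x \<in> S n" using S_ne by blast
  have "(\<lambda>j. (T n ^^ j) (indicator {u}) x) \<longlonglongrightarrow> Mn n (indicator {u})"
    by (rule T_pow_tendsto_Mn) (use assms x in auto)
  then have "0 \<le> Mn n (indicator {u})"
    by (rule LIMSEQ_le_const) (use T_pow_indicator_nonneg[OF x] in auto)
  then show ?thesis by (simp add: Mn_def p_up_def)
qed

lemma Mn_eq_sum:
  assumes "f \<in> fin_C (S n)" shows "Mn n f = (\<Sum>u\<in>S n. p_up U 0 n root u * f u)"
proof -
  have "Mn n f = Mn n (\<lambda>x. \<Sum>r\<in>S n. f r * indicator {r} x)"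
    using fin_C_expand[OF fin_S assms] by simp
  also have "\<dots> = (\<Sum>r\<in>S n. f r * Mn n (indicator {r}))"
    by (rule Mn_lincomb[OF fin_S]) auto
  finally show ?thesis by (simp add: Mn_def p_up_def mult.commute)
qed

lemma p_up_root_sum: "(\<Sum>u\<in>S n. p_up U 0 n root u) = 1"
  using Mn_eq_sum[of "indicator (S n)" n] by (simp add: Mn_one fin_C_def)

text \<open>For uniqueness, a stationary \<open>m\<close> integrates f and every power of
  \<open>T n\<close> applied to f alike, and these powers tend to the constant
  \<open>Mn n f\<close>.\<close>

lemma stationary_distribution_iff:
  "stationary_distribution (S n) (p n) m \<longleftrightarrow> (\<forall>u\<in>S n. m u = p_up U 0 n root u)"
proof
  assume m: "stationary_distribution (S n) (p n) m"
  have step: "(\<Sum>x\<in>S n. m x * T n f x) = (\<Sum>x\<in>S n. m x * f x)" for f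
  proof -
    have "(\<Sum>x\<in>S n. m x * T n f x) = (\<Sum>x\<in>S n. \<Sum>y\<in>S n. m x * p n x y * f y)"
      by (simp add: matrix_op_def sum_distrib_left mult.assoc)
    also have "\<dots> = (\<Sum>y\<in>S n. (\<Sum>x\<in>S n. m x * p n x y) * f y)"
      by (subst sum.swap) (simp add: sum_distrib_right)
    finally show ?thesis using m by (simp add: stationary_distribution_def)
  qed
  have steps: "(\<Sum>x\<in>S n. m x * (T n ^^ j) f x) = (\<Sum>x\<in>S n. m x * f x)" for f j
    by (induction j) (simp_all add: step)
  show "\<forall>u\<in>S n. m u = p_up U 0 n root u"
  proof
    fix u assume u: "u \<in> S n"
    have "(\<lambda>j. \<Sum>x\<in>S n. m x * (T n ^^ j) (indicator {u}) x) \<longlonglongrightarrow> (\<Sum>x\<in>S n. m x * Mn n (indicator {u}))"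
      using u by (intro tendsto_sum tendsto_mult tendsto_const T_pow_tendsto_Mn) auto
    then have "(\<Sum>x\<in>S n. m x * indicator {u} x) = (\<Sum>x\<in>S n. m x * Mn n (indicator {u}))"
      by (simp add: steps LIMSEQ_const_iff)
    moreover have "(\<Sum>x\<in>S n. m x * indicator {u} x) = m u"
      using u fin_S by (simp add: indicator_def if_distrib cong: if_cong)
    moreover have "(\<Sum>x\<in>S n. m x * Mn n (indicator {u})) = Mn n (indicator {u})"
      using m by (simp add: stationary_distribution_def flip: sum_distrib_right)
    ultimately show "m u = p_up U 0 n root u" by (simp add: Mn_def p_up_def)
  qed
next
  assume m: "\<forall>u\<in>S n. m u = p_up U 0 n root u"
  have "(\<Sum>x\<in>S n. m x * p n x y) = m y" if y: "y \<in> S n" for y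
  proof -
    have T: "T n (indicator {y}) x = p n x y" if "x \<in> S n" for x
      using that y fin_S by (simp add: matrix_op_def indicator_def if_distrib cong: if_cong)
    have "(\<Sum>x\<in>S n. m x * p n x y) = Mn n (T n (indicator {y}))"
      by (subst Mn_eq_sum) (auto simp: m T intro!: sum.cong)
    also have "\<dots> = m y"
      using y m by (subst Mn_T) (auto simp: Mn_def p_up_def)
    finally show ?thesis .
  qed
  then show "stationary_distribution (S n) (p n) m"
    using p_up_root_sum[of n] p_up_root_nonneg m by (simp add: stationary_distribution_def)
qed

end

section \<open>The limiting semigroup\<close>

lemma tendsto_0_upper:
  fixes f g :: "'a \<Rightarrow> real"
  assumes "\<And>n. 0 \<le> f n" "\<forall>\<^sub>F n in F. f n \<le> g n" "(g \<longlongrightarrow> 0) F"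
  shows "(f \<longlongrightarrow> 0) F"
  by (rule tendsto_sandwich[OF _ assms(2) tendsto_const assms(3)]) (simp add: assms(1))

lemma apply_bcontfun_sum:
  fixes f :: "'i \<Rightarrow> 'a::topological_space \<Rightarrow>\<^sub>C 'b::real_normed_vector"
  shows "apply_bcontfun (\<Sum>i\<in>I. f i) x = (\<Sum>i\<in>I. f i x)"
  by (induction I rule: infinite_finite_induct) auto

lemma bcontfun_measurable [measurable]: "apply_bcontfun f \<in> borel_measurable borel"
  by (rule borel_measurable_continuous_onI) simp

lemma bcontfun_abs_bound: "\<bar>apply_bcontfun f x\<bar> \<le> norm f" for f :: "'a::topological_space \<Rightarrow>\<^sub>C real"
  using norm_bounded[of f x] by simp

lemma integrable_bcontfun:
  fixes f :: "'a::topological_space \<Rightarrow>\<^sub>C real"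
  assumes "prob_space M" "sets M = sets borel"
  shows "integrable M f"
  by (rule integrable_bounded_borel[OF assms, of _ "norm f"]) (auto simp: bcontfun_abs_bound)

lemma prob_measure_eqI_bcontfun:
  fixes M N :: "'a::metric_space measure"
  assumes "prob_space M" "prob_space N" "sets M = sets borel" "sets N = sets borel"
    and "\<And>f :: 'a \<Rightarrow>\<^sub>C real. (\<integral>x. f x \<partial>M) = (\<integral>x. f x \<partial>N)"
  shows "M = N"
proof (rule prob_measure_eqI_continuous[OF assms(1-4)])
  fix f :: "'a \<Rightarrow> real" assume "continuous_on UNIV f" "bounded (range f)"
  then have "f \<in> bcontfun" by (simp add: bcontfun_def)
  then show "(\<integral>x. f x \<partial>M) = (\<integral>x. f x \<partial>N)"
    using assms(5)[of "Bcontfun f"] by (simp add: Bcontfun_inverse)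
qed

text \<open>Only the ratio j_n / c_n matters, so the limit is taken in the exponent; the logarithm
  is available once c_n exceeds b.\<close>

lemma one_minus_div_powr_limit:
  fixes b t :: real and c :: "nat \<Rightarrow> real" and j :: "nat \<Rightarrow> nat"
  assumes c: "filterlim c at_top sequentially" and j: "(\<lambda>n. real (j n) / c n) \<longlonglongrightarrow> t"
  shows "(\<lambda>n. (1 - b / c n) ^ j n) \<longlonglongrightarrow> exp (- t * b)"
proof -
  have "((\<lambda>x::real. x * ln (1 - b / x)) \<longlongrightarrow> - b) at_top"
    by real_asymp
  then have "(\<lambda>n. c n * ln (1 - b / c n)) \<longlonglongrightarrow> - b"
    using c by (rule filterlim_compose)
  then have "(\<lambda>n. exp (real (j n) / c n * (c n * ln (1 - b / c n)))) \<longlonglongrightarrow> exp (t * (- b))"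
    by (intro tendsto_exp tendsto_mult j)
  moreover have "\<forall>\<^sub>F n in sequentially. exp (real (j n) / c n * (c n * ln (1 - b / c n))) = (1 - b / c n) ^ j n"
  proof -
    have "\<forall>\<^sub>F n in sequentially. c n > \<bar>b\<bar> + 1"
      using c by (simp add: filterlim_at_top_dense)
    then show ?thesis
    proof eventually_elim
      case (elim n)
      then have "c n > 0" "b < c n" by auto
      then have "1 - b / c n > 0" by (simp add: field_simps)
      then have "exp (real (j n) * ln (1 - b / c n)) = (1 - b / c n) ^ j n"
        by (simp add: exp_of_nat_mult)
      then show ?case using \<open>c n > 0\<close> by simp
    qed
  qed
  ultimately show ?thesis
    by (simp add: Lim_transform_eventually)
qed

lemma nat_floor_div_tendsto:
  fixes c :: "nat \<Rightarrow> real"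
  assumes c: "filterlim c at_top sequentially" and "0 \<le> t"
  shows "(\<lambda>n. real (nat \<lfloor>c n * t\<rfloor>) / c n) \<longlonglongrightarrow> t"
proof -
  have ev: "\<forall>\<^sub>F n in sequentially. c n > 0"
    using c by (simp add: filterlim_at_top_dense)
  have l: "(\<lambda>n. t - 1 / c n) \<longlonglongrightarrow> t - 0"
    by (intro tendsto_diff tendsto_const tendsto_divide_0[OF tendsto_const] filterlim_mono[OF c at_top_le_at_infinity order_refl])
  show ?thesis
  proof (rule tendsto_sandwich[OF _ _ l[simplified] tendsto_const])
    show "\<forall>\<^sub>F n in sequentially. t - 1 / c n \<le> real (nat \<lfloor>c n * t\<rfloor>) / c n"
      using ev
    proof eventually_elim
      case (elim n)
      have "c n * t - 1 \<le> real (nat \<lfloor>c n * t\<rfloor>)"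
        by linarith
      then have "(c n * t - 1) / c n \<le> real (nat \<lfloor>c n * t\<rfloor>) / c n"
        using elim by (intro divide_right_mono) auto
      then show ?case using elim by (simp add: field_simps)
    qed
    show "\<forall>\<^sub>F n in sequentially. real (nat \<lfloor>c n * t\<rfloor>) / c n \<le> t"
      using ev
    proof eventually_elim
      case (elim n)
      have "0 \<le> c n * t" using elim assms by simp
      then have "real (nat \<lfloor>c n * t\<rfloor>) \<le> c n * t" by linarith
      then show ?case using elim by (simp add: field_simps)
    qed
  qed
qed

locale limit_chains = intertwined_chains S root p c D U
  for S :: "nat \<Rightarrow> 's set" and root p c D U +
  fixes \<iota> :: "'s \<Rightarrow> 'e::polish_space" and dlim :: "'s \<Rightarrow> ('e \<Rightarrow>\<^sub>C real)"
  assumes compact_E: "compact (UNIV :: 'e set)"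
    and limit_conditions: "limit_space_conditions S D \<iota> dlim"
    and c_at_top: "filterlim c at_top sequentially"
begin

section \<open>Sup norms on the finite state spaces\<close>

definition sn :: "nat \<Rightarrow> ('s \<Rightarrow> real) \<Rightarrow> real" where
  "sn n f = Max ((\<lambda>u. \<bar>f u\<bar>) ` S n)"

definition res :: "nat \<Rightarrow> ('e \<Rightarrow>\<^sub>C real) \<Rightarrow> 's \<Rightarrow> real" where
  "res n f u = (if u \<in> S n then f (\<iota> u) else 0)"

lemma sn_ge: "u \<in> S n \<Longrightarrow> \<bar>f u\<bar> \<le> sn n f"
  unfolding sn_def using fin_S by (intro Max_ge) auto

lemma sn_le: "(\<And>u. u \<in> S n \<Longrightarrow> \<bar>f u\<bar> \<le> B) \<Longrightarrow> sn n f \<le> B"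
  unfolding sn_def using fin_S S_ne by (subst Max_le_iff) auto

lemma sn_nonneg [simp]: "0 \<le> sn n f"
proof -
  obtain u where "u \<in> S n" using S_ne by blast
  from sn_ge[OF this, of f] show ?thesis by linarith
qed

lemma sn_add: "sn n (\<lambda>u. f u + g u) \<le> sn n f + sn n g"
  using sn_ge[of _ n f] sn_ge[of _ n g] by (intro sn_le) (smt (verit))

lemma sn_diff_le: "sn n (\<lambda>u. f u - g u) \<le> sn n f + sn n g"
  using sn_ge[of _ n f] sn_ge[of _ n g] by (intro sn_le) (smt (verit))

lemma sn_scale: "sn n (\<lambda>u. a * f u) \<le> \<bar>a\<bar> * sn n f"
  using sn_ge[of _ n f] by (intro sn_le) (auto simp: abs_mult intro: mult_left_mono)

lemma sn_triangle: "sn n (\<lambda>u. f u - h u) \<le> sn n (\<lambda>u. f u - g u) + sn n (\<lambda>u. g u - h u)"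
  using sn_add[of n "\<lambda>u. f u - g u" "\<lambda>u. g u - h u"] by simp

lemma sn_T_pow: "sn n ((T n ^^ j) f) \<le> sn n f"
  by (intro sn_le T_pow_bound sn_ge) auto

lemma T_pow_fin_C: "f \<in> fin_C (S n) \<Longrightarrow> (T n ^^ j) f \<in> fin_C (S n)"
  by (cases j) auto

lemma T_pow_add:
  assumes "f \<in> fin_C (S n)" "g \<in> fin_C (S n)"
  shows "(T n ^^ j) (\<lambda>u. f u + g u) = (\<lambda>u. (T n ^^ j) f u + (T n ^^ j) g u)"
  using T_pow_lincomb[of UNIV "\<lambda>b. if b then f else g" n j "\<lambda>_. 1"] assms by (simp add: UNIV_bool add.commute)

lemma T_pow_scale:
  assumes "f \<in> fin_C (S n)"
  shows "(T n ^^ j) (\<lambda>u. a * f u) = (\<lambda>u. a * (T n ^^ j) f u)"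
  using T_pow_lincomb[of "{()}" "\<lambda>_. f" n j "\<lambda>_. a"] assms by simp

lemma T_pow_diff:
  assumes "f \<in> fin_C (S n)" "g \<in> fin_C (S n)"
  shows "(T n ^^ j) (\<lambda>u. f u - g u) = (\<lambda>u. (T n ^^ j) f u - (T n ^^ j) g u)"
  using T_pow_add[OF assms(1), of "\<lambda>u. -1 * g u" j] T_pow_scale[OF assms(2), of j "-1"] assms
  by (simp add: fin_C_def)

lemma sn_T_pow_diff:
  assumes "f \<in> fin_C (S n)" "g \<in> fin_C (S n)"
  shows "sn n (\<lambda>u. (T n ^^ j) f u - (T n ^^ j) g u) \<le> sn n (\<lambda>u. f u - g u)"
  using sn_T_pow[of n j "\<lambda>u. f u - g u"] by (simp add: T_pow_diff[OF assms])

lemma res_fin_C [simp]: "res n f \<in> fin_C (S n)"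
  by (simp add: res_def[abs_def] fin_C_def)

lemma res_add: "res n (f + g) = (\<lambda>u. res n f u + res n g u)"
  and res_diff: "res n (f - g) = (\<lambda>u. res n f u - res n g u)"
  and res_scale: "res n (a *\<^sub>R f) = (\<lambda>u. a * res n f u)"
  by (auto simp: res_def fun_eq_iff)

lemma sn_res: "sn n (res n f) \<le> norm f"
  by (intro sn_le) (simp add: res_def bcontfun_abs_bound)

lemma dense_points: "\<exists>s. (\<forall>n. s n \<in> S n) \<and> (\<lambda>n. \<iota> (s n)) \<longlonglongrightarrow> x"
  using limit_conditions by (simp add: limit_space_conditions_def)

lemma res_tendsto:
  assumes "\<And>n. s n \<in> S n" "(\<lambda>n. \<iota> (s n)) \<longlonglongrightarrow> x"
  shows "(\<lambda>n. res n f (s n)) \<longlonglongrightarrow> f x"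
proof -
  have "(\<lambda>n. f (\<iota> (s n))) \<longlonglongrightarrow> f x"
    using continuous_on_tendsto_compose[OF continuous_on_apply_bcontfun[of UNIV f] assms(2)] by simp
  then show ?thesis using assms(1) by (simp add: res_def)
qed

text \<open>By (L1) each point of E is approached by images of points of \<open>S n\<close>, so a
  function on E is controlled by its values there. Contractivity, uniqueness of limits and the
  identity at time 0 follow from this.\<close>

lemma norm_le_liminf_sn:
  assumes "(\<lambda>n. sn n (\<lambda>u. g n u - res n f u)) \<longlonglongrightarrow> 0" "\<And>n. sn n (g n) \<le> B"
  shows "norm f \<le> B"
proof (rule norm_bound)
  fix x
  obtain s where s: "\<And>n. s n \<in> S n" "(\<lambda>n. \<iota> (s n)) \<longlonglongrightarrow> x"
    using dense_points by blast
  have le: "\<bar>res n f (s n)\<bar> \<le> sn n (\<lambda>u. g n u - res n f u) + B" for n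
    using sn_ge[OF s(1)[of n], of "g n"] sn_ge[OF s(1)[of n], of "\<lambda>u. g n u - res n f u"] assms(2)[of n]
    by linarith
  have "\<bar>f x\<bar> \<le> 0 + B"
    by (rule LIMSEQ_le[OF tendsto_rabs[OF res_tendsto[OF s]] tendsto_add[OF assms(1) tendsto_const]])
      (use le in auto)
  then show "norm (f x) \<le> B" by simp
qed

lemma dn_limit:
  assumes "s \<in> S k"
  shows "(\<lambda>n. sn n (\<lambda>u. dn n k s u - res n (dlim s) u)) \<longlonglongrightarrow> 0"
proof (rule tendsto_0_upper[OF sn_nonneg])
  show "(\<lambda>n. SUP u\<in>S n. \<bar>d_fun S D s u - dlim s (\<iota> u)\<bar>) \<longlonglongrightarrow> 0"
    using limit_conditions assms by (auto simp: limit_space_conditions_def)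
  show "\<forall>\<^sub>F n in sequentially. sn n (\<lambda>u. dn n k s u - res n (dlim s) u) \<le> (SUP u\<in>S n. \<bar>d_fun S D s u - dlim s (\<iota> u)\<bar>)"
    using eventually_ge_at_top[of k]
  proof eventually_elim
    case (elim n)
    show ?case
    proof (rule sn_le)
      fix u assume u: "u \<in> S n"
      have "dn n k s u - res n (dlim s) u = d_fun S D s u - dlim s (\<iota> u)"
        using u elim assms by (simp add: res_def d_fun_def level_eq p_down_def)
      then show "\<bar>dn n k s u - res n (dlim s) u\<bar> \<le> (SUP u\<in>S n. \<bar>d_fun S D s u - dlim s (\<iota> u)\<bar>)"
        using u fin_S by (auto intro!: cSUP_upper bdd_above_finite)
    qed
  qed
qed

section \<open>Limits of the eigenfunctions and density of their span\<close>

abbreviation hl :: "'s \<Rightarrow> 'e \<Rightarrow>\<^sub>C real" where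
  "hl s \<equiv> h_lim S c U dlim s"

lemma h_lim_apply:
  assumes "s \<in> S k"
  shows "hl s x = (\<Sum>i\<le>k. \<Sum>r\<in>S i. p_up U i k r s * eta c i k * dlim r x)"
proof -
  have "hl s x = (\<Sum>r\<in>(\<Union>i\<le>k. S i). p_up U (level S r) k r s * eta c (level S r) k * dlim r x)"
    unfolding h_lim_def level_eq[OF assms] apply_bcontfun_sum by simp
  also have "\<dots> = (\<Sum>i\<le>k. \<Sum>r\<in>S i. p_up U (level S r) k r s * eta c (level S r) k * dlim r x)"
    using fin_S disj by (intro sum.UNION_disjoint) (auto simp: disjoint_family_on_def)
  also have "\<dots> = (\<Sum>i\<le>k. \<Sum>r\<in>S i. p_up U i k r s * eta c i k * dlim r x)"
    by (intro sum.cong refl) (simp add: level_eq)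
  finally show ?thesis .
qed

lemma hn_limit:
  assumes "s \<in> S k"
  shows "(\<lambda>n. sn n (\<lambda>u. hn n k s u - res n (hl s) u)) \<longlonglongrightarrow> 0"
proof (rule tendsto_0_upper[OF sn_nonneg])
  let ?w = "\<lambda>i r. \<bar>p_up U i k r s * eta c i k\<bar>"
  show "(\<lambda>n. \<Sum>i\<le>k. \<Sum>r\<in>S i. ?w i r * sn n (\<lambda>u. dn n i r u - res n (dlim r) u)) \<longlonglongrightarrow> 0"
    by (intro tendsto_null_sum tendsto_mult_right_zero dn_limit)
  show "\<forall>\<^sub>F n in sequentially. sn n (\<lambda>u. hn n k s u - res n (hl s) u) \<le>
      (\<Sum>i\<le>k. \<Sum>r\<in>S i. ?w i r * sn n (\<lambda>u. dn n i r u - res n (dlim r) u))"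
  proof (intro always_eventually allI sn_le)
    fix n u assume u: "u \<in> S n"
    have eq: "hn n k s u - res n (hl s) u = (\<Sum>i\<le>k. \<Sum>r\<in>S i. p_up U i k r s * eta c i k * (dn n i r u - res n (dlim r) u))"
      using u by (simp add: hn_def res_def h_lim_apply[OF assms] sum_subtractf algebra_simps)
    have "\<bar>hn n k s u - res n (hl s) u\<bar> \<le> (\<Sum>i\<le>k. \<Sum>r\<in>S i. \<bar>p_up U i k r s * eta c i k * (dn n i r u - res n (dlim r) u)\<bar>)"
      unfolding eq by (rule order_trans[OF sum_abs sum_mono[OF sum_abs]])
    also have "\<dots> \<le> (\<Sum>i\<le>k. \<Sum>r\<in>S i. ?w i r * sn n (\<lambda>u. dn n i r u - res n (dlim r) u))"
    proof (intro sum_mono)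
      fix i r
      show "\<bar>p_up U i k r s * eta c i k * (dn n i r u - res n (dlim r) u)\<bar> \<le>
          ?w i r * sn n (\<lambda>u. dn n i r u - res n (dlim r) u)"
        unfolding abs_mult[of _ "dn n i r u - res n (dlim r) u"]
        by (rule mult_left_mono[OF sn_ge[OF u, of "\<lambda>u. dn n i r u - res n (dlim r) u"]]) simp
    qed
    finally show "\<bar>hn n k s u - res n (hl s) u\<bar> \<le> (\<Sum>i\<le>k. \<Sum>r\<in>S i. ?w i r * sn n (\<lambda>u. dn n i r u - res n (dlim r) u))" .
  qed
qed

text \<open>The unitriangular system that links \<open>dn\<close> and \<open>hn\<close> holds for
  the limits with the same coefficients, so the span of the \<open>hl s\<close> contains every
  \<open>dlim s\<close> and is dense by (L2).\<close>

lemma dense_h: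
  assumes V: "subspace V" "closed V" and h: "\<And>k s. s \<in> S k \<Longrightarrow> hl s \<in> V"
  shows "f \<in> V"
proof -
  have d: "dlim s \<in> V" if "s \<in> S k" for s k
    using that
  proof (induction k arbitrary: s rule: less_induct)
    case (less k)
    have "dlim s = hl s - (\<Sum>i<k. \<Sum>r\<in>S i. (p_up U i k r s * eta c i k) *\<^sub>R dlim r)"
      by (rule bcontfun_eqI) (use h_sum_split[OF less.prems, of "\<lambda>i r. dlim r _"] in
        \<open>simp add: h_lim_apply[OF less.prems] apply_bcontfun_sum\<close>)
    also have "\<dots> \<in> V"
      using less by (intro subspace_diff subspace_sum subspace_scale V h) auto
    finally show ?case .
  qed
  have "closure (span (dlim ` (\<Union>n. S n))) \<subseteq> V"
    using d by (intro closure_minimal span_minimal V) auto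
  then show ?thesis
    using limit_conditions by (auto simp: limit_space_conditions_def)
qed

text \<open>The functions on which the seminorms tend to 0 form a closed subspace, thanks to the
  common bound \<open>K\<close>. Strong continuity at 0, ergodicity, convergence of the M_n and the
  small-time estimate are all instances, each with its own index filter.\<close>

lemma seminorm_limit_dense:
  fixes N :: "'i \<Rightarrow> ('e \<Rightarrow>\<^sub>C real) \<Rightarrow> real"
  assumes N: "\<And>i f. 0 \<le> N i f" "\<And>i f g. N i (f + g) \<le> N i f + N i g" "\<And>i a f. N i (a *\<^sub>R f) \<le> \<bar>a\<bar> * N i f"
      "\<And>i f. N i f \<le> K * norm f"
    and h: "\<And>k s. s \<in> S k \<Longrightarrow> ((\<lambda>i. N i (hl s)) \<longlongrightarrow> 0) F"
  shows "((\<lambda>i. N i f) \<longlongrightarrow> 0) F"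
proof -
  define V where "V = {f. ((\<lambda>i. N i f) \<longlongrightarrow> 0) F}"
  have "f \<in> V"
  proof (rule dense_h)
    show "subspace V"
    proof (rule subspaceI)
      have "N i 0 = 0" for i
        using N(1)[of i 0] N(4)[of i 0] by simp
      then show "0 \<in> V" by (simp add: V_def)
    next
      fix f g assume fg: "f \<in> V" "g \<in> V"
      have "((\<lambda>i. N i (f + g)) \<longlongrightarrow> 0) F"
        by (rule tendsto_0_upper[OF N(1) always_eventually tendsto_add_zero[of "\<lambda>i. N i f" F "\<lambda>i. N i g"]])
          (use fg N in \<open>auto simp: V_def\<close>)
      then show "f + g \<in> V" by (simp add: V_def)
    next
      fix a f assume f: "f \<in> V"
      have "((\<lambda>i. N i (a *\<^sub>R f)) \<longlongrightarrow> 0) F"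
        by (rule tendsto_0_upper[OF N(1) always_eventually tendsto_mult_right_zero[of "\<lambda>i. N i f" F "\<bar>a\<bar>"]])
          (use f N in \<open>auto simp: V_def\<close>)
      then show "a *\<^sub>R f \<in> V" by (simp add: V_def)
    qed
    show "closed V"
      unfolding closed_sequential_limits
    proof (intro allI impI, elim conjE)
      fix x l assume x: "\<forall>m. x m \<in> V" "x \<longlonglongrightarrow> l"
      show "l \<in> V"
        unfolding V_def mem_Collect_eq
      proof (rule tendstoI)
        fix e :: real assume e: "0 < e"
        have K: "0 \<le> \<bar>K\<bar>" "0 < 2 * (\<bar>K\<bar> + 1)" by auto
        with e x(2) obtain m where m: "norm (l - x m) < e / (2 * (\<bar>K\<bar> + 1))"
          by (metis LIMSEQ_D divide_pos_pos norm_minus_commute order_refl)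
        have "\<bar>K\<bar> * norm (l - x m) \<le> (\<bar>K\<bar> + 1) * norm (l - x m)"
          by (intro mult_right_mono) auto
        also have "\<dots> < (\<bar>K\<bar> + 1) * (e / (2 * (\<bar>K\<bar> + 1)))"
          using m by (intro mult_strict_left_mono) auto
        also have "\<dots> = e / 2"
          using K by (simp add: field_simps)
        finally have m2: "K * norm (l - x m) < e / 2"
          by (smt (verit) mult_right_mono norm_ge_zero)
        have "\<forall>\<^sub>F i in F. dist (N i (x m)) 0 < e / 2"
          using x(1) e by (intro tendstoD) (auto simp: V_def)
        then show "\<forall>\<^sub>F i in F. dist (N i l) 0 < e"
        proof eventually_elim
          case (elim i)
          have "N i l \<le> N i (l - x m) + N i (x m)"
            using N(2)[of i "l - x m" "x m"] by simp
          with elim m2 N(4)[of i "l - x m"] N(1)[of i l] show ?case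
            by (simp add: dist_real_def)
        qed
      qed
    qed
  qed (use h in \<open>simp add: V_def\<close>)
  then show ?thesis by (simp add: V_def)
qed

text \<open>\<open>LT t f g\<close> means that \<open>T n\<close> to the power \<open>j n\<close> takes \<open>f\<close> to \<open>g\<close> in the limit whenever
  \<open>j n / c n\<close> tends to \<open>t\<close>. Arbitrary such \<open>j\<close> are allowed because rounded times do not add up.\<close>

definition LT :: "real \<Rightarrow> ('e \<Rightarrow>\<^sub>C real) \<Rightarrow> ('e \<Rightarrow>\<^sub>C real) \<Rightarrow> bool" where
  "LT t f g \<longleftrightarrow> (\<forall>j. (\<lambda>n. real (j n) / c n) \<longlonglongrightarrow> t \<longrightarrow>
     (\<lambda>n. sn n (\<lambda>u. (T n ^^ j n) (res n f) u - res n g u)) \<longlonglongrightarrow> 0)"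

lemma LT_D:
  "LT t f g \<Longrightarrow> (\<lambda>n. real (j n) / c n) \<longlonglongrightarrow> t \<Longrightarrow>
    (\<lambda>n. sn n (\<lambda>u. (T n ^^ j n) (res n f) u - res n g u)) \<longlonglongrightarrow> 0"
  by (simp add: LT_def)

lemma LT_add:
  assumes "LT t f1 g1" "LT t f2 g2" shows "LT t (f1 + f2) (g1 + g2)"
  unfolding LT_def
proof (intro allI impI)
  fix j assume j: "(\<lambda>n. real (j n) / c n) \<longlonglongrightarrow> t"
  have "sn n (\<lambda>u. (T n ^^ j n) (res n (f1 + f2)) u - res n (g1 + g2) u) \<le>
    sn n (\<lambda>u. (T n ^^ j n) (res n f1) u - res n g1 u) + sn n (\<lambda>u. (T n ^^ j n) (res n f2) u - res n g2 u)" for n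
    using sn_add[of n "\<lambda>u. (T n ^^ j n) (res n f1) u - res n g1 u" "\<lambda>u. (T n ^^ j n) (res n f2) u - res n g2 u"]
    by (simp add: res_add T_pow_add algebra_simps)
  then show "(\<lambda>n. sn n (\<lambda>u. (T n ^^ j n) (res n (f1 + f2)) u - res n (g1 + g2) u)) \<longlonglongrightarrow> 0"
    using tendsto_add_zero[OF LT_D[OF assms(1) j] LT_D[OF assms(2) j]]
    by (intro tendsto_0_upper[OF sn_nonneg always_eventually]) auto
qed

lemma LT_scale:
  assumes "LT t f g" shows "LT t (a *\<^sub>R f) (a *\<^sub>R g)"
  unfolding LT_def
proof (intro allI impI)
  fix j assume j: "(\<lambda>n. real (j n) / c n) \<longlonglongrightarrow> t"
  have "sn n (\<lambda>u. (T n ^^ j n) (res n (a *\<^sub>R f)) u - res n (a *\<^sub>R g) u) \<le>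
    \<bar>a\<bar> * sn n (\<lambda>u. (T n ^^ j n) (res n f) u - res n g u)" for n
    using sn_scale[of n a "\<lambda>u. (T n ^^ j n) (res n f) u - res n g u"]
    by (simp add: res_scale T_pow_scale algebra_simps)
  then show "(\<lambda>n. sn n (\<lambda>u. (T n ^^ j n) (res n (a *\<^sub>R f)) u - res n (a *\<^sub>R g) u)) \<longlonglongrightarrow> 0"
    using tendsto_mult_right_zero[OF LT_D[OF assms(1) j], of "\<bar>a\<bar>"]
    by (intro tendsto_0_upper[OF sn_nonneg always_eventually]) auto
qed

lemma LT_diff: "LT t f1 g1 \<Longrightarrow> LT t f2 g2 \<Longrightarrow> LT t (f1 - f2) (g1 - g2)"
  using LT_add[of t f1 g1 "-1 *\<^sub>R f2" "-1 *\<^sub>R g2"] LT_scale[of t f2 g2 "-1"] by simp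

lemma floor_steps: "0 \<le> t \<Longrightarrow> (\<lambda>n. real (nat \<lfloor>c n * t\<rfloor>) / c n) \<longlonglongrightarrow> t"
  by (rule nat_floor_div_tendsto[OF c_at_top])

lemma LT_norm:
  assumes "0 \<le> t" "LT t f g" shows "norm g \<le> norm f"
  by (rule norm_le_liminf_sn[OF LT_D[OF assms(2) floor_steps[OF assms(1)]]])
    (rule order_trans[OF sn_T_pow sn_res])

lemma LT_unique: "0 \<le> t \<Longrightarrow> LT t f g \<Longrightarrow> LT t f g' \<Longrightarrow> g = g'"
  using LT_norm[of t "f - f" "g - g'"] LT_diff[of t f g f g'] by simp

lemma LT_h:
  assumes "s \<in> S k" shows "LT t (hl s) (exp (- t * rate_before c k) *\<^sub>R hl s)"
  unfolding LT_def
proof (intro allI impI)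
  fix j assume j: "(\<lambda>n. real (j n) / c n) \<longlonglongrightarrow> t"
  let ?\<rho> = "\<lambda>n. (1 - rate_before c k / c n) ^ j n" and ?e = "exp (- t * rate_before c k)"
  have \<rho>: "?\<rho> \<longlonglongrightarrow> ?e"
    by (rule one_minus_div_powr_limit[OF c_at_top j])
  let ?v = "\<lambda>n. sn n (\<lambda>u. hn n k s u - res n (hl s) u)"
  \<comment> \<open>Replacing \<open>hl s\<close> by the exact eigenfunction costs
    \<open>?v n\<close> before the powers are taken and \<open>?v n\<close> times the eigenvalue
    power afterwards; the last term compares that power with its exponential limit.\<close>
  have le: "sn n (\<lambda>u. (T n ^^ j n) (res n (hl s)) u - res n (?e *\<^sub>R hl s) u) \<le>
      (1 + \<bar>?\<rho> n\<bar>) * ?v n + \<bar>?\<rho> n - ?e\<bar> * norm (hl s)" if n: "k \<le> n" for n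
  proof (rule sn_le)
    fix u assume u: "u \<in> S n"
    have 1: "\<bar>(T n ^^ j n) (res n (hl s)) u - (T n ^^ j n) (hn n k s) u\<bar> \<le> ?v n"
      using sn_T_pow_diff[of "hn n k s" n "res n (hl s)" "j n"] hn_fin_C[OF n, of s]
        sn_ge[OF u, of "\<lambda>u. (T n ^^ j n) (hn n k s) u - (T n ^^ j n) (res n (hl s)) u"]
      by simp
    have 2: "(T n ^^ j n) (hn n k s) u = ?\<rho> n * hn n k s u"
      by (simp add: T_pow_hn[OF n assms])
    have "\<bar>?\<rho> n * hn n k s u - ?\<rho> n * res n (hl s) u\<bar> \<le> \<bar>?\<rho> n\<bar> * ?v n"
      using sn_ge[OF u, of "\<lambda>u. hn n k s u - res n (hl s) u"]
      by (simp add: abs_mult mult_left_mono flip: right_diff_distrib)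
    moreover have "\<bar>?\<rho> n * res n (hl s) u - ?e * res n (hl s) u\<bar> \<le> \<bar>?\<rho> n - ?e\<bar> * norm (hl s)"
      using order_trans[OF sn_ge[OF u, of "res n (hl s)"] sn_res]
      by (simp add: abs_mult mult_left_mono flip: left_diff_distrib)
    ultimately show "\<bar>(T n ^^ j n) (res n (hl s)) u - res n (?e *\<^sub>R hl s) u\<bar> \<le>
        (1 + \<bar>?\<rho> n\<bar>) * ?v n + \<bar>?\<rho> n - ?e\<bar> * norm (hl s)"
      using 1 unfolding 2 res_scale by (simp add: algebra_simps)
  qed
  show "(\<lambda>n. sn n (\<lambda>u. (T n ^^ j n) (res n (hl s)) u - res n (?e *\<^sub>R hl s) u)) \<longlonglongrightarrow> 0"
  proof (rule tendsto_0_upper[OF sn_nonneg])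
    show "\<forall>\<^sub>F n in sequentially. sn n (\<lambda>u. (T n ^^ j n) (res n (hl s)) u - res n (?e *\<^sub>R hl s) u) \<le>
      (1 + \<bar>?\<rho> n\<bar>) * ?v n + \<bar>?\<rho> n - ?e\<bar> * norm (hl s)"
      using eventually_ge_at_top[of k] by eventually_elim (rule le)
    have "(\<lambda>n. (1 + \<bar>?\<rho> n\<bar>) * ?v n + \<bar>?\<rho> n - ?e\<bar> * norm (hl s)) \<longlonglongrightarrow> (1 + \<bar>?e\<bar>) * 0 + \<bar>?e - ?e\<bar> * norm (hl s)"
      by (intro tendsto_intros \<rho> hn_limit[OF assms])
    then show "(\<lambda>n. (1 + \<bar>?\<rho> n\<bar>) * ?v n + \<bar>?\<rho> n - ?e\<bar> * norm (hl s)) \<longlonglongrightarrow> 0" by simp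
  qed
qed

text \<open>Contractivity makes the images \<open>g m\<close> a Cauchy sequence; its limit serves
  for \<open>l\<close> by a three-term estimate whose outer terms are bounded uniformly in the
  level.\<close>

lemma LT_closed:
  assumes t: "0 \<le> t" and f: "f \<longlonglongrightarrow> l" and g: "\<And>m. LT t (f m) (g m)"
  shows "\<exists>g. LT t l g"
proof -
  have dist_g: "dist (g m) (g m') \<le> dist (f m) (f m')" for m m'
    using LT_norm[OF t LT_diff[OF g g]] by (simp add: dist_norm)
  have "Cauchy g"
    using LIMSEQ_imp_Cauchy[OF f] dist_g unfolding Cauchy_def by (meson le_less_trans)
  then obtain G where G: "g \<longlonglongrightarrow> G"
    using Cauchy_convergent_iff convergent_def by metis
  have "LT t l G"
    unfolding LT_def
  proof (intro allI impI tendstoI)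
    fix j and e :: real assume j: "(\<lambda>n. real (j n) / c n) \<longlonglongrightarrow> t" and e: "0 < e"
    have "\<forall>\<^sub>F m in sequentially. dist (f m) l < e/3 \<and> dist (g m) G < e/3"
      using e by (intro eventually_conj tendstoD f G) auto
    then obtain m where "dist (f m) l < e/3" and m2: "dist (g m) G < e/3"
      using eventually_happens'[OF sequentially_bot] by blast
    then have m: "norm (l - f m) < e/3" "norm (g m - G) < e/3"
      by (simp_all add: dist_norm norm_minus_commute)
    have "\<forall>\<^sub>F n in sequentially. dist (sn n (\<lambda>u. (T n ^^ j n) (res n (f m)) u - res n (g m) u)) 0 < e/3"
      using e by (intro tendstoD[OF LT_D[OF g j]]) auto
    then show "\<forall>\<^sub>F n in sequentially. dist (sn n (\<lambda>u. (T n ^^ j n) (res n l) u - res n G u)) 0 < e"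
    proof eventually_elim
      case (elim n)
      have "sn n (\<lambda>u. (T n ^^ j n) (res n l) u - (T n ^^ j n) (res n (f m)) u) \<le> norm (l - f m)"
        using sn_T_pow_diff[of "res n l" n "res n (f m)" "j n"] sn_res[of n "l - f m"] by (simp add: res_diff)
      moreover have "sn n (\<lambda>u. res n (g m) u - res n G u) \<le> norm (g m - G)"
        using sn_res[of n "g m - G"] by (simp add: res_diff)
      ultimately show ?case
        using elim m sn_triangle[of n "(T n ^^ j n) (res n l)" "res n G" "(T n ^^ j n) (res n (f m))"]
          sn_triangle[of n "(T n ^^ j n) (res n (f m))" "res n G" "res n (g m)"]
        by (simp add: dist_real_def)
    qed
  qed
  then show ?thesis ..
qed

lemma LT_ex:
  assumes "0 \<le> t" shows "\<exists>g. LT t f g"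
proof -
  define V where "V = {f. \<exists>g. LT t f g}"
  have "f \<in> V"
  proof (rule dense_h)
    show "subspace V"
    proof (rule subspaceI)
      show "0 \<in> V" using LT_scale[OF LT_h, of root 0 t 0] S0 by (auto simp: V_def)
      show "f + g \<in> V" if "f \<in> V" "g \<in> V" for f g
        using that LT_add[of t f _ g] unfolding V_def by blast
      show "a *\<^sub>R f \<in> V" if "f \<in> V" for a f
        using that LT_scale[of t f _ a] unfolding V_def by blast
    qed
    show "closed V"
      unfolding closed_sequential_limits
    proof (intro allI impI, elim conjE)
      fix x l assume x: "\<forall>m. x m \<in> V" "x \<longlonglongrightarrow> l"
      then obtain g where "\<And>m. LT t (x m) (g m)" unfolding V_def by (simp, metis)
      with LT_closed[OF assms x(2)] show "l \<in> V" by (auto simp: V_def)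
    qed
  qed (use LT_h in \<open>auto simp: V_def\<close>)
  then show ?thesis by (simp add: V_def)
qed

text \<open>\<open>max 0 t\<close> makes the family total, so that linearity and contractivity hold
  for all real \<open>t\<close>, as \<open>seminorm_limit_dense\<close> demands of every
  index.\<close>

definition TT :: "real \<Rightarrow> ('e \<Rightarrow>\<^sub>C real) \<Rightarrow> ('e \<Rightarrow>\<^sub>C real)" where
  "TT t f = (THE g. LT (max 0 t) f g)"

lemma LT_TT: "0 \<le> t \<Longrightarrow> LT t f (TT t f)"
proof -
  assume t: "0 \<le> t"
  have "\<exists>!g. LT t f g"
    using LT_ex[OF t] LT_unique[OF t] by blast
  then have "LT t f (THE g. LT t f g)" by (rule theI')
  then show ?thesis using t by (simp add: TT_def)
qed

lemma TT_eqI: "0 \<le> t \<Longrightarrow> LT t f g \<Longrightarrow> TT t f = g"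
  using LT_unique LT_TT by blast

lemma TT_max: "TT t = TT (max 0 t)"
  by (simp add: TT_def fun_eq_iff)

section \<open>Semigroup properties of the limit operators\<close>

lemma TT_add: "TT t (f + g) = TT t f + TT t g"
  unfolding TT_max[of t] by (intro TT_eqI LT_add LT_TT) auto

lemma TT_scale: "TT t (a *\<^sub>R f) = a *\<^sub>R TT t f"
  unfolding TT_max[of t] by (intro TT_eqI LT_scale LT_TT) auto

lemma TT_diff: "TT t (f - g) = TT t f - TT t g"
  unfolding TT_max[of t] by (intro TT_eqI LT_diff LT_TT) auto

lemma TT_norm: "norm (TT t f) \<le> norm f"
  unfolding TT_max[of t] by (rule LT_norm[OF _ LT_TT]) auto

lemma TT_h: "s \<in> S k \<Longrightarrow> 0 \<le> t \<Longrightarrow> TT t (hl s) = exp (- t * rate_before c k) *\<^sub>R hl s"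
  by (intro TT_eqI LT_h)

lemma TT_limit:
  assumes "0 \<le> t" "(\<lambda>n. real (j n) / c n) \<longlonglongrightarrow> t"
  shows "(\<lambda>n. sn n (\<lambda>u. (T n ^^ j n) (res n f) u - res n (TT t f) u)) \<longlonglongrightarrow> 0"
  by (rule LT_D[OF LT_TT[OF assms(1)] assms(2)])

lemma TT_0: "TT 0 f = f"
proof (rule sym, rule ccontr)
  have "(\<lambda>n. sn n (\<lambda>u. (T n ^^ 0) (res n f) u - res n (TT 0 f) u)) \<longlonglongrightarrow> 0"
    by (rule TT_limit) auto
  then have "(\<lambda>n. sn n (\<lambda>u. 0 - res n (TT 0 f - f) u)) \<longlonglongrightarrow> 0"
    by (simp add: res_diff)
  then have "norm (TT 0 f - f) \<le> 0"
    by (rule norm_le_liminf_sn) (intro sn_le, simp)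
  then show "f \<noteq> TT 0 f \<Longrightarrow> False" by simp
qed

lemma TT_semigroup:
  assumes "0 \<le> s" "0 \<le> t" shows "TT (s + t) f = TT s (TT t f)"
proof (rule TT_eqI)
  show "LT (s + t) f (TT s (TT t f))"
    unfolding LT_def
  proof (intro allI impI)
    fix j assume j: "(\<lambda>n. real (j n) / c n) \<longlonglongrightarrow> s + t"
    \<comment> \<open>The steps are split into about c_n s and the remaining ones. The minimum is
      taken because \<open>j n\<close> may fall below the floor for some \<open>n\<close>; the limit
      is still s, as t is nonnegative.\<close>
    define a where "a n = min (j n) (nat \<lfloor>c n * s\<rfloor>)" for n
    have a: "(\<lambda>n. real (a n) / c n) \<longlonglongrightarrow> s"
    proof -
      have "(\<lambda>n. min (real (j n) / c n) (real (nat \<lfloor>c n * s\<rfloor>) / c n)) \<longlonglongrightarrow> min (s + t) s"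
        by (intro tendsto_min j floor_steps assms)
      moreover have "min (real (j n) / c n) (real (nat \<lfloor>c n * s\<rfloor>) / c n) = real (a n) / c n" for n
        using c_pos[of n] by (simp add: a_def min_def divide_le_cancel)
      ultimately show ?thesis using assms by simp
    qed
    have b: "(\<lambda>n. real (j n - a n) / c n) \<longlonglongrightarrow> t"
      using tendsto_diff[OF j a] by (simp add: a_def of_nat_diff diff_divide_distrib)
    have eq: "(T n ^^ j n) g = (T n ^^ a n) ((T n ^^ (j n - a n)) g)" for n g
      by (subst funpow_add[THEN fun_cong, unfolded comp_def, symmetric]) (simp add: a_def)
    show "(\<lambda>n. sn n (\<lambda>u. (T n ^^ j n) (res n f) u - res n (TT s (TT t f)) u)) \<longlonglongrightarrow> 0"
    proof (rule tendsto_0_upper[OF sn_nonneg always_eventually tendsto_add_zero[OF TT_limit[OF assms(2) b, of f] TT_limit[OF assms(1) a, of "TT t f"]]], rule allI)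
      fix n
      show "sn n (\<lambda>u. (T n ^^ j n) (res n f) u - res n (TT s (TT t f)) u)
        \<le> sn n (\<lambda>u. (T n ^^ (j n - a n)) (res n f) u - res n (TT t f) u) +
          sn n (\<lambda>u. (T n ^^ a n) (res n (TT t f)) u - res n (TT s (TT t f)) u)"
        using sn_triangle[of n "(T n ^^ j n) (res n f)" "res n (TT s (TT t f))" "(T n ^^ a n) (res n (TT t f))"]
          sn_T_pow_diff[OF T_pow_fin_C[OF res_fin_C] res_fin_C, of n "a n" "j n - a n" f "TT t f"]
        by (simp add: eq)
    qed
  qed
qed (use assms in auto)

lemma TT_tendsto:
  assumes t: "0 \<le> t" and s: "\<And>n. s n \<in> S n" "(\<lambda>n. \<iota> (s n)) \<longlonglongrightarrow> x"
  shows "(\<lambda>n. (T n ^^ nat \<lfloor>c n * t\<rfloor>) (res n f) (s n)) \<longlonglongrightarrow> TT t f x"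
proof -
  let ?g = "\<lambda>n u. (T n ^^ nat \<lfloor>c n * t\<rfloor>) (res n f) u"
  have "(\<lambda>n. ?g n (s n) - res n (TT t f) (s n)) \<longlonglongrightarrow> 0"
  proof (rule Lim_null_comparison[OF always_eventually TT_limit[OF t floor_steps[OF t], of f]], rule allI)
    fix n
    show "norm (?g n (s n) - res n (TT t f) (s n)) \<le> sn n (\<lambda>u. ?g n u - res n (TT t f) u)"
      using sn_ge[OF s(1)[of n], of "\<lambda>u. ?g n u - res n (TT t f) u"] by simp
  qed
  from tendsto_add[OF this res_tendsto[OF s, of "TT t f"]] show ?thesis by simp
qed

text \<open>The eigenfunction of level 0 is 1 on each \<open>S n\<close>. Its rate is 0, so this
  identification yields conservation of mass for the semigroup.\<close>

lemma h_lim_root: "hl root = const_bcontfun 1"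
proof -
  have "(\<lambda>n. sn n (\<lambda>u. 0 - res n (hl root - const_bcontfun 1) u)) \<longlonglongrightarrow> 0"
  proof -
    have "sn n (\<lambda>u. hn n 0 root u - res n (hl root) u) = sn n (\<lambda>u. 0 - res n (hl root - const_bcontfun 1) u)" for n
      unfolding sn_def by (intro arg_cong[where f=Max] image_cong refl) (simp add: hn_root res_def)
    then show ?thesis using hn_limit[of root 0] by (simp add: S0)
  qed
  then have "norm (hl root - const_bcontfun 1) \<le> 0"
    by (rule norm_le_liminf_sn) (intro sn_le, simp)
  then show ?thesis by simp
qed

lemma TT_one: "TT t (const_bcontfun 1) = const_bcontfun 1"
  unfolding TT_max[of t] h_lim_root[symmetric]
  by (subst TT_h[of _ 0]) (auto simp: S0 rate_before_def)

lemma TT_continuous_0: "((\<lambda>t. TT t f) \<longlongrightarrow> f) (at_right 0)"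
proof -
  have "((\<lambda>t. norm (TT t f - f)) \<longlongrightarrow> 0) (at_right 0)"
  proof (rule seminorm_limit_dense[where K=2])
    fix t :: real and f g :: "'e \<Rightarrow>\<^sub>C real" and a :: real
    show "norm (TT t (f + g) - (f + g)) \<le> norm (TT t f - f) + norm (TT t g - g)"
      using norm_triangle_ineq[of "TT t f - f" "TT t g - g"] by (simp add: TT_add algebra_simps)
    show "norm (TT t (a *\<^sub>R f) - a *\<^sub>R f) \<le> \<bar>a\<bar> * norm (TT t f - f)"
      by (simp add: TT_scale flip: scaleR_diff_right)
    show "norm (TT t f - f) \<le> 2 * norm f"
      using norm_triangle_ineq4[of "TT t f" f] TT_norm[of t f] by simp
  next
    fix k s assume s: "s \<in> S k"
    have "((\<lambda>t. norm (exp (- t * rate_before c k) *\<^sub>R hl s - hl s)) \<longlongrightarrow> norm (exp (- 0 * rate_before c k) *\<^sub>R hl s - hl s)) (at_right 0)"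
      by (intro tendsto_intros)
    moreover have "\<forall>\<^sub>F t in at_right 0. norm (exp (- t * rate_before c k) *\<^sub>R hl s - hl s) = norm (TT t (hl s) - hl s)"
      using eventually_at_right_less[of "0::real"] by eventually_elim (simp add: TT_h[OF s])
    ultimately show "((\<lambda>t. norm (TT t (hl s) - hl s)) \<longlongrightarrow> 0) (at_right 0)"
      by (simp add: Lim_transform_eventually)
  qed simp
  then show ?thesis
    by (simp add: LIM_zero_iff tendsto_norm_zero_iff)
qed

end

section \<open>Kernels and ergodicity\<close>

lemma (in prob_space) abs_integral_le_const:
  fixes f :: "'a \<Rightarrow> real"
  assumes "integrable M f" "\<And>x. x \<in> space M \<Longrightarrow> \<bar>f x\<bar> \<le> B"
  shows "\<bar>\<integral>x. f x \<partial>M\<bar> \<le> B"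
proof -
  have "norm (\<integral>x. f x \<partial>M) \<le> (\<integral>x. \<bar>f x\<bar> \<partial>M)"
    using integral_norm_bound[of M f] by simp
  also have "\<dots> \<le> B"
    using assms by (intro integral_le_const) auto
  finally show ?thesis by simp
qed

context limit_chains
begin

text \<open>Equicontinuity at time 0 uniformly in \<open>n\<close>, the input for the exit
  estimates. With \<delta> and \<open>n\<close> as a joint index it becomes a limit of seminorms; on
  an eigenfunction Bernoulli's inequality bounds 1 - (1 - b/c_n)^j by j b / c_n, hence by \<delta>
  b.\<close>

lemma T_pow_res_small_time:
  fixes f :: "'e \<Rightarrow>\<^sub>C real"
  assumes "0 < \<eta>"
  obtains \<delta> n0 where "0 < \<delta>"
    "\<And>n j. n0 \<le> n \<Longrightarrow> real j \<le> \<delta> * c n \<Longrightarrow> sn n (\<lambda>u. (T n ^^ j) (res n f) u - res n f u) \<le> \<eta>"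
proof -
  \<comment> \<open>\<open>\<bar>\<delta>\<bar>\<close> keeps \<open>J\<close> nonempty for every
    real \<delta>, so that the supremum is a seminorm for all indices.\<close>
  define J where "J = (\<lambda>(\<delta>::real, n). {j. real j \<le> \<bar>\<delta>\<bar> * c n})"
  define N where "N i f = (SUP j\<in>J i. sn (snd i) (\<lambda>u. (T (snd i) ^^ j) (res (snd i) f) u - res (snd i) f u))"
    for i :: "real \<times> nat" and f
  have J: "0 \<in> J i" for i
    using c_pos[of "snd i"] by (auto simp: J_def less_imp_le split: prod.splits)
  have b: "sn n (\<lambda>u. (T n ^^ j) (res n f) u - res n f u) \<le> 2 * norm f" for n j f
    using sn_diff_le[of n "(T n ^^ j) (res n f)" "res n f"] sn_T_pow[of n j "res n f"] sn_res[of n f]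
    by linarith
  then have bdd: "bdd_above ((\<lambda>j. sn (snd i) (\<lambda>u. (T (snd i) ^^ j) (res (snd i) f) u - res (snd i) f u)) ` J i)" for i f
    by (auto simp: bdd_above_def)
  have N_ge: "sn (snd i) (\<lambda>u. (T (snd i) ^^ j) (res (snd i) f) u - res (snd i) f u) \<le> N i f" if "j \<in> J i" for i j f
    unfolding N_def by (rule cSUP_upper[OF that bdd])
  have N_le: "N i f \<le> B" if "\<And>j. j \<in> J i \<Longrightarrow> sn (snd i) (\<lambda>u. (T (snd i) ^^ j) (res (snd i) f) u - res (snd i) f u) \<le> B" for i f B
    unfolding N_def using J[of i] that by (intro cSUP_least) blast+
  have N0: "0 \<le> N i f" for i f
    using N_ge[OF J] sn_nonneg order_trans by blast
  have "((\<lambda>i. N i f) \<longlongrightarrow> 0) (at_right 0 \<times>\<^sub>F sequentially)"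
  proof (rule seminorm_limit_dense[where K=2])
    fix i :: "real \<times> nat" and f g :: "'e \<Rightarrow>\<^sub>C real" and a :: real
    obtain \<delta> n where i: "i = (\<delta>, n)" by (cases i)
    show "N i (f + g) \<le> N i f + N i g"
    proof (rule N_le)
      fix j assume j: "j \<in> J i"
      have "sn n (\<lambda>u. (T n ^^ j) (res n (f + g)) u - res n (f + g) u) \<le>
          sn n (\<lambda>u. (T n ^^ j) (res n f) u - res n f u) + sn n (\<lambda>u. (T n ^^ j) (res n g) u - res n g u)"
        using sn_add[of n "\<lambda>u. (T n ^^ j) (res n f) u - res n f u" "\<lambda>u. (T n ^^ j) (res n g) u - res n g u"]
        by (simp add: res_add T_pow_add algebra_simps)
      with N_ge[OF j, of f] N_ge[OF j, of g] show "sn (snd i) (\<lambda>u. (T (snd i) ^^ j) (res (snd i) (f + g)) u - res (snd i) (f + g) u) \<le> N i f + N i g"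
        by (simp add: i)
    qed
    show "N i (a *\<^sub>R f) \<le> \<bar>a\<bar> * N i f"
    proof (rule N_le)
      fix j assume j: "j \<in> J i"
      have "sn n (\<lambda>u. (T n ^^ j) (res n (a *\<^sub>R f)) u - res n (a *\<^sub>R f) u) \<le>
          \<bar>a\<bar> * sn n (\<lambda>u. (T n ^^ j) (res n f) u - res n f u)"
        using sn_scale[of n a "\<lambda>u. (T n ^^ j) (res n f) u - res n f u"]
        by (simp add: res_scale T_pow_scale algebra_simps)
      also have "\<dots> \<le> \<bar>a\<bar> * N i f"
        using N_ge[OF j, of f] by (intro mult_left_mono) (auto simp: i)
      finally show "sn (snd i) (\<lambda>u. (T (snd i) ^^ j) (res (snd i) (a *\<^sub>R f)) u - res (snd i) (a *\<^sub>R f) u) \<le> \<bar>a\<bar> * N i f"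
        by (simp add: i)
    qed
    show "N i f \<le> 2 * norm f" by (rule N_le) (rule b)
  next
    fix k s assume s: "s \<in> S k"
    let ?v = "\<lambda>n. sn n (\<lambda>u. hn n k s u - res n (hl s) u)"
    let ?b = "rate_before c k"
    let ?B = "\<lambda>i. fst i * ?b * (norm (hl s) + ?v (snd i)) + 2 * ?v (snd i)"
    have main: "N (\<delta>, n) (hl s) \<le> ?B (\<delta>, n)" if \<delta>: "0 < \<delta>" and n: "k \<le> n" for \<delta> n
    proof (rule N_le, unfold snd_conv fst_conv)
      fix j assume "j \<in> J (\<delta>, n)"
      then have j: "real j \<le> \<delta> * c n" using \<delta> by (simp add: J_def)
      show "sn n (\<lambda>u. (T n ^^ j) (res n (hl s)) u - res n (hl s) u) \<le> \<delta> * ?b * (norm (hl s) + ?v n) + 2 * ?v n"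
      proof (rule sn_le)
        fix u assume u: "u \<in> S n"
        let ?\<rho> = "(1 - ?b / c n) ^ j"
        have x: "0 \<le> ?b / c n" "?b / c n \<le> 1"
          using rate_before_nonneg[of k] rate_before_less_c[OF n] c_pos[of n] by (auto simp: field_simps)
        have "1 + real j * (- (?b / c n)) \<le> (1 + (- (?b / c n))) ^ j"
          by (rule Bernoulli_inequality) (use x in auto)
        moreover have "real j * (?b / c n) \<le> \<delta> * c n * (?b / c n)"
          using j x by (intro mult_right_mono)
        moreover have "\<delta> * c n * (?b / c n) = \<delta> * ?b" using c_pos[of n] by simp
        ultimately have r1: "1 - ?\<rho> \<le> \<delta> * ?b" by simp
        have r0: "0 \<le> 1 - ?\<rho>" using x power_le_one[of "1 - ?b / c n" j] by simp
        have 1: "\<bar>(T n ^^ j) (res n (hl s)) u - (T n ^^ j) (hn n k s) u\<bar> \<le> ?v n"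
          using sn_T_pow_diff[of "hn n k s" n "res n (hl s)" "j"] hn_fin_C[OF n, of s]
            sn_ge[OF u, of "\<lambda>u. (T n ^^ j) (hn n k s) u - (T n ^^ j) (res n (hl s)) u"]
          by simp
        have 2: "\<bar>hn n k s u - res n (hl s) u\<bar> \<le> ?v n"
          using sn_ge[OF u, of "\<lambda>u. hn n k s u - res n (hl s) u"] .
        have "\<bar>res n (hl s) u\<bar> \<le> norm (hl s)"
          using order_trans[OF sn_ge[OF u, of "res n (hl s)"] sn_res] .
        with 2 have 3: "\<bar>hn n k s u\<bar> \<le> norm (hl s) + ?v n" by linarith
        have "\<bar>(T n ^^ j) (hn n k s) u - hn n k s u\<bar> = (1 - ?\<rho>) * \<bar>hn n k s u\<bar>"
        proof -
          have "(T n ^^ j) (hn n k s) u - hn n k s u = - ((1 - ?\<rho>) * hn n k s u)"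
            by (simp add: T_pow_hn[OF n s] algebra_simps)
          then show ?thesis using r0 by (simp only: abs_minus_cancel abs_mult abs_of_nonneg)
        qed
        also have "\<dots> \<le> \<delta> * ?b * (norm (hl s) + ?v n)"
          using r0 r1 3 by (intro mult_mono) auto
        finally show "\<bar>(T n ^^ j) (res n (hl s)) u - res n (hl s) u\<bar> \<le> \<delta> * ?b * (norm (hl s) + ?v n) + 2 * ?v n"
          using 1 2 by linarith
      qed
    qed
    have f1: "filterlim fst (at_right (0::real)) (at_right 0 \<times>\<^sub>F sequentially)" and f2: "filterlim snd sequentially (at_right (0::real) \<times>\<^sub>F sequentially)"
      by (rule filterlim_fst filterlim_snd)+
    have lim1: "((\<lambda>i. fst i) \<longlongrightarrow> (0::real)) (at_right 0 \<times>\<^sub>F sequentially)"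
      by (rule filterlim_mono[OF f1 _ order_refl]) (simp add: at_within_le_nhds)
    have lim2: "((\<lambda>i. ?v (snd i)) \<longlongrightarrow> 0) (at_right (0::real) \<times>\<^sub>F sequentially)"
      by (rule filterlim_compose[OF hn_limit[OF s] f2])
    have "(?B \<longlongrightarrow> 0 * ?b * (norm (hl s) + 0) + 2 * 0) (at_right (0::real) \<times>\<^sub>F sequentially)"
      by (intro tendsto_intros lim1 lim2)
    moreover have "\<forall>\<^sub>F i in at_right (0::real) \<times>\<^sub>F sequentially. N i (hl s) \<le> ?B i"
      unfolding eventually_prod_filter
      by (intro exI[of _ "\<lambda>\<delta>. 0 < \<delta>"] exI[of _ "\<lambda>n. k \<le> n"])
        (use main eventually_at_right_less in auto)
    ultimately show "((\<lambda>i. N i (hl s)) \<longlongrightarrow> 0) (at_right 0 \<times>\<^sub>F sequentially)"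
      by (intro tendsto_0_upper[OF N0, where g="?B"]) auto
  qed (rule N0)
  then have "\<forall>\<^sub>F i in at_right 0 \<times>\<^sub>F sequentially. N i f < \<eta>"
    using assms by (rule order_tendstoD)
  then obtain P Q where PQ: "eventually P (at_right 0)" "eventually Q sequentially" "\<And>x y. P x \<Longrightarrow> Q y \<Longrightarrow> N (x, y) f < \<eta>"
    unfolding eventually_prod_filter by blast
  obtain \<delta> where \<delta>: "\<delta> > 0" "P \<delta>"
  proof -
    have "eventually (\<lambda>x. P x \<and> 0 < x) (at_right 0)"
      using PQ(1) eventually_at_right_less by (rule eventually_conj)
    then obtain d where "P d \<and> 0 < d"
      using eventually_happens'[of "at_right (0::real)"] by auto
    then show ?thesis using that by blast
  qed
  obtain n0 where "\<And>n. n0 \<le> n \<Longrightarrow> Q n"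
    using PQ(2) by (auto simp: eventually_sequentially)
  then show ?thesis
    using N_ge[of _ "(\<delta>, _)" f] PQ(3) \<delta> by (intro that[of \<delta> n0]) (force simp: J_def)+
qed

section \<open>Weighted point measures and the transition kernels\<close>

definition push :: "nat \<Rightarrow> ('s \<Rightarrow> real) \<Rightarrow> 'e measure" where
  "push n w = distr (point_measure (S n) (\<lambda>u. ennreal (w u))) borel \<iota>"

lemma
  fixes f :: "'e \<Rightarrow> real"
  assumes "\<And>u. u \<in> S n \<Longrightarrow> 0 \<le> w u" "(\<Sum>u\<in>S n. w u) = 1"
  shows prob_space_push: "prob_space (push n w)"
    and sets_push [simp]: "sets (push n w) = sets borel"
    and integral_push: "f \<in> borel_measurable borel \<Longrightarrow> (\<integral>x. f x \<partial>push n w) = (\<Sum>u\<in>S n. w u * f (\<iota> u))"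
proof -
  let ?M = "point_measure (S n) (\<lambda>u. ennreal (w u))"
  have m[measurable]: "\<iota> \<in> measurable ?M borel"
    by (simp add: measurable_point_measure_eq1)
  have "prob_space ?M"
    by (rule prob_spaceI) (use assms fin_S in \<open>simp add: emeasure_point_measure_finite space_point_measure sum_ennreal\<close>)
  then show "prob_space (push n w)"
    unfolding push_def by (rule prob_space.prob_space_distr) simp
  show "sets (push n w) = sets borel" by (simp add: push_def)
  show "(\<integral>x. f x \<partial>push n w) = (\<Sum>u\<in>S n. w u * f (\<iota> u))"
    if "f \<in> borel_measurable borel"
    unfolding push_def using that assms fin_S
    by (subst integral_distr) (simp_all add: lebesgue_integral_point_measure_finite)
qed

lemma T_pow_eq_sum:
  assumes "f \<in> fin_C (S n)"
  shows "(T n ^^ j) f x = (\<Sum>u\<in>S n. (T n ^^ j) (indicator {u}) x * f u)"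
proof -
  have "(T n ^^ j) f = (T n ^^ j) (\<lambda>x. \<Sum>u\<in>S n. f u * indicator {u} x)"
    using fin_C_expand[OF fin_S assms] by simp
  also have "\<dots> = (\<lambda>x. \<Sum>u\<in>S n. f u * (T n ^^ j) (indicator {u}) x)"
    by (rule T_pow_lincomb[OF fin_S]) simp
  finally show ?thesis by (simp add: mult.commute)
qed

lemma Bcontfun_compact:
  assumes "continuous_on UNIV (f :: 'e \<Rightarrow> real)"
  obtains g :: "'e \<Rightarrow>\<^sub>C real" where "apply_bcontfun g = f"
proof -
  have "f \<in> bcontfun"
    using assms compact_imp_bounded[OF compact_continuous_image[OF assms compact_E]] by (simp add: bcontfun_def)
  then show ?thesis using that[of "Bcontfun f"] by (simp add: Bcontfun_inverse)
qed

text \<open>Points \<open>s n\<close> whose images tend to x exist by (L1). The laws of the chains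
  started there, after floor(c_n t) steps and moved to E, converge weakly because their integrals
  tend to \<open>TT t f x\<close>.\<close>

lemma kernel_exists:
  assumes "0 \<le> t"
  shows "\<exists>M. prob_space M \<and> sets M = sets borel \<and> (\<forall>f. (\<integral>y. apply_bcontfun f y \<partial>M) = apply_bcontfun (TT t f) x)"
proof -
  obtain s where s: "\<And>n. s n \<in> S n" "(\<lambda>n. \<iota> (s n)) \<longlonglongrightarrow> x"
    using dense_points by blast
  define w where "w n u = (T n ^^ nat \<lfloor>c n * t\<rfloor>) (indicator {u}) (s n)" for n u
  have w0: "0 \<le> w n u" for n u
    unfolding w_def by (rule T_pow_indicator_nonneg[OF s(1)])
  have w1: "(\<Sum>u\<in>S n. w n u) = 1" for n
  proof -
    have "1 = (T n ^^ nat \<lfloor>c n * t\<rfloor>) (indicator (S n)) (s n)"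
      by (simp add: T_pow_one s)
    also have "\<dots> = (\<Sum>u\<in>S n. w n u * indicator (S n) u)"
      unfolding w_def by (rule T_pow_eq_sum) (simp add: fin_C_def)
    also have "\<dots> = (\<Sum>u\<in>S n. w n u)" by (intro sum.cong) auto
    finally show ?thesis by simp
  qed
  have int: "(\<integral>y. f y \<partial>push n (w n)) = (T n ^^ nat \<lfloor>c n * t\<rfloor>) (res n f) (s n)" for n and f :: "'e \<Rightarrow>\<^sub>C real"
    by (subst integral_push[OF w0 w1]) (auto simp: T_pow_eq_sum[of "res n f"] w_def res_def intro!: sum.cong)
  define L where "L f = lim (\<lambda>n. \<integral>y. f y \<partial>push n (w n))" for f :: "'e \<Rightarrow> real"
  have lim: "(\<lambda>n. \<integral>y. f y \<partial>push n (w n)) \<longlonglongrightarrow> TT t f x" for f :: "'e \<Rightarrow>\<^sub>C real"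
    unfolding int by (rule TT_tendsto[OF assms s])
  have L: "(\<lambda>n. \<integral>y. f y \<partial>push n (w n)) \<longlonglongrightarrow> L f" if f: "continuous_on UNIV f" for f :: "'e \<Rightarrow> real"
  proof -
    obtain g :: "'e \<Rightarrow>\<^sub>C real" where "apply_bcontfun g = f" by (rule Bcontfun_compact[OF f])
    with lim[of g] show ?thesis by (simp add: L_def limI)
  qed
  obtain M where M: "prob_space M" "sets M = sets borel" "\<And>f :: 'e \<Rightarrow> real. continuous_on UNIV f \<Longrightarrow> (\<integral>x. f x \<partial>M) = L f"
    by (rule prob_measures_weak_limit[OF compact_E prob_space_push[OF w0 w1] sets_push[OF w0 w1] L]) (assumption, rule that)
  then have "(\<integral>y. f y \<partial>M) = TT t f x" for f :: "'e \<Rightarrow>\<^sub>C real"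
    using limI[OF lim[of f]] by (simp add: L_def)
  with M show ?thesis by blast
qed

definition kern :: "real \<Rightarrow> 'e \<Rightarrow> 'e measure" where
  "kern t x = (SOME M. prob_space M \<and> sets M = sets borel \<and> (\<forall>f. (\<integral>y. apply_bcontfun f y \<partial>M) = apply_bcontfun (TT t f) x))"

lemma
  fixes f :: "'e \<Rightarrow>\<^sub>C real"
  assumes "0 \<le> t"
  shows prob_space_kern: "prob_space (kern t x)" and sets_kern [simp]: "sets (kern t x) = sets borel"
    and integral_kern: "(\<integral>y. f y \<partial>kern t x) = TT t f x"
  using someI_ex[OF kernel_exists[OF assms, of x]] unfolding kern_def by auto

text \<open>Closed sets generate, and the measure of a closed set under \<open>kern t x\<close> is a
  pointwise limit in x of continuous functions of the form \<open>TT t g\<close>.\<close>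

lemma kern_measurable [measurable]:
  assumes t: "0 \<le> t" shows "kern t \<in> measurable borel (prob_algebra borel)"
proof (rule measurable_prob_algebra_generated[where \<Omega>=UNIV and G="Collect closed"])
  show "sets borel = sigma_sets UNIV (Collect closed :: 'e set set)"
    by (simp add: borel_eq_closed)
  show "Int_stable (Collect closed :: 'e set set)" by (auto simp: Int_stable_def)
  show "prob_space (kern t a)" "sets (kern t a) = sets borel" for a
    using prob_space_kern[OF t] sets_kern[OF t] by auto
  fix C :: "'e set" assume "C \<in> Collect closed"
  then have C: "closed C" by simp
  obtain f :: "nat \<Rightarrow> 'e \<Rightarrow> real" where f: "\<And>m. continuous_on UNIV (f m)"
      "\<And>m x. 0 \<le> f m x" "\<And>m x. f m x \<le> 1" "\<And>m x. indicator C x \<le> f m x"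
      "\<And>x. (\<lambda>m. f m x) \<longlonglongrightarrow> indicator C x"
    by (rule closed_indicator_limit[OF C]) (rule that)
  have 1: "(\<lambda>m. \<integral>y. f m y \<partial>kern t x) \<longlonglongrightarrow> measure (kern t x) C" for x
    by (rule measure_closed_limit[OF C prob_space_kern[OF t] sets_kern[OF t] borel_measurable_continuous_onI[OF f(1)] f(2,3,5)])
  have 2: "(\<lambda>x. \<integral>y. f m y \<partial>kern t x) \<in> borel_measurable borel" for m
  proof -
    obtain g :: "'e \<Rightarrow>\<^sub>C real" where g: "apply_bcontfun g = f m" by (rule Bcontfun_compact[OF f(1)])
    have "(\<lambda>x. \<integral>y. f m y \<partial>kern t x) = apply_bcontfun (TT t g)"
      by (rule ext) (simp only: integral_kern[OF t, where f=g, unfolded g])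
    then show ?thesis by simp
  qed
  have "(\<lambda>x. measure (kern t x) C) \<in> borel_measurable borel"
    by (rule borel_measurable_LIMSEQ_real[OF 1 2])
  moreover have "emeasure (kern t x) C = ennreal (measure (kern t x) C)" for x
    using prob_space_kern[OF t] by (simp add: finite_measure.emeasure_eq_measure prob_space_def)
  ultimately show "(\<lambda>a. emeasure (kern t a) C) \<in> borel_measurable borel" by simp
qed auto

lemma
  fixes f :: "'e \<Rightarrow>\<^sub>C real"
  assumes t: "0 \<le> t" and M: "prob_space M" "sets M = sets borel"
  shows prob_space_bind_kern: "prob_space (M \<bind> kern t)" and sets_bind_kern: "sets (M \<bind> kern t) = sets borel"
    and integral_bind_kern: "(\<integral>y. f y \<partial>(M \<bind> kern t)) = (\<integral>x. TT t f x \<partial>M)"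
proof -
  interpret prob_space M by fact
  have m: "kern t \<in> measurable M (prob_algebra borel)"
    using kern_measurable[OF t] by (simp add: measurable_cong_sets[OF M(2) refl])
  then have ms: "kern t \<in> measurable M (subprob_algebra borel)" by (rule measurable_prob_algebraD)
  show "prob_space (M \<bind> kern t)"
    by (rule prob_space_bind[OF _ ms]) (simp add: prob_space_kern[OF t])
  show "sets (M \<bind> kern t) = sets borel"
    by (rule sets_bind[of _ _ borel]) (auto simp: sets_kern[OF t] not_empty)
  show "(\<integral>y. f y \<partial>(M \<bind> kern t)) = (\<integral>x. TT t f x \<partial>M)"
  proof -
    have "(\<integral>y. f y \<partial>(M \<bind> kern t)) = (\<integral>x. (\<integral>y. f y \<partial>kern t x) \<partial>M)"
      by (rule integral_bind[where K=borel and B="norm f" and B'=1 and N="kern t" and M=M])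
        (use ms not_empty in \<open>auto simp: bcontfun_abs_bound prob_space.emeasure_space_1[OF prob_space_kern[OF t]] finite_measure_axioms\<close>)
    then show ?thesis by (simp add: integral_kern[OF t])
  qed
qed

lemma kern_0: "kern 0 x = return borel x"
proof (rule prob_measure_eqI_bcontfun)
  show "prob_space (return borel x)" by (rule prob_space_return) simp
  show "(\<integral>y. f y \<partial>kern 0 x) = (\<integral>y. f y \<partial>return borel x)" for f :: "'e \<Rightarrow>\<^sub>C real"
    by (simp add: integral_kern TT_0 integral_return)
qed (use prob_space_kern in auto)

lemma kern_add:
  assumes "0 \<le> s" "0 \<le> t" shows "kern (s + t) x = kern s x \<bind> kern t"
proof (rule prob_measure_eqI_bcontfun)
  show "(\<integral>y. f y \<partial>kern (s + t) x) = (\<integral>y. f y \<partial>(kern s x \<bind> kern t))" for f :: "'e \<Rightarrow>\<^sub>C real"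
    using assms by (simp add: integral_bind_kern prob_space_kern integral_kern TT_semigroup)
qed (use assms prob_space_kern prob_space_bind_kern[OF assms(2) prob_space_kern[OF assms(1)]]
      sets_bind_kern[OF assms(2) prob_space_kern[OF assms(1)]] in auto)

lemma transition_semigroup_kern:
  "0 \<le> t \<Longrightarrow> transition_semigroup kern t (apply_bcontfun f) = apply_bcontfun (TT t f)"
  by (simp add: transition_semigroup_def integral_kern fun_eq_iff)

lemma feller_kern: "feller_transition_function kern"
  unfolding feller_transition_function_def
proof (intro conjI allI impI)
  fix f :: "'e \<Rightarrow>\<^sub>C real"
  show "continuous_on UNIV (transition_semigroup kern t f)" if "0 \<le> t" for t
    by (simp add: transition_semigroup_kern[OF that])
  have "uniform_limit UNIV (\<lambda>t. apply_bcontfun (TT t f)) f (at_right 0)"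
    by (rule tendsto_bcontfun_uniform_limit[OF TT_continuous_0])
  moreover have "\<forall>\<^sub>F t in at_right 0. \<forall>x\<in>UNIV. transition_semigroup kern t f x = TT t f x"
    using eventually_at_right_less[of "0::real"] by eventually_elim (simp add: transition_semigroup_kern)
  ultimately show "uniform_limit UNIV (\<lambda>t. transition_semigroup kern t f) f (at_right 0)"
    by (subst uniform_limit_cong) auto
qed (auto simp: kern_measurable kern_0 kern_add)

section \<open>Stationary measures and ergodicity\<close>

definition push_M :: "nat \<Rightarrow> 'e measure" where
  "push_M n = push n (p_up U 0 n root)"

lemma
  fixes f :: "'e \<Rightarrow>\<^sub>C real"
  shows prob_space_push_M: "prob_space (push_M n)" and sets_push_M [simp]: "sets (push_M n) = sets borel"
    and integral_push_M: "(\<integral>x. f x \<partial>push_M n) = Mn n (res n f)"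
  unfolding push_M_def
  using prob_space_push[OF p_up_root_nonneg p_up_root_sum] sets_push[OF p_up_root_nonneg p_up_root_sum]
  by (auto simp: integral_push[OF p_up_root_nonneg p_up_root_sum] Mn_eq_sum res_def intro!: sum.cong)

lemma Mn_bound:
  assumes "f \<in> fin_C (S n)" shows "\<bar>Mn n f\<bar> \<le> sn n f"
proof -
  have "\<bar>Mn n f\<bar> \<le> (\<Sum>u\<in>S n. \<bar>p_up U 0 n root u * f u\<bar>)"
    unfolding Mn_eq_sum[OF assms] by (rule sum_abs)
  also have "\<dots> \<le> (\<Sum>u\<in>S n. p_up U 0 n root u * sn n f)"
    by (intro sum_mono) (auto simp: abs_mult p_up_root_nonneg intro!: mult_left_mono sn_ge)
  finally show ?thesis by (simp add: p_up_root_sum flip: sum_distrib_right)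
qed

lemma Mn_hl:
  assumes s: "s \<in> S k" and k: "0 < k"
  shows "(\<lambda>n. Mn n (res n (hl s))) \<longlonglongrightarrow> 0"
proof (rule Lim_null_comparison[OF _ hn_limit[OF s]])
  show "\<forall>\<^sub>F n in sequentially. norm (Mn n (res n (hl s))) \<le> sn n (\<lambda>u. hn n k s u - res n (hl s) u)"
    using eventually_ge_at_top[of k]
  proof eventually_elim
    case (elim n)
    have fc: "(\<lambda>u. hn n k s u - res n (hl s) u) \<in> fin_C (S n)"
      using hn_fin_C[OF elim, of s] res_fin_C[of n "hl s"] by (simp add: fin_C_def)
    have "Mn n (\<lambda>u. hn n k s u - res n (hl s) u) = Mn n (hn n k s) - Mn n (res n (hl s))"
      using hn_fin_C[OF elim, of s] fc
      by (simp add: Mn_eq_sum sum_subtractf right_diff_distrib)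
    then show ?case
      using Mn_bound[OF fc] Mn_hn[OF elim s k] by simp
  qed
qed

text \<open>Compactness gives a limit M along a subsequence only. But its integral is 1 on the
  constant and 0 on every \<open>hl s\<close> of positive level, and these values determine it by
  density; this upgrades the convergence to the whole sequence and identifies the limit of
  \<open>TT t f\<close>.\<close>

lemma stationary_limit:
  obtains M where "ergodic_with kern M" "weakly_converges euclidean push_M M sequentially"
proof -
  obtain r M where r: "strict_mono (r :: nat \<Rightarrow> nat)" and M: "prob_space M" "sets M = sets borel"
    "\<And>f :: 'e \<Rightarrow> real. continuous_on UNIV f \<Longrightarrow> (\<lambda>n. \<integral>x. f x \<partial>push_M (r n)) \<longlonglongrightarrow> (\<integral>x. f x \<partial>M)"
    by (rule prob_measures_compact_weak_subsequence[OF compact_E prob_space_push_M sets_push_M]) (rule that)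
  interpret M: prob_space M by fact
  have int[simp]: "integrable M (apply_bcontfun f)" for f :: "'e \<Rightarrow>\<^sub>C real"
    by (rule integrable_bcontfun[OF M(1,2)])
  define \<Lambda> where "\<Lambda> f = (\<integral>x. apply_bcontfun f x \<partial>M)" for f :: "'e \<Rightarrow>\<^sub>C real"
  have \<Lambda>_add: "\<Lambda> (f + g) = \<Lambda> f + \<Lambda> g" and \<Lambda>_scale: "\<Lambda> (a *\<^sub>R f) = a * \<Lambda> f" for f g a
    by (simp_all add: \<Lambda>_def)
  have \<Lambda>_bound: "\<bar>\<Lambda> f\<bar> \<le> norm f" for f
    unfolding \<Lambda>_def by (rule M.abs_integral_le_const) (simp_all add: bcontfun_abs_bound)
  have \<Lambda>_h: "\<Lambda> (hl s) = 0" if "s \<in> S k" "0 < k" for s k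
    using LIMSEQ_unique[OF M(3)[OF continuous_on_apply_bcontfun, of "hl s", unfolded integral_push_M]
        LIMSEQ_subseq_LIMSEQ[OF Mn_hl[OF that] r, unfolded comp_def]]
    by (simp add: \<Lambda>_def)
  have \<Lambda>_1: "\<Lambda> (const_bcontfun 1) = 1" by (simp add: \<Lambda>_def M.prob_space)
  have conv: "(\<lambda>n. Mn n (res n f)) \<longlonglongrightarrow> \<Lambda> f" for f
  proof -
    have "(\<lambda>n. \<bar>Mn n (res n f) - \<Lambda> f\<bar>) \<longlonglongrightarrow> 0"
    proof (rule seminorm_limit_dense[where K=2])
      fix n and f g :: "'e \<Rightarrow>\<^sub>C real" and a :: real
      have "Mn n (res n (f + g)) = Mn n (res n f) + Mn n (res n g)"
        by (simp add: Mn_eq_sum flip: sum.distrib) (simp add: res_add algebra_simps)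
      then show "\<bar>Mn n (res n (f + g)) - \<Lambda> (f + g)\<bar> \<le> \<bar>Mn n (res n f) - \<Lambda> f\<bar> + \<bar>Mn n (res n g) - \<Lambda> g\<bar>"
        by (simp add: \<Lambda>_add)
      have "Mn n (res n (a *\<^sub>R f)) = a * Mn n (res n f)"
        by (simp add: Mn_eq_sum sum_distrib_left) (simp add: res_scale algebra_simps)
      then show "\<bar>Mn n (res n (a *\<^sub>R f)) - \<Lambda> (a *\<^sub>R f)\<bar> \<le> \<bar>a\<bar> * \<bar>Mn n (res n f) - \<Lambda> f\<bar>"
        by (simp add: \<Lambda>_scale flip: abs_mult right_diff_distrib)
      show "\<bar>Mn n (res n f) - \<Lambda> f\<bar> \<le> 2 * norm f"
        using Mn_bound[OF res_fin_C, of n f] sn_res[of n f] \<Lambda>_bound[of f] by linarith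
    next
      fix k s assume s: "s \<in> S k"
      show "(\<lambda>n. \<bar>Mn n (res n (hl s)) - \<Lambda> (hl s)\<bar>) \<longlonglongrightarrow> 0"
      proof (cases "k = 0")
        case True
        with s have s: "s = root" by (simp add: S0)
        have "res n (const_bcontfun 1) = indicator (S n)" for n
          by (auto simp: res_def fun_eq_iff)
        then show ?thesis by (simp add: s h_lim_root \<Lambda>_1 Mn_one)
      next
        case False
        then show ?thesis using Mn_hl[OF s] \<Lambda>_h[OF s] by (simp add: tendsto_rabs_zero)
      qed
    qed simp
    then show ?thesis by (simp add: tendsto_rabs_zero_iff LIM_zero_iff)
  qed
  have erg: "((\<lambda>t. norm (TT t f - const_bcontfun (\<Lambda> f))) \<longlongrightarrow> 0) (at_top :: real filter)" for f
  proof (rule seminorm_limit_dense[where K=2 and N="\<lambda>t f. norm (TT t f - const_bcontfun (\<Lambda> f))"])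
    fix t :: real and f g :: "'e \<Rightarrow>\<^sub>C real" and a :: real
    have "TT t (f + g) - const_bcontfun (\<Lambda> (f + g)) = (TT t f - const_bcontfun (\<Lambda> f)) + (TT t g - const_bcontfun (\<Lambda> g))"
      by (rule bcontfun_eqI) (simp add: TT_add \<Lambda>_add)
    then show "norm (TT t (f + g) - const_bcontfun (\<Lambda> (f + g))) \<le> norm (TT t f - const_bcontfun (\<Lambda> f)) + norm (TT t g - const_bcontfun (\<Lambda> g))"
      by (simp add: norm_triangle_ineq)
    have "TT t (a *\<^sub>R f) - const_bcontfun (\<Lambda> (a *\<^sub>R f)) = a *\<^sub>R (TT t f - const_bcontfun (\<Lambda> f))"
      by (rule bcontfun_eqI) (simp add: TT_scale \<Lambda>_scale right_diff_distrib)
    then show "norm (TT t (a *\<^sub>R f) - const_bcontfun (\<Lambda> (a *\<^sub>R f))) \<le> \<bar>a\<bar> * norm (TT t f - const_bcontfun (\<Lambda> f))"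
      by simp
    have "norm (const_bcontfun (\<Lambda> f) :: 'e \<Rightarrow>\<^sub>C real) \<le> norm f"
      by (rule norm_bound) (simp add: \<Lambda>_bound)
    then show "norm (TT t f - const_bcontfun (\<Lambda> f)) \<le> 2 * norm f"
      using norm_triangle_ineq4[of "TT t f" "const_bcontfun (\<Lambda> f)"] TT_norm[of t f] by simp
  next
    fix k s assume s: "s \<in> S k"
    show "((\<lambda>t. norm (TT t (hl s) - const_bcontfun (\<Lambda> (hl s)))) \<longlongrightarrow> 0) at_top"
    proof (cases "k = 0")
      case True
      with s have s: "s = root" by (simp add: S0)
      then show ?thesis by (simp add: h_lim_root \<Lambda>_1 TT_one)
    next
      case False
      then have b: "0 < rate_before c k" using c_pos by (simp add: rate_before_def)
      have "((\<lambda>t. exp (- t * b)) \<longlongrightarrow> 0) at_top" if "0 < b" for b :: real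
        using that by real_asymp
      from this[OF b] have "((\<lambda>t. exp (- t * rate_before c k)) \<longlongrightarrow> 0) at_top" .
      then have lim: "((\<lambda>t. exp (- t * rate_before c k) * norm (hl s)) \<longlongrightarrow> 0) at_top"
        by (rule tendsto_mult_left_zero)
      moreover have "\<forall>\<^sub>F t in at_top. exp (- t * rate_before c k) * norm (hl s) = norm (TT t (hl s) - const_bcontfun (\<Lambda> (hl s)))"
        using eventually_ge_at_top[of 0] by eventually_elim (use False in \<open>simp add: TT_h[OF s] \<Lambda>_h[OF s]\<close>)
      ultimately show ?thesis by (simp add: Lim_transform_eventually)
    qed
  qed simp
  have erg': "((\<lambda>t. TT t f x) \<longlongrightarrow> \<Lambda> f) at_top" for f x
  proof -
    have "((\<lambda>t. TT t f x - \<Lambda> f) \<longlongrightarrow> 0) at_top"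
      by (rule Lim_null_comparison[OF always_eventually erg[of f]])
        (use norm_bounded[of "TT _ f - const_bcontfun (\<Lambda> f)" x] in simp)
    then show ?thesis by (rule LIM_zero_cancel)
  qed
  \<comment> \<open>Obtained by letting s tend to infinity in
    \<open>TT (s + t) f = TT s (TT t f)\<close>.\<close>
  have inv: "(\<integral>x. TT t f x \<partial>M) = \<Lambda> f" if t: "0 \<le> t" for t f
  proof -
    fix x0 :: 'e
    have 1: "((\<lambda>s. TT s (TT t f) x0) \<longlongrightarrow> \<Lambda> (TT t f)) at_top" by (rule erg')
    have 2: "((\<lambda>s. TT (s + t) f x0) \<longlongrightarrow> \<Lambda> f) at_top"
      by (rule filterlim_compose[OF erg' filterlim_tendsto_add_at_top[OF tendsto_const filterlim_ident, of t, unfolded add.commute[of t]]])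
    have 3: "\<forall>\<^sub>F s in at_top. TT (s + t) f x0 = TT s (TT t f) x0"
      using eventually_ge_at_top[of 0] by eventually_elim (simp add: TT_semigroup t)
    have "\<Lambda> (TT t f) = \<Lambda> f"
      by (rule tendsto_unique[OF trivial_limit_at_top_linorder 1 Lim_transform_eventually[OF 2 3]])
    then show ?thesis by (simp add: \<Lambda>_def)
  qed
  show ?thesis
  proof (rule that)
    show "weakly_converges euclidean push_M M sequentially"
      unfolding weakly_converges_def
    proof (intro allI impI)
      fix \<phi> :: "'e \<Rightarrow> real" assume "continuous_map euclidean euclideanreal \<phi>"
      then obtain g :: "'e \<Rightarrow>\<^sub>C real" where "apply_bcontfun g = \<phi>"
        using Bcontfun_compact[of \<phi>] by (auto simp: continuous_map_iff_continuous2)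
      then show "(\<lambda>n. \<integral>x. \<phi> x \<partial>push_M n) \<longlonglongrightarrow> (\<integral>x. \<phi> x \<partial>M)"
        using conv[of g] integral_push_M[where f=g] by (simp add: \<Lambda>_def)
    qed
    show "ergodic_with kern M"
      unfolding ergodic_with_def stationary_measure_def
    proof (intro conjI allI impI)
      show "M \<bind> kern t = M" if t: "0 \<le> t" for t
        by (rule prob_measure_eqI_bcontfun)
          (use M in \<open>auto simp: prob_space_bind_kern[OF t] sets_bind_kern[OF t] integral_bind_kern[OF t] inv[OF t] \<Lambda>_def\<close>)
      fix N assume N: "prob_space N \<and> sets N = sets borel \<and> (\<forall>t\<ge>0. N \<bind> kern t = N)"
      interpret N: prob_space N using N by blast
      show "N = M"
      proof (rule prob_measure_eqI_bcontfun)
        fix f :: "'e \<Rightarrow>\<^sub>C real"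
        have intN: "integrable N (apply_bcontfun g)" for g :: "'e \<Rightarrow>\<^sub>C real"
          using N by (intro integrable_bcontfun) auto
        \<comment> \<open>An arbitrary stationary N integrates f and \<open>TT t f\<close> alike,
          and the latter is uniformly close to the constant \<open>\<Lambda> f\<close> for large
          t.\<close>
        have "\<bar>(\<integral>x. f x \<partial>N) - \<Lambda> f\<bar> \<le> norm (TT t f - const_bcontfun (\<Lambda> f))" if t: "0 \<le> t" for t
        proof -
          have "(\<integral>x. f x \<partial>N) = (\<integral>x. TT t f x \<partial>N)"
            using integral_bind_kern[OF t, where M=N and f=f] N t by simp
          then have "(\<integral>x. f x \<partial>N) - \<Lambda> f = (\<integral>x. (TT t f - const_bcontfun (\<Lambda> f)) x \<partial>N)"
            by (simp add: intN N.prob_space)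
          then show ?thesis
            using N.abs_integral_le_const[OF intN bcontfun_abs_bound, of "TT t f - const_bcontfun (\<Lambda> f)"] by simp
        qed
        then have "\<forall>\<^sub>F t in at_top. \<bar>(\<integral>x. f x \<partial>N) - \<Lambda> f\<bar> \<le> norm (TT t f - const_bcontfun (\<Lambda> f))"
          by (intro eventually_mono[OF eventually_ge_at_top[of 0]])
        then have "\<bar>(\<integral>x. f x \<partial>N) - \<Lambda> f\<bar> \<le> 0"
          by (intro tendsto_lowerbound[OF erg]) auto
        then show "(\<integral>x. f x \<partial>N) = (\<integral>x. f x \<partial>M)" by (simp add: \<Lambda>_def)
      qed (use N M in auto)
    next
      fix x
      show "weakly_converges euclidean (\<lambda>t. kern t x) M at_top"
        unfolding weakly_converges_def
      proof (intro allI impI)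
        fix \<phi> :: "'e \<Rightarrow> real" assume "continuous_map euclidean euclideanreal \<phi>"
        then obtain g :: "'e \<Rightarrow>\<^sub>C real" where g: "apply_bcontfun g = \<phi>"
          using Bcontfun_compact[of \<phi>] by (auto simp: continuous_map_iff_continuous2)
        have "\<forall>\<^sub>F t in at_top. TT t g x = (\<integral>x. \<phi> x \<partial>kern t x)"
          using eventually_ge_at_top[of 0] by eventually_elim (simp add: integral_kern flip: g)
        then show "((\<lambda>t. \<integral>x. \<phi> x \<partial>kern t x) \<longlongrightarrow> (\<integral>x. \<phi> x \<partial>M)) at_top"
          using Lim_transform_eventually[OF erg'[of g x]] by (simp add: \<Lambda>_def flip: g)
      qed
    qed (use M in auto)
  qed
qed

end

section \<open>Finite-dimensional distributions\<close>

lemma compact_UNIV_fun: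
  assumes "compact (UNIV :: 'b::topological_space set)"
  shows "compact (UNIV :: ('a \<Rightarrow> 'b) set)"
proof -
  have "compact_space (product_topology (\<lambda>i. euclidean :: 'b topology) (UNIV :: 'a set))"
    using assms unfolding compact_space_product_topology by (simp add: compact_space_def)
  then show ?thesis
    unfolding euclidean_product_topology by (simp add: compact_space_def)
qed

text \<open>The states at times 0, ..., k - 1 as one random variable with finitely many values, so
  that expectations of path functionals become finite sums.\<close>

definition word :: "(nat \<Rightarrow> 'w \<Rightarrow> 's) \<Rightarrow> nat \<Rightarrow> 'w \<Rightarrow> 's list" where
  "word X k \<omega> = map (\<lambda>i. X i \<omega>) [0..<k]"

lemma length_word [simp]: "length (word X k \<omega>) = k"
  by (simp add: word_def)

lemma word_Suc: "word X (Suc k) \<omega> = word X k \<omega> @ [X k \<omega>]"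
  by (simp add: word_def)

lemma word_nth [simp]: "i < k \<Longrightarrow> word X k \<omega> ! i = X i \<omega>"
  by (simp add: word_def)

text \<open>The expectation of G(X_1, ..., X_L) for the chain started in x; the starting point is
  not part of the word.\<close>

primrec word_op :: "'s set \<Rightarrow> ('s \<Rightarrow> 's \<Rightarrow> real) \<Rightarrow> nat \<Rightarrow> ('s list \<Rightarrow> real) \<Rightarrow> 's \<Rightarrow> real" where
  "word_op Z p 0 G x = G []"
| "word_op Z p (Suc L) G x = (\<Sum>y\<in>Z. p x y * word_op Z p L (\<lambda>w. G (y # w)) y)"

section \<open>The Markov property for functions of the trajectory\<close>

locale finite_markov_chain = prob_space P for P :: "'w measure" +
  fixes Z :: "'s set" and p :: "'s \<Rightarrow> 's \<Rightarrow> real" and X :: "nat \<Rightarrow> 'w \<Rightarrow> 's"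
  assumes fin_Z: "finite Z" and mc: "markov_chain P Z p X"
begin

lemma X_meas: "X k \<in> measurable P (count_space Z)"
  using mc by (simp add: markov_chain_def)

lemma X_in: "\<omega> \<in> space P \<Longrightarrow> X k \<omega> \<in> Z"
  using measurable_space[OF X_meas] by simp

definition words :: "nat \<Rightarrow> 's list set" where
  "words k = {w. set w \<subseteq> Z \<and> length w = k}"

lemma finite_words: "finite (words k)"
  unfolding words_def by (rule finite_lists_length_eq[OF fin_Z])

lemma word_in: "\<omega> \<in> space P \<Longrightarrow> word X k \<omega> \<in> words k"
  using X_in by (auto simp: words_def word_def)

lemma X_event: "{\<omega> \<in> space P. X k \<omega> = y} \<in> sets P"
proof -
  have "{\<omega> \<in> space P. X k \<omega> = y} = X k -` ({y} \<inter> Z) \<inter> space P" using X_in by auto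
  then show ?thesis using measurable_sets[OF X_meas, of "{y} \<inter> Z"] by auto
qed

lemma word_event: "{\<omega> \<in> space P. word X k \<omega> = w} \<in> sets P"
proof (induction k arbitrary: w)
  case 0
  have "{\<omega> \<in> space P. word X 0 \<omega> = w} = (if w = [] then space P else {})" by (auto simp: word_def)
  then show ?case by simp
next
  case (Suc k)
  have "{\<omega> \<in> space P. word X (Suc k) \<omega> = w} =
    (if w = [] then {} else {\<omega> \<in> space P. word X k \<omega> = butlast w} \<inter> {\<omega> \<in> space P. X k \<omega> = last w})"
    by (auto simp: word_Suc snoc_eq_iff_butlast)
  then show ?case using Suc X_event by auto
qed

lemma integral_word:
  shows integrable_word: "integrable P (\<lambda>\<omega>. G (word X k \<omega>) :: real)"
    and "(\<integral>\<omega>. G (word X k \<omega>) \<partial>P) = (\<Sum>w\<in>words k. G w * prob {\<omega> \<in> space P. word X k \<omega> = w})"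
proof -
  have eq: "G (word X k \<omega>) = (\<Sum>w\<in>words k. G w * indicator {\<omega> \<in> space P. word X k \<omega> = w} \<omega>)"
    if "\<omega> \<in> space P" for \<omega>
  proof -
    have "(\<Sum>w\<in>words k. G w * indicator {\<omega> \<in> space P. word X k \<omega> = w} \<omega>) =
        (\<Sum>w\<in>words k. if w = word X k \<omega> then G w else 0)"
      using that by (intro sum.cong refl) (auto simp: indicator_def)
    then show ?thesis using word_in[OF that] finite_words by simp
  qed
  have int: "integrable P (\<lambda>\<omega>. G w * indicator {\<omega> \<in> space P. word X k \<omega> = w} \<omega>)" for w
    using word_event by (intro integrable_mult_right integrable_real_indicator) (auto simp: emeasure_eq_measure)
  show "integrable P (\<lambda>\<omega>. G (word X k \<omega>))"
    by (subst Bochner_Integration.integrable_cong[OF refl eq]) (auto intro: int)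
  have "(\<integral>\<omega>. G (word X k \<omega>) \<partial>P) = (\<integral>\<omega>. (\<Sum>w\<in>words k. G w * indicator {\<omega> \<in> space P. word X k \<omega> = w} \<omega>) \<partial>P)"
    by (rule Bochner_Integration.integral_cong[OF refl eq])
  also have "\<dots> = (\<Sum>w\<in>words k. \<integral>\<omega>. G w * indicator {\<omega> \<in> space P. word X k \<omega> = w} \<omega> \<partial>P)"
    by (rule Bochner_Integration.integral_sum) (rule int)
  also have "\<dots> = (\<Sum>w\<in>words k. G w * prob {\<omega> \<in> space P. word X k \<omega> = w})"
    by (intro sum.cong refl) (simp add: word_event Int_absorb1 sets.sets_into_space)
  finally show "(\<integral>\<omega>. G (word X k \<omega>) \<partial>P) = (\<Sum>w\<in>words k. G w * prob {\<omega> \<in> space P. word X k \<omega> = w})" .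
qed

text \<open>On a null history the Markov property asserts nothing, but then both sides are
  0.\<close>

lemma prob_word_Suc:
  assumes w: "w \<in> words (Suc k)" and y: "y \<in> Z"
  shows "prob {\<omega> \<in> space P. word X (Suc (Suc k)) \<omega> = w @ [y]} = prob {\<omega> \<in> space P. word X (Suc k) \<omega> = w} * p (last w) y"
proof -
  have ev: "(\<forall>i\<le>k. X i \<omega> = w ! i) \<longleftrightarrow> word X (Suc k) \<omega> = w" for \<omega>
    using w by (auto simp: words_def list_eq_iff_nth_eq less_Suc_eq_le simp del: upt_Suc)
  have ev2: "word X (Suc (Suc k)) \<omega> = w @ [y] \<longleftrightarrow> X (Suc k) \<omega> = y \<and> word X (Suc k) \<omega> = w" for \<omega>
    using w by (auto simp: word_Suc[of _ "Suc k"])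
  have lw: "last w = w ! k" using w last_conv_nth[of w] by (cases w) (auto simp: words_def)
  show ?thesis
  proof (cases "prob {\<omega> \<in> space P. word X (Suc k) \<omega> = w} > 0")
    case True
    have "\<forall>i\<le>k. w ! i \<in> Z" using w by (auto simp: words_def)
    then have "\<P>(\<omega> in P. X (Suc k) \<omega> = y \<bar> \<forall>i\<le>k. X i \<omega> = w ! i) = p (w ! k) y"
      using mc y True unfolding markov_chain_def ev[symmetric] by blast
    then show ?thesis using True unfolding cond_prob_def ev ev2 lw by (simp add: field_simps)
  next
    case False
    then have "prob {\<omega> \<in> space P. word X (Suc k) \<omega> = w} = 0"
      by (simp add: zero_less_measure_iff)
    moreover have "prob {\<omega> \<in> space P. word X (Suc (Suc k)) \<omega> = w @ [y]} \<le> prob {\<omega> \<in> space P. word X (Suc k) \<omega> = w}"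
      by (rule finite_measure_mono) (auto simp: ev2 word_event)
    ultimately show ?thesis
      by (simp add: measure_le_0_iff)
  qed
qed

lemma markov_step:
  "(\<integral>\<omega>. G (word X (Suc (Suc k)) \<omega>) \<partial>P) = (\<integral>\<omega>. (\<Sum>y\<in>Z. p (X k \<omega>) y * G (word X (Suc k) \<omega> @ [y])) \<partial>P)"
proof -
  have inj: "inj_on (\<lambda>(w, y). w @ [y]) (words (Suc k) \<times> Z)"
    by (auto simp: inj_on_def)
  have img: "words (Suc (Suc k)) = (\<lambda>(w, y). w @ [y]) ` (words (Suc k) \<times> Z)"
  proof (intro equalityI subsetI)
    fix v assume "v \<in> words (Suc (Suc k))"
    then show "v \<in> (\<lambda>(w, y). w @ [y]) ` (words (Suc k) \<times> Z)"
      by (cases v rule: rev_cases) (auto simp: words_def intro!: image_eqI)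
  qed (auto simp: words_def)
  have "(\<integral>\<omega>. G (word X (Suc (Suc k)) \<omega>) \<partial>P) = (\<Sum>w\<in>words (Suc k). \<Sum>y\<in>Z. G (w @ [y]) * prob {\<omega> \<in> space P. word X (Suc (Suc k)) \<omega> = w @ [y]})"
    unfolding integral_word(2) img sum.reindex[OF inj] by (simp add: sum.cartesian_product case_prod_unfold)
  also have "\<dots> = (\<Sum>w\<in>words (Suc k). (\<Sum>y\<in>Z. p (last w) y * G (w @ [y])) * prob {\<omega> \<in> space P. word X (Suc k) \<omega> = w})"
    by (intro sum.cong refl) (simp add: prob_word_Suc sum_distrib_left sum_distrib_right mult_ac)
  also have "\<dots> = (\<integral>\<omega>. (\<Sum>y\<in>Z. p (last (word X (Suc k) \<omega>)) y * G (word X (Suc k) \<omega> @ [y])) \<partial>P)"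
    by (rule integral_word(2)[symmetric])
  finally show ?thesis by (simp add: word_Suc[of _ k])
qed

lemma markov_word_op:
  "(\<integral>\<omega>. G (word X (Suc k + L) \<omega>) \<partial>P) = (\<integral>\<omega>. word_op Z p L (\<lambda>w. G (word X (Suc k) \<omega> @ w)) (X k \<omega>) \<partial>P)"
proof (induction L arbitrary: k)
  case 0 then show ?case by simp
next
  case (Suc L)
  have "(\<integral>\<omega>. G (word X (Suc k + Suc L) \<omega>) \<partial>P) = (\<integral>\<omega>. word_op Z p L (\<lambda>w. G (word X (Suc (Suc k)) \<omega> @ w)) (X (Suc k) \<omega>) \<partial>P)"
    using Suc[of "Suc k"] by simp
  also have "\<dots> = (\<integral>\<omega>. (\<lambda>v. word_op Z p L (\<lambda>w. G (v @ w)) (last v)) (word X (Suc (Suc k)) \<omega>) \<partial>P)"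
    by (simp add: word_Suc[of _ "Suc k"])
  also have "\<dots> = (\<integral>\<omega>. (\<Sum>y\<in>Z. p (X k \<omega>) y * word_op Z p L (\<lambda>w. G ((word X (Suc k) \<omega> @ [y]) @ w)) y) \<partial>P)"
    by (subst markov_step) simp
  finally show ?case by simp
qed

lemma markov_multi_step:
  assumes "f \<in> fin_C Z"
  shows "(\<integral>\<omega>. H (word X (Suc k) \<omega>) * f (X (k + j) \<omega>) \<partial>P) = (\<integral>\<omega>. H (word X (Suc k) \<omega>) * (matrix_op Z Z p ^^ j) f (X k \<omega>) \<partial>P)"
proof (induction j arbitrary: k H)
  case 0 then show ?case by simp
next
  case (Suc j)
  let ?g = "(matrix_op Z Z p ^^ j) f"
  have tk: "take (Suc k) (word X (Suc (Suc k)) \<omega>) = word X (Suc k) \<omega>" for \<omega>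
    by (simp add: word_Suc[of _ "Suc k"])
  \<comment> \<open>The induction hypothesis is used at time \<open>Suc k\<close>, for
    \<open>H\<close> composed with truncation so as to ignore the newest state.\<close>
  have "(\<integral>\<omega>. H (word X (Suc k) \<omega>) * f (X (k + Suc j) \<omega>) \<partial>P) = (\<integral>\<omega>. H (word X (Suc k) \<omega>) * ?g (X (Suc k) \<omega>) \<partial>P)"
    using Suc[of "\<lambda>v. H (take (Suc k) v)" "Suc k"] by (simp add: tk)
  also have "\<dots> = (\<integral>\<omega>. (\<lambda>v. H (take (Suc k) v) * ?g (last v)) (word X (Suc (Suc k)) \<omega>) \<partial>P)"
    by (simp add: tk word_Suc[of _ "Suc k"])
  also have "\<dots> = (\<integral>\<omega>. (\<Sum>y\<in>Z. p (X k \<omega>) y * (H (word X (Suc k) \<omega>) * ?g y)) \<partial>P)"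
    by (subst markov_step) simp
  also have "\<dots> = (\<integral>\<omega>. H (word X (Suc k) \<omega>) * (matrix_op Z Z p ^^ Suc j) f (X k \<omega>) \<partial>P)"
    by (rule Bochner_Integration.integral_cong)
      (auto simp: matrix_op_def X_in sum_distrib_left mult_ac)
  finally show ?case .
qed

end

section \<open>The Markov property in the limit\<close>

locale chain_processes = limit_chains S root p c D U \<iota> dlim
  for S :: "nat \<Rightarrow> 's set" and root p c D U and \<iota> :: "'s \<Rightarrow> 'e::polish_space" and dlim +
  fixes P :: "nat \<Rightarrow> 'w measure" and X :: "nat \<Rightarrow> nat \<Rightarrow> 'w \<Rightarrow> 's" and \<mu> :: "'e measure"
  assumes chain: "markov_chain (P n) (S n) (p n) (X n)"
    and prob_\<mu>: "prob_space \<mu>" and sets_\<mu>: "sets \<mu> = sets borel"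
    and initial: "weakly_converges euclidean (\<lambda>n. distr (P n) borel (\<lambda>\<omega>. \<iota> (X n 0 \<omega>))) \<mu> sequentially"
begin

sublocale mc: finite_markov_chain "P n" "S n" "p n" "X n" for n
  using chain[of n] fin_S unfolding finite_markov_chain_def finite_markov_chain_axioms_def
  by (simp add: markov_chain_def)

definition Y :: "nat \<Rightarrow> real \<Rightarrow> 'w \<Rightarrow> 'e" where
  "Y n t \<omega> = \<iota> (X n (nat \<lfloor>c n * t\<rfloor>) \<omega>)"

lemma iota_X_measurable [measurable]: "(\<lambda>\<omega>. \<iota> (X n k \<omega>)) \<in> borel_measurable (P n)"
  by (rule measurable_compose[OF mc.X_meas]) simp

lemma Y_measurable [measurable]: "Y n t \<in> borel_measurable (P n)"
  unfolding Y_def[abs_def] by simp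

lemma prod_abs_le_bound:
  fixes f :: "'i \<Rightarrow> 'e \<Rightarrow>\<^sub>C real"
  shows "\<bar>\<Prod>i\<in>I. f i (z i)\<bar> \<le> (\<Prod>i\<in>I. norm (f i))"
  unfolding abs_prod by (rule prod_mono) (auto simp: bcontfun_abs_bound)

lemma integrable_P_bounded:
  "f \<in> borel_measurable (P n) \<Longrightarrow> (\<And>\<omega>. \<bar>f \<omega>\<bar> \<le> B) \<Longrightarrow> integrable (P n) (f :: 'w \<Rightarrow> real)"
  by (rule mc.integrable_const_bound[of _ B]) auto

text \<open>Conditioning at step floor(c_n s) leaves \<open>j n\<close> steps, a difference of two
  floors with j_n / c_n tending to t. The error is at most \<open>B\<close> times a sup norm that
  tends to 0, whatever the functionals \<open>H n\<close> of the past.\<close>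

lemma markov_limit:
  assumes s: "0 \<le> s" and t: "0 \<le> t" and H: "\<And>n v. \<bar>H n v\<bar> \<le> B"
  shows "(\<lambda>n. (\<integral>\<omega>. H n (word (X n) (Suc (nat \<lfloor>c n * s\<rfloor>)) \<omega>) * apply_bcontfun f (Y n (s + t) \<omega>) \<partial>P n)
    - (\<integral>\<omega>. H n (word (X n) (Suc (nat \<lfloor>c n * s\<rfloor>)) \<omega>) * apply_bcontfun (TT t f) (Y n s \<omega>) \<partial>P n)) \<longlonglongrightarrow> 0"
proof -
  define a where "a n = nat \<lfloor>c n * s\<rfloor>" for n
  define j where "j n = nat \<lfloor>c n * (s + t)\<rfloor> - a n" for n
  have le: "a n \<le> nat \<lfloor>c n * (s + t)\<rfloor>" for n
    unfolding a_def using c_pos[of n] t by (intro nat_mono floor_mono mult_left_mono) auto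
  have aj: "a n + j n = nat \<lfloor>c n * (s + t)\<rfloor>" for n
    using le[of n] by (simp add: j_def)
  have j: "(\<lambda>n. real (j n) / c n) \<longlonglongrightarrow> t"
  proof -
    have "real (j n) / c n = real (nat \<lfloor>c n * (s + t)\<rfloor>) / c n - real (nat \<lfloor>c n * s\<rfloor>) / c n" for n
      unfolding j_def of_nat_diff[OF le] by (simp add: diff_divide_distrib a_def)
    then show ?thesis
      using tendsto_diff[OF floor_steps[of "s + t"] floor_steps[OF s]] s t by simp
  qed
  let ?w = "\<lambda>n \<omega>. word (X n) (Suc (a n)) \<omega>"
  let ?g = "\<lambda>n. (T n ^^ j n) (res n f)"
  have B: "0 \<le> B" using H[of 0 undefined] by linarith
  have 1: "(\<integral>\<omega>. H n (?w n \<omega>) * f (Y n (s + t) \<omega>) \<partial>P n) = (\<integral>\<omega>. H n (?w n \<omega>) * ?g n (X n (a n) \<omega>) \<partial>P n)" for n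
  proof -
    have "(\<integral>\<omega>. H n (?w n \<omega>) * f (Y n (s + t) \<omega>) \<partial>P n) = (\<integral>\<omega>. H n (?w n \<omega>) * res n f (X n (a n + j n) \<omega>) \<partial>P n)"
      by (rule Bochner_Integration.integral_cong) (auto simp: Y_def aj res_def mc.X_in)
    also have "\<dots> = (\<integral>\<omega>. H n (?w n \<omega>) * ?g n (X n (a n) \<omega>) \<partial>P n)"
      by (rule mc.markov_multi_step) simp
    finally show ?thesis .
  qed
  have 2: "(\<integral>\<omega>. H n (?w n \<omega>) * TT t f (Y n s \<omega>) \<partial>P n) = (\<integral>\<omega>. H n (?w n \<omega>) * res n (TT t f) (X n (a n) \<omega>) \<partial>P n)" for n
    by (rule Bochner_Integration.integral_cong) (auto simp: Y_def a_def res_def mc.X_in)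
  have int: "integrable (P n) (\<lambda>\<omega>. H n (?w n \<omega>) * g (X n (a n) \<omega>))" for n g
    using mc.integrable_word[of n "\<lambda>v. H n v * g (last v)" "Suc (a n)"] by (simp add: word_Suc[of _ "a n"])
  have bound: "norm ((\<integral>\<omega>. H n (?w n \<omega>) * f (Y n (s + t) \<omega>) \<partial>P n) - (\<integral>\<omega>. H n (?w n \<omega>) * TT t f (Y n s \<omega>) \<partial>P n))
      \<le> B * sn n (\<lambda>u. ?g n u - res n (TT t f) u)" for n
  proof -
    have eq: "(\<integral>\<omega>. H n (?w n \<omega>) * f (Y n (s + t) \<omega>) \<partial>P n) - (\<integral>\<omega>. H n (?w n \<omega>) * TT t f (Y n s \<omega>) \<partial>P n)
      = (\<integral>\<omega>. H n (?w n \<omega>) * ?g n (X n (a n) \<omega>) - H n (?w n \<omega>) * res n (TT t f) (X n (a n) \<omega>) \<partial>P n)"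
      unfolding 1 2 by (rule Bochner_Integration.integral_diff[symmetric]) (rule int)+
    show ?thesis
      unfolding eq real_norm_def
    proof (rule mc.abs_integral_le_const)
      show "integrable (P n) (\<lambda>\<omega>. H n (?w n \<omega>) * ?g n (X n (a n) \<omega>) - H n (?w n \<omega>) * res n (TT t f) (X n (a n) \<omega>))"
        by (intro Bochner_Integration.integrable_diff int)
      fix \<omega> assume "\<omega> \<in> space (P n)"
      then have "\<bar>?g n (X n (a n) \<omega>) - res n (TT t f) (X n (a n) \<omega>)\<bar> \<le> sn n (\<lambda>u. ?g n u - res n (TT t f) u)"
        using sn_ge[OF mc.X_in, of \<omega> n "\<lambda>u. ?g n u - res n (TT t f) u" "a n"] by simp
      then show "\<bar>H n (?w n \<omega>) * ?g n (X n (a n) \<omega>) - H n (?w n \<omega>) * res n (TT t f) (X n (a n) \<omega>)\<bar> \<le> B * sn n (\<lambda>u. ?g n u - res n (TT t f) u)"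
        unfolding right_diff_distrib[symmetric] abs_mult by (intro mult_mono H B) auto
    qed
  qed
  show ?thesis
    unfolding a_def[symmetric]
    by (rule Lim_null_comparison[OF always_eventually tendsto_mult_right_zero[OF TT_limit[OF t j, of f], of B]])
      (intro allI bound)
qed

text \<open>A finite product of values at times up to \<open>s\<close> is a function of the word of visited states.\<close>

lemma markov_limit_prod:
  fixes f :: "'i \<Rightarrow> 'e \<Rightarrow>\<^sub>C real"
  assumes s: "0 \<le> s" and t: "0 \<le> t" and u: "\<And>i. i \<in> I \<Longrightarrow> u i \<le> s"
  shows "(\<lambda>n. (\<integral>\<omega>. (\<Prod>i\<in>I. f i (Y n (u i) \<omega>)) * apply_bcontfun g (Y n (s + t) \<omega>) \<partial>P n)
    - (\<integral>\<omega>. (\<Prod>i\<in>I. f i (Y n (u i) \<omega>)) * apply_bcontfun (TT t g) (Y n s \<omega>) \<partial>P n)) \<longlonglongrightarrow> 0"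
proof -
  let ?H = "\<lambda>n v. \<Prod>i\<in>I. f i (\<iota> (v ! nat \<lfloor>c n * u i\<rfloor>))"
  have le: "nat \<lfloor>c n * u i\<rfloor> < Suc (nat \<lfloor>c n * s\<rfloor>)" if "i \<in> I" for i n
    unfolding less_Suc_eq_le using c_pos[of n] u[OF that] by (intro nat_mono floor_mono mult_left_mono) auto
  have eq: "(\<Prod>i\<in>I. f i (Y n (u i) \<omega>)) = ?H n (word (X n) (Suc (nat \<lfloor>c n * s\<rfloor>)) \<omega>)" for n \<omega>
    by (intro prod.cong refl) (simp add: le Y_def)
  show ?thesis
    unfolding eq by (rule markov_limit[OF s t]) (rule prod_abs_le_bound)
qed

lemma initial_limit:
  fixes f :: "'e \<Rightarrow>\<^sub>C real"
  shows "(\<lambda>n. \<integral>\<omega>. apply_bcontfun f (Y n 0 \<omega>) \<partial>P n) \<longlonglongrightarrow> (\<integral>x. f x \<partial>\<mu>)"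
proof -
  have "(\<lambda>n. \<integral>x. f x \<partial>distr (P n) borel (\<lambda>\<omega>. \<iota> (X n 0 \<omega>))) \<longlonglongrightarrow> (\<integral>x. f x \<partial>\<mu>)"
    using initial[unfolded weakly_converges_def, rule_format, of "apply_bcontfun f"]
    by (simp add: continuous_map_iff_continuous2)
  then show ?thesis
    by (simp add: integral_distr Y_def)
qed

lemma bcontfun_mult:
  fixes f g :: "'e \<Rightarrow>\<^sub>C real"
  obtains h :: "'e \<Rightarrow>\<^sub>C real" where "\<And>x. h x = f x * g x"
proof -
  have "continuous_on UNIV (\<lambda>x. f x * g x)" by (intro continuous_intros) simp_all
  from Bcontfun_compact[OF this] show ?thesis using that by (metis)
qed

text \<open>Induction along increasing times: the factor with the latest time \<open>u x\<close> is
  moved to the preceding time s as \<open>TT (u x - s) (f x)\<close> and multiplied into the factor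
  there. The factor \<open>g\<close> at time 0 provides a preceding time in every case and takes up
  the initial law.\<close>

lemma fdd_convergent:
  fixes f :: "'i \<Rightarrow> 'e \<Rightarrow>\<^sub>C real"
  assumes "finite I" "\<And>i. i \<in> I \<Longrightarrow> 0 \<le> u i"
  shows "convergent (\<lambda>n. \<integral>\<omega>. (\<Prod>i\<in>I. f i (Y n (u i) \<omega>)) * apply_bcontfun g (Y n 0 \<omega>) \<partial>P n)"
  using assms
proof (induction I arbitrary: f g rule: finite_ranking_induct[where f=u])
  case empty
  then show ?case using initial_limit[of g] by (auto simp: convergent_def)
next
  case (insert x I)
  have ux: "0 \<le> u x" using insert.prems by auto
  define s where "s = Max (insert 0 (u ` I))"
  have fin: "finite (insert 0 (u ` I))" using insert.hyps by auto
  have s0: "0 \<le> s" and us: "i \<in> I \<Longrightarrow> u i \<le> s" for i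
    unfolding s_def using fin by (auto intro: Max_ge)
  have sx: "s \<le> u x" unfolding s_def using fin insert.hyps(2) ux by (auto simp: Max_le_iff)
  have s_mem: "s = 0 \<or> (\<exists>y\<in>I. s = u y)"
    using Max_in[OF fin] by (auto simp: s_def)
  let ?F = "\<lambda>n \<omega>. \<Prod>i\<in>I. f i (Y n (u i) \<omega>)"
  \<comment> \<open>\<open>None\<close> indexes the factor at time 0, so that the whole past is one
    finite product.\<close>
  define J where "J = insert None (Some ` I)"
  define f' where "f' = case_option g f"
  define u' where "u' = case_option 0 u"
  have J: "(\<Prod>i\<in>J. f' i (Y n (u' i) \<omega>)) = ?F n \<omega> * g (Y n 0 \<omega>)" for n \<omega>
    using insert.hyps(1) by (simp add: J_def f'_def u'_def prod.reindex mult.commute)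
  have lim: "(\<lambda>n. (\<integral>\<omega>. (?F n \<omega> * g (Y n 0 \<omega>)) * f x (Y n (s + (u x - s)) \<omega>) \<partial>P n)
      - (\<integral>\<omega>. (?F n \<omega> * g (Y n 0 \<omega>)) * TT (u x - s) (f x) (Y n s \<omega>) \<partial>P n)) \<longlonglongrightarrow> 0"
    unfolding J[symmetric]
    by (rule markov_limit_prod) (use s0 sx us in \<open>auto simp: J_def u'_def\<close>)
  have "convergent (\<lambda>n. \<integral>\<omega>. (?F n \<omega> * g (Y n 0 \<omega>)) * TT (u x - s) (f x) (Y n s \<omega>) \<partial>P n)"
    using s_mem
  proof
    assume s: "s = 0"
    obtain h :: "'e \<Rightarrow>\<^sub>C real" where h: "\<And>z. h z = g z * TT (u x - s) (f x) z"
      by (rule bcontfun_mult[of g "TT (u x - s) (f x)"]) (rule that)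
    have eq: "(?F n \<omega> * g (Y n 0 \<omega>)) * TT (u x - s) (f x) (Y n s \<omega>) = ?F n \<omega> * h (Y n 0 \<omega>)" for n \<omega>
      using s by (simp add: h)
    show ?thesis unfolding eq by (rule insert.IH) (use insert.prems in auto)
  next
    assume "\<exists>y\<in>I. s = u y"
    then obtain y where y: "y \<in> I" "s = u y" by blast
    obtain h :: "'e \<Rightarrow>\<^sub>C real" where h: "\<And>z. h z = f y z * TT (u x - s) (f x) z"
      by (rule bcontfun_mult[of "f y" "TT (u x - s) (f x)"]) (rule that)
    have eq: "(?F n \<omega> * g (Y n 0 \<omega>)) * TT (u x - s) (f x) (Y n s \<omega>) =
        (\<Prod>i\<in>I. (f(y := h)) i (Y n (u i) \<omega>)) * g (Y n 0 \<omega>)" for n \<omega>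
    proof -
      have "(\<Prod>i\<in>I - {y}. (f(y := h)) i (Y n (u i) \<omega>)) = (\<Prod>i\<in>I - {y}. f i (Y n (u i) \<omega>))"
        by (intro prod.cong) auto
      then show ?thesis
        using insert.hyps(1) y by (simp add: prod.remove[OF _ y(1)] h)
    qed
    show ?thesis unfolding eq by (rule insert.IH) (use insert.prems in auto)
  qed
  then obtain l where "(\<lambda>n. \<integral>\<omega>. (?F n \<omega> * g (Y n 0 \<omega>)) * TT (u x - s) (f x) (Y n s \<omega>) \<partial>P n) \<longlonglongrightarrow> l"
    by (auto simp: convergent_def)
  from tendsto_add[OF lim this]
  have l: "(\<lambda>n. \<integral>\<omega>. (?F n \<omega> * g (Y n 0 \<omega>)) * f x (Y n (u x) \<omega>) \<partial>P n) \<longlonglongrightarrow> l" by simp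
  show ?case
  proof (cases "x \<in> I")
    case True
    then show ?thesis using insert by (simp add: insert_absorb)
  next
    case False
    then have eq: "(\<Prod>i\<in>insert x I. f i (Y n (u i) \<omega>)) * g (Y n 0 \<omega>) = (?F n \<omega> * g (Y n 0 \<omega>)) * f x (Y n (u x) \<omega>)" for n \<omega>
      using insert.hyps(1) by simp
    show ?thesis unfolding eq convergent_def using l by blast
  qed
qed

end

section \<open>The limit law at countably many times\<close>

definition tm :: "nat \<Rightarrow> real" where
  "tm i = \<bar>real_of_rat (from_nat i)\<bar>"

lemma tm_nonneg [simp]: "0 \<le> tm i"
  by (simp add: tm_def)

lemma tm_dense:
  assumes "0 \<le> a" "a < b"
  obtains i where "a < tm i" "tm i < b"
proof -
  obtain q where q: "a < real_of_rat q" "real_of_rat q < b"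
    using of_rat_dense[OF assms(2)] by blast
  then have "tm (to_nat q) = real_of_rat q"
    using assms by (simp add: tm_def del: abs_of_rat)
  with q show ?thesis by (intro that[of "to_nat q"]) auto
qed

definition coord_prod :: "(('e::topological_space \<Rightarrow>\<^sub>C real) \<times> nat) list \<Rightarrow> (nat \<Rightarrow> 'e) \<Rightarrow> real" where
  "coord_prod xs z = prod_list (map (\<lambda>(f, i). apply_bcontfun f (z i)) xs)"

lemma coord_prod_Nil [simp]: "coord_prod [] z = 1"
  and coord_prod_Cons [simp]: "coord_prod ((f, i) # xs) z = f (z i) * coord_prod xs z"
  and coord_prod_append [simp]: "coord_prod (xs @ ys) z = coord_prod xs z * coord_prod ys z"
  by (simp_all add: coord_prod_def)

lemma coord_prod_conv_prod:
  "coord_prod xs z = (\<Prod>k\<in>{..<length xs}. fst (xs ! k) (z (snd (xs ! k))))"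
  by (simp add: coord_prod_def prod.list_conv_set_nth case_prod_unfold atLeast0LessThan)

lemma continuous_bcontfun_coordinate:
  "continuous_on UNIV (\<lambda>z :: nat \<Rightarrow> 'e::topological_space. apply_bcontfun f (z i))"
  by (rule continuous_on_compose2[OF continuous_on_apply_bcontfun[of UNIV f] continuous_on_product_coordinates]) simp

lemma continuous_coord_prod: "continuous_on UNIV (coord_prod xs)"
proof (induction xs)
  case Nil then show ?case by (simp add: coord_prod_def[abs_def])
next
  case (Cons x xs)
  obtain f i where x: "x = (f, i)" by (cases x)
  have "coord_prod (x # xs) = (\<lambda>z. f (z i) * coord_prod xs z)" by (simp add: x fun_eq_iff)
  then show ?case using Cons by (auto intro!: continuous_intros continuous_bcontfun_coordinate)
qed

text \<open>Scalars need no clause of their own: a constant is a one-factor product, and closure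
  under multiplication by constants follows from closure under products.\<close>

inductive_set coord_algebra :: "((nat \<Rightarrow> 'e::topological_space) \<Rightarrow> real) set" where
  base: "coord_prod xs \<in> coord_algebra"
| add: "\<phi> \<in> coord_algebra \<Longrightarrow> \<psi> \<in> coord_algebra \<Longrightarrow> (\<lambda>z. \<phi> z + \<psi> z) \<in> coord_algebra"

lemma coord_algebra_mult:
  assumes "\<phi> \<in> coord_algebra" "\<psi> \<in> coord_algebra"
  shows "(\<lambda>z. \<phi> z * \<psi> z) \<in> coord_algebra"
  using assms(1)
proof induction
  case (base xs)
  show ?case using assms(2)
  proof induction
    case (base ys)
    have "(\<lambda>z. coord_prod xs z * coord_prod ys z) = coord_prod (xs @ ys)" by (simp add: fun_eq_iff)
    then show ?case using coord_algebra.base[of "xs @ ys"] by simp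
  next
    case (add \<phi> \<psi>)
    then show ?case using coord_algebra.add[OF add.IH] by (simp add: algebra_simps)
  qed
next
  case (add \<phi>1 \<phi>2)
  then show ?case using coord_algebra.add[OF add.IH] by (simp add: algebra_simps)
qed

lemma coord_algebra_continuous: "\<phi> \<in> coord_algebra \<Longrightarrow> continuous_on UNIV \<phi>"
  by (induction rule: coord_algebra.induct) (auto intro: continuous_coord_prod continuous_on_add)

lemma coord_algebra_dense:
  fixes \<psi> :: "(nat \<Rightarrow> 'e::metric_space) \<Rightarrow> real"
  assumes "compact (UNIV :: 'e set)" "continuous_on UNIV \<psi>" "0 < \<epsilon>"
  shows "\<exists>\<phi>\<in>coord_algebra. \<forall>z. \<bar>\<psi> z - \<phi> z\<bar> < \<epsilon>"
proof -
  interpret function_ring_on "coord_algebra :: ((nat \<Rightarrow> 'e) \<Rightarrow> real) set" UNIV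
  proof
    show "compact (UNIV :: (nat \<Rightarrow> 'e) set)" by (rule compact_UNIV_fun[OF assms(1)])
    show "continuous_on UNIV f" if "f \<in> coord_algebra" for f :: "(nat \<Rightarrow> 'e) \<Rightarrow> real"
      using that by (rule coord_algebra_continuous)
    show "(\<lambda>_. a) \<in> (coord_algebra :: ((nat \<Rightarrow> 'e) \<Rightarrow> real) set)" for a
    proof -
      have "(\<lambda>_. a) = (coord_prod [(const_bcontfun a, 0)] :: (nat \<Rightarrow> 'e) \<Rightarrow> real)" by (simp add: fun_eq_iff)
      then show ?thesis using coord_algebra.base by metis
    qed
    fix x y :: "nat \<Rightarrow> 'e" assume "x \<noteq> y"
    then obtain i where i: "x i \<noteq> y i" by auto
    \<comment> \<open>Two points that differ in coordinate i are separated by the distance of that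
      coordinate to \<open>x i\<close>.\<close>
    have "(\<lambda>u. dist u (x i)) \<in> bcontfun"
      using compact_imp_bounded[OF compact_continuous_image[OF _ assms(1), of "\<lambda>u. dist u (x i)"]]
      by (simp add: bcontfun_def continuous_on_dist)
    then obtain g :: "'e \<Rightarrow>\<^sub>C real" where g: "apply_bcontfun g = (\<lambda>u. dist u (x i))" by (metis bcontfunE)
    have "coord_prod [(g, i)] x \<noteq> coord_prod [(g, i)] y" using i by (simp add: g)
    then show "\<exists>f\<in>coord_algebra. f x \<noteq> f y" using coord_algebra.base by blast
  qed (auto intro: coord_algebra.add coord_algebra_mult)
  show ?thesis using Stone_Weierstrass_basic[OF assms(2,3)] by simp
qed

context chain_processes
begin

definition samp :: "nat \<Rightarrow> 'w \<Rightarrow> nat \<Rightarrow> 'e" where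
  "samp n \<omega> = (\<lambda>i. Y n (tm i) \<omega>)"

lemma samp_measurable [measurable]: "samp n \<in> borel_measurable (P n)"
  unfolding samp_def[abs_def] by (rule measurable_coordinatewise_then_product) simp

lemma compact_paths: "compact (UNIV :: (nat \<Rightarrow> 'e) set)"
  by (rule compact_UNIV_fun[OF compact_E])

lemma integrable_samp:
  assumes "continuous_on UNIV (\<psi> :: (nat \<Rightarrow> 'e) \<Rightarrow> real)"
  shows "integrable (P n) (\<lambda>\<omega>. \<psi> (samp n \<omega>))"
proof -
  obtain B where B: "\<And>z. \<bar>\<psi> z\<bar> \<le> B"
    by (rule continuous_bounded_on_compact_UNIV[OF compact_paths assms]) (rule that)
  show ?thesis
    by (rule integrable_P_bounded[OF measurable_compose[OF samp_measurable borel_measurable_continuous_onI[OF assms]] B])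
qed

lemma samp_convergent:
  assumes \<psi>: "continuous_on UNIV (\<psi> :: (nat \<Rightarrow> 'e) \<Rightarrow> real)"
  shows "convergent (\<lambda>n. \<integral>\<omega>. \<psi> (samp n \<omega>) \<partial>P n)"
proof -
  have alg: "convergent (\<lambda>n. \<integral>\<omega>. \<phi> (samp n \<omega>) \<partial>P n)" if "\<phi> \<in> coord_algebra" for \<phi> :: "(nat \<Rightarrow> 'e) \<Rightarrow> real"
    using that
  proof induction
    case (base xs)
    show ?case
      using fdd_convergent[of "{..<length xs}" "\<lambda>k. tm (snd (xs ! k))" "\<lambda>k. fst (xs ! k)" "const_bcontfun 1"]
      by (simp add: coord_prod_conv_prod samp_def)
  next
    case (add \<phi> \<psi>)
    have "(\<integral>\<omega>. \<phi> (samp n \<omega>) + \<psi> (samp n \<omega>) \<partial>P n) = (\<integral>\<omega>. \<phi> (samp n \<omega>) \<partial>P n) + (\<integral>\<omega>. \<psi> (samp n \<omega>) \<partial>P n)" for n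
      using add.hyps by (intro Bochner_Integration.integral_add integrable_samp coord_algebra_continuous)
    then show ?case using convergent_add[OF add.IH] by simp
  qed
  have "Cauchy (\<lambda>n. \<integral>\<omega>. \<psi> (samp n \<omega>) \<partial>P n)"
  proof (rule metric_CauchyI)
    fix e :: real assume e: "0 < e"
    obtain \<phi> where \<phi>: "\<phi> \<in> coord_algebra" "\<And>z. \<bar>\<psi> z - \<phi> z\<bar> < e / 3"
      using coord_algebra_dense[OF compact_E \<psi>, of "e/3"] e by auto
    have close: "\<bar>(\<integral>\<omega>. \<psi> (samp n \<omega>) \<partial>P n) - (\<integral>\<omega>. \<phi> (samp n \<omega>) \<partial>P n)\<bar> \<le> e / 3" for n
    proof -
      have eq: "(\<integral>\<omega>. \<psi> (samp n \<omega>) \<partial>P n) - (\<integral>\<omega>. \<phi> (samp n \<omega>) \<partial>P n) = (\<integral>\<omega>. \<psi> (samp n \<omega>) - \<phi> (samp n \<omega>) \<partial>P n)"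
        by (intro Bochner_Integration.integral_diff[symmetric] integrable_samp \<psi> coord_algebra_continuous[OF \<phi>(1)])
      show ?thesis
        unfolding eq
      proof (rule mc.abs_integral_le_const)
        show "integrable (P n) (\<lambda>\<omega>. \<psi> (samp n \<omega>) - \<phi> (samp n \<omega>))"
          by (intro Bochner_Integration.integrable_diff integrable_samp \<psi> coord_algebra_continuous[OF \<phi>(1)])
        show "\<bar>\<psi> (samp n \<omega>) - \<phi> (samp n \<omega>)\<bar> \<le> e / 3" for \<omega>
          using \<phi>(2)[of "samp n \<omega>"] by simp
      qed
    qed
    obtain N where N: "\<And>m n. m \<ge> N \<Longrightarrow> n \<ge> N \<Longrightarrow> dist (\<integral>\<omega>. \<phi> (samp m \<omega>) \<partial>P m) (\<integral>\<omega>. \<phi> (samp n \<omega>) \<partial>P n) < e / 3"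
      using metric_CauchyD[OF convergent_Cauchy[OF alg[OF \<phi>(1)]], of "e/3"] e by auto
    show "\<exists>M. \<forall>m\<ge>M. \<forall>n\<ge>M. dist (\<integral>\<omega>. \<psi> (samp m \<omega>) \<partial>P m) (\<integral>\<omega>. \<psi> (samp n \<omega>) \<partial>P n) < e"
    proof (intro exI allI impI)
      fix m n assume "N \<le> m" "N \<le> n"
      from N[OF this] close[of m] close[of n] show "dist (\<integral>\<omega>. \<psi> (samp m \<omega>) \<partial>P m) (\<integral>\<omega>. \<psi> (samp n \<omega>) \<partial>P n) < e"
        unfolding dist_real_def by linarith
    qed
  qed
  then show ?thesis by (rule Cauchy_convergent)
qed

definition samp_law :: "nat \<Rightarrow> (nat \<Rightarrow> 'e) measure" where
  "samp_law n = distr (P n) borel (samp n)"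

lemma prob_space_samp_law: "prob_space (samp_law n)"
  unfolding samp_law_def by (rule mc.prob_space_distr) simp

lemma sets_samp_law [simp]: "sets (samp_law n) = sets borel"
  by (simp add: samp_law_def)

lemma integral_samp_law:
  "continuous_on UNIV \<psi> \<Longrightarrow> (\<integral>z. \<psi> z \<partial>samp_law n) = (\<integral>\<omega>. (\<psi> (samp n \<omega>) :: real) \<partial>P n)"
  unfolding samp_law_def by (intro integral_distr) (auto intro: borel_measurable_continuous_onI)

lemma limit_law_exists:
  "\<exists>\<Lambda>. prob_space \<Lambda> \<and> sets \<Lambda> = sets borel \<and>
    (\<forall>\<psi> :: (nat \<Rightarrow> 'e) \<Rightarrow> real. continuous_on UNIV \<psi> \<longrightarrow> (\<lambda>n. \<integral>\<omega>. \<psi> (samp n \<omega>) \<partial>P n) \<longlonglongrightarrow> (\<integral>z. \<psi> z \<partial>\<Lambda>))"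
proof -
  define L where "L \<psi> = lim (\<lambda>n. \<integral>\<omega>. \<psi> (samp n \<omega>) \<partial>P n)" for \<psi> :: "(nat \<Rightarrow> 'e) \<Rightarrow> real"
  have L: "(\<lambda>n. \<integral>\<omega>. \<psi> (samp n \<omega>) \<partial>P n) \<longlonglongrightarrow> L \<psi>" if "continuous_on UNIV \<psi>" for \<psi> :: "(nat \<Rightarrow> 'e) \<Rightarrow> real"
    using samp_convergent[OF that] by (simp add: L_def convergent_LIMSEQ_iff)
  then have L': "(\<lambda>n. \<integral>z. \<psi> z \<partial>samp_law n) \<longlonglongrightarrow> L \<psi>" if "continuous_on UNIV \<psi>" for \<psi> :: "(nat \<Rightarrow> 'e) \<Rightarrow> real"
    using that by (simp add: integral_samp_law)
  obtain \<Lambda> where "prob_space \<Lambda>" "sets \<Lambda> = sets borel"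
    "\<And>\<psi> :: (nat \<Rightarrow> 'e) \<Rightarrow> real. continuous_on UNIV \<psi> \<Longrightarrow> (\<integral>z. \<psi> z \<partial>\<Lambda>) = L \<psi>"
    by (rule prob_measures_weak_limit[OF compact_paths prob_space_samp_law sets_samp_law L']) (assumption, rule that)
  with L show ?thesis by auto
qed

definition \<Lambda> :: "(nat \<Rightarrow> 'e) measure" where
  "\<Lambda> = (SOME \<Lambda>. prob_space \<Lambda> \<and> sets \<Lambda> = sets borel \<and>
    (\<forall>\<psi> :: (nat \<Rightarrow> 'e) \<Rightarrow> real. continuous_on UNIV \<psi> \<longrightarrow> (\<lambda>n. \<integral>\<omega>. \<psi> (samp n \<omega>) \<partial>P n) \<longlonglongrightarrow> (\<integral>z. \<psi> z \<partial>\<Lambda>)))"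

lemma
  fixes \<psi> :: "(nat \<Rightarrow> 'e) \<Rightarrow> real"
  shows prob_space_\<Lambda>: "prob_space \<Lambda>" and sets_\<Lambda> [simp]: "sets \<Lambda> = sets borel"
    and samp_tendsto: "continuous_on UNIV \<psi> \<Longrightarrow> (\<lambda>n. \<integral>\<omega>. \<psi> (samp n \<omega>) \<partial>P n) \<longlonglongrightarrow> (\<integral>z. \<psi> z \<partial>\<Lambda>)"
  using someI_ex[OF limit_law_exists] unfolding \<Lambda>_def by auto

lemma \<Lambda>_markov:
  assumes "tm a \<le> tm b" "\<And>i. i \<in> I \<Longrightarrow> tm (k i) \<le> tm a"
  shows "(\<integral>z. (\<Prod>i\<in>I. apply_bcontfun (f i) (z (k i))) * apply_bcontfun g (z b) \<partial>\<Lambda>) =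
    (\<integral>z. (\<Prod>i\<in>I. apply_bcontfun (f i) (z (k i))) * apply_bcontfun (TT (tm b - tm a) g) (z a) \<partial>\<Lambda>)"
proof -
  let ?\<psi> = "\<lambda>z. (\<Prod>i\<in>I. apply_bcontfun (f i) (z (k i))) * apply_bcontfun g (z b)"
  let ?\<psi>' = "\<lambda>z. (\<Prod>i\<in>I. apply_bcontfun (f i) (z (k i))) * apply_bcontfun (TT (tm b - tm a) g) (z a)"
  have c: "continuous_on UNIV ?\<psi>" "continuous_on UNIV ?\<psi>'"
    by (intro continuous_intros continuous_bcontfun_coordinate)+
  have "(\<lambda>n. (\<integral>\<omega>. ?\<psi> (samp n \<omega>) \<partial>P n) - (\<integral>\<omega>. ?\<psi>' (samp n \<omega>) \<partial>P n)) \<longlonglongrightarrow> 0"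
    using markov_limit_prod[of "tm a" "tm b - tm a" I "\<lambda>i. tm (k i)" f g] assms
    by (simp add: samp_def)
  moreover have "(\<lambda>n. (\<integral>\<omega>. ?\<psi> (samp n \<omega>) \<partial>P n) - (\<integral>\<omega>. ?\<psi>' (samp n \<omega>) \<partial>P n)) \<longlonglongrightarrow> (\<integral>z. ?\<psi> z \<partial>\<Lambda>) - (\<integral>z. ?\<psi>' z \<partial>\<Lambda>)"
    by (intro tendsto_diff samp_tendsto c)
  ultimately show ?thesis using LIMSEQ_unique by fastforce
qed

lemma \<Lambda>_marginal: "(\<integral>z. apply_bcontfun f (z b) \<partial>\<Lambda>) = (\<integral>x. apply_bcontfun (TT (tm b) f) x \<partial>\<mu>)"
proof -
  have "(\<lambda>n. (\<integral>\<omega>. f (Y n (0 + tm b) \<omega>) \<partial>P n) - (\<integral>\<omega>. TT (tm b) f (Y n 0 \<omega>) \<partial>P n)) \<longlonglongrightarrow> 0"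
    using markov_limit_prod[of 0 "tm b" "{}" "\<lambda>_. 0" undefined f] by simp
  from tendsto_add[OF this initial_limit[of "TT (tm b) f"]]
  have "(\<lambda>n. \<integral>\<omega>. f (samp n \<omega> b) \<partial>P n) \<longlonglongrightarrow> (\<integral>x. TT (tm b) f x \<partial>\<mu>)"
    by (simp add: samp_def)
  then show ?thesis
    using samp_tendsto[OF continuous_bcontfun_coordinate[of f b]] LIMSEQ_unique by blast
qed

end

section \<open>Sample functions and the Skorokhod topology\<close>

text \<open>The piecewise linear map through the nodes, with slope 1 after the last one. On a
  segment the displacement \<open>l t - t\<close> is a convex combination of those at the two ends,
  hence below \<eta>. The induction replaces the final ray by a segment and a new ray.\<close>

lemma time_change_interpolation:
  fixes a b :: "nat \<Rightarrow> real"
  assumes ab: "a 0 = 0" "b 0 = 0" "\<And>i. i < m \<Longrightarrow> a i < a (Suc i)" "\<And>i. i < m \<Longrightarrow> b i < b (Suc i)"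
    and close: "\<And>i. i \<le> m \<Longrightarrow> \<bar>a i - b i\<bar> < \<eta>"
  shows "\<exists>l\<in>time_changes. (\<forall>i\<le>m. l (a i) = b i) \<and> (\<forall>t\<ge>0. \<bar>l t - t\<bar> < \<eta>) \<and> (\<forall>t\<ge>a m. l t = b m + (t - a m))"
  using assms(3-)
proof (induction m)
  case 0
  have "(\<lambda>t. t) \<in> time_changes" by (auto simp: time_changes_def strict_mono_on_def)
  moreover have "\<eta> > 0" using 0(3)[of 0] by (simp add: ab)
  ultimately show ?case by (intro bexI[of _ "\<lambda>t. t"]) (auto simp: ab)
next
  case (Suc m)
  then obtain l where l: "l \<in> time_changes" "\<And>i. i \<le> m \<Longrightarrow> l (a i) = b i" "\<And>t. 0 \<le> t \<Longrightarrow> \<bar>l t - t\<bar> < \<eta>"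
    "\<And>t. a m \<le> t \<Longrightarrow> l t = b m + (t - a m)"
    by (auto simp: less_Suc_eq)
  have mono: "l s < l t" if "0 \<le> s" "s < t" for s t
    using l(1) that by (auto simp: time_changes_def strict_mono_on_def)
  have surj: "\<exists>t\<ge>0. l t = y" if "0 \<le> y" for y
  proof -
    have "y \<in> l ` {0..}" using l(1) that by (simp add: time_changes_def)
    then show ?thesis by auto
  qed
  have nonneg: "0 \<le> l t" if "0 \<le> t" for t
    using l(1) that by (auto simp: time_changes_def)
  have am: "a m < a (Suc m)" and bm: "b m < b (Suc m)" using Suc.prems by auto
  have a_mono: "a i \<le> a m" "0 \<le> a i" if "i \<le> m" for i
  proof -
    have "i \<le> j \<Longrightarrow> j \<le> m \<Longrightarrow> a i \<le> a j" for i j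
    proof (induction j)
      case (Suc j)
      then show ?case
        using \<open>\<And>i. i < Suc m \<Longrightarrow> a i < a (Suc i)\<close>[of j] by (cases "i = Suc j") auto
    qed simp
    from this[of i m] this[of 0 i] that ab show "a i \<le> a m" "0 \<le> a i" by auto
  qed
  have a0: "0 \<le> a m" using a_mono(2)[of m] by simp
  have lam: "l (a m) = b m" using l(2) by simp
  have b0: "0 \<le> b m" using nonneg[OF a0] lam by simp
  define r where "r = (b (Suc m) - b m) / (a (Suc m) - a m)"
  have r: "0 < r" using am bm by (simp add: r_def)
  have r_end: "b m + (a (Suc m) - a m) * r = b (Suc m)" using am by (simp add: r_def)
  define l' where "l' t = (if t \<le> a m then l t else if t \<le> a (Suc m) then b m + (t - a m) * r else b (Suc m) + (t - a (Suc m)))" for t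
  have l'1: "l' t = l t" if "t \<le> a m" for t using that by (simp add: l'_def)
  have l'2: "l' t = b m + (t - a m) * r" if "a m \<le> t" "t \<le> a (Suc m)" for t
    using that lam by (cases "t = a m") (auto simp: l'_def)
  have l'3: "l' t = b (Suc m) + (t - a (Suc m))" if "a (Suc m) \<le> t" for t
    using that am r_end by (cases "t = a (Suc m)") (auto simp: l'_def)
  have mono': "l' s < l' t" if st: "0 \<le> s" "s < t" for s t
  proof -
    have m1: "l' s < l' t" if "0 \<le> s" "s < t" "t \<le> a m" for s t
      using that mono by (simp add: l'1)
    have m2: "l' s < l' t" if "a m \<le> s" "s < t" "t \<le> a (Suc m)" for s t
      using that r by (simp add: l'2)
    have m3: "l' s < l' t" if "a (Suc m) \<le> s" "s < t" for s t
      using that by (simp add: l'3)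
    have m4: "l' s < l' t" if "a m \<le> s" "s < t" for s t
    proof -
      consider "t \<le> a (Suc m)" | "a (Suc m) \<le> s" | "s < a (Suc m)" "a (Suc m) < t" by linarith
      then show ?thesis
        using m2[of s t] m3[of s t] m2[of s "a (Suc m)"] m3[of "a (Suc m)" t] that by cases auto
    qed
    consider "t \<le> a m" | "a m \<le> s" | "s < a m" "a m < t" by linarith
    then show ?thesis
      using m1[of s t] m4[of s t] m1[of s "a m"] m4[of "a m" t] st by cases auto
  qed
  have "l' \<in> time_changes"
    unfolding time_changes_def mem_Collect_eq
  proof
    show "strict_mono_on {0..} l'" using mono' by (auto simp: strict_mono_on_def)
    have l'0: "0 \<le> l' t" if "0 \<le> t" for t
    proof (cases "t \<le> a m")
      case True then show ?thesis using nonneg[OF that] by (simp add: l'1)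
    next
      case False
      then have "l' (a m) < l' t" using a0 by (intro mono') auto
      then show ?thesis using b0 lam by (simp add: l'1)
    qed
    have "\<exists>t\<ge>0. l' t = y" if y: "0 \<le> y" for y
    proof -
      consider "y \<le> b m" | "b m \<le> y" "y \<le> b (Suc m)" | "b (Suc m) \<le> y" by linarith
      then show ?thesis
      proof cases
        case 1
        obtain t where t: "0 \<le> t" "l t = y" using surj[OF y] by blast
        have "t \<le> a m" using mono[of "a m" t] 1 t a0 lam by (cases "a m < t") auto
        then show ?thesis using t by (auto simp: l'1)
      next
        case 2
        have "l' (a m + (y - b m) / r) = y"
        proof -
          have "(y - b m) / r \<le> a (Suc m) - a m"
            using 2 r_end r by (simp add: pos_divide_le_eq)
          then show ?thesis using 2 r by (subst l'2) auto
        qed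
        moreover have "0 \<le> a m + (y - b m) / r" using 2 r a0 by simp
        ultimately show ?thesis by blast
      next
        case 3
        have "l' (a (Suc m) + (y - b (Suc m))) = y" using 3 by (subst l'3) auto
        moreover have "0 \<le> a (Suc m) + (y - b (Suc m))" using 3 a0 am by simp
        ultimately show ?thesis by blast
      qed
    qed
    with l'0 show "l' ` {0..} = {0..}" by (fastforce simp: image_iff)
  qed
  moreover have "\<forall>i\<le>Suc m. l' (a i) = b i"
    using l(2) a_mono(1) l'3[of "a (Suc m)"] by (auto simp: le_Suc_eq l'1)
  moreover have "\<forall>t\<ge>0. \<bar>l' t - t\<bar> < \<eta>"
  proof (intro allI impI)
    fix t :: real assume t: "0 \<le> t"
    consider "t \<le> a m" | "a m \<le> t" "t \<le> a (Suc m)" | "a (Suc m) \<le> t" by linarith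
    then show "\<bar>l' t - t\<bar> < \<eta>"
    proof cases
      case 1 then show ?thesis using l(3)[OF t] by (simp add: l'1)
    next
      case 3 then show ?thesis using Suc.prems(3)[of "Suc m"] by (simp add: l'3)
    next
      case 2
      define \<theta> where "\<theta> = (t - a m) / (a (Suc m) - a m)"
      have \<theta>: "0 \<le> \<theta>" "\<theta> \<le> 1" using 2 am by (auto simp: \<theta>_def)
      have t\<theta>: "t = a m + \<theta> * (a (Suc m) - a m)" using am by (simp add: \<theta>_def)
      have "(t - a m) * r = \<theta> * (b (Suc m) - b m)" by (simp add: \<theta>_def r_def)
      then have "l' t - t = b m + \<theta> * (b (Suc m) - b m) - t" using 2 by (simp add: l'2)
      also have "\<dots> = (1 - \<theta>) * (b m - a m) + \<theta> * (b (Suc m) - a (Suc m))"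
        by (subst t\<theta>) (simp add: algebra_simps)
      finally have eq: "l' t - t = (1 - \<theta>) * (b m - a m) + \<theta> * (b (Suc m) - a (Suc m))" .
      have c: "\<bar>b m - a m\<bar> < \<eta>" "\<bar>b (Suc m) - a (Suc m)\<bar> < \<eta>"
        using Suc.prems(3)[of m] Suc.prems(3)[of "Suc m"] by auto
      show ?thesis
        unfolding eq
        using convex_bound_lt[of "b m - a m" \<eta> "b (Suc m) - a (Suc m)" "1 - \<theta>" \<theta>]
          convex_bound_lt[of "- (b m - a m)" \<eta> "- (b (Suc m) - a (Suc m))" "1 - \<theta>" \<theta>] c \<theta>
        by (simp add: abs_less_iff algebra_simps)
    qed
  qed
  ultimately show ?case using l'3 by blast
qed

text \<open>The gap \<delta> is the separation in the Skorokhod modulus. The bound \<open>B\<close>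
  confines \<open>\<tau> i\<close> to [0, i B], whence the compactness needed to extract limits of
  partitions.\<close>

definition partition_times :: "real \<Rightarrow> real \<Rightarrow> (nat \<Rightarrow> real) \<Rightarrow> bool" where
  "partition_times \<delta> B \<tau> \<longleftrightarrow> \<tau> 0 = 0 \<and> (\<forall>i. \<delta> \<le> \<tau> (Suc i) - \<tau> i \<and> \<tau> (Suc i) - \<tau> i \<le> B)"

text \<open>Open intervals are used because the limit of a sequence of such sample functions may fail to
  be right-continuous at the partition points.\<close>

definition osc_le :: "(nat \<Rightarrow> real) \<Rightarrow> real \<Rightarrow> real \<Rightarrow> (nat \<Rightarrow> 'e::metric_space) \<Rightarrow> bool" where
  "osc_le \<tau> T \<epsilon> z \<longleftrightarrow> (\<forall>i a b. \<tau> i < tm a \<longrightarrow> tm a < \<tau> (Suc i) \<longrightarrow> \<tau> i < tm b \<longrightarrow> tm b < \<tau> (Suc i) \<longrightarrow>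
     tm a \<le> T \<longrightarrow> tm b \<le> T \<longrightarrow> dist (z a) (z b) \<le> \<epsilon>)"

lemma osc_leD:
  "osc_le \<tau> T \<epsilon> z \<Longrightarrow> \<tau> i < tm a \<Longrightarrow> tm a < \<tau> (Suc i) \<Longrightarrow> \<tau> i < tm b \<Longrightarrow> tm b < \<tau> (Suc i) \<Longrightarrow>
    tm a \<le> T \<Longrightarrow> tm b \<le> T \<Longrightarrow> dist (z a) (z b) \<le> \<epsilon>"
  by (simp add: osc_le_def)

text \<open>In essence the condition w'(\<delta>, T) \<le> \<epsilon> on the cadlag modulus, read on
  rational times only.\<close>

definition Kset :: "real \<Rightarrow> real \<Rightarrow> real \<Rightarrow> real \<Rightarrow> (nat \<Rightarrow> 'e::metric_space) set" where
  "Kset \<delta> B T \<epsilon> = {z. \<exists>\<tau>. partition_times \<delta> B \<tau> \<and> osc_le \<tau> T \<epsilon> z}"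

lemma Kset_mono: "T \<le> T' \<Longrightarrow> \<epsilon>' \<le> \<epsilon> \<Longrightarrow> Kset \<delta> B T' \<epsilon>' \<subseteq> Kset \<delta> B T \<epsilon>"
  unfolding Kset_def osc_le_def by (auto, meson order_trans)

lemma partition_times_lower:
  assumes "partition_times \<delta> B \<tau>" shows "real i * \<delta> \<le> \<tau> i"
proof (induction i)
  case (Suc i)
  then show ?case using assms[unfolded partition_times_def] by (auto simp: algebra_simps dest: spec[of _ i])
qed (use assms in \<open>simp add: partition_times_def\<close>)

lemma partition_times_nonneg: "partition_times \<delta> B \<tau> \<Longrightarrow> 0 \<le> \<delta> \<Longrightarrow> 0 \<le> \<tau> i"
  using partition_times_lower[of \<delta> B \<tau> i] by (rule order_trans[rotated]) auto

lemma partition_times_upper: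
  assumes "partition_times \<delta> B \<tau>" shows "\<tau> i \<le> real i * B"
proof (induction i)
  case (Suc i)
  then show ?case using assms[unfolded partition_times_def] by (auto simp: algebra_simps dest: spec[of _ i])
qed (use assms in \<open>simp add: partition_times_def\<close>)

lemma partition_times_less:
  assumes "partition_times \<delta> B \<tau>" "0 < \<delta>" shows "\<tau> i < \<tau> (Suc i)"
proof -
  have "\<delta> \<le> \<tau> (Suc i) - \<tau> i" using assms by (simp add: partition_times_def)
  then show ?thesis using assms(2) by linarith
qed

lemma partition_times_cell:
  assumes "partition_times \<delta> B \<tau>" "0 < \<delta>" "0 \<le> t"
  obtains i where "\<tau> i \<le> t" "t < \<tau> (Suc i)"
proof -
  obtain m :: nat where "t < real m * \<delta>" using reals_Archimedean3[OF assms(2)] by blast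
  then have ex: "\<exists>i. t < \<tau> i" using partition_times_lower[OF assms(1), of m] by (intro exI[of _ m]) linarith
  define i where "i = (LEAST i. t < \<tau> i)"
  have 1: "t < \<tau> i" unfolding i_def using ex by (rule LeastI_ex)
  have "i \<noteq> 0" using 1 assms by (metis not_less partition_times_def)
  then obtain k where k: "i = Suc k" using not0_implies_Suc by blast
  then have "\<not> t < \<tau> k" using not_less_Least[of k "\<lambda>i. t < \<tau> i"] by (simp add: i_def)
  then show ?thesis using 1 k that[of k] by simp
qed

lemma compact_partition_times:
  "compact {\<tau> :: nat \<Rightarrow> real. \<forall>i. \<tau> i \<in> {0..real i * B}}"
proof -
  have "compactin (product_topology (\<lambda>i. euclideanreal) (UNIV :: nat set)) (PiE UNIV (\<lambda>i. {0..real i * B}))"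
    by (simp add: compactin_PiE)
  moreover have "PiE UNIV (\<lambda>i::nat. {0..real i * B}) = {\<tau>. \<forall>i. \<tau> i \<in> {0..real i * B}}"
    by (auto simp: PiE_def Pi_def)
  ultimately show ?thesis unfolding euclidean_product_topology by simp
qed

lemma tendsto_coordinate:
  fixes x :: "'i \<Rightarrow> 'a \<Rightarrow> 'b::topological_space"
  assumes "(x \<longlongrightarrow> z) F" shows "((\<lambda>k. x k i) \<longlongrightarrow> z i) F"
  using continuous_on_tendsto_compose[OF continuous_on_product_coordinates[of i] assms] by simp

lemma partition_times_subsequence:
  assumes "\<And>k. partition_times \<delta> B (\<tau> k)" "0 \<le> \<delta>"
  obtains r \<sigma> where "strict_mono (r :: nat \<Rightarrow> nat)" "partition_times \<delta> B \<sigma>" "\<And>i. (\<lambda>k. \<tau> (r k) i) \<longlonglongrightarrow> \<sigma> i"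
proof -
  have "\<tau> k i \<in> {0..real i * B}" for k i
    using partition_times_nonneg[OF assms] partition_times_upper[OF assms(1), of k i] by simp
  then obtain \<sigma> r where r: "strict_mono (r :: nat \<Rightarrow> nat)" "(\<tau> \<circ> r) \<longlonglongrightarrow> \<sigma>"
    using compact_partition_times[of B, unfolded compact_def, rule_format, of \<tau>] by auto
  have lim: "(\<lambda>k. \<tau> (r k) i) \<longlonglongrightarrow> \<sigma> i" for i
    using tendsto_coordinate[OF r(2), of i] by (simp add: comp_def)
  have "partition_times \<delta> B \<sigma>"
    unfolding partition_times_def
  proof (intro conjI allI)
    show "\<sigma> 0 = 0"
      using LIMSEQ_unique[OF lim[of 0]] assms(1) by (simp add: partition_times_def)
    fix i
    have d: "(\<lambda>k. \<tau> (r k) (Suc i) - \<tau> (r k) i) \<longlonglongrightarrow> \<sigma> (Suc i) - \<sigma> i"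
      by (intro tendsto_diff lim)
    show "\<delta> \<le> \<sigma> (Suc i) - \<sigma> i" "\<sigma> (Suc i) - \<sigma> i \<le> B"
      using assms(1) by (auto intro!: LIMSEQ_le_const[OF d] LIMSEQ_le_const2[OF d] simp: partition_times_def)
  qed
  with r(1) lim show ?thesis by (intro that)
qed

text \<open>Strict inequalities at the limiting partition hold eventually along the sequence, so
  closeness within a cell passes to the limit.\<close>

lemma osc_le_limit:
  assumes \<tau>: "\<And>i. (\<lambda>k. \<tau> k i) \<longlonglongrightarrow> \<sigma> i" and x: "\<And>a. (\<lambda>k. x k a) \<longlonglongrightarrow> z a"
    and osc: "\<And>k. osc_le (\<tau> k) T \<epsilon> (x k)"
  shows "osc_le \<sigma> T \<epsilon> z"
  unfolding osc_le_def
proof (intro allI impI)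
  fix i a b assume ab: "\<sigma> i < tm a" "tm a < \<sigma> (Suc i)" "\<sigma> i < tm b" "tm b < \<sigma> (Suc i)" "tm a \<le> T" "tm b \<le> T"
  have "\<forall>\<^sub>F k in sequentially. \<tau> k i < tm a \<and> tm a < \<tau> k (Suc i) \<and> \<tau> k i < tm b \<and> tm b < \<tau> k (Suc i)"
    using ab by (intro eventually_conj order_tendstoD[OF \<tau>])
  then have "\<forall>\<^sub>F k in sequentially. dist (x k a) (x k b) \<le> \<epsilon>"
    by eventually_elim (use osc ab in \<open>auto simp: osc_le_def\<close>)
  then show "dist (z a) (z b) \<le> \<epsilon>"
    by (intro tendsto_upperbound[OF tendsto_dist[OF x x]]) auto
qed

lemma closed_Kset:
  assumes "0 \<le> \<delta>" shows "closed (Kset \<delta> B T \<epsilon> :: (nat \<Rightarrow> 'e::metric_space) set)"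
  unfolding closed_sequential_limits
proof (intro allI impI, elim conjE)
  fix x and z :: "nat \<Rightarrow> 'e" assume x: "\<forall>n. x n \<in> Kset \<delta> B T \<epsilon>" "x \<longlonglongrightarrow> z"
  then obtain \<tau> where \<tau>: "\<And>k. partition_times \<delta> B (\<tau> k)" "\<And>k. osc_le (\<tau> k) T \<epsilon> (x k)"
    unfolding Kset_def mem_Collect_eq by metis
  obtain r \<sigma> where r: "strict_mono (r :: nat \<Rightarrow> nat)" "partition_times \<delta> B \<sigma>" "\<And>i. (\<lambda>k. \<tau> (r k) i) \<longlonglongrightarrow> \<sigma> i"
    by (rule partition_times_subsequence[of \<delta> B \<tau>, OF \<tau>(1) assms]) (rule that)
  have "(\<lambda>k. x (r k) a) \<longlonglongrightarrow> z a" for a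
    using tendsto_coordinate[OF LIMSEQ_subseq_LIMSEQ[OF x(2) r(1)], of a] by (simp add: comp_def)
  from osc_le_limit[OF r(3) this \<tau>(2)] show "z \<in> Kset \<delta> B T \<epsilon>"
    using r(2) by (auto simp: Kset_def)
qed

text \<open>The modulus criterion for being cadlag, as a condition on the values at rational times;
  it ensures one-sided limits, not right-continuity of \<open>z\<close> itself.\<close>

definition regular :: "(nat \<Rightarrow> 'e::metric_space) \<Rightarrow> bool" where
  "regular z \<longleftrightarrow> (\<forall>\<epsilon>>0. \<forall>T. \<exists>\<delta>>0. \<exists>B. z \<in> Kset \<delta> B T \<epsilon>)"

text \<open>Times strictly after \<open>t\<close>, also when \<open>t\<close> is itself one of the
  \<open>tm i\<close>: the sample at a partition point may be neither one-sided limit.\<close>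

definition idx :: "real \<Rightarrow> nat \<Rightarrow> nat" where
  "idx t k = (SOME i. t < tm i \<and> tm i < t + 1 / real (Suc k))"

lemma idx:
  assumes "0 \<le> t" shows "t < tm (idx t k)" "tm (idx t k) < t + 1 / real (Suc k)"
proof -
  have "\<exists>i. t < tm i \<and> tm i < t + 1 / real (Suc k)"
    using tm_dense[OF assms, of "t + 1 / real (Suc k)"] by (metis less_add_same_cancel1 of_nat_0_less_iff zero_less_Suc zero_less_divide_1_iff)
  from someI_ex[OF this] show "t < tm (idx t k)" "tm (idx t k) < t + 1 / real (Suc k)"
    by (auto simp: idx_def)
qed

lemma tm_idx_tendsto: "0 \<le> t \<Longrightarrow> (\<lambda>k. tm (idx t k)) \<longlonglongrightarrow> t"
proof (rule tendsto_sandwich[OF _ _ tendsto_const])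
  assume t: "0 \<le> t"
  show "\<forall>\<^sub>F k in sequentially. t \<le> tm (idx t k)" "\<forall>\<^sub>F k in sequentially. tm (idx t k) \<le> t + 1 / real (Suc k)"
    using idx[OF t] by (auto intro!: always_eventually less_imp_le)
  show "(\<lambda>k. t + 1 / real (Suc k)) \<longlonglongrightarrow> t"
    using tendsto_add[OF tendsto_const LIMSEQ_inverse_real_of_nat, of t] by (simp add: inverse_eq_divide)
qed

section \<open>Right limits and the cadlag extension\<close>

definition right_lim :: "(nat \<Rightarrow> 'e::metric_space) \<Rightarrow> real \<Rightarrow> 'e" where
  "right_lim z t = lim (\<lambda>k. z (idx t k))"

text \<open>For each precision, times just after t lie in the interior of the cell that contains t.
  This gives the Cauchy property along \<open>idx\<close> and then the same closeness for all such
  times.\<close>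

lemma right_lim:
  fixes z :: "nat \<Rightarrow> 'e::complete_space"
  assumes z: "regular z" and t: "0 \<le> t" and e: "0 < e"
  shows "\<exists>\<eta>>0. \<forall>a. t < tm a \<longrightarrow> tm a < t + \<eta> \<longrightarrow> dist (z a) (right_lim z t) < e"
proof -
  have window: "\<exists>\<eta>>0. \<forall>a b. t < tm a \<longrightarrow> tm a < t + \<eta> \<longrightarrow> t < tm b \<longrightarrow> tm b < t + \<eta> \<longrightarrow> dist (z a) (z b) \<le> \<epsilon>"
    if \<epsilon>: "0 < \<epsilon>" for \<epsilon>
  proof -
    obtain \<delta> B where "\<delta> > 0" "z \<in> Kset \<delta> B (t + 1) \<epsilon>" using z \<epsilon> unfolding regular_def by blast
    then obtain \<tau> where \<tau>: "partition_times \<delta> B \<tau>" "osc_le \<tau> (t + 1) \<epsilon> z" unfolding Kset_def by blast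
    obtain i where i: "\<tau> i \<le> t" "t < \<tau> (Suc i)" by (rule partition_times_cell[OF \<tau>(1) \<open>\<delta> > 0\<close> t]) (rule that)
    show ?thesis
      using i by (intro exI[of _ "min 1 (\<tau> (Suc i) - t)"] conjI allI impI osc_leD[OF \<tau>(2), of i]) linarith+
  qed
  have near: "\<forall>\<^sub>F k in sequentially. tm (idx t k) < t + \<eta>" if "0 < \<eta>" for \<eta>
    using that by (intro order_tendstoD[OF tm_idx_tendsto[OF t]]) simp
  have "Cauchy (\<lambda>k. z (idx t k))"
  proof (rule metric_CauchyI)
    fix e :: real assume "0 < e"
    then obtain \<eta> where \<eta>: "\<eta> > 0" "\<And>a b. t < tm a \<Longrightarrow> tm a < t + \<eta> \<Longrightarrow> t < tm b \<Longrightarrow> tm b < t + \<eta> \<Longrightarrow> dist (z a) (z b) \<le> e/2"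
      using window[of "e/2"] by auto
    obtain N where N: "\<And>k. N \<le> k \<Longrightarrow> tm (idx t k) < t + \<eta>"
      using near[OF \<eta>(1)] by (auto simp: eventually_sequentially)
    have "dist (z (idx t m)) (z (idx t n)) < e" if "N \<le> m" "N \<le> n" for m n
      using \<eta>(2)[OF idx(1)[OF t] N[OF that(1)] idx(1)[OF t] N[OF that(2)]] \<open>0 < e\<close> by linarith
    then show "\<exists>M. \<forall>m\<ge>M. \<forall>n\<ge>M. dist (z (idx t m)) (z (idx t n)) < e" by blast
  qed
  then have lim: "(\<lambda>k. z (idx t k)) \<longlonglongrightarrow> right_lim z t"
    unfolding right_lim_def using Cauchy_convergent convergent_LIMSEQ_iff by blast
  obtain \<eta> where \<eta>: "\<eta> > 0" "\<And>a b. t < tm a \<Longrightarrow> tm a < t + \<eta> \<Longrightarrow> t < tm b \<Longrightarrow> tm b < t + \<eta> \<Longrightarrow> dist (z a) (z b) \<le> e/2"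
    using window[of "e/2"] e by auto
  have "dist (z a) (right_lim z t) < e" if a: "t < tm a" "tm a < t + \<eta>" for a
  proof -
    have "\<forall>\<^sub>F k in sequentially. dist (z a) (z (idx t k)) \<le> e/2"
      using near[OF \<eta>(1)] by eventually_elim (rule \<eta>(2)[OF a idx(1)[OF t]])
    then have "dist (z a) (right_lim z t) \<le> e/2"
      by (intro tendsto_upperbound[OF tendsto_dist[OF tendsto_const lim]]) auto
    then show ?thesis using e by linarith
  qed
  then show ?thesis using \<eta>(1) by blast
qed

lemma right_lim_tendsto:
  fixes z :: "nat \<Rightarrow> 'e::complete_space"
  assumes "regular z" "0 \<le> t"
  shows "(\<lambda>k. z (idx t k)) \<longlonglongrightarrow> right_lim z t"
proof (rule metric_LIMSEQ_I)
  fix e :: real assume "0 < e"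
  then obtain \<eta> where \<eta>: "\<eta> > 0" "\<And>a. t < tm a \<Longrightarrow> tm a < t + \<eta> \<Longrightarrow> dist (z a) (right_lim z t) < e"
    using right_lim[OF assms, of e] by blast
  have "\<forall>\<^sub>F k in sequentially. tm (idx t k) < t + \<eta>"
    using \<eta>(1) by (intro order_tendstoD[OF tm_idx_tendsto[OF assms(2)]]) simp
  then show "\<exists>N. \<forall>k\<ge>N. dist (z (idx t k)) (right_lim z t) < e"
    using \<eta>(2)[OF idx(1)[OF assms(2)]] by (auto simp: eventually_sequentially)
qed

lemma right_lim_approx:
  fixes z :: "nat \<Rightarrow> 'e::complete_space"
  assumes z: "regular z" and t: "0 \<le> t" "t < u" and e: "0 < e"
  obtains a where "t < tm a" "tm a < u" "dist (z a) (right_lim z t) < e"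
proof -
  obtain \<eta> where \<eta>: "\<eta> > 0" "\<And>a. t < tm a \<Longrightarrow> tm a < t + \<eta> \<Longrightarrow> dist (z a) (right_lim z t) < e"
    using right_lim[OF z t(1) e] by blast
  have "t < min u (t + \<eta>)" using t \<eta> by simp
  then obtain a where "t < tm a" "tm a < min u (t + \<eta>)" by (rule tm_dense[OF t(1)])
  with \<eta> show ?thesis by (intro that[of a]) auto
qed

lemma osc_right_lim:
  fixes z :: "nat \<Rightarrow> 'e::complete_space"
  assumes z: "regular z" and osc: "osc_le \<tau> T \<epsilon> z"
    and t: "0 \<le> t" "\<tau> i \<le> t" "t < \<tau> (Suc i)" "t < T" and b: "\<tau> i < tm b" "tm b < \<tau> (Suc i)" "tm b \<le> T"
  shows "dist (right_lim z t) (z b) \<le> \<epsilon>"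
proof (rule field_le_epsilon)
  fix e :: real assume e: "0 < e"
  have "t < min (\<tau> (Suc i)) T" using t by simp
  then obtain a where a: "t < tm a" "tm a < min (\<tau> (Suc i)) T" "dist (z a) (right_lim z t) < e"
    by (rule right_lim_approx[OF z t(1) _ e])
  then have "dist (z a) (z b) \<le> \<epsilon>" using t b by (intro osc_leD[OF osc, of i]) auto
  then show "dist (right_lim z t) (z b) \<le> \<epsilon> + e"
    using a(3) dist_triangle[of "right_lim z t" "z b" "z a"] by (simp add: dist_commute)
qed

lemma osc_right_lim2:
  fixes z :: "nat \<Rightarrow> 'e::complete_space"
  assumes z: "regular z" and osc: "osc_le \<tau> T \<epsilon> z"
    and t: "0 \<le> t" "\<tau> i \<le> t" "t < \<tau> (Suc i)" "t < T" and s: "0 \<le> s" "\<tau> i \<le> s" "s < \<tau> (Suc i)" "s < T"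
  shows "dist (right_lim z t) (right_lim z s) \<le> \<epsilon>"
proof (rule field_le_epsilon)
  fix e :: real assume e: "0 < e"
  have "s < min (\<tau> (Suc i)) T" using s by simp
  then obtain a where a: "s < tm a" "tm a < min (\<tau> (Suc i)) T" "dist (z a) (right_lim z s) < e"
    by (rule right_lim_approx[OF z s(1) _ e])
  then have "dist (right_lim z t) (z a) \<le> \<epsilon>" using s by (intro osc_right_lim[OF z osc t]) auto
  then show "dist (right_lim z t) (right_lim z s) \<le> \<epsilon> + e"
    using a(3) dist_triangle[of "right_lim z t" "right_lim z s" "z a"] by simp
qed

definition cadlag_ext :: "(nat \<Rightarrow> 'e::metric_space) \<Rightarrow> real \<Rightarrow> 'e" where
  "cadlag_ext z = restrict (right_lim z) {0..}"

lemma cadlag_ext_apply [simp]: "0 \<le> t \<Longrightarrow> cadlag_ext z t = right_lim z t"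
  by (simp add: cadlag_ext_def)

lemma cadlag_ext_cadlag:
  fixes z :: "nat \<Rightarrow> 'e::complete_space"
  assumes z: "regular z" shows "cadlag_ext z \<in> cadlag_paths"
  unfolding cadlag_paths_def mem_Collect_eq
proof (intro conjI allI impI CollectI)
  show "cadlag_ext z \<in> extensional {0..}" by (simp add: cadlag_ext_def)
next
  fix t :: real assume t: "0 \<le> t"
  show "(cadlag_ext z \<longlongrightarrow> cadlag_ext z t) (at_right t)"
  proof (rule tendstoI)
    fix e :: real assume e: "0 < e"
    then obtain \<delta> B where "\<delta> > 0" "z \<in> Kset \<delta> B (t + 1) (e/2)" using z unfolding regular_def by (meson half_gt_zero)
    then obtain \<tau> where \<tau>: "partition_times \<delta> B \<tau>" "osc_le \<tau> (t + 1) (e/2) z" unfolding Kset_def by blast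
    obtain i where i: "\<tau> i \<le> t" "t < \<tau> (Suc i)" by (rule partition_times_cell[OF \<tau>(1) \<open>\<delta> > 0\<close> t]) (rule that)
    have "dist (cadlag_ext z s) (cadlag_ext z t) < e" if "t < s" "s < min (t + 1) (\<tau> (Suc i))" for s
      using osc_right_lim2[OF z \<tau>(2), of s i t] that t i e by simp
    then show "\<forall>\<^sub>F s in at_right t. dist (cadlag_ext z s) (cadlag_ext z t) < e"
      using i by (intro eventually_at_rightI[of t "min (t + 1) (\<tau> (Suc i))"]) auto
  qed
next
  fix t :: real assume t: "0 < t"
  have window: "\<exists>s0. 0 \<le> s0 \<and> s0 < t \<and> (\<forall>s s'. s0 < s \<longrightarrow> s < t \<longrightarrow> s0 < s' \<longrightarrow> s' < t \<longrightarrow> dist (right_lim z s) (right_lim z s') \<le> \<epsilon>)"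
    if \<epsilon>: "0 < \<epsilon>" for \<epsilon>
  proof -
    obtain \<delta> B where \<delta>: "\<delta> > 0" "z \<in> Kset \<delta> B (t + 1) \<epsilon>" using z \<epsilon> unfolding regular_def by blast
    then obtain \<tau> where \<tau>: "partition_times \<delta> B \<tau>" "osc_le \<tau> (t + 1) \<epsilon> z" unfolding Kset_def by blast
    obtain i where i: "\<tau> i \<le> t" "t < \<tau> (Suc i)" by (rule partition_times_cell[OF \<tau>(1) \<delta>(1) less_imp_le[OF t]]) (rule that)
    \<comment> \<open>A left limit needs a cell that begins strictly before t; if t is a partition
      point, this is the preceding cell.\<close>
    obtain j where j: "\<tau> j < t" "t \<le> \<tau> (Suc j)"
    proof (cases "\<tau> i = t")
      case True
      with t \<tau>(1) have "i \<noteq> 0" by (metis less_irrefl partition_times_def)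
      then obtain k where "i = Suc k" using not0_implies_Suc by blast
      then show ?thesis using that[of k] True partition_times_less[OF \<tau>(1) \<delta>(1), of k] by simp
    next
      case False then show ?thesis using that[of i] i by simp
    qed
    have "0 \<le> \<tau> j"
      by (rule partition_times_nonneg[OF \<tau>(1) less_imp_le[OF \<delta>(1)]])
    have "dist (right_lim z s) (right_lim z s') \<le> \<epsilon>" if "\<tau> j < s" "s < t" "\<tau> j < s'" "s' < t" for s s'
      by (rule osc_right_lim2[OF z \<tau>(2), of s j s']) (use that j \<open>0 \<le> \<tau> j\<close> in linarith)+
    with j \<open>0 \<le> \<tau> j\<close> show ?thesis by blast
  qed
  define s where "s k = t - t / real (k + 2)" for k
  have s: "0 \<le> s k" "s k < t" for k using t by (auto simp: s_def field_simps)
  have s_lim: "s \<longlonglongrightarrow> t"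
  proof -
    have "(\<lambda>k. t - t / real (k + 2)) \<longlonglongrightarrow> t" by real_asymp
    then show ?thesis by (simp add: s_def[abs_def])
  qed
  have "Cauchy (\<lambda>k. right_lim z (s k))"
  proof (rule metric_CauchyI)
    fix e :: real assume e: "0 < e"
    then obtain s0 where s0: "s0 < t" "\<And>u u'. s0 < u \<Longrightarrow> u < t \<Longrightarrow> s0 < u' \<Longrightarrow> u' < t \<Longrightarrow> dist (right_lim z u) (right_lim z u') \<le> e/2"
      using window[of "e/2"] by auto
    obtain N where N: "\<And>k. N \<le> k \<Longrightarrow> s0 < s k"
      using order_tendstoD(1)[OF s_lim s0(1)] by (auto simp: eventually_sequentially)
    have "dist (right_lim z (s m)) (right_lim z (s n)) < e" if "N \<le> m" "N \<le> n" for m n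
      using s0(2)[OF N[OF that(1)] s(2) N[OF that(2)] s(2)] e by linarith
    then show "\<exists>M. \<forall>m\<ge>M. \<forall>n\<ge>M. dist (right_lim z (s m)) (right_lim z (s n)) < e" by blast
  qed
  then obtain l where l: "(\<lambda>k. right_lim z (s k)) \<longlonglongrightarrow> l"
    using Cauchy_convergent convergent_def by blast
  have "(cadlag_ext z \<longlongrightarrow> l) (at_left t)"
  proof (rule tendstoI)
    fix e :: real assume e: "0 < e"
    then obtain s0 where s0: "0 \<le> s0" "s0 < t" "\<And>u u'. s0 < u \<Longrightarrow> u < t \<Longrightarrow> s0 < u' \<Longrightarrow> u' < t \<Longrightarrow> dist (right_lim z u) (right_lim z u') \<le> e/2"
      using window[of "e/2"] by auto
    have "dist (cadlag_ext z u) l < e" if u: "s0 < u" "u < t" for u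
    proof -
      have "\<forall>\<^sub>F k in sequentially. dist (right_lim z u) (right_lim z (s k)) \<le> e/2"
        using order_tendstoD(1)[OF s_lim s0(2)] by eventually_elim (use s0 u s in auto)
      then have "dist (right_lim z u) l \<le> e/2"
        by (intro tendsto_upperbound[OF tendsto_dist[OF tendsto_const l]]) auto
      then show ?thesis using e u s0 by simp
    qed
    then show "\<forall>\<^sub>F u in at_left t. dist (cadlag_ext z u) l < e"
      using s0 by (intro eventually_at_leftI[of s0 t]) auto
  qed
  then show "\<exists>l. (cadlag_ext z \<longlongrightarrow> l) (at_left t)" ..
qed

text \<open>Along a subsequence the partitions of the \<open>x k\<close> converge to a partition for
  z. A time change sends the nodes of the one to those of the other, so that corresponding times lie
  in corresponding cells, and both paths are compared through one rational time \<open>b i\<close>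
  interior to both cells. This costs 2 \<epsilon> plus the difference of the samples at
  \<open>b i\<close>.\<close>

lemma skorokhod_nhd_of_coordinatewise_limit:
  fixes z :: "nat \<Rightarrow> 'e::complete_space"
  assumes x: "\<And>k. x k \<in> Kset \<delta> B T \<epsilon>" "\<And>k. regular (x k)" "\<And>a. (\<lambda>k. x k a) \<longlonglongrightarrow> z a"
    and z: "regular z" and \<delta>: "0 < \<delta>" and T: "0 \<le> T'" "T' < T" and e: "2 * \<epsilon> < e" "0 < e"
  shows "\<exists>k. cadlag_ext (x k) \<in> skorokhod_nhd (cadlag_ext z) T' e"
proof -
  obtain \<tau>0 where \<tau>0: "\<And>k. partition_times \<delta> B (\<tau>0 k)" "\<And>k. osc_le (\<tau>0 k) T \<epsilon> (x k)"
    using x(1) unfolding Kset_def mem_Collect_eq by metis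
  obtain r \<sigma> where r: "strict_mono (r :: nat \<Rightarrow> nat)" and \<sigma>: "partition_times \<delta> B \<sigma>" "\<And>i. (\<lambda>k. \<tau>0 (r k) i) \<longlonglongrightarrow> \<sigma> i"
    by (rule partition_times_subsequence[of \<delta> B \<tau>0, OF \<tau>0(1) less_imp_le[OF \<delta>]]) (rule that)
  define y where "y k = x (r k)" for k
  define \<tau> where "\<tau> k = \<tau>0 (r k)" for k
  have y: "regular (y k)" "(\<lambda>k. y k a) \<longlonglongrightarrow> z a" for k a
    using x(2) LIMSEQ_subseq_LIMSEQ[OF x(3) r, of a] by (auto simp: y_def comp_def)
  have \<tau>: "partition_times \<delta> B (\<tau> k)" "osc_le (\<tau> k) T \<epsilon> (y k)" "(\<lambda>k. \<tau> k i) \<longlonglongrightarrow> \<sigma> i" for k i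
    using \<tau>0 \<sigma> by (auto simp: \<tau>_def y_def)
  have \<sigma>_osc: "osc_le \<sigma> T \<epsilon> z" by (rule osc_le_limit[OF \<tau>(3) y(2) \<tau>(2)])
  \<comment> \<open>\<open>m\<close> gaps of at least \<delta> cover [0, T], so finitely many nodes
    matter. \<open>\<kappa>\<close> is the slack left by the two oscillations, and
    \<open>\<eta>\<close> also keeps the changed time below \<open>T\<close>, where z is
    controlled.\<close>
  obtain m :: nat where m: "T < real m * \<delta>" using reals_Archimedean3[OF \<delta>] by blast
  define \<kappa> where "\<kappa> = e - 2 * \<epsilon>"
  define \<eta> where "\<eta> = min e (T - T')"
  have \<kappa>: "0 < \<kappa>" and \<eta>: "0 < \<eta>" using e T by (auto simp: \<kappa>_def \<eta>_def)
  define b where "b i = (SOME b. \<sigma> i < tm b \<and> tm b < min (\<sigma> (Suc i)) T)" for i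
  have \<sigma>0: "0 \<le> \<sigma> i" for i
    by (rule partition_times_nonneg[OF \<sigma>(1) less_imp_le[OF \<delta>]])
  have b: "\<sigma> i < tm (b i)" "tm (b i) < \<sigma> (Suc i)" "tm (b i) < T" if "\<sigma> i < T" for i
  proof -
    have "\<sigma> i < min (\<sigma> (Suc i)) T" using that partition_times_less[OF \<sigma>(1) \<delta>] by simp
    then obtain a where "\<sigma> i < tm a \<and> tm a < min (\<sigma> (Suc i)) T" by (rule tm_dense[OF \<sigma>0]) blast
    then have "\<sigma> i < tm (b i) \<and> tm (b i) < min (\<sigma> (Suc i)) T" unfolding b_def by (rule someI)
    then show "\<sigma> i < tm (b i)" "tm (b i) < \<sigma> (Suc i)" "tm (b i) < T" by auto
  qed
  have 1: "\<forall>\<^sub>F k in sequentially. \<forall>i\<in>{..m}. \<bar>\<tau> k i - \<sigma> i\<bar> < \<eta>"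
  proof (rule eventually_ball_finite)
    show "\<forall>i\<in>{..m}. \<forall>\<^sub>F k in sequentially. \<bar>\<tau> k i - \<sigma> i\<bar> < \<eta>"
      using tendstoD[OF \<tau>(3) \<eta>] by (simp add: dist_real_def)
  qed simp
  \<comment> \<open>Only cells that begin before \<open>T\<close> contain a time \<open>b i\<close>;
    its strict position in the limiting cell persists for the approximating cells.\<close>
  have 2: "\<forall>\<^sub>F k in sequentially. \<forall>i\<in>{..m}. \<sigma> i < T \<longrightarrow> \<tau> k i < tm (b i) \<and> tm (b i) < \<tau> k (Suc i) \<and> dist (y k (b i)) (z (b i)) < \<kappa>"
  proof (rule eventually_ball_finite, simp, intro ballI)
    fix i
    show "\<forall>\<^sub>F k in sequentially. \<sigma> i < T \<longrightarrow> \<tau> k i < tm (b i) \<and> tm (b i) < \<tau> k (Suc i) \<and> dist (y k (b i)) (z (b i)) < \<kappa>"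
    proof (cases "\<sigma> i < T")
      case True
      have "\<forall>\<^sub>F k in sequentially. \<tau> k i < tm (b i) \<and> tm (b i) < \<tau> k (Suc i) \<and> dist (y k (b i)) (z (b i)) < \<kappa>"
        by (intro eventually_conj order_tendstoD[OF \<tau>(3)] tendstoD[OF y(2) \<kappa>] b[OF True])
      then show ?thesis by eventually_elim simp
    qed simp
  qed
  obtain k where k1: "\<And>i. i \<le> m \<Longrightarrow> \<bar>\<tau> k i - \<sigma> i\<bar> < \<eta>"
    and k2: "\<And>i. i \<le> m \<Longrightarrow> \<sigma> i < T \<Longrightarrow> \<tau> k i < tm (b i) \<and> tm (b i) < \<tau> k (Suc i) \<and> dist (y k (b i)) (z (b i)) < \<kappa>"
    using eventually_happens'[OF sequentially_bot eventually_conj[OF 1 2]] by auto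
  obtain l where l: "l \<in> time_changes" "\<And>i. i \<le> m \<Longrightarrow> l (\<tau> k i) = \<sigma> i" "\<And>t. 0 \<le> t \<Longrightarrow> \<bar>l t - t\<bar> < \<eta>"
    using time_change_interpolation[of "\<tau> k" \<sigma> m \<eta>] \<tau>(1)[of k] \<sigma>(1) partition_times_less[OF \<tau>(1) \<delta>, of k]
      partition_times_less[OF \<sigma>(1) \<delta>] k1 by (auto simp: partition_times_def)
  have l_mono: "l s \<le> l t" if "0 \<le> s" "s \<le> t" for s t
    using l(1) that by (cases "s = t") (auto simp: time_changes_def strict_mono_on_def less_imp_le)
  have l_less: "l s < l t" if "0 \<le> s" "s < t" for s t
    using l(1) that by (auto simp: time_changes_def strict_mono_on_def)
  have "cadlag_ext (y k) \<in> skorokhod_nhd (cadlag_ext z) T' e"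
    unfolding skorokhod_nhd_def mem_Collect_eq
  proof (intro conjI bexI[OF _ l(1)] ballI)
    show "cadlag_ext (y k) \<in> cadlag_paths" by (rule cadlag_ext_cadlag[OF y(1)])
    fix t assume "t \<in> {0..T'}"
    then have t: "0 \<le> t" "t \<le> T'" by auto
    show "\<bar>l t - t\<bar> < e" using l(3)[OF t(1)] by (simp add: \<eta>_def)
    have lt: "0 \<le> l t" "l t < T"
      using l(1) t l(3)[OF t(1)] by (auto simp: time_changes_def \<eta>_def)
    obtain i where i: "\<tau> k i \<le> t" "t < \<tau> k (Suc i)" by (rule partition_times_cell[OF \<tau>(1) \<delta> t(1)]) (rule that)
    have \<tau>0i: "0 \<le> \<tau> k i" for i
      by (rule partition_times_nonneg[OF \<tau>(1) less_imp_le[OF \<delta>]])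
    have im: "Suc i \<le> m"
    proof (rule ccontr)
      assume "\<not> Suc i \<le> m"
      then have "real m * \<delta> \<le> real i * \<delta>" using \<delta> by (intro mult_right_mono) auto
      then show False using partition_times_lower[OF \<tau>(1), of i k] i(1) m t T by linarith
    qed
    have li: "\<sigma> i \<le> l t" "l t < \<sigma> (Suc i)"
      using l_mono[OF \<tau>0i i(1)] l_less[OF t(1) i(2)] l(2)[of i] l(2)[of "Suc i"] im by auto
    have \<sigma>T: "\<sigma> i < T" using li lt by simp
    note bi = b[OF \<sigma>T] and k2i = k2[OF _ \<sigma>T]
    have "dist (right_lim (y k) t) (y k (b i)) \<le> \<epsilon>"
      using i t T bi k2i im by (intro osc_right_lim[OF y(1) \<tau>(2), of t k i]) auto
    moreover have "dist (right_lim z (l t)) (z (b i)) \<le> \<epsilon>"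
      using li lt bi by (intro osc_right_lim[OF z \<sigma>_osc, of "l t" i]) auto
    moreover have "dist (y k (b i)) (z (b i)) < \<kappa>" using k2i im by simp
    ultimately have "dist (right_lim (y k) t) (right_lim z (l t)) < e"
      using dist_triangle[of "right_lim (y k) t" "right_lim z (l t)" "y k (b i)"]
        dist_triangle[of "y k (b i)" "right_lim z (l t)" "z (b i)"]
      by (simp add: \<kappa>_def dist_commute)
    then show "dist (cadlag_ext (y k) t) (cadlag_ext z (l t)) < e" using t lt by simp
  qed
  then show ?thesis by (auto simp: y_def)
qed

text \<open>On \<open>Kinf\<close>, a compact set of regular sample functions when the state space is compact,
  the extension to cadlag paths is continuous.\<close>

definition Kinf :: "(nat \<Rightarrow> real) \<Rightarrow> (nat \<Rightarrow> real) \<Rightarrow> (nat \<Rightarrow> 'e::metric_space) set" where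
  "Kinf \<delta> B = (\<Inter>j. Kset (\<delta> j) (B j) (real j) (1 / real (Suc j)))"

lemma closed_Kinf: "(\<And>j. 0 < \<delta> j) \<Longrightarrow> closed (Kinf \<delta> B)"
  unfolding Kinf_def by (intro closed_INT ballI closed_Kset) (auto intro: less_imp_le)

lemma Kinf_Kset:
  assumes "0 < \<epsilon>"
  obtains j where "T \<le> real j" "1 / real (Suc j) \<le> \<epsilon>"
proof -
  obtain a :: nat where a: "T \<le> real a" using real_arch_simple by blast
  obtain b :: nat where b: "1 / \<epsilon> \<le> real b" using real_arch_simple by blast
  have "1 / \<epsilon> \<le> real (Suc (max a b))" using b by simp
  then have "1 / real (Suc (max a b)) \<le> \<epsilon>" using assms by (simp add: field_simps)
  then show ?thesis using a by (intro that[of "max a b"]) auto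
qed

lemma Kinf_regular:
  assumes "\<And>j. 0 < \<delta> j" "z \<in> Kinf \<delta> B" shows "regular z"
  unfolding regular_def
proof (intro allI impI)
  fix \<epsilon> T :: real assume "0 < \<epsilon>"
  then obtain j where j: "T \<le> real j" "1 / real (Suc j) \<le> \<epsilon>" by (rule Kinf_Kset)
  have "z \<in> Kset (\<delta> j) (B j) (real j) (1 / real (Suc j))" using assms(2) by (auto simp: Kinf_def)
  then have "z \<in> Kset (\<delta> j) (B j) T \<epsilon>" using Kset_mono[OF j] by blast
  then show "\<exists>\<delta>>0. \<exists>B. z \<in> Kset \<delta> B T \<epsilon>" using assms(1) by blast
qed

text \<open>\<open>skorokhod_nhd_of_coordinatewise_limit\<close> yields a single good index. Applied
  to a subsequence of bad indices it gives a contradiction, so all late indices are good.\<close>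

lemma cadlag_ext_eventually_nhd:
  fixes z :: "nat \<Rightarrow> 'e::complete_space"
  assumes \<delta>: "\<And>j. 0 < \<delta> j" and x: "\<And>k. x k \<in> Kinf \<delta> B" "x \<longlonglongrightarrow> z" and e: "0 < e" and T: "0 \<le> T"
  shows "\<forall>\<^sub>F k in sequentially. cadlag_ext (x k) \<in> skorokhod_nhd (cadlag_ext z) T e"
proof (rule ccontr)
  assume "\<not> ?thesis"
  then have inf: "\<exists>k\<ge>N. cadlag_ext (x k) \<notin> skorokhod_nhd (cadlag_ext z) T e" for N
    by (auto simp: eventually_sequentially)
  then have "infinite {k. cadlag_ext (x k) \<notin> skorokhod_nhd (cadlag_ext z) T e}"
    by (simp add: infinite_nat_iff_unbounded_le)
  then obtain r :: "nat \<Rightarrow> nat" where r: "strict_mono r" "\<And>k. cadlag_ext (x (r k)) \<notin> skorokhod_nhd (cadlag_ext z) T e"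
    using infinite_enumerate by blast
  have z: "z \<in> Kinf \<delta> B"
    by (rule closed_sequentially[OF closed_Kinf[of \<delta> B, OF \<delta>] _ x(2)]) (use x(1) in blast)
  obtain j where j: "T + 1 \<le> real j" "1 / real (Suc j) \<le> e / 3" using Kinf_Kset[of "e/3" "T + 1"] e by auto
  have "\<exists>k. cadlag_ext (x (r k)) \<in> skorokhod_nhd (cadlag_ext z) T e"
  proof (rule skorokhod_nhd_of_coordinatewise_limit)
    show "x (r k) \<in> Kset (\<delta> j) (B j) (real j) (1 / real (Suc j))" for k
      using x(1)[of "r k"] by (auto simp: Kinf_def)
    show "regular (x (r k))" for k by (rule Kinf_regular[of \<delta>, OF \<delta> x(1)])
    show "regular z" by (rule Kinf_regular[of \<delta>, OF \<delta> z])
    show "(\<lambda>k. x (r k) a) \<longlonglongrightarrow> z a" for a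
      using tendsto_coordinate[OF LIMSEQ_subseq_LIMSEQ[OF x(2) r(1)], of a] by (simp add: comp_def)
  qed (use j e T \<delta> in auto)
  with r(2) show False by blast
qed

text \<open>Continuity of the extension on \<open>Kinf\<close>, stated through preimages. It makes
  Skorokhod-open events measurable for the limit and for the chains.\<close>

lemma closed_Kinf_preimage:
  fixes V :: "(real \<Rightarrow> 'e::complete_space) set"
  assumes \<delta>: "\<And>j. 0 < \<delta> j" and V: "skorokhod_open V"
  shows "closed {z \<in> Kinf \<delta> B. cadlag_ext z \<notin> V}"
  unfolding closed_sequential_limits
proof (intro allI impI, elim conjE)
  fix x and z :: "nat \<Rightarrow> 'e" assume x: "\<forall>n. x n \<in> {z \<in> Kinf \<delta> B. cadlag_ext z \<notin> V}" "x \<longlonglongrightarrow> z"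
  then have z: "z \<in> Kinf \<delta> B"
    using closed_Kinf[of \<delta> B, OF \<delta>] unfolding closed_sequential_limits by blast
  have "cadlag_ext z \<notin> V"
  proof
    assume "cadlag_ext z \<in> V"
    then obtain T e where "T > 0" "e > 0" "skorokhod_nhd (cadlag_ext z) T e \<subseteq> V"
      using V unfolding skorokhod_open_def by blast
    moreover have "\<forall>\<^sub>F k in sequentially. cadlag_ext (x k) \<in> skorokhod_nhd (cadlag_ext z) T e"
      by (rule cadlag_ext_eventually_nhd[of \<delta>, OF \<delta>]) (use x \<open>T > 0\<close> \<open>e > 0\<close> in auto)
    ultimately have "\<forall>\<^sub>F k in sequentially. cadlag_ext (x k) \<in> V" by (auto elim: eventually_mono)
    then show False using x(1) eventually_happens'[OF sequentially_bot] by blast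
  qed
  with z show "z \<in> {z \<in> Kinf \<delta> B. cadlag_ext z \<notin> V}" by blast
qed

lemma continuous_on_Kinf:
  fixes \<phi> :: "(real \<Rightarrow> 'e::complete_space) \<Rightarrow> real"
  assumes \<delta>: "\<And>j. 0 < \<delta> j" and \<phi>: "continuous_map skorokhod_topology euclideanreal \<phi>"
  shows "continuous_on (Kinf \<delta> B) (\<lambda>z. \<phi> (cadlag_ext z))"
  unfolding continuous_on_sequentially
proof (intro allI ballI impI, elim conjE)
  fix x and z :: "nat \<Rightarrow> 'e" assume z: "z \<in> Kinf \<delta> B" and x: "\<forall>n. x n \<in> Kinf \<delta> B" "x \<longlonglongrightarrow> z"
  show "((\<lambda>z. \<phi> (cadlag_ext z)) \<circ> x) \<longlonglongrightarrow> \<phi> (cadlag_ext z)"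
  proof (rule tendstoI)
    fix e :: real assume e: "0 < e"
    define V where "V = {y \<in> cadlag_paths. \<phi> y \<in> ball (\<phi> (cadlag_ext z)) e}"
    have "openin skorokhod_topology V"
      using openin_continuous_map_preimage[OF \<phi>, of "ball (\<phi> (cadlag_ext z)) e"]
      by (simp add: V_def topspace_skorokhod)
    then have V: "skorokhod_open V" by (simp add: openin_skorokhod)
    have "cadlag_ext z \<in> V"
      using cadlag_ext_cadlag[OF Kinf_regular[of \<delta>, OF \<delta> z]] e by (simp add: V_def)
    then obtain T d where "T > 0" "d > 0" and sub: "skorokhod_nhd (cadlag_ext z) T d \<subseteq> V"
      using V unfolding skorokhod_open_def by blast
    have "\<forall>\<^sub>F k in sequentially. cadlag_ext (x k) \<in> skorokhod_nhd (cadlag_ext z) T d"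
      by (rule cadlag_ext_eventually_nhd[of \<delta>, OF \<delta>]) (use x \<open>T > 0\<close> \<open>d > 0\<close> in auto)
    then show "\<forall>\<^sub>F k in sequentially. dist (((\<lambda>z. \<phi> (cadlag_ext z)) \<circ> x) k) (\<phi> (cadlag_ext z)) < e"
      by eventually_elim (use sub in \<open>auto simp: V_def dist_commute\<close>)
  qed
qed

section \<open>Exit times\<close>

locale finite_kernel =
  fixes Z :: "'s set" and p :: "'s \<Rightarrow> 's \<Rightarrow> real" and e :: "'s \<Rightarrow> 'e::metric_space"
  assumes stoch_p: "stochastic_matrix Z Z p"
begin

lemma p_nonneg: "x \<in> Z \<Longrightarrow> y \<in> Z \<Longrightarrow> 0 \<le> p x y"
  using stoch_p by (simp add: stochastic_matrix_def)

lemma p_sum: "x \<in> Z \<Longrightarrow> (\<Sum>y\<in>Z. p x y) = 1"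
  using stoch_p by (simp add: stochastic_matrix_def)

lemma p_average_le:
  assumes "x \<in> Z" "\<And>y. y \<in> Z \<Longrightarrow> f y \<le> B" shows "(\<Sum>y\<in>Z. p x y * f y) \<le> B"
proof -
  have "(\<Sum>y\<in>Z. p x y * f y) \<le> (\<Sum>y\<in>Z. p x y * B)"
    using assms p_nonneg by (intro sum_mono mult_left_mono) auto
  then show ?thesis by (simp add: p_sum[OF assms(1)] flip: sum_distrib_right)
qed

text \<open>For the chain started in \<open>x\<close>: the probability to leave the ball of radius \<open>r\<close> around \<open>a\<close>
  within \<open>m\<close> steps, and the expectation of \<open>\<beta>\<close> to the power of the exit time if that is at most
  \<open>m\<close> (and \<open>0\<close> otherwise).\<close>

primrec exit_prob :: "real \<Rightarrow> nat \<Rightarrow> 'e \<Rightarrow> 's \<Rightarrow> real" where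
  "exit_prob r 0 a x = 0"
| "exit_prob r (Suc m) a x = (\<Sum>y\<in>Z. p x y * (if r \<le> dist a (e y) then 1 else exit_prob r m a y))"

primrec exit_discount :: "real \<Rightarrow> real \<Rightarrow> nat \<Rightarrow> 'e \<Rightarrow> 's \<Rightarrow> real" where
  "exit_discount \<beta> r 0 a x = 0"
| "exit_discount \<beta> r (Suc m) a x = \<beta> * (\<Sum>y\<in>Z. p x y * (if r \<le> dist a (e y) then 1 else exit_discount \<beta> r m a y))"

definition far :: "real \<Rightarrow> 'e \<Rightarrow> 's \<Rightarrow> real" where
  "far r a y = (if y \<in> Z \<and> r \<le> dist a (e y) then 1 else 0)"

lemma exit_prob_nonneg: "x \<in> Z \<Longrightarrow> 0 \<le> exit_prob r m a x"
  by (induction m arbitrary: x) (auto intro!: sum_nonneg mult_nonneg_nonneg p_nonneg)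

lemma exit_discount_le_1:
  assumes "0 \<le> \<beta>" "\<beta> \<le> 1" shows "x \<in> Z \<Longrightarrow> exit_discount \<beta> r m a x \<le> 1"
proof (induction m arbitrary: x)
  case (Suc m)
  have "(\<Sum>y\<in>Z. p x y * (if r \<le> dist a (e y) then 1 else exit_discount \<beta> r m a y)) \<le> 1"
    using Suc by (intro p_average_le) auto
  from mult_left_mono[OF this assms(1)] show ?case
    using assms(2) by simp
qed simp

text \<open>Ottaviani's inequality: from the point of exit, which is at distance \<open>r\<close> from \<open>a\<close>, the
  chain moves by less than \<open>r/2\<close> with probability at least \<open>1 - \<alpha>\<close>.\<close>

lemma exit_prob_le_far:
  assumes \<alpha>: "\<And>j y. j \<le> m \<Longrightarrow> y \<in> Z \<Longrightarrow> (matrix_op Z Z p ^^ j) (far (r/2) (e y)) y \<le> \<alpha>"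
  shows "x \<in> Z \<Longrightarrow> (1 - \<alpha>) * exit_prob r m a x \<le> (matrix_op Z Z p ^^ m) (far (r/2) a) x"
  using assms
proof (induction m arbitrary: x)
  case 0 then show ?case by (simp add: far_def)
next
  case (Suc m)
  have one: "(matrix_op Z Z p ^^ m) (indicator Z) = indicator Z"
    by (induction m) (simp_all add: matrix_op_one[OF stoch_p])
  have mono: "(matrix_op Z Z p ^^ m) f y \<le> (matrix_op Z Z p ^^ m) g y" if "\<And>y. y \<in> Z \<Longrightarrow> f y \<le> g y" "y \<in> Z" for f g y
    using that by (induction m arbitrary: y) (auto intro!: matrix_op_mono[OF stoch_p])
  have add: "(matrix_op Z Z p ^^ m) (\<lambda>x. f x + g x) y = (matrix_op Z Z p ^^ m) f y + (matrix_op Z Z p ^^ m) g y" if "y \<in> Z" for f g y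
  proof -
    have "matrix_op Z Z p (\<lambda>x. f x + g x) = (\<lambda>x. matrix_op Z Z p f x + matrix_op Z Z p g x)" for f g :: "'s \<Rightarrow> real"
      by (auto simp: matrix_op_def fun_eq_iff sum.distrib algebra_simps)
    then have "(matrix_op Z Z p ^^ m) (\<lambda>x. f x + g x) = (\<lambda>x. (matrix_op Z Z p ^^ m) f x + (matrix_op Z Z p ^^ m) g x)"
      by (induction m) auto
    then show ?thesis by simp
  qed
  have key: "(1 - \<alpha>) * (if r \<le> dist a (e y) then 1 else exit_prob r m a y) \<le> (matrix_op Z Z p ^^ m) (far (r/2) a) y"
    if y: "y \<in> Z" for y
  proof (cases "r \<le> dist a (e y)")
    case True
    \<comment> \<open>No point is within r/2 of both \<open>a\<close> and \<open>e y\<close> when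
      these are at least r apart.\<close>
    have "indicator Z z \<le> far (r/2) a z + far (r/2) (e y) z" if "z \<in> Z" for z
      using True dist_triangle[of a "e y" "e z"] that by (auto simp: far_def indicator_def dist_commute)
    then have "(matrix_op Z Z p ^^ m) (indicator Z) y \<le> (matrix_op Z Z p ^^ m) (\<lambda>z. far (r/2) a z + far (r/2) (e y) z) y"
      by (intro mono y)
    then have "1 \<le> (matrix_op Z Z p ^^ m) (far (r/2) a) y + (matrix_op Z Z p ^^ m) (far (r/2) (e y)) y"
      using y by (simp add: one add)
    then show ?thesis using True Suc.prems(2)[of m y] y by simp
  next
    case False
    then show ?thesis using Suc.IH[OF y] Suc.prems(2) by simp
  qed
  have "(1 - \<alpha>) * exit_prob r (Suc m) a x = (\<Sum>y\<in>Z. p x y * ((1 - \<alpha>) * (if r \<le> dist a (e y) then 1 else exit_prob r m a y)))"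
    by (simp add: sum_distrib_left mult.left_commute)
  also have "\<dots> \<le> (\<Sum>y\<in>Z. p x y * (matrix_op Z Z p ^^ m) (far (r/2) a) y)"
    by (intro sum_mono mult_left_mono key p_nonneg Suc.prems(1))
  also have "\<dots> = (matrix_op Z Z p ^^ Suc m) (far (r/2) a) x"
    using Suc.prems(1) by (simp add: matrix_op_def)
  finally show ?case .
qed

lemma exit_prob_bound:
  assumes \<alpha>: "\<And>j y. j \<le> m \<Longrightarrow> y \<in> Z \<Longrightarrow> (matrix_op Z Z p ^^ j) (far (r/2) (e y)) y \<le> \<alpha>"
    and "\<alpha> < 1" "y \<in> Z"
  shows "exit_prob r m (e y) y \<le> \<alpha> / (1 - \<alpha>)"
proof -
  have "(1 - \<alpha>) * exit_prob r m (e y) y \<le> \<alpha>"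
    by (rule order_trans[OF exit_prob_le_far[OF \<alpha> assms(3)] \<alpha>[OF order_refl assms(3)]])
  then show ?thesis using assms(2) by (simp add: field_simps)
qed

text \<open>Split according to whether the exit happens within m steps: if so the discount is at
  most 1, otherwise at most \<beta>^m. The bound holds for every horizon \<open>L\<close>.\<close>

lemma exit_discount_le_exit_prob:
  assumes \<beta>: "0 \<le> \<beta>" "\<beta> \<le> 1"
  shows "x \<in> Z \<Longrightarrow> exit_discount \<beta> r L a x \<le> exit_prob r m a x + \<beta> ^ m"
proof (induction m arbitrary: L x)
  case 0
  then show ?case using exit_discount_le_1[OF \<beta> 0] by simp
next
  case (Suc m)
  show ?case
  proof (cases L)
    case 0
    then show ?thesis using exit_prob_nonneg[OF Suc.prems] \<beta>
      by (simp add: add_nonneg_nonneg del: exit_prob.simps(2) power_Suc)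
  next
    case (Suc L')
    have "exit_discount \<beta> r L a x \<le> (\<Sum>y\<in>Z. p x y * (\<beta> * (if r \<le> dist a (e y) then 1 else exit_prob r m a y + \<beta> ^ m)))"
      unfolding Suc exit_discount.simps sum_distrib_left
      using Suc.IH Suc.prems \<beta> by (auto intro!: sum_mono mult_left_mono p_nonneg simp: mult.left_commute[of \<beta>])
    also have "\<dots> \<le> (\<Sum>y\<in>Z. p x y * ((if r \<le> dist a (e y) then 1 else exit_prob r m a y) + \<beta> ^ Suc m))"
    proof (intro sum_mono mult_left_mono p_nonneg Suc.prems)
      fix y assume y: "y \<in> Z"
      have "\<beta> * exit_prob r m a y \<le> 1 * exit_prob r m a y"
        using \<beta> exit_prob_nonneg[OF y] by (intro mult_right_mono) auto
      then show "\<beta> * (if r \<le> dist a (e y) then 1 else exit_prob r m a y + \<beta> ^ m) \<le> (if r \<le> dist a (e y) then 1 else exit_prob r m a y) + \<beta> ^ Suc m"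
        using \<beta> by (auto simp: algebra_simps intro: add_increasing2)
    qed auto
    also have "\<dots> = exit_prob r (Suc m) a x + \<beta> ^ Suc m"
      by (simp add: distrib_left sum.distrib p_sum[OF Suc.prems] flip: sum_distrib_right)
    finally show ?thesis .
  qed
qed

text \<open>\<open>short_exit r G a g w\<close>: along the word \<open>w\<close>, cut at the successive exits from the balls of
  radius \<open>r\<close> around the last exit points, some exit takes less than \<open>G\<close> steps; \<open>a\<close> is the current
  centre and \<open>g\<close> the number of steps since it was reached.\<close>

primrec short_exit :: "real \<Rightarrow> nat \<Rightarrow> 'e \<Rightarrow> nat \<Rightarrow> 's list \<Rightarrow> bool" where
  "short_exit r G a g [] = False"
| "short_exit r G a g (y # w) =
    (if r \<le> dist a (e y) then Suc g < G \<or> short_exit r G (e y) 0 w else short_exit r G a (Suc g) w)"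

lemma word_op_le_1: "x \<in> Z \<Longrightarrow> (\<And>w. G w \<le> 1) \<Longrightarrow> word_op Z p L G x \<le> 1"
proof (induction L arbitrary: x G)
  case (Suc L)
  then show ?case by (auto intro!: p_average_le)
qed simp

text \<open>A sum over exits: by Markov's inequality the k-th exit happens within L steps with
  probability at most (3/4)^k / \<beta>^L if the start is a centre, and the next exit is short, that
  is, takes at most \<open>G - 1\<close> steps, with probability at most \<gamma>. The geometric
  series has sum 4. The recursion encodes it, keeping apart the current exit, for which
  \<open>g\<close> steps have already elapsed.\<close>

lemma short_exit_prob:
  assumes \<beta>: "0 < \<beta>" "\<beta> \<le> 1" and \<gamma>: "0 \<le> \<gamma>" "\<And>y. y \<in> Z \<Longrightarrow> exit_prob r (G - 1) (e y) y \<le> \<gamma>"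
    and disc: "\<And>L y. y \<in> Z \<Longrightarrow> exit_discount \<beta> r L (e y) y \<le> 3/4"
  shows "x \<in> Z \<Longrightarrow> word_op Z p L (\<lambda>w. of_bool (short_exit r G a g w)) x \<le>
    exit_prob r (G - 1 - g) a x + 4 * \<gamma> / \<beta> ^ L * exit_discount \<beta> r L a x"
proof (induction L arbitrary: a g x)
  case 0
  then show ?case using exit_prob_nonneg by simp
next
  case (Suc L)
  let ?C = "4 * \<gamma> / \<beta> ^ L"
  have "\<beta> ^ L \<le> 1" "0 < \<beta> ^ L" using \<beta> by (auto intro: power_le_one)
  then have C: "4 * \<gamma> \<le> ?C" "0 \<le> ?C" using \<gamma>(1) by (auto simp: le_divide_eq mult_left_le)
  \<comment> \<open>\<open>ex y\<close> is the probability, given that the next state is y, that the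
    current exit is short.\<close>
  define ex where "ex y = (if Suc g < G then (if r \<le> dist a (e y) then 1 else exit_prob r (G - 1 - Suc g) a y) else 0)" for y
  have ex: "exit_prob r (G - 1 - g) a x = (\<Sum>y\<in>Z. p x y * ex y)"
  proof (cases "Suc g < G")
    case True
    then have "G - 1 - g = Suc (G - 1 - Suc g)" by simp
    then have "exit_prob r (G - 1 - g) a x = exit_prob r (Suc (G - 1 - Suc g)) a x" by (rule arg_cong)
    also have "\<dots> = (\<Sum>y\<in>Z. p x y * ex y)"
      unfolding exit_prob.simps ex_def using True by (intro sum.cong refl) (simp only: if_True)
    finally show ?thesis .
  next
    case False
    then have "G - 1 - g = 0" by simp
    then show ?thesis using False by (simp add: ex_def)
  qed
  have key: "word_op Z p L (\<lambda>w. of_bool (short_exit r G a g (y # w))) y \<le>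
      ex y + ?C * (if r \<le> dist a (e y) then 1 else exit_discount \<beta> r L a y)" if y: "y \<in> Z" for y
  proof (cases "r \<le> dist a (e y)")
    case True
    show ?thesis
    proof (cases "Suc g < G")
      case g: True
      have "word_op Z p L (\<lambda>w. of_bool (short_exit r G a g (y # w))) y \<le> 1"
        by (rule word_op_le_1[OF y]) simp
      then show ?thesis using True g C by (simp add: ex_def)
    next
      case g: False
      have "word_op Z p L (\<lambda>w. of_bool (short_exit r G (e y) 0 w)) y \<le> exit_prob r (G - 1) (e y) y + ?C * exit_discount \<beta> r L (e y) y"
        using Suc.IH[OF y, of "e y" 0] by simp
      \<comment> \<open>The series closes up here: a fresh start costs \<gamma> plus three quarters
        of \<open>?C\<close>, and \<open>?C\<close> is at least 4 \<gamma>.\<close>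
      also have "\<dots> \<le> \<gamma> + ?C * (3/4)"
        using C by (intro add_mono mult_left_mono \<gamma>(2) disc y) auto
      also have "\<dots> \<le> ?C" using C by simp
      finally show ?thesis using True g by (simp add: ex_def)
    qed
  next
    case False
    have "word_op Z p L (\<lambda>w. of_bool (short_exit r G a (Suc g) w)) y \<le> exit_prob r (G - 1 - Suc g) a y + ?C * exit_discount \<beta> r L a y"
      by (rule Suc.IH[OF y])
    then show ?thesis using False by (auto simp: ex_def)
  qed
  have "word_op Z p (Suc L) (\<lambda>w. of_bool (short_exit r G a g w)) x \<le>
      (\<Sum>y\<in>Z. p x y * (ex y + ?C * (if r \<le> dist a (e y) then 1 else exit_discount \<beta> r L a y)))"
    unfolding word_op.simps by (intro sum_mono mult_left_mono key p_nonneg Suc.prems)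
  also have "\<dots> = exit_prob r (G - 1 - g) a x + ?C * (\<Sum>y\<in>Z. p x y * (if r \<le> dist a (e y) then 1 else exit_discount \<beta> r L a y))"
    unfolding ex by (simp only: distrib_left sum.distrib sum_distrib_left mult.left_commute)
  also have "?C * (\<Sum>y\<in>Z. p x y * (if r \<le> dist a (e y) then 1 else exit_discount \<beta> r L a y)) = 4 * \<gamma> / \<beta> ^ Suc L * exit_discount \<beta> r (Suc L) a x"
    using \<beta> by simp
  finally show ?case .
qed

lemma short_exit_first:
  "\<not> short_exit r G a g w \<Longrightarrow> (\<forall>y\<in>set w. dist a (e y) < r) \<or>
    (\<exists>u y v. w = u @ y # v \<and> (\<forall>z\<in>set u. dist a (e z) < r) \<and> G \<le> g + length u + 1 \<and> \<not> short_exit r G (e y) 0 v)"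
proof (induction w arbitrary: g)
  case (Cons y w)
  show ?case
  proof (cases "r \<le> dist a (e y)")
    case True
    with Cons.prems have "y # w = [] @ y # w \<and> (\<forall>z\<in>set []. dist a (e z) < r) \<and> G \<le> g + length [] + 1 \<and> \<not> short_exit r G (e y) 0 w"
      by auto
    then show ?thesis by blast
  next
    case False
    with Cons.prems have "\<not> short_exit r G a (Suc g) w" by simp
    from Cons.IH[OF this] show ?thesis
    proof
      assume "\<exists>u y' v. w = u @ y' # v \<and> (\<forall>z\<in>set u. dist a (e z) < r) \<and> G \<le> Suc g + length u + 1 \<and> \<not> short_exit r G (e y') 0 v"
      then obtain u y' v where "w = u @ y' # v" "\<forall>z\<in>set u. dist a (e z) < r" "G \<le> Suc g + length u + 1" "\<not> short_exit r G (e y') 0 v"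
        by blast
      then have "y # w = (y # u) @ y' # v \<and> (\<forall>z\<in>set (y # u). dist a (e z) < r) \<and> G \<le> g + length (y # u) + 1 \<and> \<not> short_exit r G (e y') 0 v"
        using False by auto
      then show ?thesis by blast
    qed (use False in auto)
  qed
qed simp

text \<open>Recursion over the exits by \<open>short_exit_first\<close>: each exit index becomes a
  node, and the absence of short exits is the gap of at least \<open>G\<close>.\<close>

lemma no_short_exit_partition:
  assumes "0 < r" "\<not> short_exit r G (e x) 0 w"
  shows "\<exists>\<sigma> :: nat \<Rightarrow> nat. \<sigma> 0 = 0 \<and> (\<forall>i. \<sigma> i + G \<le> \<sigma> (Suc i) \<and> \<sigma> (Suc i) \<le> \<sigma> i + (length w + 1 + G)) \<and>
    (\<forall>i k. \<sigma> i \<le> k \<longrightarrow> k < \<sigma> (Suc i) \<longrightarrow> k \<le> length w \<longrightarrow> dist (e ((x # w) ! \<sigma> i)) (e ((x # w) ! k)) < r)"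
  using assms(2)
proof (induction "length w" arbitrary: w x rule: less_induct)
  case less
  from short_exit_first[OF less.prems] show ?case
  proof
    assume all: "\<forall>y\<in>set w. dist (e x) (e y) < r"
    \<comment> \<open>No exit is left, so all further nodes are placed beyond the word; the summand
      \<open>G\<close> provides the minimal gap even if the final stretch is shorter.\<close>
    define \<sigma> where "\<sigma> i = i * (length w + 1 + G)" for i :: nat
    have "dist (e ((x # w) ! \<sigma> i)) (e ((x # w) ! k)) < r" if k: "\<sigma> i \<le> k" "k < \<sigma> (Suc i)" "k \<le> length w" for i k
    proof -
      have "i = 0"
      proof (rule ccontr)
        assume "i \<noteq> 0"
        then have "1 * (length w + 1 + G) \<le> \<sigma> i" unfolding \<sigma>_def by (intro mult_right_mono) auto
        then show False using k by simp
      qed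
      then show ?thesis using k all assms(1) by (cases k) (auto simp: \<sigma>_def)
    qed
    then show ?thesis by (intro exI[of _ \<sigma>]) (auto simp: \<sigma>_def)
  next
    assume "\<exists>u y v. w = u @ y # v \<and> (\<forall>z\<in>set u. dist (e x) (e z) < r) \<and> G \<le> 0 + length u + 1 \<and> \<not> short_exit r G (e y) 0 v"
    then obtain u y v where w: "w = u @ y # v" and u: "\<forall>z\<in>set u. dist (e x) (e z) < r" and G: "G \<le> length u + 1"
      and v: "\<not> short_exit r G (e y) 0 v" by auto
    obtain \<sigma> :: "nat \<Rightarrow> nat" where \<sigma>: "\<sigma> 0 = 0" "\<And>i. \<sigma> i + G \<le> \<sigma> (Suc i)" "\<And>i. \<sigma> (Suc i) \<le> \<sigma> i + (length v + 1 + G)"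
      "\<And>i k. \<sigma> i \<le> k \<Longrightarrow> k < \<sigma> (Suc i) \<Longrightarrow> k \<le> length v \<Longrightarrow> dist (e ((y # v) ! \<sigma> i)) (e ((y # v) ! k)) < r"
      using less.hyps[OF _ v] by (auto simp: w)
    define \<sigma>' where "\<sigma>' i = (case i of 0 \<Rightarrow> 0 | Suc j \<Rightarrow> length u + 1 + \<sigma> j)" for i
    have \<sigma>'_simps: "\<sigma>' 0 = 0" "\<And>j. \<sigma>' (Suc j) = length u + 1 + \<sigma> j" by (simp_all add: \<sigma>'_def)
    have nth: "(x # w) ! (length u + 1 + k) = (y # v) ! k" for k
      by (simp add: w nth_append)
    have d: "dist (e ((x # w) ! \<sigma>' i)) (e ((x # w) ! k)) < r" if k: "\<sigma>' i \<le> k" "k < \<sigma>' (Suc i)" "k \<le> length w" for i k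
    proof (cases i)
      case 0
      then have "k < length u + 1" using k \<sigma>(1) by (simp add: \<sigma>'_simps)
      then show ?thesis using 0 u assms(1) by (cases k) (auto simp: \<sigma>'_simps w nth_append)
    next
      case (Suc j)
      then obtain k' where k': "k = length u + 1 + k'" using k by (metis \<sigma>'_simps(2) le_iff_add add.assoc)
      then have "dist (e ((y # v) ! \<sigma> j)) (e ((y # v) ! k')) < r"
        using k Suc by (intro \<sigma>(4)) (auto simp: \<sigma>'_simps w)
      then show ?thesis unfolding Suc \<sigma>'_simps k' nth .
    qed
    have gaps: "\<sigma>' i + G \<le> \<sigma>' (Suc i)" "\<sigma>' (Suc i) \<le> \<sigma>' i + (length w + 1 + G)" for i
      using \<sigma>(1) \<sigma>(2,3)[of "i - 1"] G by (cases i; simp add: \<sigma>'_simps w)+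
    show ?thesis
      by (intro exI[of _ \<sigma>'] conjI allI impI gaps d \<sigma>'_simps(1))
  qed
qed

end

context limit_chains
begin

sublocale fk: finite_kernel "S n" "p n" \<iota> for n
  by unfold_locales (rule stoch)

text \<open>Compactness reduces the claim to finitely many test functions. For y within \<rho>/4 of
  a centre x, the function \<open>f x\<close> vanishes at y and is at least \<rho>/2 wherever the
  distance to y is at least \<rho>. So 2/\<rho> times \<open>f x\<close> dominates the indicator of
  being far, and its mean stays small for short times.\<close>

lemma far_uniformly_small:
  assumes "0 < \<rho>" "0 < \<eta>"
  obtains \<delta> n0 where "0 < \<delta>"
    "\<And>n j y. n0 \<le> n \<Longrightarrow> real j \<le> \<delta> * c n \<Longrightarrow> y \<in> S n \<Longrightarrow> (T n ^^ j) (fk.far n \<rho> (\<iota> y)) y \<le> \<eta>"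
proof -
  have cover: "UNIV \<subseteq> (\<Union>x\<in>UNIV. ball (x :: 'e) (\<rho>/4))"
  proof
    fix x :: 'e
    have "x \<in> ball x (\<rho>/4)" using assms by simp
    then show "x \<in> (\<Union>x\<in>UNIV. ball x (\<rho>/4))" by blast
  qed
  obtain C :: "'e set" where C: "finite C" "UNIV \<subseteq> (\<Union>x\<in>C. ball x (\<rho>/4))"
    by (rule compactE_image[OF compact_E _ cover]) (rule open_ball, rule that)
  have "\<exists>f :: 'e \<Rightarrow>\<^sub>C real. \<forall>z. f z = max 0 (dist z x - \<rho>/4)" for x
  proof -
    have "continuous_on UNIV (\<lambda>z. max 0 (dist z x - \<rho>/4))" by (intro continuous_intros)
    from Bcontfun_compact[OF this] show ?thesis by metis
  qed
  then obtain f :: "'e \<Rightarrow> 'e \<Rightarrow>\<^sub>C real" where f: "\<And>x z. f x z = max 0 (dist z x - \<rho>/4)" by metis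
  have "\<exists>\<delta> n0. 0 < \<delta> \<and> (\<forall>n j. n0 \<le> n \<longrightarrow> real j \<le> \<delta> * c n \<longrightarrow> sn n (\<lambda>u. (T n ^^ j) (res n (f x)) u - res n (f x) u) \<le> \<eta> * \<rho> / 2)" for x
  proof -
    have pos: "0 < \<eta> * \<rho> / 2" using assms by simp
    show ?thesis by (rule T_pow_res_small_time[OF pos, of "f x"]) blast
  qed
  then obtain \<delta> n0 where \<delta>: "\<And>x. 0 < \<delta> x"
    "\<And>x n j. n0 x \<le> n \<Longrightarrow> real j \<le> \<delta> x * c n \<Longrightarrow> sn n (\<lambda>u. (T n ^^ j) (res n (f x)) u - res n (f x) u) \<le> \<eta> * \<rho> / 2"
    by metis
  have C_ne: "C \<noteq> {}" using C(2) by auto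
  define \<delta>' where "\<delta>' = Min (\<delta> ` C)"
  define n0' where "n0' = Max (n0 ` C)"
  have \<delta>': "0 < \<delta>'" unfolding \<delta>'_def using C C_ne \<delta> by (subst Min_gr_iff) auto
  show ?thesis
  proof (rule that[OF \<delta>'])
    fix n j y assume n: "n0' \<le> n" and j: "real j \<le> \<delta>' * c n" and y: "y \<in> S n"
    obtain x where x: "x \<in> C" "dist x (\<iota> y) < \<rho>/4" using C(2) by fastforce
    have "n0 x \<le> n" using n C(1) x(1) unfolding n0'_def by (meson Max_ge finite_imageI imageI order_trans)
    moreover have "\<delta>' \<le> \<delta> x" unfolding \<delta>'_def using C(1) x(1) by (intro Min_le) auto
    then have "\<delta>' * c n \<le> \<delta> x * c n" using c_pos[of n] by (intro mult_right_mono) auto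
    then have "real j \<le> \<delta> x * c n" using j by linarith
    ultimately have s: "sn n (\<lambda>u. (T n ^^ j) (res n (f x)) u - res n (f x) u) \<le> \<eta> * \<rho> / 2" by (rule \<delta>(2))
    have "res n (f x) y = 0" using x(2) y by (simp add: res_def f dist_commute)
    with sn_ge[OF y, of "\<lambda>u. (T n ^^ j) (res n (f x)) u - res n (f x) u"] s
    have le: "(T n ^^ j) (res n (f x)) y \<le> \<eta> * \<rho> / 2" by simp
    have "(T n ^^ j) (fk.far n \<rho> (\<iota> y)) y \<le> (T n ^^ j) (\<lambda>u. 2 / \<rho> * res n (f x) u) y"
    proof (rule T_pow_mono[OF _ y])
      fix z assume z: "z \<in> S n"
      show "fk.far n \<rho> (\<iota> y) z \<le> 2 / \<rho> * res n (f x) z"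
      proof (cases "\<rho> \<le> dist (\<iota> y) (\<iota> z)")
        case True
        then have "\<rho> / 2 \<le> dist (\<iota> z) x - \<rho> / 4"
          using x(2) dist_triangle[of "\<iota> y" "\<iota> z" x] dist_commute[of "\<iota> y" x] dist_commute[of "\<iota> z" x] by linarith
        then have "\<rho> / 2 \<le> f x (\<iota> z)" unfolding f by (rule max.coboundedI2)
        then have "1 \<le> 2 / \<rho> * f x (\<iota> z)" using assms by (simp add: field_simps)
        then show ?thesis using True z by (simp add: fk.far_def res_def)
      next
        case False
        have "0 \<le> f x (\<iota> z)" by (simp add: f)
        then show ?thesis using False z assms by (simp add: fk.far_def res_def)
      qed
    qed
    also have "\<dots> = 2 / \<rho> * (T n ^^ j) (res n (f x)) y" by (rule fun_cong[OF T_pow_scale[OF res_fin_C]])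
    also have "\<dots> \<le> 2 / \<rho> * (\<eta> * \<rho> / 2)" using assms le by (intro mult_left_mono) auto
    also have "\<dots> = \<eta>" using assms by simp
    finally show "(T n ^^ j) (fk.far n \<rho> (\<iota> y)) y \<le> \<eta>" .
  qed
qed

end

section \<open>Tightness\<close>

lemma (in finite_markov_chain) word_pred_event: "{\<omega> \<in> space P. Q (word X k \<omega>)} \<in> sets P"
proof -
  have "{\<omega> \<in> space P. Q (word X k \<omega>)} = (\<Union>w\<in>{w \<in> words k. Q w}. {\<omega> \<in> space P. word X k \<omega> = w})"
    using word_in by auto
  also have "\<dots> \<in> sets P"
    using finite_words by (intro sets.finite_UN word_event) auto
  finally show ?thesis .
qed

lemma half_le_nat_floor:
  fixes x :: real
  assumes "1 \<le> x" shows "x / 2 \<le> real (nat \<lfloor>x\<rfloor>)" "real (nat \<lfloor>x\<rfloor>) \<le> x" "0 < nat \<lfloor>x\<rfloor>"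
proof -
  have "1 \<le> \<lfloor>x\<rfloor>" using assms by simp
  then have "real (nat \<lfloor>x\<rfloor>) = real_of_int \<lfloor>x\<rfloor>" "(1::real) \<le> real_of_int \<lfloor>x\<rfloor>" "0 < nat \<lfloor>x\<rfloor>" by auto
  then show "x / 2 \<le> real (nat \<lfloor>x\<rfloor>)" "real (nat \<lfloor>x\<rfloor>) \<le> x" "0 < nat \<lfloor>x\<rfloor>"
    by linarith+
qed

context chain_processes
begin

text \<open>The exit indices divided by c_n are the partition times. Two points of a cell are both
  within r of the value at its first index, hence the bound 2 r.\<close>

lemma no_short_exit_Kset:
  assumes r: "0 < r" and G: "0 < G" "\<delta> \<le> real G / c n"
    and B: "real (nat \<lfloor>c n * R\<rfloor> + 1 + G) / c n \<le> B"
    and no: "\<not> fk.short_exit r G (\<iota> (X n 0 \<omega>)) 0 (tl (word (X n) (Suc (nat \<lfloor>c n * R\<rfloor>)) \<omega>))"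
  shows "samp n \<omega> \<in> Kset \<delta> B R (2 * r)"
proof -
  let ?L = "nat \<lfloor>c n * R\<rfloor>"
  let ?w = "tl (word (X n) (Suc ?L) \<omega>)"
  have nth: "(X n 0 \<omega> # ?w) ! k = X n k \<omega>" if "k \<le> ?L" for k
  proof -
    have "X n 0 \<omega> # ?w = word (X n) (Suc ?L) \<omega>" by (simp add: word_def upt_rec del: upt_Suc)
    then show ?thesis using that by simp
  qed
  obtain \<sigma> :: "nat \<Rightarrow> nat" where \<sigma>: "\<sigma> 0 = 0" "\<And>i. \<sigma> i + G \<le> \<sigma> (Suc i)" "\<And>i. \<sigma> (Suc i) \<le> \<sigma> i + (?L + 1 + G)"
    "\<And>i k. \<sigma> i \<le> k \<Longrightarrow> k < \<sigma> (Suc i) \<Longrightarrow> k \<le> ?L \<Longrightarrow> dist (\<iota> ((X n 0 \<omega> # ?w) ! \<sigma> i)) (\<iota> ((X n 0 \<omega> # ?w) ! k)) < r"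
    using fk.no_short_exit_partition[OF r no] by auto
  have cp: "0 < c n" by (rule c_pos)
  define \<tau> where "\<tau> i = real (\<sigma> i) / c n" for i
  have "partition_times \<delta> B \<tau>"
    unfolding partition_times_def
  proof (intro conjI allI)
    show "\<tau> 0 = 0" by (simp add: \<tau>_def \<sigma>)
    fix i
    have "real G / c n \<le> \<tau> (Suc i) - \<tau> i"
      unfolding \<tau>_def diff_divide_distrib[symmetric] using \<sigma>(2)[of i] cp by (intro divide_right_mono) linarith+
    then show "\<delta> \<le> \<tau> (Suc i) - \<tau> i" using G by linarith
    have "\<tau> (Suc i) - \<tau> i \<le> real (?L + 1 + G) / c n"
      unfolding \<tau>_def diff_divide_distrib[symmetric] using \<sigma>(3)[of i] cp by (intro divide_right_mono) linarith+
    then show "\<tau> (Suc i) - \<tau> i \<le> B" using B by linarith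
  qed
  moreover have "osc_le \<tau> R (2 * r) (samp n \<omega>)"
    unfolding osc_le_def
  proof (intro allI impI)
    fix i a b
    assume a: "\<tau> i < tm a" "tm a < \<tau> (Suc i)" "tm a \<le> R" and b: "\<tau> i < tm b" "tm b < \<tau> (Suc i)" "tm b \<le> R"
    have near: "dist (\<iota> (X n (\<sigma> i) \<omega>)) (samp n \<omega> a) < r" if a: "\<tau> i < tm a" "tm a < \<tau> (Suc i)" "tm a \<le> R" for a
    proof -
      let ?k = "nat \<lfloor>c n * tm a\<rfloor>"
      have "real (\<sigma> i) < c n * tm a" "c n * tm a < real (\<sigma> (Suc i))"
        using a cp by (auto simp: \<tau>_def field_simps)
      then have k: "\<sigma> i \<le> ?k" "?k < \<sigma> (Suc i)" by linarith+
      have kL: "?k \<le> ?L" using a cp by (intro nat_mono floor_mono mult_left_mono) auto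
      show ?thesis
        using \<sigma>(4)[OF k kL] nth[of "\<sigma> i"] nth[OF kL] k kL by (simp add: samp_def Y_def)
    qed
    from near[OF a] near[OF b] show "dist (samp n \<omega> a) (samp n \<omega> b) \<le> 2 * r"
      using dist_triangle3[of "samp n \<omega> a" "samp n \<omega> b" "\<iota> (X n (\<sigma> i) \<omega>)"] by simp
  qed
  ultimately show ?thesis by (auto simp: Kset_def)
qed

text \<open>A path of chain \<open>n\<close> is constant on cells of length 1/c_n. This settles each
  single \<open>n\<close>, with a partition that depends on \<open>n\<close>.\<close>

lemma fine_partition_Kset:
  assumes "\<delta> \<le> 1 / c n" "1 / c n \<le> B" "0 \<le> \<epsilon>"
  shows "samp n \<omega> \<in> Kset \<delta> B R \<epsilon>"
proof -
  have cp: "0 < c n" by (rule c_pos)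
  define \<tau> where "\<tau> i = real i / c n" for i
  have "\<tau> (Suc i) - \<tau> i = 1 / c n" for i by (simp add: \<tau>_def flip: diff_divide_distrib)
  then have "partition_times \<delta> B \<tau>" using assms by (simp add: partition_times_def) (simp add: \<tau>_def)
  moreover have "osc_le \<tau> R \<epsilon> (samp n \<omega>)"
    unfolding osc_le_def
  proof (intro allI impI)
    fix i a b assume a: "\<tau> i < tm a" "tm a < \<tau> (Suc i)" and b: "\<tau> i < tm b" "tm b < \<tau> (Suc i)"
    have "nat \<lfloor>c n * tm a\<rfloor> = i" if "\<tau> i < tm a" "tm a < \<tau> (Suc i)" for a
    proof -
      have "real i < c n * tm a" "c n * tm a < real i + 1"
        using that cp by (auto simp: \<tau>_def field_simps)
      then show ?thesis by linarith
    qed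
    from this[OF a] this[OF b] show "dist (samp n \<omega> a) (samp n \<omega> b) \<le> \<epsilon>"
      using assms(3) by (simp add: samp_def Y_def)
  qed
  ultimately show ?thesis by (auto simp: Kset_def)
qed

lemma samp_Kset_prob:
  assumes r: "0 < r" and G: "0 < G" "\<delta> \<le> real G / c n" and \<delta>: "0 \<le> \<delta>"
    and B: "real (nat \<lfloor>c n * R\<rfloor> + 1 + G) / c n \<le> B"
    and \<beta>: "0 < \<beta>" "\<beta> \<le> 1" and \<gamma>: "0 \<le> \<gamma>" "\<And>y. y \<in> S n \<Longrightarrow> fk.exit_prob n r (G - 1) (\<iota> y) y \<le> \<gamma>"
    and disc: "\<And>L y. y \<in> S n \<Longrightarrow> fk.exit_discount n \<beta> r L (\<iota> y) y \<le> 3/4"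
  shows "1 - 4 * \<gamma> / \<beta> ^ nat \<lfloor>c n * R\<rfloor> \<le> measure (samp_law n) (Kset \<delta> B R (2 * r))"
proof -
  let ?L = "nat \<lfloor>c n * R\<rfloor>"
  let ?bad = "\<lambda>v. fk.short_exit r G (\<iota> (hd v)) 0 (tl v)"
  let ?C = "4 * \<gamma> / \<beta> ^ ?L"
  let ?E = "{\<omega> \<in> space (P n). ?bad (word (X n) (Suc ?L) \<omega>)}"
  have E: "?E \<in> sets (P n)" by (rule mc.word_pred_event)
  have "measure (P n) ?E = (\<integral>\<omega>. indicator ?E \<omega> \<partial>P n)"
    using E by (simp add: Int_absorb1 sets.sets_into_space)
  also have "\<dots> = (\<integral>\<omega>. of_bool (?bad (word (X n) (Suc 0 + ?L) \<omega>)) \<partial>P n)"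
    by (rule Bochner_Integration.integral_cong) (auto simp: indicator_def)
  \<comment> \<open>Conditioning on the initial state, which is both the starting point and the
    first centre.\<close>
  also have "\<dots> = (\<integral>\<omega>. word_op (S n) (p n) ?L (\<lambda>w. of_bool (?bad (word (X n) (Suc 0) \<omega> @ w))) (X n 0 \<omega>) \<partial>P n)"
    by (rule mc.markov_word_op)
  also have "\<dots> \<le> ?C"
  proof (rule mc.integral_le_const)
    show "integrable (P n) (\<lambda>\<omega>. word_op (S n) (p n) ?L (\<lambda>w. of_bool (?bad (word (X n) (Suc 0) \<omega> @ w))) (X n 0 \<omega>))"
      using mc.integrable_word[of n "\<lambda>v. word_op (S n) (p n) ?L (\<lambda>w. of_bool (?bad (v @ w))) (hd v)" "Suc 0"]
      by (simp add: word_def)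
    have "word_op (S n) (p n) ?L (\<lambda>w. of_bool (?bad (word (X n) (Suc 0) \<omega> @ w))) (X n 0 \<omega>) \<le> ?C"
      if "\<omega> \<in> space (P n)" for \<omega>
    proof -
      have x: "X n 0 \<omega> \<in> S n" by (rule mc.X_in[OF that])
      have C: "4 * \<gamma> \<le> ?C"
      proof -
        have "\<beta> ^ ?L \<le> 1" "0 < \<beta> ^ ?L" using \<beta> by (auto intro: power_le_one)
        then show ?thesis using \<gamma>(1) by (simp add: le_divide_eq mult_left_le)
      qed
      have "word_op (S n) (p n) ?L (\<lambda>w. of_bool (fk.short_exit r G (\<iota> (X n 0 \<omega>)) 0 w)) (X n 0 \<omega>)
        \<le> fk.exit_prob n r (G - 1 - 0) (\<iota> (X n 0 \<omega>)) (X n 0 \<omega>) + ?C * fk.exit_discount n \<beta> r ?L (\<iota> (X n 0 \<omega>)) (X n 0 \<omega>)"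
        by (rule fk.short_exit_prob[OF \<beta> \<gamma> disc x])
      also have "\<dots> \<le> \<gamma> + ?C * (3/4)"
        using C \<gamma>(1) \<gamma>(2)[OF x] disc[OF x, of ?L] by (intro add_mono mult_left_mono) auto
      also have "\<dots> \<le> ?C" using C by simp
      finally show ?thesis by (simp add: word_def)
    qed
    then show "AE \<omega> in P n. word_op (S n) (p n) ?L (\<lambda>w. of_bool (?bad (word (X n) (Suc 0) \<omega> @ w))) (X n 0 \<omega>) \<le> ?C"
      by simp
  qed
  finally have "measure (P n) ?E \<le> ?C" .
  then have "1 - ?C \<le> measure (P n) (space (P n) - ?E)"
    using mc.prob_compl[OF E] by simp
  also have "\<dots> \<le> measure (P n) (samp n -` Kset \<delta> B R (2 * r) \<inter> space (P n))"
  proof (rule mc.finite_measure_mono)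
    show "samp n -` Kset \<delta> B R (2 * r) \<inter> space (P n) \<in> sets (P n)"
      by (rule measurable_sets[OF samp_measurable borel_closed[OF closed_Kset[OF \<delta>]]])
    have hd: "hd (word (X n) (Suc ?L) \<omega>) = X n 0 \<omega>" for \<omega>
      by (simp add: word_def upt_rec del: upt_Suc)
    show "space (P n) - ?E \<subseteq> samp n -` Kset \<delta> B R (2 * r) \<inter> space (P n)"
      using no_short_exit_Kset[OF r G B] by (auto simp: hd)
  qed
  also have "\<dots> = measure (samp_law n) (Kset \<delta> B R (2 * r))"
    unfolding samp_law_def by (rule measure_distr[OF samp_measurable borel_closed[OF closed_Kset[OF \<delta>]], symmetric])
  finally show ?thesis .
qed

text \<open>Two time scales enter: within \<delta>1 an exit has probability at most 1/2, which
  limits how often exits occur; within \<delta>2 a single exit is so unlikely that quick exits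
  together have probability at most \<eta>.\<close>

lemma tight_Kset:
  assumes R: "0 \<le> R" and \<epsilon>: "0 < \<epsilon>" and \<eta>: "0 < \<eta>"
  shows "\<exists>\<delta>>0. \<exists>B. \<forall>n. 1 - \<eta> \<le> measure (samp_law n) (Kset \<delta> B R \<epsilon>)"
proof -
  define r where "r = \<epsilon> / 2"
  have r: "0 < r" "0 < r / 2" using \<epsilon> by (auto simp: r_def)
  \<comment> \<open>The value 1/3 for \<alpha> makes \<alpha> / (1 - \<alpha>) equal to 1/2 in
    Ottaviani's bound.\<close>
  obtain \<delta>1 n1 where \<delta>1: "0 < \<delta>1"
    "\<And>n j y. n1 \<le> n \<Longrightarrow> real j \<le> \<delta>1 * c n \<Longrightarrow> y \<in> S n \<Longrightarrow> (T n ^^ j) (fk.far n (r/2) (\<iota> y)) y \<le> 1/3"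
    by (rule far_uniformly_small[OF r(2), of "1/3"]) (simp, rule that)
  \<comment> \<open>With \<beta> = exp(-A / c_n), already \<delta>1 c_n / 2 steps give a power of
    \<beta> at most 1/4; together with the exit probability 1/2 this is the required 3/4.\<close>
  define A where "A = 2 * ln 4 / \<delta>1"
  have A: "0 < A" using \<delta>1 by (simp add: A_def)
  \<comment> \<open>\<alpha> \<le> 1/2 gives \<alpha> / (1 - \<alpha>) \<le> 2 \<alpha>, taken as
    \<gamma>. The 8 comes from 4 \<gamma>, and exp(-A R) compensates the division by \<beta>^L for L
    up to c_n R.\<close>
  define \<alpha> where "\<alpha> = min (1/2) (\<eta> * exp (- (A * R)) / 8)"
  have \<alpha>: "0 < \<alpha>" "\<alpha> \<le> 1/2" using \<eta> by (auto simp: \<alpha>_def)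
  obtain \<delta>2 n2 where \<delta>2: "0 < \<delta>2"
    "\<And>n j y. n2 \<le> n \<Longrightarrow> real j \<le> \<delta>2 * c n \<Longrightarrow> y \<in> S n \<Longrightarrow> (T n ^^ j) (fk.far n (r/2) (\<iota> y)) y \<le> \<alpha>"
    by (rule far_uniformly_small[OF r(2) \<alpha>(1)]) (rule that)
  have "\<forall>\<^sub>F n in sequentially. max (1 / \<delta>1) (1 / \<delta>2) \<le> c n"
    using c_at_top unfolding filterlim_at_top by blast
  then obtain n3 where n3: "\<And>n. n3 \<le> n \<Longrightarrow> max (1 / \<delta>1) (1 / \<delta>2) \<le> c n"
    by (auto simp: eventually_sequentially)
  define N where "N = max n1 (max n2 n3)"
  \<comment> \<open>The half of \<delta>2 appears because \<open>G\<close>, a floor, is at least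
    half of \<delta>2 c_n; \<open>1 / c N\<close> serves the levels below \<open>N\<close>.\<close>
  define \<delta> where "\<delta> = min (\<delta>2 / 2) (1 / c N)"
  define B where "B = R + 1 / c 0 + \<delta>2"
  have \<delta>: "0 < \<delta>" using \<delta>2 c_pos[of N] by (simp add: \<delta>_def)
  have c0: "c 0 \<le> c n" for n by simp
  have "1 - \<eta> \<le> measure (samp_law n) (Kset \<delta> B R \<epsilon>)" for n
  proof (cases "N \<le> n")
    \<comment> \<open>For these finitely many levels the intervals of constancy, of length at least
      \<open>1 / c N\<close>, serve as partition.\<close>
    case False
    then have "c n \<le> c N" by simp
    then have "1 / c N \<le> 1 / c n" using c_pos[of n] by (intro divide_left_mono mult_pos_pos c_pos) auto
    then have 1: "\<delta> \<le> 1 / c n" by (simp add: \<delta>_def)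
    have "1 / c n \<le> 1 / c 0" using c0 by (intro divide_left_mono mult_pos_pos c_pos) auto
    then have 2: "1 / c n \<le> B" using R \<delta>2 by (simp add: B_def)
    interpret sl: prob_space "samp_law n" by (rule prob_space_samp_law)
    have "samp n -` Kset \<delta> B R \<epsilon> \<inter> space (P n) = space (P n)"
      using fine_partition_Kset[OF 1 2 less_imp_le[OF \<epsilon>]] by auto
    then have "measure (samp_law n) (Kset \<delta> B R \<epsilon>) = 1"
      unfolding samp_law_def measure_distr[OF samp_measurable borel_closed[OF closed_Kset[OF less_imp_le[OF \<delta>]]]]
      by (simp add: mc.prob_space)
    then show ?thesis using \<eta> by simp
  next
    case True
    then have n: "n1 \<le> n" "n2 \<le> n" "1 / \<delta>1 \<le> c n" "1 / \<delta>2 \<le> c n"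
      using n3[of n] by (auto simp: N_def)
    have cp: "0 < c n" by (rule c_pos)
    have d1: "1 \<le> \<delta>1 * c n" and d2: "1 \<le> \<delta>2 * c n"
      using n \<delta>1(1) \<delta>2(1) by (auto simp: field_simps)
    define m where "m = nat \<lfloor>\<delta>1 * c n\<rfloor>"
    have m: "real m \<le> \<delta>1 * c n" "\<delta>1 * c n / 2 \<le> real m" unfolding m_def by (rule half_le_nat_floor[OF d1])+
    define G where "G = nat \<lfloor>\<delta>2 * c n\<rfloor>"
    have G: "real G \<le> \<delta>2 * c n" "\<delta>2 * c n / 2 \<le> real G" "0 < G" unfolding G_def by (rule half_le_nat_floor[OF d2])+
    define \<beta> where "\<beta> = exp (- A / c n)"
    have \<beta>: "0 < \<beta>" "\<beta> \<le> 1" using A cp by (auto simp: \<beta>_def)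
    have \<beta>_pow: "\<beta> ^ k = exp (- A * real k / c n)" for k
      by (simp add: \<beta>_def flip: exp_of_nat_mult)
    let ?\<gamma> = "2 * \<alpha>"
    have exit1: "fk.exit_prob n r m (\<iota> y) y \<le> 1/2" if "y \<in> S n" for y
    proof -
      have "fk.exit_prob n r m (\<iota> y) y \<le> (1/3) / (1 - 1/3)"
      proof (rule fk.exit_prob_bound[OF _ _ that])
        fix j y assume "j \<le> m" "y \<in> S n"
        then show "(T n ^^ j) (fk.far n (r/2) (\<iota> y)) y \<le> 1/3" using m by (intro \<delta>1(2) n(1)) auto
      qed simp
      then show ?thesis by simp
    qed
    have exit2: "fk.exit_prob n r (G - 1) (\<iota> y) y \<le> ?\<gamma>" if "y \<in> S n" for y
    proof -
      have "fk.exit_prob n r (G - 1) (\<iota> y) y \<le> \<alpha> / (1 - \<alpha>)"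
      proof (rule fk.exit_prob_bound[OF _ _ that])
        fix j y assume "j \<le> G - 1" "y \<in> S n"
        then show "(T n ^^ j) (fk.far n (r/2) (\<iota> y)) y \<le> \<alpha>" using G by (intro \<delta>2(2) n(2)) auto
      qed (use \<alpha> in simp)
      also have "\<dots> \<le> ?\<gamma>" using \<alpha> by (simp add: field_simps)
      finally show ?thesis .
    qed
    have disc: "fk.exit_discount n \<beta> r L (\<iota> y) y \<le> 3/4" if "y \<in> S n" for L y
    proof -
      have "\<beta> ^ m \<le> 1/4"
      proof -
        have "ln 4 \<le> A * real m / c n"
        proof -
          have le: "A * (\<delta>1 * c n / 2) \<le> A * real m" using A m by (intro mult_left_mono) auto
          have "A * (\<delta>1 * c n / 2) = ln 4 * c n" using \<delta>1 by (simp add: A_def)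
          from le[unfolded this] show ?thesis unfolding pos_le_divide_eq[OF cp] .
        qed
        then have "\<beta> ^ m \<le> exp (- ln 4)" unfolding \<beta>_pow by simp
        then show ?thesis by (simp add: exp_minus inverse_eq_divide)
      qed
      then show ?thesis
        using fk.exit_discount_le_exit_prob[OF less_imp_le[OF \<beta>(1)] \<beta>(2) that, of r L "\<iota> y" m] exit1[OF that] by linarith
    qed
    have G\<delta>: "\<delta> \<le> real G / c n"
    proof -
      have "\<delta>2 / 2 \<le> real G / c n" using G(2) by (simp add: pos_le_divide_eq[OF cp])
      then show ?thesis unfolding \<delta>_def by (rule min.coboundedI1)
    qed
    have L: "real (nat \<lfloor>c n * R\<rfloor>) \<le> c n * R"
    proof -
      have "0 \<le> c n * R" using cp R by simp
      then show ?thesis by linarith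
    qed
    have B': "real (nat \<lfloor>c n * R\<rfloor> + 1 + G) / c n \<le> B"
    proof -
      have "real (nat \<lfloor>c n * R\<rfloor> + 1 + G) / c n \<le> (c n * R + 1 + \<delta>2 * c n) / c n"
        using L G cp by (intro divide_right_mono) auto
      also have "\<dots> = R + 1 / c n + \<delta>2" using cp by (simp add: field_simps)
      also have "1 / c n \<le> 1 / c 0" using c0 by (intro divide_left_mono mult_pos_pos c_pos) auto
      finally show ?thesis by (simp add: B_def)
    qed
    have "1 - 4 * ?\<gamma> / \<beta> ^ nat \<lfloor>c n * R\<rfloor> \<le> measure (samp_law n) (Kset \<delta> B R (2 * r))"
      by (rule samp_Kset_prob[OF r(1) G(3) G\<delta> less_imp_le[OF \<delta>] B' \<beta> _ exit2 disc]) (use \<alpha> in auto)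
    moreover have "4 * ?\<gamma> / \<beta> ^ nat \<lfloor>c n * R\<rfloor> \<le> \<eta>"
    proof -
      have "A * real (nat \<lfloor>c n * R\<rfloor>) \<le> A * (c n * R)" using L A by (intro mult_left_mono) auto
      then have "A * real (nat \<lfloor>c n * R\<rfloor>) / c n \<le> A * R" using cp by (simp add: field_simps)
      then have "exp (- (A * R)) \<le> \<beta> ^ nat \<lfloor>c n * R\<rfloor>" unfolding \<beta>_pow by simp
      then have "\<eta> * exp (- (A * R)) \<le> \<eta> * \<beta> ^ nat \<lfloor>c n * R\<rfloor>" using \<eta> by (intro mult_left_mono) auto
      moreover have "8 * \<alpha> \<le> \<eta> * exp (- (A * R))" by (simp add: \<alpha>_def min_def)
      ultimately show ?thesis using \<beta>(1) by (simp add: divide_le_eq)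
    qed
    moreover have "2 * r = \<epsilon>" by (simp add: r_def)
    ultimately show ?thesis by simp
  qed
  with \<delta> show ?thesis by blast
qed

text \<open>A union bound over all precisions and horizons. Since \<open>Kinf\<close> is closed, the
  bound passes to the weak limit \<Lambda>.\<close>

lemma tight_Kinf:
  assumes \<eta>: "0 < \<eta>"
  obtains \<delta> B where "\<And>j. 0 < \<delta> j" "\<And>n. 1 - \<eta> \<le> measure (samp_law n) (Kinf \<delta> B)" "1 - \<eta> \<le> measure \<Lambda> (Kinf \<delta> B)"
proof -
  \<comment> \<open>The exceptional probabilities allowed for the single j add up to \<eta>.\<close>
  define h where "h j = \<eta> * (1/2) ^ Suc j" for j :: nat
  have "\<exists>\<delta>>0. \<exists>B. \<forall>n. 1 - h j \<le> measure (samp_law n) (Kset \<delta> B (real j) (1 / real (Suc j)))" for j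
    by (rule tight_Kset) (use \<eta> in \<open>auto simp: h_def\<close>)
  then obtain \<delta> B where \<delta>: "\<And>j. 0 < \<delta> j" and B: "\<And>j n. 1 - h j \<le> measure (samp_law n) (Kset (\<delta> j) (B j) (real j) (1 / real (Suc j)))"
    by metis
  have h: "h sums \<eta>"
    using sums_mult[OF power_half_series, of \<eta>] by (simp add: h_def[abs_def])
  have cl: "closed (Kinf \<delta> B :: (nat \<Rightarrow> 'e) set)" by (rule closed_Kinf[of \<delta> B, OF \<delta>])
  have 1: "1 - \<eta> \<le> measure (samp_law n) (Kinf \<delta> B)" for n
  proof -
    interpret sl: prob_space "samp_law n" by (rule prob_space_samp_law)
    have sp: "space (samp_law n) = UNIV" by (simp add: samp_law_def)
    let ?K = "\<lambda>j. Kset (\<delta> j) (B j) (real j) (1 / real (Suc j)) :: (nat \<Rightarrow> 'e) set"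
    have K: "?K j \<in> sets (samp_law n)" for j
      using borel_closed[OF closed_Kset[OF less_imp_le[OF \<delta>]]] by simp
    have compl: "measure (samp_law n) (- ?K j) \<le> h j" for j
      using sl.prob_compl[OF K[of j]] B[of j n] by (simp add: sp Compl_eq_Diff_UNIV)
    have sumK: "summable (\<lambda>j. measure (samp_law n) (- ?K j))"
      using compl by (intro summable_comparison_test'[OF sums_summable[OF h]]) auto
    have "measure (samp_law n) (\<Union>j. - ?K j) \<le> (\<Sum>j. measure (samp_law n) (- ?K j))"
      using K sumK by (intro sl.finite_measure_subadditive_countably) auto
    also have "\<dots> \<le> \<eta>"
      using suminf_le[OF compl sumK sums_summable[OF h]] sums_unique[OF h] by simp
    finally have "measure (samp_law n) (\<Union>j. - ?K j) \<le> \<eta>" .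
    moreover have "(\<Union>j. - ?K j) = space (samp_law n) - Kinf \<delta> B" by (auto simp: Kinf_def sp)
    moreover have "Kinf \<delta> B \<in> sets (samp_law n)" using cl by auto
    ultimately show ?thesis using sl.prob_compl[of "Kinf \<delta> B"] by simp
  qed
  have "1 - \<eta> \<le> measure \<Lambda> (Kinf \<delta> B)"
  proof (rule closed_measure_ge_weak_limit[OF cl prob_space_\<Lambda> sets_\<Lambda> prob_space_samp_law sets_samp_law 1])
    fix f :: "(nat \<Rightarrow> 'e) \<Rightarrow> real" assume "continuous_on UNIV f"
    then show "(\<lambda>n. \<integral>z. f z \<partial>samp_law n) \<longlonglongrightarrow> (\<integral>z. f z \<partial>\<Lambda>)"
      using samp_tendsto[of f] by (simp add: integral_samp_law)
  qed
  with \<delta> 1 show ?thesis by (rule that)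
qed

end

section \<open>The limit process\<close>

lemma space_borel_of_topology [simp]: "space (borel_of_topology T) = topspace T"
  unfolding borel_of_topology_def by (simp add: space_measure_of_conv)

lemma measurable_borel_of_topology:
  assumes "\<And>\<omega>. \<omega> \<in> space M \<Longrightarrow> f \<omega> \<in> topspace T" "\<And>V. openin T V \<Longrightarrow> f -` V \<inter> space M \<in> sets M"
  shows "f \<in> measurable M (borel_of_topology T)"
  unfolding borel_of_topology_def
  by (rule measurable_measure_of) (use assms in \<open>auto dest: openin_subset\<close>)

lemma continuous_map_borel_measurable:
  assumes "continuous_map T euclideanreal \<phi>"
  shows "\<phi> \<in> borel_measurable (borel_of_topology T)"
proof (rule borel_measurableI)
  fix V :: "real set" assume "open V"
  then have "openin T {x \<in> topspace T. \<phi> x \<in> V}"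
    using openin_continuous_map_preimage[OF assms] by simp
  then have "{x \<in> topspace T. \<phi> x \<in> V} \<in> sets (borel_of_topology T)"
    unfolding borel_of_topology_def
    by (subst sets_measure_of) (auto dest: openin_subset)
  moreover have "\<phi> -` V \<inter> space (borel_of_topology T) = {x \<in> topspace T. \<phi> x \<in> V}" by auto
  ultimately show "\<phi> -` V \<inter> space (borel_of_topology T) \<in> sets (borel_of_topology T)" by simp
qed

lemma (in prob_space) integral_diff_le_off_set:
  fixes f g :: "'a \<Rightarrow> real"
  assumes f: "f \<in> borel_measurable M" "\<And>x. x \<in> space M \<Longrightarrow> \<bar>f x\<bar> \<le> C"
    and g: "g \<in> borel_measurable M" "\<And>x. x \<in> space M \<Longrightarrow> \<bar>g x\<bar> \<le> C"
    and A: "A \<in> sets M" "AE x in M. x \<in> A \<longrightarrow> f x = g x"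
  shows "\<bar>(\<integral>x. f x \<partial>M) - (\<integral>x. g x \<partial>M)\<bar> \<le> 2 * C * (1 - prob A)"
proof -
  have int: "integrable M f" "integrable M g"
    using f g by (auto intro!: integrable_const_bound[of _ C])
  have cA: "space M - A \<in> sets M" using A by auto
  have iA: "integrable M (\<lambda>x. 2 * C * indicator (space M - A) x)"
    using cA by (intro integrable_mult_right integrable_real_indicator) (auto simp: emeasure_eq_measure)
  have "\<bar>(\<integral>x. f x \<partial>M) - (\<integral>x. g x \<partial>M)\<bar> = \<bar>\<integral>x. f x - g x \<partial>M\<bar>"
    using int by simp
  also have "\<dots> \<le> (\<integral>x. \<bar>f x - g x\<bar> \<partial>M)"
    using integral_norm_bound[of M "\<lambda>x. f x - g x"] by simp
  also have "\<dots> \<le> (\<integral>x. 2 * C * indicator (space M - A) x \<partial>M)"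
  proof (rule integral_mono_AE)
    show "integrable M (\<lambda>x. \<bar>f x - g x\<bar>)" using int by auto
    show "AE x in M. \<bar>f x - g x\<bar> \<le> 2 * C * indicator (space M - A) x"
      using A(2)
    proof (rule AE_mp, intro AE_I2 impI)
      fix x assume "x \<in> space M" "x \<in> A \<longrightarrow> f x = g x"
      then show "\<bar>f x - g x\<bar> \<le> 2 * C * indicator (space M - A) x"
        using f(2)[of x] g(2)[of x] by (cases "x \<in> A") auto
    qed
  qed (rule iA)
  also have "\<dots> = 2 * C * (1 - prob A)"
    using cA prob_compl[OF A(1)] by (simp add: Int_absorb1 sets.sets_into_space)
  finally show ?thesis .
qed

context chain_processes
begin

text \<open>Right-continuity at 0 becomes continuity at each t, because by contractivity the change
  over [a, a + b] is at most that over [0, b].\<close>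

lemma TT_continuous:
  assumes "0 \<le> t" "\<And>n. 0 \<le> s n" "s \<longlonglongrightarrow> t"
  shows "(\<lambda>n. TT (s n) f) \<longlonglongrightarrow> TT t f"
proof -
  have "continuous (at 0 within {0..}) (\<lambda>t. TT t f)"
    using TT_continuous_0[of f] by (simp add: continuous_within TT_0 at_within_Ici_at_right)
  moreover have "(\<lambda>n. \<bar>s n - t\<bar>) \<longlonglongrightarrow> 0"
    using tendsto_rabs[OF tendsto_diff[OF assms(3) tendsto_const[of t]]] by simp
  ultimately have lim: "(\<lambda>n. TT \<bar>s n - t\<bar> f) \<longlonglongrightarrow> f"
    using continuous_within_tendsto_compose'[of 0 "{0..}" "\<lambda>t. TT t f" "\<lambda>n. \<bar>s n - t\<bar>" sequentially]
    by (simp add: TT_0)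
  have shift: "norm (TT (a + b) f - TT a f) \<le> norm (TT b f - f)" if "0 \<le> a" "0 \<le> b" for a b
    using TT_norm[of a "TT b f - f"] by (simp add: TT_semigroup[OF that] TT_diff)
  have "norm (TT (s n) f - TT t f) \<le> norm (TT \<bar>s n - t\<bar> f - f)" for n
    using shift[of t "s n - t"] shift[of "s n" "t - s n"] assms(1) assms(2)[of n]
    by (cases "t \<le> s n") (auto simp: norm_minus_commute)
  then have "(\<lambda>n. TT (s n) f - TT t f) \<longlonglongrightarrow> 0"
    using lim by (intro Lim_null_comparison[OF always_eventually tendsto_norm_zero[OF LIM_zero[OF lim]]]) auto
  then show ?thesis by (rule LIM_zero_cancel)
qed

interpretation \<Lambda>: prob_space \<Lambda> by (rule prob_space_\<Lambda>)

lemma space_\<Lambda> [simp]: "space \<Lambda> = UNIV"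
  using sets_eq_imp_space_eq[OF sets_\<Lambda>] by simp

definition KD :: "nat \<Rightarrow> (nat \<Rightarrow> real) \<times> (nat \<Rightarrow> real)" where
  "KD = (SOME D. \<forall>l. (\<forall>j. 0 < fst (D l) j) \<and> 1 - 1 / real (Suc l) \<le> measure \<Lambda> (Kinf (fst (D l)) (snd (D l))))"

lemma KD: "0 < fst (KD l) j" "1 - 1 / real (Suc l) \<le> measure \<Lambda> (Kinf (fst (KD l)) (snd (KD l)))"
proof -
  have "\<exists>D. (\<forall>j. 0 < fst D j) \<and> 1 - 1 / real (Suc l) \<le> measure \<Lambda> (Kinf (fst D) (snd D))" for l
  proof -
    obtain \<delta> B where "\<And>j. 0 < \<delta> j" "1 - 1 / real (Suc l) \<le> measure \<Lambda> (Kinf \<delta> B)"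
      by (rule tight_Kinf[of "1 / real (Suc l)"]) (simp, rule that)
    then show ?thesis by (intro exI[of _ "(\<delta>, B)"]) auto
  qed
  then have "\<exists>D. \<forall>l. (\<forall>j. 0 < fst (D l) j) \<and> 1 - 1 / real (Suc l) \<le> measure \<Lambda> (Kinf (fst (D l)) (snd (D l)))"
    by metis
  from someI_ex[OF this] show "0 < fst (KD l) j" "1 - 1 / real (Suc l) \<le> measure \<Lambda> (Kinf (fst (KD l)) (snd (KD l)))"
    unfolding KD_def by blast+
qed

text \<open>A countable union of closed sets, of full mass under \<Lambda>: a Borel stand-in for the
  set of regular functions.\<close>

definition Kreg :: "(nat \<Rightarrow> 'e) set" where
  "Kreg = (\<Union>l. Kinf (fst (KD l)) (snd (KD l)))"

lemma closed_KD: "closed (Kinf (fst (KD l)) (snd (KD l)) :: (nat \<Rightarrow> 'e) set)"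
  by (rule closed_Kinf) (rule KD)

lemma Kreg_sets [measurable]: "Kreg \<in> sets borel"
  unfolding Kreg_def using closed_KD by (intro sets.countable_UN) auto

lemma Kreg_regular: "z \<in> Kreg \<Longrightarrow> regular z"
  unfolding Kreg_def by (auto intro: Kinf_regular[of "fst (KD _)", OF KD(1)])

lemma AE_Kreg: "AE z in \<Lambda>. z \<in> Kreg"
proof -
  have "1 - 1 / real (Suc l) \<le> measure \<Lambda> Kreg" for l
    by (rule order_trans[OF KD(2) \<Lambda>.finite_measure_mono]) (auto simp: Kreg_def[symmetric], auto simp: Kreg_def)
  moreover have "(\<lambda>l. 1 - 1 / real (Suc l)) \<longlonglongrightarrow> 1 - 0"
    by (intro tendsto_diff tendsto_const) (use LIMSEQ_inverse_real_of_nat in \<open>simp add: inverse_eq_divide\<close>)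
  ultimately have "1 \<le> measure \<Lambda> Kreg" by (intro LIMSEQ_le_const2[where X="\<lambda>l. 1 - 1 / real (Suc l)"]) auto
  then have "measure \<Lambda> Kreg = 1" using \<Lambda>.prob_le_1[of Kreg] by linarith
  then show ?thesis by (subst (asm) \<Lambda>.prob_eq_1) auto
qed

text \<open>The fallback is a constant path, hence cadlag, so that the path space consists of cadlag
  paths without exception.\<close>

definition ext :: "(nat \<Rightarrow> 'e) \<Rightarrow> real \<Rightarrow> 'e" where
  "ext z = (if z \<in> Kreg then cadlag_ext z else restrict (\<lambda>_. undefined) {0..})"

lemma ext_cadlag: "ext z \<in> cadlag_paths"
proof (cases "z \<in> Kreg")
  case True
  then show ?thesis by (simp add: ext_def cadlag_ext_cadlag Kreg_regular)
next
  case False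
  let ?k = "restrict (\<lambda>_. undefined) {0..} :: real \<Rightarrow> 'e"
  have 1: "(?k \<longlongrightarrow> ?k t) (at_right t)" if "0 \<le> t" for t
  proof (rule tendsto_eventually)
    show "\<forall>\<^sub>F x in at_right t. ?k x = ?k t"
      using eventually_at_right_less[of t] by eventually_elim (use that in auto)
  qed
  have 2: "(?k \<longlongrightarrow> undefined) (at_left t)" if "0 < t" for t
  proof (rule tendsto_eventually)
    show "\<forall>\<^sub>F x in at_left t. ?k x = undefined"
      by (rule eventually_at_leftI[of 0]) (use that in auto)
  qed
  show ?thesis using False 1 2 unfolding cadlag_paths_def ext_def by auto
qed

section \<open>Measurability of the extension and the law on path space\<close>

lemma ext_tendsto: "z \<in> Kreg \<Longrightarrow> 0 \<le> t \<Longrightarrow> (\<lambda>k. z (idx t k)) \<longlonglongrightarrow> ext z t"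
  by (simp add: ext_def right_lim_tendsto Kreg_regular)

lemma coordinate_measurable [measurable]: "(\<lambda>z :: nat \<Rightarrow> 'e. z i) \<in> borel_measurable borel"
  by (rule borel_measurable_continuous_onI) simp

lemma ext_eval_measurable [measurable]:
  assumes "0 \<le> t" shows "(\<lambda>z. ext z t) \<in> borel_measurable borel"
proof (rule borel_measurable_LIMSEQ_metric)
  show "(\<lambda>z. if z \<in> Kreg then z (idx t k) else undefined) \<in> borel_measurable borel" for k
    by (rule measurable_If_set) auto
  show "(\<lambda>k. if z \<in> Kreg then z (idx t k) else undefined) \<longlonglongrightarrow> ext z t" for z
  proof (cases "z \<in> Kreg")
    case True
    then show ?thesis using ext_tendsto[OF True assms] by simp
  next
    case False
    then show ?thesis using assms by (simp add: ext_def)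
  qed
qed

text \<open>On each closed piece of \<open>Kreg\<close> the part mapped outside \<open>V\<close> is
  closed, so the preimage is a countable union of differences of closed sets, up to the complement
  of \<open>Kreg\<close>.\<close>

lemma ext_open_preimage:
  assumes V: "skorokhod_open V" shows "ext -` V \<in> sets borel"
proof -
  let ?k = "restrict (\<lambda>_. undefined) {0..} :: real \<Rightarrow> 'e"
  let ?K = "\<lambda>l. Kinf (fst (KD l)) (snd (KD l)) :: (nat \<Rightarrow> 'e) set"
  have "{z \<in> Kreg. cadlag_ext z \<in> V} = (\<Union>l. ?K l - {z \<in> ?K l. cadlag_ext z \<notin> V})"
    unfolding Kreg_def by blast
  also have "\<dots> \<in> sets borel"
  proof (intro sets.countable_UN image_subsetI)
    fix l
    have "closed {z \<in> ?K l. cadlag_ext z \<notin> V}" by (rule closed_Kinf_preimage[OF KD(1) V])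
    then show "?K l - {z \<in> ?K l. cadlag_ext z \<notin> V} \<in> sets borel"
      by (rule sets.Diff[OF borel_closed[OF closed_KD] borel_closed])
  qed
  finally have 1: "{z \<in> Kreg. cadlag_ext z \<in> V} \<in> sets borel" .
  have 2: "- Kreg \<in> sets borel" using sets.compl_sets[OF Kreg_sets] by (simp add: Compl_eq_Diff_UNIV)
  have "ext -` V = {z \<in> Kreg. cadlag_ext z \<in> V} \<union> (if ?k \<in> V then - Kreg else {})"
    by (auto simp: ext_def split: if_splits)
  also have "\<dots> \<in> sets borel" using 1 2 by (intro sets.Un) simp_all
  finally show ?thesis .
qed

text \<open>The path space carries the final \<open>\<sigma>\<close>-algebra of the extension map, which contains
  both the evaluation maps and the Skorokhod-open sets; this avoids comparing the \<open>\<sigma>\<close>-algebras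
  generated by the two.\<close>

definition Q :: "(real \<Rightarrow> 'e) measure" where
  "Q = distr \<Lambda> (sigma cadlag_paths {A. A \<subseteq> cadlag_paths \<and> ext -` A \<in> sets borel}) ext"

abbreviation F :: "real \<Rightarrow> (real \<Rightarrow> 'e) \<Rightarrow> 'e" where
  "F \<equiv> \<lambda>t \<omega>. \<omega> t"

lemma ext_measurable: "ext \<in> measurable \<Lambda> (sigma cadlag_paths {A. A \<subseteq> cadlag_paths \<and> ext -` A \<in> sets borel})"
  by (rule measurable_measure_of) (auto simp: ext_cadlag)

lemma prob_space_Q: "prob_space Q"
  unfolding Q_def by (rule \<Lambda>.prob_space_distr[OF ext_measurable])

lemma space_Q [simp]: "space Q = cadlag_paths"
  unfolding Q_def by (simp add: space_measure_of_conv)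

lemma sets_QI: "A \<subseteq> cadlag_paths \<Longrightarrow> ext -` A \<in> sets borel \<Longrightarrow> A \<in> sets Q"
  unfolding Q_def by (subst sets_distr, subst sets_measure_of) auto

lemma F_measurable [measurable]:
  assumes "0 \<le> t" shows "F t \<in> borel_measurable Q"
proof (rule measurableI)
  fix A :: "'e set" assume A: "A \<in> sets borel"
  have "ext -` (F t -` A \<inter> cadlag_paths) = (\<lambda>z. ext z t) -` A" using ext_cadlag by auto
  also have "\<dots> \<in> sets borel"
    using measurable_sets[OF ext_eval_measurable[OF assms] A] by simp
  finally show "F t -` A \<inter> space Q \<in> sets Q" by (intro sets_QI) auto
qed simp

lemma integral_Q: "g \<in> borel_measurable Q \<Longrightarrow> (\<integral>\<omega>. (g \<omega> :: real) \<partial>Q) = (\<integral>z. g (ext z) \<partial>\<Lambda>)"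
  unfolding Q_def by (rule integral_distr[OF ext_measurable]) (simp add: measurable_distr_eq1)

section \<open>Convergence in the Skorokhod space\<close>

lemma path_of_F: "\<omega> \<in> cadlag_paths \<Longrightarrow> path_of F \<omega> = \<omega>"
  unfolding path_of_def cadlag_paths_def by (auto simp: extensional_restrict)

lemma path_of_F_measurable: "path_of F \<in> measurable Q (borel_of_topology skorokhod_topology)"
proof (rule measurable_borel_of_topology)
  fix V :: "(real \<Rightarrow> 'e) set" assume "openin skorokhod_topology V"
  then have V: "skorokhod_open V" by (simp add: openin_skorokhod)
  then have sub: "V \<subseteq> cadlag_paths" by (simp add: skorokhod_open_def)
  have "path_of F -` V \<inter> space Q = V" using sub path_of_F by auto
  then show "path_of F -` V \<inter> space Q \<in> sets Q"
    using sets_QI[OF sub ext_open_preimage[OF V]] by simp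
qed (simp add: path_of_F topspace_skorokhod)

text \<open>For a single chain one deterministic set \<open>Kinf\<close> contains all sampled paths;
  measurability into the Skorokhod space is proved on it.\<close>

lemma samp_Kinf: "samp n \<omega> \<in> Kinf (\<lambda>_. 1 / c n) (\<lambda>_. 1 / c n)"
  unfolding Kinf_def by (auto intro: fine_partition_Kset)

lemma samp_regular: "regular (samp n \<omega>)"
  by (rule Kinf_regular[of "\<lambda>_. 1 / c n", OF _ samp_Kinf]) (simp add: c_pos)

text \<open>Step functions that jump only at multiples of 1/c_n are right-continuous: the floor does
  not change just after t.\<close>

lemma cadlag_ext_samp: "cadlag_ext (samp n \<omega>) = path_of (Y n) \<omega>"
proof
  fix t
  show "cadlag_ext (samp n \<omega>) t = path_of (Y n) \<omega> t"
  proof (cases "0 \<le> t")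
    case True
    have "(\<lambda>k. samp n \<omega> (idx t k)) \<longlonglongrightarrow> Y n t \<omega>"
    proof (rule tendsto_eventually)
      have "c n * t < real_of_int \<lfloor>c n * t\<rfloor> + 1" by linarith
      then have "t < (real_of_int \<lfloor>c n * t\<rfloor> + 1) / c n"
        using c_pos[of n] by (simp add: field_simps)
      then have "\<forall>\<^sub>F k in sequentially. tm (idx t k) < (real_of_int \<lfloor>c n * t\<rfloor> + 1) / c n"
        by (rule order_tendstoD[OF tm_idx_tendsto[OF True]])
      then show "\<forall>\<^sub>F k in sequentially. samp n \<omega> (idx t k) = Y n t \<omega>"
      proof eventually_elim
        case (elim k)
        then have 1: "c n * tm (idx t k) < real_of_int \<lfloor>c n * t\<rfloor> + 1"
          using c_pos[of n] by (simp add: field_simps)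
        have 2: "c n * t \<le> c n * tm (idx t k)"
          using idx(1)[OF True, of k] c_pos[of n] by (intro mult_left_mono) auto
        have "\<lfloor>c n * tm (idx t k)\<rfloor> = \<lfloor>c n * t\<rfloor>" using 1 2 by linarith
        then show ?case by (simp add: samp_def Y_def)
      qed
    qed
    from LIMSEQ_unique[OF right_lim_tendsto[OF samp_regular True] this] True
    show ?thesis by (simp add: path_of_def)
  qed (simp add: cadlag_ext_def path_of_def)
qed

lemma path_of_Y_measurable: "path_of (Y n) \<in> measurable (P n) (borel_of_topology skorokhod_topology)"
proof (rule measurable_borel_of_topology)
  fix V :: "(real \<Rightarrow> 'e) set" assume "openin skorokhod_topology V"
  then have V: "skorokhod_open V" by (simp add: openin_skorokhod)
  let ?K = "Kinf (\<lambda>_. 1 / c n) (\<lambda>_. 1 / c n) :: (nat \<Rightarrow> 'e) set"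
  have "closed {z \<in> ?K. cadlag_ext z \<notin> V}" by (rule closed_Kinf_preimage[OF _ V]) (simp add: c_pos)
  then have "samp n -` {z \<in> ?K. cadlag_ext z \<notin> V} \<inter> space (P n) \<in> sets (P n)"
    by (rule measurable_sets[OF samp_measurable borel_closed])
  then have "space (P n) - samp n -` {z \<in> ?K. cadlag_ext z \<notin> V} \<inter> space (P n) \<in> sets (P n)" by auto
  also have "space (P n) - samp n -` {z \<in> ?K. cadlag_ext z \<notin> V} \<inter> space (P n) = path_of (Y n) -` V \<inter> space (P n)"
    using samp_Kinf by (auto simp: cadlag_ext_samp[symmetric])
  finally show "path_of (Y n) -` V \<inter> space (P n) \<in> sets (P n)" .
qed (simp add: topspace_skorokhod cadlag_ext_cadlag[OF samp_regular] flip: cadlag_ext_samp)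

lemma skorokhod_weak_limit:
  assumes \<phi>: "continuous_map skorokhod_topology euclideanreal \<phi>" and bd: "bounded (\<phi> ` cadlag_paths)"
  shows "(\<lambda>n. \<integral>\<omega>. \<phi> (path_of (Y n) \<omega>) \<partial>P n) \<longlonglongrightarrow> (\<integral>z. \<phi> (ext z) \<partial>\<Lambda>)"
proof (rule LIMSEQ_I)
  fix e :: real assume e: "0 < e"
  obtain C0 where C0: "\<And>x. x \<in> cadlag_paths \<Longrightarrow> \<bar>\<phi> x\<bar> \<le> C0"
    using bd by (auto simp: bounded_iff)
  define C where "C = \<bar>C0\<bar> + 1"
  have C: "0 < C" "\<And>x. x \<in> cadlag_paths \<Longrightarrow> \<bar>\<phi> x\<bar> \<le> C"
    using C0 by (force simp: C_def)+
  \<comment> \<open>Off a set of mass at least 1 - \<eta> the integrands differ by at most 2 C, so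
    each of the two replacements costs at most 2 C \<eta> = e/4; the convergence for
    \<open>\<psi>\<close> costs another e/4.\<close>
  define \<eta> where "\<eta> = e / (8 * C)"
  have \<eta>: "0 < \<eta>" using e C by (simp add: \<eta>_def)
  obtain \<delta> B where \<delta>: "\<And>j. 0 < \<delta> j" and K: "\<And>n. 1 - \<eta> \<le> measure (samp_law n) (Kinf \<delta> B)" "1 - \<eta> \<le> measure \<Lambda> (Kinf \<delta> B)"
    by (rule tight_Kinf[OF \<eta>]) (rule that)
  let ?K = "Kinf \<delta> B :: (nat \<Rightarrow> 'e) set"
  have clK: "closed ?K" by (rule closed_Kinf[of \<delta> B, OF \<delta>])
  have regK: "regular z" if "z \<in> ?K" for z by (rule Kinf_regular[of \<delta>, OF \<delta> that])
  have cont: "continuous_on ?K (\<lambda>z. \<phi> (cadlag_ext z))" by (rule continuous_on_Kinf[OF \<delta> \<phi>])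
  \<comment> \<open>Restricted to \<open>?K\<close>, a Skorokhod-continuous functional is a
    continuous function of the sampled values; the extension keeps the bound
    \<open>C\<close>.\<close>
  obtain \<psi> where \<psi>: "continuous_on UNIV \<psi>" "\<And>z. z \<in> ?K \<Longrightarrow> \<psi> z = \<phi> (cadlag_ext z)" "\<And>z. \<bar>\<psi> z\<bar> \<le> C"
    using Tietze[of ?K "\<lambda>z. \<phi> (cadlag_ext z)" UNIV C, OF cont] clK C cadlag_ext_cadlag[OF regK] by auto
  have \<psi>m: "\<psi> \<in> borel_measurable borel" by (rule borel_measurable_continuous_onI[OF \<psi>(1)])
  have \<phi>m: "\<phi> \<in> borel_measurable (borel_of_topology skorokhod_topology)" by (rule continuous_map_borel_measurable[OF \<phi>])
  have bound: "2 * C * (1 - x) \<le> e / 4" if "1 - \<eta> \<le> x" for x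
  proof -
    have "2 * C * (1 - x) \<le> 2 * C * \<eta>" using that C by (intro mult_left_mono) auto
    also have "\<dots> = e / 4" using C by (simp add: \<eta>_def)
    finally show ?thesis .
  qed
  have 1: "\<bar>(\<integral>\<omega>. \<phi> (path_of (Y n) \<omega>) \<partial>P n) - (\<integral>\<omega>. \<psi> (samp n \<omega>) \<partial>P n)\<bar> \<le> e / 4" for n
  proof -
    have m: "samp n -` ?K \<inter> space (P n) \<in> sets (P n)"
      by (rule measurable_sets[OF samp_measurable borel_closed[OF clK]])
    have "\<bar>(\<integral>\<omega>. \<phi> (path_of (Y n) \<omega>) \<partial>P n) - (\<integral>\<omega>. \<psi> (samp n \<omega>) \<partial>P n)\<bar> \<le> 2 * C * (1 - measure (P n) (samp n -` ?K \<inter> space (P n)))"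
    proof (rule mc.integral_diff_le_off_set[OF _ _ _ _ m])
      show "(\<lambda>\<omega>. \<phi> (path_of (Y n) \<omega>)) \<in> borel_measurable (P n)"
        by (rule measurable_compose[OF path_of_Y_measurable \<phi>m])
      show "(\<lambda>\<omega>. \<psi> (samp n \<omega>)) \<in> borel_measurable (P n)"
        by (rule measurable_compose[OF samp_measurable \<psi>m])
      show "\<bar>\<phi> (path_of (Y n) \<omega>)\<bar> \<le> C" for \<omega>
        unfolding cadlag_ext_samp[symmetric] by (rule C(2)[OF cadlag_ext_cadlag[OF samp_regular]])
      show "AE \<omega> in P n. \<omega> \<in> samp n -` ?K \<inter> space (P n) \<longrightarrow> \<phi> (path_of (Y n) \<omega>) = \<psi> (samp n \<omega>)"
        using \<psi>(2) by (auto simp: cadlag_ext_samp)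
    qed (rule \<psi>(3))
    also have "measure (P n) (samp n -` ?K \<inter> space (P n)) = measure (samp_law n) ?K"
      unfolding samp_law_def by (rule measure_distr[OF samp_measurable borel_closed[OF clK], symmetric])
    finally show ?thesis using bound[OF K(1)] by (rule order_trans)
  qed
  have 2: "\<bar>(\<integral>z. \<phi> (ext z) \<partial>\<Lambda>) - (\<integral>z. \<psi> z \<partial>\<Lambda>)\<bar> \<le> e / 4"
  proof -
    have "\<bar>(\<integral>z. \<phi> (ext z) \<partial>\<Lambda>) - (\<integral>z. \<psi> z \<partial>\<Lambda>)\<bar> \<le> 2 * C * (1 - measure \<Lambda> ?K)"
    proof (rule \<Lambda>.integral_diff_le_off_set)
      have "ext \<in> measurable \<Lambda> (borel_of_topology skorokhod_topology)"
      proof (rule measurable_borel_of_topology)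
        fix V :: "(real \<Rightarrow> 'e) set" assume "openin skorokhod_topology V"
        then show "ext -` V \<inter> space \<Lambda> \<in> sets \<Lambda>"
          using ext_open_preimage[of V] by (simp add: openin_skorokhod)
      qed (simp add: topspace_skorokhod ext_cadlag)
      then show "(\<lambda>z. \<phi> (ext z)) \<in> borel_measurable \<Lambda>"
        by (rule measurable_compose[OF _ \<phi>m])
      show "?K \<in> sets \<Lambda>" using clK by simp
      show "\<psi> \<in> borel_measurable \<Lambda>" using \<psi>m by (simp add: measurable_cong_sets[OF sets_\<Lambda> refl])
      show "AE z in \<Lambda>. z \<in> ?K \<longrightarrow> \<phi> (ext z) = \<psi> z"
        using AE_Kreg by eventually_elim (simp add: ext_def \<psi>(2))
    qed (use \<psi>(3) C(2)[OF ext_cadlag] in auto)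
    then show ?thesis using bound[OF K(2)] by (rule order_trans)
  qed
  obtain N where N: "\<And>n. N \<le> n \<Longrightarrow> \<bar>(\<integral>\<omega>. \<psi> (samp n \<omega>) \<partial>P n) - (\<integral>z. \<psi> z \<partial>\<Lambda>)\<bar> < e / 4"
    using LIMSEQ_D[OF samp_tendsto[OF \<psi>(1)], of "e/4"] e by auto
  have "norm ((\<integral>\<omega>. \<phi> (path_of (Y n) \<omega>) \<partial>P n) - (\<integral>z. \<phi> (ext z) \<partial>\<Lambda>)) < e" if "N \<le> n" for n
    using 1[of n] 2 N[OF that] e unfolding real_norm_def by linarith
  then show "\<exists>N. \<forall>n\<ge>N. norm ((\<integral>\<omega>. \<phi> (path_of (Y n) \<omega>) \<partial>P n) - (\<integral>z. \<phi> (ext z) \<partial>\<Lambda>)) < e" by blast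
qed

lemma convergence_in_distribution:
  "converges_in_distribution skorokhod_topology P (\<lambda>n. path_of (Y n)) Q (path_of F)"
  unfolding converges_in_distribution_def weakly_converges_def topspace_skorokhod
proof (intro conjI allI impI path_of_Y_measurable path_of_F_measurable)
  fix \<phi> :: "(real \<Rightarrow> 'e) \<Rightarrow> real"
  assume \<phi>: "continuous_map skorokhod_topology euclideanreal \<phi>" "bounded (\<phi> ` cadlag_paths)"
  note \<phi>m = continuous_map_borel_measurable[OF \<phi>(1)]
  have "(\<integral>x. \<phi> x \<partial>distr Q (borel_of_topology skorokhod_topology) (path_of F)) = (\<integral>\<omega>. \<phi> (path_of F \<omega>) \<partial>Q)"
    by (rule integral_distr[OF path_of_F_measurable \<phi>m])
  also have "\<dots> = (\<integral>z. \<phi> (path_of F (ext z)) \<partial>\<Lambda>)"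
    by (rule integral_Q[OF measurable_compose[OF path_of_F_measurable \<phi>m]])
  also have "\<dots> = (\<integral>z. \<phi> (ext z) \<partial>\<Lambda>)" by (simp add: path_of_F ext_cadlag)
  finally have F: "(\<integral>x. \<phi> x \<partial>distr Q (borel_of_topology skorokhod_topology) (path_of F)) = (\<integral>z. \<phi> (ext z) \<partial>\<Lambda>)" .
  show "(\<lambda>n. \<integral>x. \<phi> x \<partial>distr (P n) (borel_of_topology skorokhod_topology) (path_of (Y n))) \<longlonglongrightarrow>
      (\<integral>x. \<phi> x \<partial>distr Q (borel_of_topology skorokhod_topology) (path_of F))"
    unfolding F integral_distr[OF path_of_Y_measurable \<phi>m] by (rule skorokhod_weak_limit[OF \<phi>])
qed

end

context chain_processes
begin

interpretation \<Lambda>: prob_space \<Lambda> by (rule prob_space_\<Lambda>)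
interpretation Q: prob_space Q by (rule prob_space_Q)

section \<open>Initial law and Markov property of the limit process\<close>

lemma F_bcontfun_measurable: "0 \<le> t \<Longrightarrow> (\<lambda>\<omega>. apply_bcontfun f (\<omega> t) :: real) \<in> borel_measurable Q"
  by (rule measurable_compose[OF F_measurable bcontfun_measurable])

lemma prod_F_measurable:
  fixes g :: "real \<Rightarrow> 'e \<Rightarrow>\<^sub>C real"
  assumes "\<And>u. u \<in> I \<Longrightarrow> 0 \<le> u"
  shows "(\<lambda>\<omega>. \<Prod>u\<in>I. apply_bcontfun (g u) (\<omega> u)) \<in> borel_measurable Q"
  using assms by (intro borel_measurable_prod F_bcontfun_measurable) auto

lemma integral_ext_limit:
  fixes \<psi> :: "nat \<Rightarrow> (nat \<Rightarrow> 'e) \<Rightarrow> real"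
  assumes "\<And>k. \<psi> k \<in> borel_measurable borel" "\<psi>' \<in> borel_measurable borel" "\<And>k z. \<bar>\<psi> k z\<bar> \<le> B"
    "\<And>z. z \<in> Kreg \<Longrightarrow> (\<lambda>k. \<psi> k z) \<longlonglongrightarrow> \<psi>' z"
  shows "(\<lambda>k. \<integral>z. \<psi> k z \<partial>\<Lambda>) \<longlonglongrightarrow> (\<integral>z. \<psi>' z \<partial>\<Lambda>)"
proof (rule integral_dominated_convergence[where w="\<lambda>_. B"])
  show "AE z in \<Lambda>. (\<lambda>k. \<psi> k z) \<longlonglongrightarrow> \<psi>' z" using AE_Kreg by eventually_elim (rule assms(4))
qed (use assms in \<open>auto simp: measurable_cong_sets[OF sets_\<Lambda> refl]\<close>)

lemma bcontfun_ext_tendsto: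
  fixes f :: "'e \<Rightarrow>\<^sub>C real"
  shows "z \<in> Kreg \<Longrightarrow> 0 \<le> t \<Longrightarrow> (\<lambda>k. f (z (idx t k))) \<longlonglongrightarrow> f (ext z t)"
  using continuous_on_tendsto_compose[OF continuous_on_apply_bcontfun[of UNIV f] ext_tendsto] by simp

text \<open>The path at time 0 is a limit over rational times after 0, so its law is obtained from
  the marginals there by strong continuity of \<open>TT\<close>.\<close>

lemma initial_law: "distr Q borel (F 0) = \<mu>"
proof (rule prob_measure_eqI_bcontfun)
  show "prob_space (distr Q borel (F 0))" by (rule Q.prob_space_distr) (simp add: F_measurable)
  fix f :: "'e \<Rightarrow>\<^sub>C real"
  interpret \<mu>: prob_space \<mu> by (rule prob_\<mu>)
  have "(\<lambda>k. \<integral>z. f (z (idx 0 k)) \<partial>\<Lambda>) \<longlonglongrightarrow> (\<integral>z. f (ext z 0) \<partial>\<Lambda>)"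
    by (rule integral_ext_limit[where B="norm f"])
      (auto simp: bcontfun_abs_bound intro!: bcontfun_ext_tendsto measurable_compose[OF ext_eval_measurable bcontfun_measurable]
        borel_measurable_continuous_onI continuous_bcontfun_coordinate)
  then have 1: "(\<lambda>k. \<integral>x. TT (tm (idx 0 k)) f x \<partial>\<mu>) \<longlonglongrightarrow> (\<integral>z. f (ext z 0) \<partial>\<Lambda>)"
    by (simp add: \<Lambda>_marginal)
  have lim: "(\<lambda>k. TT (tm (idx 0 k)) f) \<longlonglongrightarrow> TT 0 f"
    by (rule TT_continuous[OF order_refl tm_nonneg tm_idx_tendsto[OF order_refl]])
  have int: "integrable \<mu> (apply_bcontfun g)" for g :: "'e \<Rightarrow>\<^sub>C real"
    by (rule integrable_bcontfun[OF prob_\<mu> sets_\<mu>])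
  have "(\<lambda>k. (\<integral>x. TT (tm (idx 0 k)) f x \<partial>\<mu>) - (\<integral>x. f x \<partial>\<mu>)) \<longlonglongrightarrow> 0"
  proof (rule Lim_null_comparison[OF always_eventually tendsto_norm_zero[OF LIM_zero[OF lim]]], rule allI)
    fix k
    show "norm ((\<integral>x. TT (tm (idx 0 k)) f x \<partial>\<mu>) - (\<integral>x. f x \<partial>\<mu>)) \<le> norm (TT (tm (idx 0 k)) f - TT 0 f)"
      using \<mu>.abs_integral_le_const[OF int bcontfun_abs_bound, of "TT (tm (idx 0 k)) f - f"] int
      by (simp add: TT_0)
  qed
  then have 2: "(\<lambda>k. \<integral>x. TT (tm (idx 0 k)) f x \<partial>\<mu>) \<longlonglongrightarrow> (\<integral>x. f x \<partial>\<mu>)" by (rule LIM_zero_cancel)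
  have "(\<integral>x. f x \<partial>distr Q borel (F 0)) = (\<integral>\<omega>. f (\<omega> 0) \<partial>Q)"
    by (rule integral_distr) (auto simp: F_measurable)
  also have "\<dots> = (\<integral>z. f (ext z 0) \<partial>\<Lambda>)" by (rule integral_Q[OF F_bcontfun_measurable]) simp
  also have "\<dots> = (\<integral>x. f x \<partial>\<mu>)" by (rule LIMSEQ_unique[OF 1 2])
  finally show "(\<integral>x. f x \<partial>distr Q borel (F 0)) = (\<integral>x. f x \<partial>\<mu>)" .
qed (use prob_\<mu> sets_\<mu> in auto)

text \<open>Every time u is approximated from the right by the times with index
  \<open>idx u k\<close>, and the identity for rational times passes to the limit by dominated
  convergence.\<close>

lemma F_markov_prod:
  fixes g :: "real \<Rightarrow> 'e \<Rightarrow>\<^sub>C real" and f :: "'e \<Rightarrow>\<^sub>C real"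
  assumes I: "finite I" "I \<subseteq> {0..s}" and s: "0 \<le> s" and t: "0 \<le> t"
  shows "(\<integral>\<omega>. (\<Prod>u\<in>I. g u (\<omega> u)) * f (\<omega> (s + t)) \<partial>Q) = (\<integral>\<omega>. (\<Prod>u\<in>I. g u (\<omega> u)) * TT t f (\<omega> s) \<partial>Q)"
proof -
  have I0: "0 \<le> u" "u \<le> s" if "u \<in> I" for u using I that by auto
  have st: "0 \<le> s + t" using s t by simp
  let ?a = "\<lambda>k. idx s k" and ?b = "\<lambda>k. idx (s + t) k"
  let ?\<psi> = "\<lambda>k z. (\<Prod>u\<in>I. g u (z (idx u k))) * f (z (?b k))"
  \<comment> \<open>The absolute value keeps the time nonnegative for all k; eventually the
    difference is nonnegative anyway.\<close>
  let ?t = "\<lambda>k. \<bar>tm (?b k) - tm (?a k)\<bar>"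
  let ?\<psi>' = "\<lambda>k z. (\<Prod>u\<in>I. g u (z (idx u k))) * TT (?t k) f (z (?a k))"
  let ?B = "(\<Prod>u\<in>I. norm (g u)) * norm f"
  have B: "\<bar>(\<Prod>u\<in>I. g u (y u)) * h x\<bar> \<le> ?B" if "norm h \<le> norm f" for y x and h :: "'e \<Rightarrow>\<^sub>C real"
    unfolding abs_mult
    by (intro mult_mono prod_abs_le_bound order_trans[OF bcontfun_abs_bound that] prod_nonneg) auto
  have cont: "continuous_on UNIV (\<lambda>z :: nat \<Rightarrow> 'e. (\<Prod>u\<in>I. g u (z (j u))) * h (z i))" for j i and h :: "'e \<Rightarrow>\<^sub>C real"
    by (intro continuous_intros continuous_bcontfun_coordinate)
  have m: "(\<lambda>z. (\<Prod>u\<in>I. g u (ext z u)) * h (ext z v)) \<in> borel_measurable borel" if "0 \<le> v" for v and h :: "'e \<Rightarrow>\<^sub>C real"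
    using I0 that by (intro borel_measurable_times borel_measurable_prod measurable_compose[OF ext_eval_measurable bcontfun_measurable]) auto
  have lim_prod: "(\<lambda>k. \<Prod>u\<in>I. g u (z (idx u k))) \<longlonglongrightarrow> (\<Prod>u\<in>I. g u (ext z u))" if "z \<in> Kreg" for z
    using I0 that by (intro tendsto_prod bcontfun_ext_tendsto) auto
  have L1: "(\<lambda>k. \<integral>z. ?\<psi> k z \<partial>\<Lambda>) \<longlonglongrightarrow> (\<integral>z. (\<Prod>u\<in>I. g u (ext z u)) * f (ext z (s + t)) \<partial>\<Lambda>)"
  proof (rule integral_ext_limit)
    show "?\<psi> k \<in> borel_measurable borel" for k by (rule borel_measurable_continuous_onI[OF cont])
    show "(\<lambda>z. (\<Prod>u\<in>I. g u (ext z u)) * f (ext z (s + t))) \<in> borel_measurable borel" by (rule m[OF st])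
    show "\<bar>?\<psi> k z\<bar> \<le> ?B" for k z by (rule B) simp
    show "(\<lambda>k. ?\<psi> k z) \<longlonglongrightarrow> (\<Prod>u\<in>I. g u (ext z u)) * f (ext z (s + t))" if "z \<in> Kreg" for z
      by (intro tendsto_mult lim_prod bcontfun_ext_tendsto that st)
  qed
  have t_lim: "?t \<longlonglongrightarrow> t"
    using tendsto_rabs[OF tendsto_diff[OF tm_idx_tendsto[OF st] tm_idx_tendsto[OF s]]] t by simp
  have L2: "(\<lambda>k. \<integral>z. ?\<psi>' k z \<partial>\<Lambda>) \<longlonglongrightarrow> (\<integral>z. (\<Prod>u\<in>I. g u (ext z u)) * TT t f (ext z s) \<partial>\<Lambda>)"
  proof (rule integral_ext_limit)
    show "?\<psi>' k \<in> borel_measurable borel" for k by (rule borel_measurable_continuous_onI[OF cont])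
    show "(\<lambda>z. (\<Prod>u\<in>I. g u (ext z u)) * TT t f (ext z s)) \<in> borel_measurable borel" by (rule m[OF s])
    show "\<bar>?\<psi>' k z\<bar> \<le> ?B" for k z by (rule B[OF TT_norm])
    fix z assume z: "z \<in> Kreg"
    have lim: "(\<lambda>k. TT (?t k) f) \<longlonglongrightarrow> TT t f"
      by (rule TT_continuous[OF t _ t_lim]) simp
    have "(\<lambda>k. TT (?t k) f (z (?a k)) - TT t f (z (?a k))) \<longlonglongrightarrow> 0"
    proof (rule Lim_null_comparison[OF always_eventually tendsto_norm_zero[OF LIM_zero[OF lim]]], rule allI)
      fix k
      show "norm (TT (?t k) f (z (?a k)) - TT t f (z (?a k))) \<le> norm (TT (?t k) f - TT t f)"
        using norm_bounded[of "TT (?t k) f - TT t f" "z (?a k)"] by simp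
    qed
    from tendsto_add[OF this bcontfun_ext_tendsto[OF z s, of "TT t f"]]
    have "(\<lambda>k. TT (?t k) f (z (?a k))) \<longlonglongrightarrow> TT t f (ext z s)" by simp
    then show "(\<lambda>k. ?\<psi>' k z) \<longlonglongrightarrow> (\<Prod>u\<in>I. g u (ext z u)) * TT t f (ext z s)"
      by (intro tendsto_mult lim_prod z)
  qed
  have "\<forall>\<^sub>F k in sequentially. (\<integral>z. ?\<psi> k z \<partial>\<Lambda>) = (\<integral>z. ?\<psi>' k z \<partial>\<Lambda>)"
  proof -
    have 1: "\<forall>\<^sub>F k in sequentially. tm (?a k) \<le> tm (?b k)"
    proof (cases "t = 0")
      case False
      then have "\<forall>\<^sub>F k in sequentially. tm (?a k) < s + t"
        using t by (intro order_tendstoD[OF tm_idx_tendsto[OF s]]) auto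
      then show ?thesis by eventually_elim (use idx(1)[OF st] in \<open>auto intro: less_imp_le order.strict_trans\<close>)
    qed simp
    \<comment> \<open>For u < s the approximating times are eventually separated by s; for u = s the
      two indices coincide.\<close>
    have 2: "\<forall>\<^sub>F k in sequentially. \<forall>u\<in>I. tm (idx u k) \<le> tm (?a k)"
    proof (rule eventually_ball_finite[OF I(1)], rule ballI)
      fix u assume u: "u \<in> I"
      show "\<forall>\<^sub>F k in sequentially. tm (idx u k) \<le> tm (?a k)"
      proof (cases "u = s")
        case False
        then have "\<forall>\<^sub>F k in sequentially. tm (idx u k) < s"
          using I0[OF u] by (intro order_tendstoD[OF tm_idx_tendsto]) auto
        then show ?thesis by eventually_elim (use idx(1)[OF s] in \<open>auto intro: less_imp_le order.strict_trans\<close>)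
      qed simp
    qed
    from 1 2 show ?thesis
    proof eventually_elim
      case (elim k)
      have "(\<integral>z. ?\<psi> k z \<partial>\<Lambda>) = (\<integral>z. (\<Prod>u\<in>I. g u (z (idx u k))) * TT (tm (?b k) - tm (?a k)) f (z (?a k)) \<partial>\<Lambda>)"
        by (rule \<Lambda>_markov) (use elim in auto)
      then show ?case using elim(1) by simp
    qed
  qed
  from LIMSEQ_unique[OF Lim_transform_eventually[OF L1 this] L2]
  have "(\<integral>z. (\<Prod>u\<in>I. g u (ext z u)) * f (ext z (s + t)) \<partial>\<Lambda>) = (\<integral>z. (\<Prod>u\<in>I. g u (ext z u)) * TT t f (ext z s) \<partial>\<Lambda>)" .
  moreover have "(\<lambda>\<omega>. (\<Prod>u\<in>I. g u (\<omega> u)) * h (\<omega> v)) \<in> borel_measurable Q" if "0 \<le> v" for v and h :: "'e \<Rightarrow>\<^sub>C real"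
    using I0 that by (intro borel_measurable_times prod_F_measurable F_bcontfun_measurable) auto
  ultimately show ?thesis
    using s st by (simp add: integral_Q)
qed

text \<open>Closed sets are used because their indicators are limits of continuous functions; the
  resulting sets form an intersection-stable generator of the past.\<close>

definition cylinders :: "real \<Rightarrow> (real \<Rightarrow> 'e) set set" where
  "cylinders s = {{\<omega> \<in> cadlag_paths. \<forall>u\<in>I. \<omega> u \<in> C u} | I C. finite I \<and> I \<subseteq> {0..s} \<and> (\<forall>u. closed (C u))}"

lemma Int_stable_cylinders: "Int_stable (cylinders s)"
proof (rule Int_stableI)
  fix A B assume "A \<in> cylinders s" "B \<in> cylinders s"
  then obtain I C J D where A: "A = {\<omega> \<in> cadlag_paths. \<forall>u\<in>I. \<omega> u \<in> C u}" "finite I" "I \<subseteq> {0..s}" "\<And>u. closed (C u)"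
    and B: "B = {\<omega> \<in> cadlag_paths. \<forall>u\<in>J. \<omega> u \<in> D u}" "finite J" "J \<subseteq> {0..s}" "\<And>u. closed (D u)"
    unfolding cylinders_def by blast
  define E where "E u = (if u \<in> I then C u else UNIV) \<inter> (if u \<in> J then D u else UNIV)" for u
  have "A \<inter> B = {\<omega> \<in> cadlag_paths. \<forall>u\<in>I \<union> J. \<omega> u \<in> E u}"
    by (auto simp: A(1) B(1) E_def)
  moreover have "closed (E u)" for u using A(4) B(4) by (simp add: E_def closed_Int)
  ultimately show "A \<inter> B \<in> cylinders s"
    unfolding cylinders_def using A(2,3) B(2,3) by (intro CollectI exI[of _ "I \<union> J"] exI[of _ E]) auto
qed

lemma space_past [simp]: "space (past Q F s) = cadlag_paths"
  unfolding past_def by (simp add: space_measure_of_conv)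

lemma past_eval:
  assumes "u \<in> {0..s}" "B \<in> sets borel" shows "{\<omega> \<in> cadlag_paths. \<omega> u \<in> B} \<in> sets (past Q F s)"
proof -
  have "{\<omega> \<in> cadlag_paths. \<omega> u \<in> B} = F u -` B \<inter> space Q" by auto
  then have "{\<omega> \<in> cadlag_paths. \<omega> u \<in> B} \<in> (\<Union>u\<in>{0..s}. {F u -` A \<inter> space Q | A. A \<in> sets borel})"
    using assms by blast
  then show ?thesis
    unfolding past_def by (subst sets_measure_of) (auto intro: sigma_sets.Basic)
qed

lemma sets_past: "sets (past Q F s) = sigma_sets cadlag_paths (cylinders s)"
proof (rule antisym)
  have "cylinders s \<subseteq> sets (past Q F s)"
  proof (rule subsetI)
    fix A assume "A \<in> cylinders s"
    then obtain I C where A: "A = {\<omega> \<in> cadlag_paths. \<forall>u\<in>I. \<omega> u \<in> C u}" "finite I" "I \<subseteq> {0..s}" "\<And>u. closed (C u)"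
      unfolding cylinders_def by blast
    have "{\<omega> \<in> space (past Q F s). \<omega> u \<in> C u} \<in> sets (past Q F s)" if "u \<in> I" for u
      using past_eval[of u s "C u"] A(3) borel_closed[OF A(4)] that by auto
    then have "{\<omega> \<in> space (past Q F s). \<forall>u\<in>I. \<omega> u \<in> C u} \<in> sets (past Q F s)"
      using A(2) by (intro sets.sets_Collect_finite_All) auto
    then show "A \<in> sets (past Q F s)" by (simp add: A(1))
  qed
  then show "sigma_sets cadlag_paths (cylinders s) \<subseteq> sets (past Q F s)"
    using sets.sigma_sets_subset[of "cylinders s" "past Q F s"] by simp
next
  have eval: "{\<omega> \<in> cadlag_paths. \<omega> u \<in> B} \<in> sigma_sets cadlag_paths (cylinders s)" if u: "u \<in> {0..s}" and B: "B \<in> sets borel" for u B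
  proof -
    have "B \<in> sigma_sets UNIV (Collect closed)" using B by (simp add: borel_eq_closed)
    then show ?thesis
    proof induction
      case (Basic C)
      have "{\<omega> \<in> cadlag_paths. \<omega> u \<in> C} \<in> cylinders s"
        unfolding cylinders_def using u Basic by (intro CollectI exI[of _ "{u}"] exI[of _ "\<lambda>_. C"]) simp
      then show ?case by (rule sigma_sets.Basic)
    next
      case Empty then show ?case by (simp add: sigma_sets.Empty)
    next
      case (Compl B)
      have "{\<omega> \<in> cadlag_paths. \<omega> u \<in> UNIV - B} = cadlag_paths - {\<omega> \<in> cadlag_paths. \<omega> u \<in> B}" by auto
      then show ?case using sigma_sets.Compl[OF Compl.IH] by simp
    next
      case (Union B)
      have "{\<omega> \<in> cadlag_paths. \<omega> u \<in> (\<Union>i. B i)} = (\<Union>i. {\<omega> \<in> cadlag_paths. \<omega> u \<in> B i})" by auto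
      then show ?case using sigma_sets.Union[of "\<lambda>i. {\<omega> \<in> cadlag_paths. \<omega> u \<in> B i}"] Union.IH by simp
    qed
  qed
  have sub: "(\<Union>u\<in>{0..s}. {F u -` A \<inter> space Q | A. A \<in> sets borel}) \<subseteq> sigma_sets cadlag_paths (cylinders s)"
  proof (rule subsetI)
    fix A assume "A \<in> (\<Union>u\<in>{0..s}. {F u -` A \<inter> space Q | A. A \<in> sets borel})"
    then obtain u B where u: "u \<in> {0..s}" and A: "A = F u -` B \<inter> space Q" and B: "B \<in> sets borel" by blast
    have "A = {\<omega> \<in> cadlag_paths. \<omega> u \<in> B}" unfolding A by auto
    then show "A \<in> sigma_sets cadlag_paths (cylinders s)" using eval[OF u B] by simp
  qed
  have cyl: "cylinders s \<subseteq> Pow cadlag_paths" by (auto simp: cylinders_def)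
  have "sets (past Q F s) = sigma_sets cadlag_paths (\<Union>u\<in>{0..s}. {F u -` A \<inter> space Q | A. A \<in> sets borel})"
    unfolding past_def by (subst sets_measure_of) auto
  also have "\<dots> \<subseteq> sigma_sets cadlag_paths (cylinders s)"
    by (rule sigma_algebra.sigma_sets_subset[OF sigma_algebra_sigma_sets[OF cyl] sub])
  finally show "sets (past Q F s) \<subseteq> sigma_sets cadlag_paths (cylinders s)" .
qed

lemma subalgebra_past: "subalgebra Q (past Q F s)"
proof -
  have "sets (past Q F s) \<subseteq> sets Q"
    unfolding sets_past space_Q[symmetric]
  proof (rule sets.sigma_sets_subset, rule subsetI)
    fix A assume "A \<in> cylinders s"
    then obtain I C where A: "A = {\<omega> \<in> cadlag_paths. \<forall>u\<in>I. \<omega> u \<in> C u}" "finite I" "I \<subseteq> {0..s}" "\<And>u. closed (C u)"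
      unfolding cylinders_def by blast
    have "{\<omega> \<in> space Q. \<omega> u \<in> C u} \<in> sets Q" if "u \<in> I" for u
    proof -
      have "0 \<le> u" using that A(3) by auto
      from measurable_sets[OF F_measurable[OF this] borel_closed[OF A(4)[of u]]]
      have "F u -` C u \<inter> space Q \<in> sets Q" .
      moreover have "F u -` C u \<inter> space Q = {\<omega> \<in> space Q. \<omega> u \<in> C u}" by auto
      ultimately show ?thesis by simp
    qed
    then have "{\<omega> \<in> space Q. \<forall>u\<in>I. \<omega> u \<in> C u} \<in> sets Q"
      using A(2) by (intro sets.sets_Collect_finite_All) auto
    then show "A \<in> sets Q" by (simp add: A(1))
  qed
  then show ?thesis by (simp add: subalgebra_def)
qed

lemma F_markov_cylinder:
  fixes f :: "'e \<Rightarrow>\<^sub>C real"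
  assumes A: "A \<in> cylinders s" and s: "0 \<le> s" and t: "0 \<le> t"
  shows "(\<integral>\<omega>. indicator A \<omega> * f (\<omega> (s + t)) \<partial>Q) = (\<integral>\<omega>. indicator A \<omega> * TT t f (\<omega> s) \<partial>Q)"
proof -
  obtain I C where A: "A = {\<omega> \<in> cadlag_paths. \<forall>u\<in>I. \<omega> u \<in> C u}" and I: "finite I" "I \<subseteq> {0..s}" and C: "\<And>u. closed (C u)"
    using A unfolding cylinders_def by blast
  have "\<exists>g :: nat \<Rightarrow> 'e \<Rightarrow>\<^sub>C real. (\<forall>m x. 0 \<le> g m x \<and> g m x \<le> 1) \<and> (\<forall>x. (\<lambda>m. g m x) \<longlonglongrightarrow> indicator (C u) x)" for u
  proof -
    obtain h :: "nat \<Rightarrow> 'e \<Rightarrow> real" where h: "\<And>m. continuous_on UNIV (h m)" "\<And>m x. 0 \<le> h m x" "\<And>m x. h m x \<le> 1"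
      "\<And>m x. indicator (C u) x \<le> h m x" "\<And>x. (\<lambda>m. h m x) \<longlonglongrightarrow> indicator (C u) x"
      by (rule closed_indicator_limit[OF C]) (rule that)
    have "\<exists>g :: 'e \<Rightarrow>\<^sub>C real. apply_bcontfun g = h m" for m by (rule Bcontfun_compact[OF h(1)]) blast
    then obtain g :: "nat \<Rightarrow> 'e \<Rightarrow>\<^sub>C real" where "\<And>m. apply_bcontfun (g m) = h m" by metis
    then show ?thesis using h(2,3,5) by (intro exI[of _ g]) auto
  qed
  then obtain g :: "real \<Rightarrow> nat \<Rightarrow> 'e \<Rightarrow>\<^sub>C real" where g: "\<And>u m x. 0 \<le> g u m x" "\<And>u m x. g u m x \<le> 1"
    "\<And>u x. (\<lambda>m. g u m x) \<longlonglongrightarrow> indicator (C u) x"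
    by metis
  have prod_lim: "(\<lambda>m. \<Prod>u\<in>I. g u m (\<omega> u)) \<longlonglongrightarrow> indicator A \<omega>" if "\<omega> \<in> space Q" for \<omega>
  proof -
    have "(\<Prod>u\<in>I. indicator (C u) (\<omega> u) :: real) = indicator A \<omega>"
      using I(1) that by (auto simp: A indicator_def prod_zero_iff intro!: prod.neutral)
    moreover have "(\<lambda>m. \<Prod>u\<in>I. g u m (\<omega> u)) \<longlonglongrightarrow> (\<Prod>u\<in>I. indicator (C u) (\<omega> u))"
      by (intro tendsto_prod g(3))
    ultimately show ?thesis by simp
  qed
  have prod_b: "\<bar>\<Prod>u\<in>I. g u m (\<omega> u)\<bar> \<le> 1" for m \<omega>
    unfolding abs_prod by (rule prod_le_1) (use g in auto)
  have I0: "0 \<le> u" if "u \<in> I" for u using I that by auto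
  have Am: "A \<in> sets Q"
    using subalgebra_past[of s] A I C unfolding subalgebra_def sets_past by (auto simp: cylinders_def)
  have lim: "(\<lambda>m. \<integral>\<omega>. (\<Prod>u\<in>I. g u m (\<omega> u)) * h (\<omega> v) \<partial>Q) \<longlonglongrightarrow> (\<integral>\<omega>. indicator A \<omega> * h (\<omega> v) \<partial>Q)"
    if v: "0 \<le> v" for v and h :: "'e \<Rightarrow>\<^sub>C real"
  proof (rule integral_dominated_convergence[where w="\<lambda>_. norm h"])
    show "(\<lambda>\<omega>. indicator A \<omega> * h (\<omega> v)) \<in> borel_measurable Q"
      using Am by (intro borel_measurable_times F_bcontfun_measurable v) auto
    show "(\<lambda>\<omega>. (\<Prod>u\<in>I. g u m (\<omega> u)) * h (\<omega> v)) \<in> borel_measurable Q" for m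
      using I0 v by (intro borel_measurable_times prod_F_measurable F_bcontfun_measurable) auto
    show "AE \<omega> in Q. (\<lambda>m. (\<Prod>u\<in>I. g u m (\<omega> u)) * h (\<omega> v)) \<longlonglongrightarrow> indicator A \<omega> * h (\<omega> v)"
      by (intro AE_I2 tendsto_mult prod_lim tendsto_const)
    show "AE \<omega> in Q. norm ((\<Prod>u\<in>I. g u m (\<omega> u)) * h (\<omega> v)) \<le> norm h" for m
    proof (intro AE_I2)
      fix \<omega>
      have "\<bar>\<Prod>u\<in>I. g u m (\<omega> u)\<bar> * \<bar>h (\<omega> v)\<bar> \<le> 1 * norm h"
        by (intro mult_mono prod_b bcontfun_abs_bound) auto
      then show "norm ((\<Prod>u\<in>I. g u m (\<omega> u)) * h (\<omega> v)) \<le> norm h" by (simp add: abs_mult)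
    qed
  qed simp
  have "0 \<le> s + t" using s t by simp
  from LIMSEQ_unique[OF lim[OF this, of f, unfolded F_markov_prod[OF I s t]] lim[OF s, of "TT t f"]]
  show ?thesis .
qed

text \<open>Dynkin's argument extends the identity of expectations from cylinders to the whole past;
  as \<open>?g\<close> is measurable with respect to the past, it is the conditional
  expectation.\<close>

lemma F_markov:
  fixes f :: "'e \<Rightarrow>\<^sub>C real"
  assumes s: "0 \<le> s" and t: "0 \<le> t"
  shows "AE \<omega> in Q. real_cond_exp Q (past Q F s) (\<lambda>\<omega>. f (\<omega> (s + t))) \<omega> = transition_semigroup kern t f (\<omega> s)"
proof -
  interpret fs: finite_measure_subalgebra Q "past Q F s"
    by (rule finite_measure_subalgebra.intro[OF Q.finite_measure_axioms])
      (simp add: finite_measure_subalgebra_axioms_def subalgebra_past)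
  have st: "0 \<le> s + t" using s t by simp
  let ?f = "\<lambda>\<omega>. f (\<omega> (s + t))" and ?g = "\<lambda>\<omega>. TT t f (\<omega> s)"
  have int: "integrable Q (\<lambda>\<omega>. h (\<omega> v))" if "0 \<le> v" for v and h :: "'e \<Rightarrow>\<^sub>C real"
    by (rule Q.integrable_const_bound[of _ "norm h"]) (use F_bcontfun_measurable[OF that] in \<open>auto simp: bcontfun_abs_bound\<close>)
  have intA: "set_integrable Q A (\<lambda>\<omega>. h (\<omega> v))" if "A \<in> sets Q" "0 \<le> v" for A v and h :: "'e \<Rightarrow>\<^sub>C real"
    unfolding set_integrable_def using integrable_mult_indicator[OF that(1) int[OF that(2)]] .
  have cyl: "cylinders s \<subseteq> Pow cadlag_paths" by (auto simp: cylinders_def)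
  have past_Q: "A \<in> sets Q" if "A \<in> sigma_sets cadlag_paths (cylinders s)" for A
    using subalgebra_past[of s] that by (auto simp: subalgebra_def sets_past)
  have eq: "(\<integral>\<omega>\<in>A. ?f \<omega> \<partial>Q) = (\<integral>\<omega>\<in>A. ?g \<omega> \<partial>Q)" if "A \<in> sigma_sets cadlag_paths (cylinders s)" for A
    using Int_stable_cylinders cyl that
  proof (induction rule: sigma_sets_induct_disjoint)
    case (basic A)
    then show ?case using F_markov_cylinder[OF basic s t, of f] by (simp add: set_lebesgue_integral_def)
  next
    case empty then show ?case by (simp add: set_lebesgue_integral_def)
  next
    case (compl A)
    have A: "A \<in> sets Q" by (rule past_Q[OF compl.hyps])
    have "(\<integral>\<omega>\<in>cadlag_paths - A. h (\<omega> v) \<partial>Q) = (\<integral>\<omega>. h (\<omega> v) \<partial>Q) - (\<integral>\<omega>\<in>A. h (\<omega> v) \<partial>Q)" if v: "0 \<le> v" for v and h :: "'e \<Rightarrow>\<^sub>C real"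
    proof -
      have "(\<integral>\<omega>\<in>cadlag_paths - A. h (\<omega> v) \<partial>Q) = (\<integral>\<omega>. h (\<omega> v) - indicator A \<omega> *\<^sub>R h (\<omega> v) \<partial>Q)"
        unfolding set_lebesgue_integral_def
        by (rule Bochner_Integration.integral_cong) (auto simp: indicator_def)
      also have "\<dots> = (\<integral>\<omega>. h (\<omega> v) \<partial>Q) - (\<integral>\<omega>\<in>A. h (\<omega> v) \<partial>Q)"
        unfolding set_lebesgue_integral_def
        by (rule Bochner_Integration.integral_diff[OF int[OF v] intA[OF A v, unfolded set_integrable_def]])
      finally show ?thesis .
    qed
    moreover have "(\<integral>\<omega>. ?f \<omega> \<partial>Q) = (\<integral>\<omega>. ?g \<omega> \<partial>Q)"
      using F_markov_prod[of "{}" s t undefined f] s t by simp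
    ultimately show ?case using s st compl.IH by simp
  next
    case (union A)
    have A: "A i \<in> sets Q" for i using union.hyps(2) past_Q by blast
    then have UA: "(\<Union>i. A i) \<in> sets Q" by blast
    have "(\<integral>\<omega>\<in>(\<Union>i. A i). h (\<omega> v) \<partial>Q) = (\<Sum>i. (\<integral>\<omega>\<in>A i. h (\<omega> v) \<partial>Q))" if "0 \<le> v" for v and h :: "'e \<Rightarrow>\<^sub>C real"
      using union.hyps(1) by (intro lebesgue_integral_countable_add[OF A _ intA[OF UA that]]) (auto simp: disjoint_family_on_def)
    then show ?case using s st union.IH by simp
  qed
  have "(\<lambda>\<omega>. \<omega> s) \<in> borel_measurable (past Q F s)"
  proof (rule measurableI)
    fix B :: "'e set" assume B: "B \<in> sets borel"
    have "(\<lambda>\<omega>. \<omega> s) -` B \<inter> space (past Q F s) = {\<omega> \<in> cadlag_paths. \<omega> s \<in> B}" by auto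
    then show "(\<lambda>\<omega>. \<omega> s) -` B \<inter> space (past Q F s) \<in> sets (past Q F s)"
      using past_eval[of s s B] s B by simp
  qed simp
  then have gm: "?g \<in> borel_measurable (past Q F s)" by (rule measurable_compose[OF _ bcontfun_measurable])
  have "AE \<omega> in Q. real_cond_exp Q (past Q F s) ?f \<omega> = ?g \<omega>"
    by (rule fs.real_cond_exp_charact[OF eq int[OF st] int[OF s] gm]) (simp add: sets_past)
  then show ?thesis by (simp add: transition_semigroup_kern[OF t])
qed

lemma feller_process_F: "feller_process Q F kern"
  unfolding feller_process_def
proof (intro conjI)
  show "prob_space Q" by (rule prob_space_Q)
  show "feller_transition_function kern" by (rule feller_kern)
  show "\<forall>t\<ge>0. F t \<in> borel_measurable Q" by (intro allI impI) (rule F_measurable)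
  show "\<forall>\<omega>\<in>space Q. path_of F \<omega> \<in> cadlag_paths"
  proof
    fix \<omega> assume "\<omega> \<in> space Q"
    then have "\<omega> \<in> cadlag_paths" by (simp only: space_Q)
    then show "path_of F \<omega> \<in> cadlag_paths" by (simp only: path_of_F)
  qed
  show "\<forall>s\<ge>0. \<forall>t\<ge>0. \<forall>f::'e \<Rightarrow>\<^sub>C real. AE \<omega> in Q. real_cond_exp Q (past Q F s) (\<lambda>\<omega>. f (F (s + t) \<omega>)) \<omega> =
          transition_semigroup kern t f (F s \<omega>)"
    by (intro allI impI) (rule F_markov)
qed

end

section \<open>The two settings as instances of the commutation relations\<close>

lemma intertwined_chains_up_down:
  fixes S :: "nat \<Rightarrow> 's set" and root :: 's
  assumes S: "\<And>n. finite (S n)" "disjoint_family S" "S 0 = {root}" "\<And>n. S n \<noteq> {}"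
    and stoch: "\<And>n. stochastic_matrix (S n) (S n) (p n)" and ud: "up_down_setting S p c D U"
  shows "intertwined_chains S root p c D U"
proof -
  obtain pup pdown \<beta> where up: "\<forall>n. stochastic_matrix (S n) (S (Suc n)) (pup n)"
    and down: "\<forall>n\<ge>1. stochastic_matrix (S n) (S (n - 1)) (pdown n)"
    and p: "\<forall>n. \<forall>x\<in>S n. \<forall>y\<in>S n. p n x y = (\<Sum>z\<in>S (Suc n). pup n x z * pdown (Suc n) z y)"
    and \<beta>: "\<forall>n\<ge>1. 0 < \<beta> n \<and> \<beta> n < (1::real)"
    and comm: "\<forall>n\<ge>1. \<forall>x\<in>S n. \<forall>y\<in>S n. (\<Sum>z\<in>S (Suc n). pup n x z * pdown (Suc n) z y) =
       \<beta> n * (\<Sum>z\<in>S (n - 1). pdown n x z * pup (n - 1) z y) + (1 - \<beta> n) * (if x = y then 1 else 0)"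
    and c: "\<forall>n. c n = (\<Prod>i=1..n. inverse (\<beta> i))"
    and D: "\<forall>n\<ge>1. D n = matrix_op (S n) (S (n - 1)) (pdown n)"
    and U: "\<forall>n. U n = matrix_op (S n) (S (Suc n)) (pup n)"
    using ud unfolding up_down_setting_def by (elim exE conjE) (rule that)
  note up = up[rule_format] and down = down[rule_format] and p = p[rule_format] and \<beta> = \<beta>[rule_format]
    and comm = comm[rule_format] and c = c[rule_format] and D = D[rule_format] and U = U[rule_format]
  have c_pos: "0 < c n" for n unfolding c using \<beta> by (intro prod_pos) auto
  have c_Suc: "c (Suc n) = c n * inverse (\<beta> (Suc n))" for n by (simp add: c)
  \<comment> \<open>c_n is the inverse of the product of \<beta>_1, ..., \<beta>_n, so multiplying
    (C) at level n + 1 by c_(n+1) turns \<beta>_(n+1) into the factor c_n of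
    \<open>rate_DU\<close>.\<close>
  have c\<beta>: "c (Suc n) * \<beta> (Suc n) = c n" for n using \<beta>[of "Suc n"] by (simp add: c_Suc)
  show ?thesis
  proof
    fix n
    show "0 < c n" by (rule c_pos)
    have "c (Suc n) * \<beta> (Suc n) < c (Suc n) * 1"
      using \<beta>[of "Suc n"] by (intro mult_strict_left_mono c_pos) auto
    then show "c n < c (Suc n)" by (simp add: c\<beta>)
    show "transition_operator (S n) (S (Suc n)) (D (Suc n))"
      unfolding transition_operator_def using down[of "Suc n"] D[of "Suc n"] by auto
    show "linear_operator (S (Suc n)) (S n) (U n)" unfolding U by (rule linear_operator_matrix_op)
    show "U n (D (Suc n) f) = matrix_op (S n) (S n) (p n) f" for f
    proof
      fix x
      have "(\<Sum>z\<in>S (Suc n). pup n x z * (\<Sum>y\<in>S n. pdown (Suc n) z y * f y)) = (\<Sum>y\<in>S n. p n x y * f y)" if x: "x \<in> S n"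
      proof -
        have "(\<Sum>z\<in>S (Suc n). pup n x z * (\<Sum>y\<in>S n. pdown (Suc n) z y * f y)) = (\<Sum>z\<in>S (Suc n). \<Sum>y\<in>S n. pup n x z * pdown (Suc n) z y * f y)"
          by (simp add: sum_distrib_left mult.assoc)
        also have "\<dots> = (\<Sum>y\<in>S n. (\<Sum>z\<in>S (Suc n). pup n x z * pdown (Suc n) z y) * f y)"
          by (subst sum.swap) (simp add: sum_distrib_right)
        finally show ?thesis using p[OF x] by simp
      qed
      then show "U n (D (Suc n) f) x = matrix_op (S n) (S n) (p n) f x"
        by (simp add: U D matrix_op_def)
    qed
    show "c (Suc n) * (matrix_op (S (Suc n)) (S (Suc n)) (p (Suc n)) f r - f r) = c n * (D (Suc n) (U n f) r - f r)"
      if f: "f \<in> fin_C (S (Suc n))" for f r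
    proof (cases "r \<in> S (Suc n)")
      case False
      then show ?thesis using f by (simp add: matrix_op_def D fin_C_def)
    next
      case r: True
      let ?b = "\<beta> (Suc n)"
      have "matrix_op (S (Suc n)) (S (Suc n)) (p (Suc n)) f r =
          (\<Sum>y\<in>S (Suc n). (?b * (\<Sum>z\<in>S n. pdown (Suc n) r z * pup n z y) + (1 - ?b) * (if r = y then 1 else 0)) * f y)"
        using r p[of r "Suc n"] comm[of "Suc n" r] by (simp add: matrix_op_def)
      also have "\<dots> = ?b * (\<Sum>y\<in>S (Suc n). \<Sum>z\<in>S n. pdown (Suc n) r z * pup n z y * f y) + (1 - ?b) * (\<Sum>y\<in>S (Suc n). if r = y then f y else 0)"
      proof -
        have "(?b * (\<Sum>z\<in>S n. pdown (Suc n) r z * pup n z y) + (1 - ?b) * (if r = y then 1 else 0)) * f y =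
            ?b * (\<Sum>z\<in>S n. pdown (Suc n) r z * pup n z y * f y) + (1 - ?b) * (if r = y then f y else 0)" for y
        proof -
          have "(\<Sum>z\<in>S n. pdown (Suc n) r z * pup n z y * f y) = (\<Sum>z\<in>S n. pdown (Suc n) r z * pup n z y) * f y"
            by (simp add: sum_distrib_right)
          then show ?thesis by (simp add: distrib_right)
        qed
        then show ?thesis by (simp only: sum.distrib sum_distrib_left)
      qed
      also have "(\<Sum>y\<in>S (Suc n). if r = y then f y else 0) = f r" using r S(1) by simp
      also have "(\<Sum>y\<in>S (Suc n). \<Sum>z\<in>S n. pdown (Suc n) r z * pup n z y * f y) = D (Suc n) (U n f) r"
        using r by (subst sum.swap) (simp add: D U matrix_op_def sum_distrib_left mult.assoc)
      finally have "matrix_op (S (Suc n)) (S (Suc n)) (p (Suc n)) f r - f r = ?b * (D (Suc n) (U n f) r - f r)"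
        by (simp add: algebra_simps)
      then show ?thesis by (simp add: c\<beta> flip: mult.assoc)
    qed
  qed (use S stoch in auto)
qed

text \<open>The relation U D = T is the one to be derived: by (A5) and the defining relation of U,
  the functions U D f and T f have the same image under the injective D.\<close>

lemma intertwined_chains_general:
  fixes S :: "nat \<Rightarrow> 's set" and root :: 's
  assumes S: "\<And>n. finite (S n)" "disjoint_family S" "S 0 = {root}" "\<And>n. S n \<noteq> {}"
    and stoch: "\<And>n. stochastic_matrix (S n) (S n) (p n)" and gs: "general_setting S p c D U"
  shows "intertwined_chains S root p c D U"
proof
  fix n
  note g = gs[unfolded general_setting_def, rule_format, of n]
  show c: "0 < c n" "c n < c (Suc n)" using g by auto
  show Dt: "transition_operator (S n) (S (Suc n)) (D (Suc n))" using g by auto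
  show Ul: "linear_operator (S (Suc n)) (S n) (U n)" using g by auto
  have inj: "inj_on (D (Suc n)) (fin_C (S n))" using g by blast
  have AD: "rate_op S p c (Suc n) (D (Suc n) f) = D (Suc n) (rate_op S p c n f)" if "f \<in> fin_C (S n)" for f
    using g that by blast
  have DU: "c n * D (Suc n) (U n f) r = rate_op S p c (Suc n) f r + c n * f r" if "f \<in> fin_C (S (Suc n))" for f r
    using g that by (metis (no_types, lifting))
  show "c (Suc n) * (matrix_op (S (Suc n)) (S (Suc n)) (p (Suc n)) f r - f r) = c n * (D (Suc n) (U n f) r - f r)"
    if "f \<in> fin_C (S (Suc n))" for f r
    using DU[OF that, of r] by (simp add: rate_op_def algebra_simps)
  show "U n (D (Suc n) f) = matrix_op (S n) (S n) (p n) f" if f: "f \<in> fin_C (S n)" for f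
  proof -
    have Dl: "linear_operator (S n) (S (Suc n)) (D (Suc n))" by (rule transition_operator_linear[OF Dt])
    let ?T = "matrix_op (S n) (S n) (p n) f"
    have Df: "D (Suc n) f \<in> fin_C (S (Suc n))" by (rule linear_operator_fin_C[OF Dl f])
    have Tf: "?T \<in> fin_C (S n)" by (simp add: matrix_op_def fin_C_def)
    have m: "(\<lambda>x. -1 * f x) \<in> fin_C (S n)" using f by (simp add: fin_C_def)
    have d: "(\<lambda>x. ?T x + -1 * f x) \<in> fin_C (S n)" using f Tf by (simp add: fin_C_def)
    have "D (Suc n) (rate_op S p c n f) = D (Suc n) (\<lambda>x. c n * (?T x + -1 * f x))"
      by (simp add: rate_op_def[abs_def])
    also have "\<dots> = (\<lambda>x. c n * (D (Suc n) ?T x + -1 * D (Suc n) f x))"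
      unfolding linear_operator_scale[OF Dl d] linear_operator_add[OF Dl Tf m] linear_operator_scale[OF Dl f] ..
    finally have "c n * D (Suc n) (U n (D (Suc n) f)) r = c n * D (Suc n) ?T r" for r
      using DU[OF Df, of r] by (simp add: AD[OF f] algebra_simps)
    then have "D (Suc n) (U n (D (Suc n) f)) = D (Suc n) ?T"
      using c(1) by (simp add: fun_eq_iff)
    then show ?thesis
      by (rule inj_onD[OF inj _ linear_operator_fin_C[OF Ul Df] Tf])
  qed
qed (use S stoch in auto)

theorem theorem1p2:
  fixes S :: "nat \<Rightarrow> 's set" and root :: 's
    and P :: "nat \<Rightarrow> 'w measure" and X :: "nat \<Rightarrow> nat \<Rightarrow> 'w \<Rightarrow> 's"
    and p :: "nat \<Rightarrow> 's \<Rightarrow> 's \<Rightarrow> real"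
    and c :: "nat \<Rightarrow> real"
    and D U :: "nat \<Rightarrow> ('s \<Rightarrow> real) \<Rightarrow> ('s \<Rightarrow> real)"
    and \<iota> :: "'s \<Rightarrow> 'e::polish_space"
    and dlim :: "'s \<Rightarrow> ('e \<Rightarrow>\<^sub>C real)"
    and \<mu> :: "'e measure"
  assumes "\<And>n. finite (S n)" and "disjoint_family S" and "S 0 = {root}"
    and "\<And>n. markov_chain (P n) (S n) (p n) (X n)"
    and "up_down_setting S p c D U \<or> general_setting S p c D U"
    and "compact (UNIV :: 'e set)"
    and "limit_space_conditions S D \<iota> dlim"
    and "filterlim c at_top sequentially"
    and "prob_space \<mu>" and "sets \<mu> = sets borel"
    and "weakly_converges euclidean (\<lambda>n. distr (P n) borel (\<lambda>\<omega>. \<iota> (X n 0 \<omega>))) \<mu> sequentially"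
  shows "\<exists>(Q :: (real \<Rightarrow> 'e) measure) (F :: real \<Rightarrow> (real \<Rightarrow> 'e) \<Rightarrow> 'e) \<kappa> M.
      feller_process Q F \<kappa> \<and> distr Q borel (F 0) = \<mu> \<and>
      converges_in_distribution skorokhod_topology
        P (\<lambda>n. path_of (\<lambda>t \<omega>. \<iota> (X n (nat \<lfloor>c n * t\<rfloor>) \<omega>))) Q (path_of F) \<and>
      (\<forall>k. \<forall>s\<in>S k. \<forall>t\<ge>0.
         transition_semigroup \<kappa> t (h_lim S c U dlim s) =
           (\<lambda>x. exp (- t * rate_before c k) * h_lim S c U dlim s x)) \<and>
      ergodic_with \<kappa> M \<and>
      (\<forall>n m. stationary_distribution (S n) (p n) m \<longleftrightarrow> (\<forall>u\<in>S n. m u = p_up U 0 n root u)) \<and>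
      weakly_converges euclidean
        (\<lambda>n. distr (point_measure (S n) (\<lambda>u. ennreal (p_up U 0 n root u))) borel \<iota>) M sequentially"
proof -
  have stoch: "stochastic_matrix (S n) (S n) (p n)" for n
    using assms(4)[of n] by (simp add: markov_chain_def)
  \<comment> \<open>A chain on a probability space has to take some value in
    \<open>S n\<close>.\<close>
  have S_ne: "S n \<noteq> {}" for n
  proof -
    have "prob_space (P n)" "X n 0 \<in> measurable (P n) (count_space (S n))"
      using assms(4)[of n] by (auto simp: markov_chain_def)
    then show ?thesis using prob_space.not_empty[of "P n"] measurable_space[of "X n 0" "P n"] by fastforce
  qed
  have "intertwined_chains S root p c D U"
    using assms(5)
    by (auto intro: intertwined_chains_up_down[OF assms(1-3) S_ne stoch] intertwined_chains_general[OF assms(1-3) S_ne stoch])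
  then interpret chain_processes S root p c D U \<iota> dlim P X \<mu>
    using assms by (intro chain_processes.intro limit_chains.intro limit_chains_axioms.intro chain_processes_axioms.intro)
  obtain M where M: "ergodic_with kern M" "weakly_converges euclidean push_M M sequentially"
    by (rule stationary_limit) (rule that)
  have Y: "Y n = (\<lambda>t \<omega>. \<iota> (X n (nat \<lfloor>c n * t\<rfloor>) \<omega>))" for n by (simp add: Y_def fun_eq_iff)
  have push: "push_M = (\<lambda>n. distr (point_measure (S n) (\<lambda>u. ennreal (p_up U 0 n root u))) borel \<iota>)"
    by (simp add: push_M_def push_def fun_eq_iff)
  have h: "\<forall>k. \<forall>s\<in>S k. \<forall>t\<ge>0. transition_semigroup kern t (h_lim S c U dlim s) =
      (\<lambda>x. exp (- t * rate_before c k) * h_lim S c U dlim s x)"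
    by (auto simp: transition_semigroup_kern TT_h fun_eq_iff)
  show ?thesis
    using feller_process_F initial_law convergence_in_distribution[unfolded Y] h M[unfolded push] stationary_distribution_iff
    by (intro exI[of _ Q] exI[of _ F] exI[of _ kern] exI[of _ M]) blast
qed

end
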